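(* For $i=1,2$, let $\Lambda_i\subset(0,\infty)$ be a finitely generated multiplicative subgroup and let $\Gamma_i\subset\mathbb{R}$ be a countable $\mathbb{Z}\Lambda_i$-module which is dense in $\mathbb{R}$. Suppose $\operatorname{rank}\Gamma_i\geq2$ for $i=1,2$, and let $\mathcal{S}(\Gamma_i,\Lambda_i)$ be the Stein groupoids. Let $\ell_i\in\Gamma_i\cap(0,\infty)$. The following conditions are equivalent. (1) $V(\Gamma_1,\Lambda_1,\ell_1)$ is isomorphic to $V(\Gamma_2,\Lambda_2,\ell_2)$ as discrete groups. (2) $D(V(\Gamma_1,\Lambda_1,\ell_1))$ is isomorphic to $D(V(\Gamma_2,\Lambda_2,\ell_2))$ as discrete groups. (3) $\mathcal{S}(\Gamma_1,\Lambda_1)|[0_+,\ell_{1-}]$ is isomorphic to $\mathcal{S}(\Gamma_2,\Lambda_2)|[0_+,\ell_{2-}]$ as ample groupoids. (4) $\Lambda_1=\Lambda_2$ and there exists $s>0$ such that $\Gamma_1=s\Gamma_2$ and $\ell_1-s\ell_2$ is zero in $H_0(\Lambda_1,\Gamma_1)$.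
   Context: "$\Gamma\subset\mathbb{R}$ is a $\mathbb{Z}\Lambda$-module" means that $\Gamma$ is an additive subgroup of $\mathbb{R}$ with $\lambda\Gamma\subset\Gamma$ for all $\lambda\in\Lambda$. $\operatorname{rank}\Gamma:=\dim_{\mathbb{Q}}(\Gamma\otimes\mathbb{Q})$. $H_0(\Lambda,\Gamma)$ is group homology of $\Lambda$ with coefficients in $\Gamma$ ($\Lambda$ acting by multiplication), i.e. the coinvariants: the quotient of $\Gamma$ by the subgroup generated by $\{t-\lambda t\mid t\in\Gamma,\lambda\in\Lambda\}$. $D(G)$ is the derived (commutator) subgroup of $G$. Stein's group $V(\Gamma,\Lambda,\ell)$, for $\ell\in\Gamma\cap(0,\infty)$, is the group (under composition) of piecewise linear bijections $f$ of $[0,\ell)$ that are right continuous, have finitely many discontinuous or nondifferentiable points, all in $\Gamma$, and have slopes only in $\Lambda$. (Thus there are $0=t_1<\dots<t_{m+1}=\ell$ in $\Gamma$, $\lambda_i\in\Lambda$, $s_i\in\Gamma$ with $f(t)=\lambda_it+s_i$ on $[t_i,t_{i+1})$.) The space $\mathbb{R}_\Gamma$: as a set $\mathbb{R}_\Gamma=(\mathbb{R}\setminus\Gamma)\sqcup\{t_+,t_-\mid t\in\Gamma\}$, with the canonical surjection $q:\mathbb{R}_\Gamma\to\mathbb{R}$ ($q(t_\pm)=t$, $q(x)=x$ for $x\notin\Gamma$), the total order such that $q(x)<q(y)$ implies $x<y$ and $t_-<t_+$ for $t\in\Gamma$, and the order topology. It is totally disconnected and locally compact Hausdorff; the sets $[t_+,s_-]$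 ($t<s$ in $\Gamma$) are compact open and form a basis. For $\ell_i\in\Gamma_i$, $\ell_{i-}$ denotes the point $(\ell_i)_-$. The group $\Gamma\rtimes\Lambda$ (with $(s,\lambda)(s',\lambda')=(s+\lambda s',\lambda\lambda')$) acts on $\mathbb{R}_\Gamma$ by $(s,\lambda)\cdot x=\lambda x+s$ for $x\in\mathbb{R}\setminus\Gamma$ and $(s,\lambda)\cdot t_\pm=(\lambda t+s)_\pm$. For an action of a discrete group $G$ on $X$, the transformation groupoid $X\rtimes G$ is $X\times G$ with the product topology, unit space $X$ (identified with $X\times\{1\}$), $r(x,\gamma)=x$, $s(x,\gamma)=\gamma^{-1}x$, $(x,\gamma)(\gamma^{-1}x,\gamma')=(x,\gamma\gamma')$. The Stein groupoid is $\mathcal{S}(\Gamma,\Lambda):=\mathbb{R}_\Gamma\rtimes(\Gamma\rtimes\Lambda)$. For an open subset $Y$ of the unit space of a groupoid $\mathcal{G}$, $\mathcal{G}|Y:=r^{-1}(Y)\cap s^{-1}(Y)$ is the reduction. Isomorphism of ample groupoids means isomorphism of topological groupoids. *)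

theory Defs
  imports
    "HOL-Analysis.Analysis"
    "HOL-Algebra.Bij"
    "HOL-Algebra.Coset"
    "HOL-Algebra.Generated_Groups"
    "HOL-Library.Extended_Nat"
begin

section \<open>The data \<open>\<Lambda>\<close> and \<open>\<Gamma>\<close>\<close>

definition real_additive :: "real monoid" where
  "real_additive = \<lparr>carrier = UNIV, mult = (+), one = 0\<rparr>"

definition positive_reals :: "real monoid" where
  "positive_reals = \<lparr>carrier = {0<..}, mult = (*), one = 1\<rparr>"

definition fg_subgroup :: "'a set \<Rightarrow> ('a, 'b) monoid_scheme \<Rightarrow> bool" where
  "fg_subgroup H G \<longleftrightarrow>
     subgroup H G \<and> (\<exists>S. finite S \<and> S \<subseteq> carrier G \<and> H = generate G S)"

definition ZLambda_module :: "real set \<Rightarrow> real set \<Rightarrow> bool" where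
  "ZLambda_module \<Lambda> \<Gamma> \<longleftrightarrow>
     subgroup \<Gamma> real_additive \<and> (\<forall>a\<in>\<Lambda>. (\<lambda>t. a * t) ` \<Gamma> \<subseteq> \<Gamma>)"


section \<open>Rank\<close>

definition rat_scale :: "rat \<Rightarrow> real \<Rightarrow> real" where
  "rat_scale q x = of_rat q * x"

global_interpretation rat_real: vector_space rat_scale
  by unfold_locales (simp_all add: rat_scale_def algebra_simps of_rat_add of_rat_mult)

text \<open>
  For a subgroup \<open>\<Gamma>\<close> of the reals, \<open>\<Gamma> \<otimes> \<rat>\<close> is taken to be the rational span of \<open>\<Gamma>\<close>,
  with \<open>g \<otimes> q\<close> being \<open>q * g\<close>; lemma \<open>rat_span_tensor_product\<close> below is the universal
  property of the tensor product. The library's \<open>dim\<close> is \<open>0\<close> in the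
  infinite-dimensional case, whence the case distinction.
\<close>

definition group_rank :: "real set \<Rightarrow> enat" where
  "group_rank \<Gamma> =
     (if \<exists>B. finite B \<and> rat_real.span B = rat_real.span \<Gamma>
      then enat (rat_real.dim (rat_real.span \<Gamma>)) else \<infinity>)"

lemma subgroup_real_additiveD:
  assumes "subgroup \<Gamma> real_additive"
  shows "0 \<in> \<Gamma>" "g \<in> \<Gamma> \<Longrightarrow> h \<in> \<Gamma> \<Longrightarrow> g + h \<in> \<Gamma>" "g \<in> \<Gamma> \<Longrightarrow> - g \<in> \<Gamma>"
    "g \<in> \<Gamma> \<Longrightarrow> of_nat n * g \<in> \<Gamma>" "g \<in> \<Gamma> \<Longrightarrow> of_int k * g \<in> \<Gamma>"
proof -
  have grp: "group real_additive"
    unfolding real_additive_def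
    by (rule groupI) (auto intro: exI[of _ "- x" for x])
  have minus: "inv\<^bsub>real_additive\<^esub> x = - x" for x :: real
    by (rule group.inv_equality[OF grp]) (auto simp: real_additive_def)
  show z: "0 \<in> \<Gamma>"
    using subgroup.one_closed[OF assms] by (simp add: real_additive_def)
  show add: "g \<in> \<Gamma> \<Longrightarrow> h \<in> \<Gamma> \<Longrightarrow> g + h \<in> \<Gamma>" for g h
    using subgroup.m_closed[OF assms, of g h] by (simp add: real_additive_def)
  show neg: "g \<in> \<Gamma> \<Longrightarrow> - g \<in> \<Gamma>" for g
    using subgroup.m_inv_closed[OF assms, of g] by (simp add: minus)
  show nat: "g \<in> \<Gamma> \<Longrightarrow> of_nat n * g \<in> \<Gamma>" for g n
    by (induction n) (auto simp: z add algebra_simps)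
  show "g \<in> \<Gamma> \<Longrightarrow> of_int k * g \<in> \<Gamma>"
    by (cases k rule: int_cases2) (use nat[of g] neg in auto)
qed

lemma rat_span_fraction:
  assumes "subgroup \<Gamma> real_additive"
  shows "x \<in> rat_real.span \<Gamma> \<longleftrightarrow> (\<exists>g\<in>\<Gamma>. \<exists>n>0. x = g / of_nat n)"
proof
  note sg = subgroup_real_additiveD[OF assms]
  let ?T = "{x. \<exists>g\<in>\<Gamma>. \<exists>n>0. x = g / of_nat n}"
  assume "x \<in> rat_real.span \<Gamma>"
  moreover have "rat_real.span \<Gamma> \<subseteq> ?T"
  proof (rule rat_real.span_minimal)
    show "\<Gamma> \<subseteq> ?T"
      by (force intro: exI[of _ "1::nat"])
    show "rat_real.subspace ?T"
    proof (rule rat_real.subspaceI)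
      show "0 \<in> ?T" using sg(1) by (force intro: exI[of _ "1::nat"])
    next
      fix x y assume "x \<in> ?T" "y \<in> ?T"
      then obtain g n h m where *: "g \<in> \<Gamma>" "n > 0" "x = g / of_nat n"
        "h \<in> \<Gamma>" "m > 0" "y = h / of_nat m" by auto
      have "x + y = (of_nat m * g + of_nat n * h) / of_nat (n * m)"
        using * by (simp add: field_simps)
      moreover have "of_nat m * g + of_nat n * h \<in> \<Gamma>" using * sg by blast
      ultimately show "x + y \<in> ?T"
        using * by (force intro!: exI[of _ "n * m"])
    next
      fix q :: rat and x assume "x \<in> ?T"
      then obtain g n where *: "g \<in> \<Gamma>" "n > 0" "x = g / of_nat n" by auto
      obtain k l where kl: "q = of_int k / of_int l" "l > 0"
        using quotient_of_div[of q] quotient_of_denom_pos[of q] by (metis surjective_pairing)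
      have "rat_scale q x = (of_int k * g) / of_nat (nat l * n)"
        unfolding rat_scale_def kl(1) using * kl(2) by (simp add: of_rat_divide)
      then show "rat_scale q x \<in> ?T"
        using * kl sg(5)[of g k] by (auto intro!: bexI[of _ "of_int k * g"] exI[of _ "nat l * n"])
    qed
  qed
  ultimately show "\<exists>g\<in>\<Gamma>. \<exists>n>0. x = g / of_nat n" by auto
next
  assume "\<exists>g\<in>\<Gamma>. \<exists>n>0. x = g / of_nat n"
  then obtain g n where "g \<in> \<Gamma>" "x = rat_scale (1 / of_nat n) g"
    by (auto simp: rat_scale_def of_rat_divide)
  then show "x \<in> rat_real.span \<Gamma>"
    by (simp add: rat_real.span_scale rat_real.span_base)
qed

lemma rat_span_tensor_product:
  assumes \<Gamma>: "subgroup \<Gamma> real_additive" and A: "comm_group A"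
    and closed: "\<And>g q. g \<in> \<Gamma> \<Longrightarrow> b g q \<in> carrier A"
    and left: "\<And>g g' q. g \<in> \<Gamma> \<Longrightarrow> g' \<in> \<Gamma> \<Longrightarrow> b (g + g') q = b g q \<otimes>\<^bsub>A\<^esub> b g' q"
    and right: "\<And>g q q'. g \<in> \<Gamma> \<Longrightarrow> b g (q + q') = b g q \<otimes>\<^bsub>A\<^esub> b g q'"
  shows "\<exists>!h. h \<in> extensional (rat_real.span \<Gamma>) \<and>
              h \<in> hom (real_additive\<lparr>carrier := rat_real.span \<Gamma>\<rparr>) A \<and>
              (\<forall>g\<in>\<Gamma>. \<forall>q. h (rat_scale q g) = b g q)"
proof -
  note sg = subgroup_real_additiveD[OF \<Gamma>]
  interpret A: comm_group A by (rule A)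
  have zl: "b 0 q = \<one>\<^bsub>A\<^esub>" for q
    using left[of 0 0 q] closed[of 0 q] sg(1) A.l_cancel_one by auto
  have zr: "b g 0 = \<one>\<^bsub>A\<^esub>" if "g \<in> \<Gamma>" for g
    using right[of g 0 0] closed[of g 0] that A.l_cancel_one by auto
  have nat: "b (of_nat n * g) q = b g (of_nat n * q)" if g: "g \<in> \<Gamma>" for g q n
  proof (induction n)
    case (Suc n)
    have "b (of_nat (Suc n) * g) q = b g q \<otimes>\<^bsub>A\<^esub> b (of_nat n * g) q"
      using left[OF g sg(4)[OF g, of n], of q] by (simp add: distrib_right)
    also have "\<dots> = b g (of_nat (Suc n) * q)"
      using right[OF g, of q "of_nat n * q"] by (simp add: Suc distrib_right)
    finally show ?case .
  qed (use g zl zr in auto)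
  have neg: "b (- g) q = b g (- q)" if g: "g \<in> \<Gamma>" for g q
  proof -
    have "b (- g) q \<otimes>\<^bsub>A\<^esub> b g q = b g (- q) \<otimes>\<^bsub>A\<^esub> b g q"
      using left[OF sg(3)[OF g] g, of q] right[OF g, of "- q" q] g zl zr by simp
    then show ?thesis using closed g sg(3) by simp
  qed
  have int: "b (of_int k * g) q = b g (of_int k * q)" if g: "g \<in> \<Gamma>" for g q k
  proof (cases k rule: int_cases2)
    case (nonneg n) then show ?thesis using nat[OF g] by simp
  next
    case (nonpos n) then show ?thesis using nat[OF g] neg[OF sg(4)[OF g, of n], of q] by simp
  qed
  have common: "b g (1 / of_nat n) = b (of_nat m * g) (1 / of_nat (n * m))"
    if "g \<in> \<Gamma>" "m > 0" for g n m
    using nat[OF that(1), of m "1 / of_nat (n * m)"] that by simp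
  have wd: "b g (1 / of_nat n) = b g' (1 / of_nat n')"
    if "g \<in> \<Gamma>" "g' \<in> \<Gamma>" "n > 0" "n' > 0" "g / of_nat n = g' / of_nat n'" for g g' n n'
  proof -
    have "of_nat n' * g = of_nat n * g'" using that by (simp add: field_simps)
    then show ?thesis
      using common[of g n' n] common[of g' n n'] that by (simp add: mult.commute)
  qed
  define h where "h = (\<lambda>x\<in>rat_real.span \<Gamma>. SOME y. \<exists>g\<in>\<Gamma>. \<exists>n>0. x = g / of_nat n \<and> y = b g (1 / of_nat n))"
  have h: "h (g / of_nat n) = b g (1 / of_nat n)" if g: "g \<in> \<Gamma>" "n > 0" for g n
  proof -
    have mem: "g / of_nat n \<in> rat_real.span \<Gamma>" using rat_span_fraction[OF \<Gamma>] g by blast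
    have "\<exists>g'\<in>\<Gamma>. \<exists>n'>0. g / of_nat n = g' / of_nat n' \<and> h (g / of_nat n) = b g' (1 / of_nat n')"
      unfolding h_def restrict_apply'[OF mem] by (rule someI_ex) (use g in blast)
    then show ?thesis using wd g by metis
  qed
  have hom: "h \<in> hom (real_additive\<lparr>carrier := rat_real.span \<Gamma>\<rparr>) A"
  proof (rule homI)
    fix x assume "x \<in> carrier (real_additive\<lparr>carrier := rat_real.span \<Gamma>\<rparr>)"
    then obtain g n where "g \<in> \<Gamma>" "n > 0" "x = g / of_nat n"
      using rat_span_fraction[OF \<Gamma>] by auto
    then show "h x \<in> carrier A" using h closed by simp
  next
    fix x y assume "x \<in> carrier (real_additive\<lparr>carrier := rat_real.span \<Gamma>\<rparr>)"
      "y \<in> carrier (real_additive\<lparr>carrier := rat_real.span \<Gamma>\<rparr>)"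
    then obtain g n g' m where *: "g \<in> \<Gamma>" "n > 0" "x = g / of_nat n"
      "g' \<in> \<Gamma>" "m > 0" "y = g' / of_nat m"
      using rat_span_fraction[OF \<Gamma>] by auto
    have "x + y = (of_nat m * g + of_nat n * g') / of_nat (n * m)"
      using * by (simp add: field_simps)
    moreover have "of_nat m * g + of_nat n * g' \<in> \<Gamma>" using * sg by blast
    ultimately have "h (x + y) = b (of_nat m * g + of_nat n * g') (1 / of_nat (n * m))"
      using * h[of "of_nat m * g + of_nat n * g'" "n * m"] by simp
    also have "\<dots> = h x \<otimes>\<^bsub>A\<^esub> h y"
      using * common[of g m n] common[of g' n m] h left sg(4) by (simp add: mult.commute)
    finally show "h (x \<otimes>\<^bsub>real_additive\<lparr>carrier := rat_real.span \<Gamma>\<rparr>\<^esub> y) = h x \<otimes>\<^bsub>A\<^esub> h y"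
      by (simp add: real_additive_def)
  qed
  have val: "h (rat_scale q g) = b g q" if g: "g \<in> \<Gamma>" for g q
  proof -
    obtain k l where kl: "q = of_int k / of_int l" "l > 0"
      using quotient_of_div[of q] quotient_of_denom_pos[of q] by (metis surjective_pairing)
    have "rat_scale q g = (of_int k * g) / of_nat (nat l)"
      using kl by (simp add: rat_scale_def of_rat_divide)
    then have "h (rat_scale q g) = b (of_int k * g) (1 / of_nat (nat l))"
      using h[OF sg(5)[OF g, of k], of "nat l"] kl by simp
    then show ?thesis using int[OF g] kl by simp
  qed
  show ?thesis
  proof (rule ex1I[of _ h], intro conjI ballI allI)
    show "h \<in> extensional (rat_real.span \<Gamma>)" by (simp add: h_def)
  next
    fix k assume k: "k \<in> extensional (rat_real.span \<Gamma>) \<and>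
      k \<in> hom (real_additive\<lparr>carrier := rat_real.span \<Gamma>\<rparr>) A \<and>
      (\<forall>g\<in>\<Gamma>. \<forall>q. k (rat_scale q g) = b g q)"
    show "k = h"
    proof (rule extensionalityI[of _ "rat_real.span \<Gamma>"])
      fix x assume "x \<in> rat_real.span \<Gamma>"
      then obtain g n where g: "g \<in> \<Gamma>" "n > 0" "x = g / of_nat n"
        using rat_span_fraction[OF \<Gamma>] by auto
      then have "x = rat_scale (1 / of_nat n) g" by (simp add: rat_scale_def of_rat_divide)
      then show "k x = h x" using k val g by simp
    qed (use k in \<open>auto simp: h_def\<close>)
  qed (use hom val in auto)
qed


section \<open>Coinvariants and commutator subgroups\<close>

abbreviation module_group :: "real set \<Rightarrow> real monoid" where
  "module_group \<Gamma> \<equiv> real_additive\<lparr>carrier := \<Gamma>\<rparr>"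

definition coinvariant_relations :: "real set \<Rightarrow> real set \<Rightarrow> real set" where
  "coinvariant_relations \<Lambda> \<Gamma> = generate (module_group \<Gamma>) {t - a * t |t a. t \<in> \<Gamma> \<and> a \<in> \<Lambda>}"

definition H0 :: "real set \<Rightarrow> real set \<Rightarrow> real set monoid" where
  "H0 \<Lambda> \<Gamma> = module_group \<Gamma> Mod coinvariant_relations \<Lambda> \<Gamma>"

definition H0_class :: "real set \<Rightarrow> real set \<Rightarrow> real \<Rightarrow> real set" where
  "H0_class \<Lambda> \<Gamma> t = coinvariant_relations \<Lambda> \<Gamma> #>\<^bsub>module_group \<Gamma>\<^esub> t"

definition commutator_subgroup :: "('a, 'b) monoid_scheme \<Rightarrow> ('a, 'b) monoid_scheme" where
  "commutator_subgroup G = G\<lparr>carrier := derived G (carrier G)\<rparr>"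


section \<open>Stein's groups\<close>

text \<open>
  Elements are functions on all of the reals that are \<open>undefined\<close> outside \<open>{0..<l}\<close>, as in
  \<^const>\<open>BijGroup\<close>. Right continuity is built into the half-open pieces.
\<close>

definition stein_maps :: "real set \<Rightarrow> real set \<Rightarrow> real \<Rightarrow> (real \<Rightarrow> real) set" where
  "stein_maps \<Gamma> \<Lambda> l =
     {f \<in> Bij {0..<l}. \<exists>(m::nat) t a s.
        t 0 = 0 \<and> t m = l \<and> (\<forall>i\<le>m. t i \<in> \<Gamma>) \<and>
        (\<forall>i<m. t i < t (Suc i) \<and> a i \<in> \<Lambda> \<and> s i \<in> \<Gamma> \<and>
               (\<forall>x\<in>{t i..<t (Suc i)}. f x = a i * x + s i))}"

definition stein_group :: "real set \<Rightarrow> real set \<Rightarrow> real \<Rightarrow> (real \<Rightarrow> real) monoid" where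
  "stein_group \<Gamma> \<Lambda> l = (BijGroup {0..<l})\<lparr>carrier := stein_maps \<Gamma> \<Lambda> l\<rparr>"


section \<open>The space \<open>\<real>\<^sub>\<Gamma>\<close>\<close>

text \<open>
  \<open>Minus t\<close> and \<open>Plus t\<close> are \<open>t\<^sub>-\<close> and \<open>t\<^sub>+\<close>. The order is total on the whole type; on
  \<open>split_points \<Gamma>\<close> it is the order of \<open>\<real>\<^sub>\<Gamma>\<close>.
\<close>

datatype split_real = Regular real | Minus real | Plus real

primrec collapse :: "split_real \<Rightarrow> real" where
  "collapse (Regular x) = x"
| "collapse (Minus t) = t"
| "collapse (Plus t) = t"

primrec side :: "split_real \<Rightarrow> int" where
  "side (Regular x) = 0"
| "side (Minus t) = -1"
| "side (Plus t) = 1"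

instantiation split_real :: linorder
begin

definition less_eq_split_real :: "split_real \<Rightarrow> split_real \<Rightarrow> bool" where
  "x \<le> y \<longleftrightarrow> collapse x < collapse y \<or> (collapse x = collapse y \<and> side x \<le> side y)"

definition less_split_real :: "split_real \<Rightarrow> split_real \<Rightarrow> bool" where
  "x < y \<longleftrightarrow> collapse x < collapse y \<or> (collapse x = collapse y \<and> side x < side y)"

instance
proof
  fix x y :: split_real
  assume "x \<le> y" "y \<le> x"
  then have "collapse x = collapse y" "side x = side y"
    by (auto simp: less_eq_split_real_def)
  then show "x = y" by (cases x; cases y) auto
qed (auto simp: less_eq_split_real_def less_split_real_def)

end

definition split_points :: "real set \<Rightarrow> split_real set" where
  "split_points \<Gamma> = Regular ` (- \<Gamma>) \<union> Plus ` \<Gamma> \<union> Minus ` \<Gamma>"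

text \<open>
  There are no endpoints, so the open rays of \<open>split_points \<Gamma>\<close> alone are a subbase of its
  order topology.
\<close>

definition split_topology :: "real set \<Rightarrow> split_real topology" where
  "split_topology \<Gamma> = topology_generated_by
     ((\<lambda>x. {y \<in> split_points \<Gamma>. y < x}) ` split_points \<Gamma> \<union>
      (\<lambda>x. {y \<in> split_points \<Gamma>. x < y}) ` split_points \<Gamma>)"


section \<open>Topological groupoids\<close>

text \<open>
  The set of arrows is the underlying set of \<open>arrows\<close>, and units are particular arrows.
  \<open>gcomp g h\<close> is meaningful only if \<open>src g = rng h\<close>. Unit space and inverses are
  determined by these data.
\<close>

record 'a top_groupoid =
  arrows :: "'a topology"
  rng :: "'a \<Rightarrow> 'a"
  src :: "'a \<Rightarrow> 'a"
  gcomp :: "'a \<Rightarrow> 'a \<Rightarrow> 'a"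

definition groupoid_iso ::
  "'a top_groupoid \<Rightarrow> 'b top_groupoid \<Rightarrow> ('a \<Rightarrow> 'b) \<Rightarrow> bool" where
  "groupoid_iso \<G> \<H> \<phi> \<longleftrightarrow>
     homeomorphic_map (arrows \<G>) (arrows \<H>) \<phi> \<and>
     (\<forall>g\<in>topspace (arrows \<G>). \<phi> (rng \<G> g) = rng \<H> (\<phi> g) \<and> \<phi> (src \<G> g) = src \<H> (\<phi> g)) \<and>
     (\<forall>g\<in>topspace (arrows \<G>). \<forall>h\<in>topspace (arrows \<G>).
        src \<G> g = rng \<G> h \<longrightarrow> \<phi> (gcomp \<G> g h) = gcomp \<H> (\<phi> g) (\<phi> h))"

definition isomorphic_groupoids :: "'a top_groupoid \<Rightarrow> 'b top_groupoid \<Rightarrow> bool" where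
  "isomorphic_groupoids \<G> \<H> \<longleftrightarrow> (\<exists>\<phi>. groupoid_iso \<G> \<H> \<phi>)"

definition reduction :: "'a top_groupoid \<Rightarrow> 'a set \<Rightarrow> 'a top_groupoid" where
  "reduction \<G> Y = \<G>\<lparr>arrows :=
     subtopology (arrows \<G>) {g \<in> topspace (arrows \<G>). rng \<G> g \<in> Y \<and> src \<G> g \<in> Y}\<rparr>"

definition transformation_groupoid ::
  "'x topology \<Rightarrow> ('g, 'b) monoid_scheme \<Rightarrow> ('g \<Rightarrow> 'x \<Rightarrow> 'x) \<Rightarrow> ('x \<times> 'g) top_groupoid" where
  "transformation_groupoid X G act =
     \<lparr>arrows = prod_topology X (discrete_topology (carrier G)),
      rng = (\<lambda>(x, g). (x, \<one>\<^bsub>G\<^esub>)),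
      src = (\<lambda>(x, g). (act (inv\<^bsub>G\<^esub> g) x, \<one>\<^bsub>G\<^esub>)),
      gcomp = (\<lambda>(x, g) (y, h). (x, g \<otimes>\<^bsub>G\<^esub> h))\<rparr>"


section \<open>Stein groupoids\<close>

definition affine_group :: "real set \<Rightarrow> real set \<Rightarrow> (real \<times> real) monoid" where
  "affine_group \<Gamma> \<Lambda> =
     \<lparr>carrier = \<Gamma> \<times> \<Lambda>, mult = (\<lambda>(s, a) (s', a'). (s + a * s', a * a')), one = (0, 1)\<rparr>"

fun affine_act :: "real \<times> real \<Rightarrow> split_real \<Rightarrow> split_real" where
  "affine_act (s, a) (Regular x) = Regular (a * x + s)"
| "affine_act (s, a) (Minus t) = Minus (a * t + s)"
| "affine_act (s, a) (Plus t) = Plus (a * t + s)"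

definition stein_groupoid ::
  "real set \<Rightarrow> real set \<Rightarrow> (split_real \<times> real \<times> real) top_groupoid" where
  "stein_groupoid \<Gamma> \<Lambda> =
     transformation_groupoid (split_topology \<Gamma>) (affine_group \<Gamma> \<Lambda>) affine_act"

text \<open>The unit space of the Stein groupoid is \<open>\<real>\<^sub>\<Gamma> \<times> {1}\<close>, not \<open>\<real>\<^sub>\<Gamma>\<close> itself.\<close>

definition unit_interval :: "real set \<Rightarrow> real set \<Rightarrow> real \<Rightarrow> (split_real \<times> real \<times> real) set" where
  "unit_interval \<Gamma> \<Lambda> l =
     {x \<in> split_points \<Gamma>. Plus 0 \<le> x \<and> x \<le> Minus l} \<times> {\<one>\<^bsub>affine_group \<Gamma> \<Lambda>\<^esub>}"

end

theory Submission
  imports Defs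
begin

text \<open>
  Two constructions carry the proof: one turns the numerical relation of the last condition into
  a homeomorphism of the line, the other turns an isomorphism of commutator subgroups or of
  groupoids into the numerical relation.

  If \<open>l\<^sub>1 - s * l\<^sub>2\<close> is a sum of terms \<open>\<plusminus> (t - a * t)\<close>, the interval of length \<open>l\<^sub>1\<close> is carried to
  that of length \<open>s * l\<^sub>2\<close> by an increasing piecewise linear homeomorphism of \<real> with slopes in
  \<open>\<Lambda>\<close> and breakpoints in \<open>\<Gamma>\<^sub>1\<close>, because stretching a piece of length \<open>t\<close> by \<open>a\<close> changes the
  length by \<open>a * t - t\<close> (\<open>pl_equivalent_of_coinvariant\<close>). Followed by division by \<open>s\<close> it
  conjugates one Stein group onto the other (\<open>pl_equivalence.stein_groups_isomorphic\<close>), and its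
  affine germs conjugate the arrows of the groupoids (\<open>pl_equivalence.groupoids_isomorphic\<close>). An
  isomorphism of groups restricts to the commutator subgroups.

  For the converse let \<open>\<B>\<close> be the Boolean algebra of finite unions of half-open intervals with
  endpoints in \<open>\<Gamma>\<close>. An isomorphism of commutator subgroups induces an order isomorphism \<kappa> of the
  two algebras: these subgroups contain enough three-cycles of intervals for every member of
  \<open>\<B>\<close> to be the support of an element, and inclusion of supports can be expressed by group
  multiplication alone, as in Rubin's reconstruction theorems (\<open>supported_within_iff\<close>,
  \<open>support_group_iso\<close>). An isomorphism of groupoids induces such a \<kappa> as well, since the compact
  open sets of units form the same algebra (\<open>projection_bij\<close>). Let \<open>m x\<close> be the Lebesgue measure
  of \<open>\<kappa> [0, x)\<close>. An affine map with slope in \<open>\<Lambda>\<^sub>2\<close> corresponds under \<kappa> to a piecewise affine map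
  with slopes in \<open>\<Lambda>\<^sub>1\<close>, so it multiplies the increments of \<open>m\<close> by factors in \<open>\<Lambda>\<^sub>1\<close> that are
  constant on finitely many pieces (\<open>scaling_model\<close>).

  The core is that such an \<open>m\<close> is piecewise linear. Extend it quasi-periodically to \<open>M\<close>, with
  \<open>M (x + l\<^sub>2) = M x + l\<^sub>1\<close>, and let \<open>jump y\<close> be the quotient of the right and left derivatives at
  \<open>0\<close>, measured with \<open>M\<close>, of the translation by \<open>y\<close>. For each \<open>t\<close> the functions \<open>jump\<close> and
  \<open>jump (_ + t)\<close> differ at finitely many points modulo \<open>l\<^sub>2\<close> only, and over one period the product
  of their quotients is \<open>1\<close>. As the rank is at least two, some translation in \<open>\<Gamma>\<^sub>2\<close> has infinite
  orbits modulo \<open>l\<^sub>2\<close>; summing the changes of \<open>ln jump\<close> along these orbits shows that \<open>jump\<close> is constant up to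
  finitely many points of a period (\<open>almost_invariant.constant_off_finite\<close>). Correcting \<open>m\<close> by a
  step function with values in \<open>\<Lambda>\<^sub>1\<close> removes the exceptions, and the corrected \<open>N\<close> is multiplied
  by a single factor \<open>h t\<close> under translation by \<open>t\<close>. If \<open>h\<close> were not trivial near \<open>0\<close>, \<open>N\<close> would
  be exponential; this is impossible if all factors are \<open>1\<close>, and impossible if some affine
  map with slope different from \<open>1\<close> scales \<open>N\<close>, for then \<open>h (a * t) = h t\<close>. Hence \<open>N\<close> is linear
  and \<open>m\<close> has slopes in \<open>s * \<Lambda>\<^sub>1\<close> (\<open>scaling.piecewise_linear\<close>). Reading off slopes, values and
  total length of \<open>m\<close> gives \<open>\<Lambda>\<^sub>2 \<subseteq> \<Lambda>\<^sub>1\<close>, \<open>\<Gamma>\<^sub>1 = s \<Gamma>\<^sub>2\<close>, and \<open>l\<^sub>1 = m l\<^sub>2\<close> as \<open>s * l\<^sub>2\<close> up to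
  coinvariant relations. With the model in the other direction as well, one of the two
  alternatives for \<open>h\<close> is always available (\<open>invariants_of_two_models\<close>).
\<close>

section \<open>Piecewise statements\<close>

text \<open>
  \<open>Q\<close> is a property of intervals. Naming a finite set of cuts instead of a partition makes
  refinement trivial: a common refinement is a union of sets of cuts.
\<close>

definition piecewise :: "real set \<Rightarrow> real \<Rightarrow> real \<Rightarrow> (real \<Rightarrow> real \<Rightarrow> bool) \<Rightarrow> bool" where
  "piecewise \<Gamma> u v Q \<longleftrightarrow> (\<exists>D. finite D \<and> D \<subseteq> \<Gamma> \<and>
     (\<forall>p\<in>\<Gamma>. \<forall>q\<in>\<Gamma>. u \<le> p \<longrightarrow> p < q \<longrightarrow> q \<le> v \<longrightarrow> {p<..<q} \<inter> D = {} \<longrightarrow> Q p q))"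

lemma piecewiseI:
  assumes "finite D" "D \<subseteq> \<Gamma>"
    "\<And>p q. \<lbrakk>p \<in> \<Gamma>; q \<in> \<Gamma>; u \<le> p; p < q; q \<le> v; {p<..<q} \<inter> D = {}\<rbrakk> \<Longrightarrow> Q p q"
  shows "piecewise \<Gamma> u v Q"
  unfolding piecewise_def using assms by (intro exI[of _ D]) auto

lemma piecewise_trivial:
  assumes "\<And>p q. \<lbrakk>p \<in> \<Gamma>; q \<in> \<Gamma>; u \<le> p; p < q; q \<le> v\<rbrakk> \<Longrightarrow> Q p q"
  shows "piecewise \<Gamma> u v Q"
  by (rule piecewiseI[of "{}"]) (use assms in auto)

lemma piecewise_conj:
  assumes "piecewise \<Gamma> u v Q" "piecewise \<Gamma> u v R"
  shows "piecewise \<Gamma> u v (\<lambda>p q. Q p q \<and> R p q)"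
proof -
  obtain D where D: "finite D" "D \<subseteq> \<Gamma>"
    "\<forall>p\<in>\<Gamma>. \<forall>q\<in>\<Gamma>. u \<le> p \<longrightarrow> p < q \<longrightarrow> q \<le> v \<longrightarrow> {p<..<q} \<inter> D = {} \<longrightarrow> (Q p q)"
    using assms(1) unfolding piecewise_def by (elim exE conjE) (rule that)
  obtain E where E: "finite E" "E \<subseteq> \<Gamma>"
    "\<forall>p\<in>\<Gamma>. \<forall>q\<in>\<Gamma>. u \<le> p \<longrightarrow> p < q \<longrightarrow> q \<le> v \<longrightarrow> {p<..<q} \<inter> E = {} \<longrightarrow> (R p q)"
    using assms(2) unfolding piecewise_def by (elim exE conjE) (rule that)
  show ?thesis
    by (rule piecewiseI[of "D \<union> E"]) (use D E in \<open>auto simp: Int_Un_distrib\<close>)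
qed

lemma piecewise_all:
  assumes "finite I" "\<And>i. i \<in> I \<Longrightarrow> piecewise \<Gamma> u v (Q i)"
  shows "piecewise \<Gamma> u v (\<lambda>p q. \<forall>i\<in>I. Q i p q)"
  using assms
proof (induction I)
  case empty
  show ?case by (rule piecewise_trivial) auto
next
  case (insert i I)
  have "piecewise \<Gamma> u v (\<lambda>p q. Q i p q \<and> (\<forall>i\<in>I. Q i p q))"
    using insert by (intro piecewise_conj) auto
  then show ?case by simp
qed

lemma piecewise_mono:
  assumes "piecewise \<Gamma> u v Q"
    and "\<And>p q. \<lbrakk>p \<in> \<Gamma>; q \<in> \<Gamma>; u \<le> p; p < q; q \<le> v; Q p q\<rbrakk> \<Longrightarrow> R p q"
  shows "piecewise \<Gamma> u v R"
  using assms(1) unfolding piecewise_def by (meson assms(2))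

lemma piecewise_subinterval:
  assumes "piecewise \<Gamma> u v Q" "u \<le> u'" "v' \<le> v"
  shows "piecewise \<Gamma> u' v' Q"
  using assms(1) unfolding piecewise_def by (meson assms(2,3) order_trans)

text \<open>
  A relation between the endpoints of an interval that is inherited by concatenation holds
  on the whole interval as soon as it holds piecewise. All inductions over the pieces of a
  piecewise linear map are instances of this rule.
\<close>

lemma piecewise_glue:
  assumes "piecewise \<Gamma> u v Q"
    and base: "\<And>p q. \<lbrakk>p \<in> \<Gamma>; q \<in> \<Gamma>; u \<le> p; p < q; q \<le> v; Q p q\<rbrakk> \<Longrightarrow> R p q"
    and concat: "\<And>p c q. \<lbrakk>p \<in> \<Gamma>; c \<in> \<Gamma>; q \<in> \<Gamma>; u \<le> p; p < c; c < q; q \<le> v; R p c; R c q\<rbrakk> \<Longrightarrow> R p q"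
    and pq: "p \<in> \<Gamma>" "q \<in> \<Gamma>" "u \<le> p" "p < q" "q \<le> v"
  shows "R p q"
proof -
  obtain D where D: "finite D" "D \<subseteq> \<Gamma>"
    "\<forall>p\<in>\<Gamma>. \<forall>q\<in>\<Gamma>. u \<le> p \<longrightarrow> p < q \<longrightarrow> q \<le> v \<longrightarrow> {p<..<q} \<inter> D = {} \<longrightarrow> (Q p q)"
    using assms(1) unfolding piecewise_def by (elim exE conjE) (rule that)
  show ?thesis using pq
  proof (induction "card (D \<inter> {p<..<q})" arbitrary: p q rule: less_induct)
    case less
    show ?case
    proof (cases "{p<..<q} \<inter> D = {}")
      case True
      then show ?thesis using less.prems base D(3)[rule_format, of p q] by blast
    next
      case False
      then obtain c where c: "c \<in> D" "p < c" "c < q" by auto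
      have "D \<inter> {p<..<c} \<subset> D \<inter> {p<..<q}" "D \<inter> {c<..<q} \<subset> D \<inter> {p<..<q}"
        using c by auto
      then have "card (D \<inter> {p<..<c}) < card (D \<inter> {p<..<q})"
        "card (D \<inter> {c<..<q}) < card (D \<inter> {p<..<q})"
        using D(1) by (auto intro: psubset_card_mono)
      then have "R p c" "R c q" using less c D(2) by auto
      then show ?thesis using concat[of p c q] less.prems c D(2) by auto
    qed
  qed
qed

lemma piecewise_concat:
  assumes "piecewise \<Gamma> u w Q" "piecewise \<Gamma> w v Q" "w \<in> \<Gamma>"
  shows "piecewise \<Gamma> u v Q"
proof -
  obtain D where D: "finite D" "D \<subseteq> \<Gamma>"
    "\<forall>p\<in>\<Gamma>. \<forall>q\<in>\<Gamma>. u \<le> p \<longrightarrow> p < q \<longrightarrow> q \<le> w \<longrightarrow> {p<..<q} \<inter> D = {} \<longrightarrow> (Q p q)"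
    using assms(1) unfolding piecewise_def by (elim exE conjE) (rule that)
  obtain E where E: "finite E" "E \<subseteq> \<Gamma>"
    "\<forall>p\<in>\<Gamma>. \<forall>q\<in>\<Gamma>. w \<le> p \<longrightarrow> p < q \<longrightarrow> q \<le> v \<longrightarrow> {p<..<q} \<inter> E = {} \<longrightarrow> (Q p q)"
    using assms(2) unfolding piecewise_def by (elim exE conjE) (rule that)
  show ?thesis
  proof (rule piecewiseI[of "insert w (D \<union> E)"])
    fix p q assume pq: "p \<in> \<Gamma>" "q \<in> \<Gamma>" "u \<le> p" "p < q" "q \<le> v" "{p<..<q} \<inter> insert w (D \<union> E) = {}"
    then have "w \<notin> {p<..<q}" by blast
    then have "q \<le> w \<or> w \<le> p" by auto
    then show "Q p q" using D(3)[rule_format, of p q] E(3)[rule_format, of p q] pq by (auto simp: Int_Un_distrib)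
  qed (use D E assms in auto)
qed

text \<open>
  Up to its first cut the interval is a single piece; density of \<open>\<Gamma>\<close> provides an endpoint there.
\<close>

lemma piecewise_right_end:
  assumes "piecewise \<Gamma> u v Q" "u \<in> \<Gamma>" "u < v" "closure \<Gamma> = UNIV"
  shows "\<exists>q\<in>\<Gamma>. u < q \<and> q < v \<and> Q u q"
proof -
  obtain D where D: "finite D" "D \<subseteq> \<Gamma>"
    "\<forall>p\<in>\<Gamma>. \<forall>q\<in>\<Gamma>. u \<le> p \<longrightarrow> p < q \<longrightarrow> q \<le> v \<longrightarrow> {p<..<q} \<inter> D = {} \<longrightarrow> Q p q"
    using assms(1) unfolding piecewise_def by (elim exE conjE) (rule that)
  define w where "w = Min (insert v (D \<inter> {u<..}))"
  have w: "u < w" "w \<le> v" "\<And>d. d \<in> D \<Longrightarrow> u < d \<Longrightarrow> w \<le> d"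
    unfolding w_def using D(1) assms(3) by (auto simp: Min_gr_iff intro: Min_le)
  have "{u<..<w} \<inter> \<Gamma> \<noteq> {}"
    using assms(4) w(1) open_Int_closure_eq_empty[of "{u<..<w}" \<Gamma>] by (auto simp: dense_le)
  then obtain q where q: "q \<in> \<Gamma>" "u < q" "q < w" by auto
  have "{u<..<q} \<inter> D = {}" using w(3) q by force
  then show ?thesis using D(3)[rule_format, of u q] q assms(2) w(2) by force
qed

lemma piecewise_left_end:
  assumes "piecewise \<Gamma> u v Q" "v \<in> \<Gamma>" "u < v" "closure \<Gamma> = UNIV"
  shows "\<exists>p\<in>\<Gamma>. u < p \<and> p < v \<and> Q p v"
proof -
  obtain D where D: "finite D" "D \<subseteq> \<Gamma>"
    "\<forall>p\<in>\<Gamma>. \<forall>q\<in>\<Gamma>. u \<le> p \<longrightarrow> p < q \<longrightarrow> q \<le> v \<longrightarrow> {p<..<q} \<inter> D = {} \<longrightarrow> Q p q"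
    using assms(1) unfolding piecewise_def by (elim exE conjE) (rule that)
  define w where "w = Max (insert u (D \<inter> {..<v}))"
  have w: "w < v" "u \<le> w" "\<And>d. d \<in> D \<Longrightarrow> d < v \<Longrightarrow> d \<le> w"
    unfolding w_def using D(1) assms(3) by (auto simp: Max_less_iff intro: Max_ge)
  have "{w<..<v} \<inter> \<Gamma> \<noteq> {}"
    using assms(4) w(1) open_Int_closure_eq_empty[of "{w<..<v}" \<Gamma>] by (auto simp: dense_le)
  then obtain p where q: "p \<in> \<Gamma>" "w < p" "p < v" by auto
  have "{p<..<v} \<inter> D = {}" using w(3) q by force
  then show ?thesis using D(3)[rule_format, of p v] q assms(2) w(2) by force
qed

section \<open>Modules over a group of slopes\<close>

definition mult_group :: "real set \<Rightarrow> bool" where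
  "mult_group A \<longleftrightarrow> 1 \<in> A \<and> (\<forall>a\<in>A. 0 < a \<and> inverse a \<in> A \<and> (\<forall>b\<in>A. a * b \<in> A))"

lemma mult_groupD:
  assumes "mult_group A"
  shows "1 \<in> A" "a \<in> A \<Longrightarrow> 0 < a" "a \<in> A \<Longrightarrow> inverse a \<in> A" "a \<in> A \<Longrightarrow> b \<in> A \<Longrightarrow> a * b \<in> A"
    "a \<in> A \<Longrightarrow> b \<in> A \<Longrightarrow> a / b \<in> A" "a \<in> A \<Longrightarrow> 1 / a \<in> A"
  using assms unfolding mult_group_def divide_inverse by auto

lemma mult_group_prod:
  assumes "mult_group A" "\<And>i. i \<in> I \<Longrightarrow> f i \<in> A"
  shows "prod f I \<in> A"
  using assms(2) by (induction I rule: infinite_finite_induct) (auto intro: mult_groupD[OF assms(1)])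

lemma mult_group_subgroup:
  assumes "subgroup H positive_reals"
  shows "mult_group H"
proof -
  have grp: "group positive_reals"
    unfolding positive_reals_def by (rule groupI) (auto intro!: bexI[of _ "inverse x" for x])
  have inv: "inv\<^bsub>positive_reals\<^esub> x = inverse x" if "0 < x" for x :: real
    by (rule group.inv_equality[OF grp]) (use that in \<open>auto simp: positive_reals_def\<close>)
  have sub: "H \<subseteq> {0<..}"
    using subgroup.subset[OF assms] by (simp add: positive_reals_def)
  have one: "1 \<in> H" using subgroup.one_closed[OF assms] by (simp add: positive_reals_def)
  have mul: "a * b \<in> H" if "a \<in> H" "b \<in> H" for a b
    using subgroup.m_closed[OF assms that] by (simp add: positive_reals_def)
  have "inverse a \<in> H" if "a \<in> H" for a
    using subgroup.m_inv_closed[OF assms that] inv[of a] sub that by auto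
  then show ?thesis unfolding mult_group_def using sub one mul by auto
qed

definition add_group :: "real set \<Rightarrow> bool" where
  "add_group H \<longleftrightarrow> 0 \<in> H \<and> (\<forall>x\<in>H. - x \<in> H \<and> (\<forall>y\<in>H. x + y \<in> H))"

lemma add_groupD:
  assumes "add_group H"
  shows "0 \<in> H" "x \<in> H \<Longrightarrow> - x \<in> H" "x \<in> H \<Longrightarrow> y \<in> H \<Longrightarrow> x + y \<in> H"
    "x \<in> H \<Longrightarrow> y \<in> H \<Longrightarrow> x - y \<in> H" "x \<in> H \<Longrightarrow> of_nat n * x \<in> H" "x \<in> H \<Longrightarrow> of_int k * x \<in> H"
    "x \<in> H \<Longrightarrow> numeral w * x \<in> H"
proof -
  show A: "0 \<in> H" "x \<in> H \<Longrightarrow> - x \<in> H" "\<And>x y. x \<in> H \<Longrightarrow> y \<in> H \<Longrightarrow> x + y \<in> H" for x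
    using assms unfolding add_group_def by auto
  then show "x \<in> H \<Longrightarrow> y \<in> H \<Longrightarrow> x - y \<in> H" by (metis add_uminus_conv_diff)
  show nat: "of_nat n * x \<in> H" if "x \<in> H" for x n
    by (induction n) (use A that in \<open>auto simp: distrib_right\<close>)
  show "x \<in> H \<Longrightarrow> of_int k * x \<in> H"
    by (cases k rule: int_cases2) (use nat[of x] A(2) in auto)
  show "x \<in> H \<Longrightarrow> numeral w * x \<in> H"
    using nat[of x "numeral w"] by simp
qed

lemma add_group_subgroup:
  assumes "subgroup H real_additive"
  shows "add_group H"
  unfolding add_group_def using subgroup_real_additiveD[OF assms] by blast

locale stein =
  fixes \<Gamma> \<Lambda> :: "real set" and l :: real
  assumes add_group: "add_group \<Gamma>" and mult_group: "mult_group \<Lambda>"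
    and stable: "\<And>a x. a \<in> \<Lambda> \<Longrightarrow> x \<in> \<Gamma> \<Longrightarrow> a * x \<in> \<Gamma>"
    and dense: "closure \<Gamma> = UNIV" and l_in: "l \<in> \<Gamma>" and l_pos: "0 < l"
begin

lemmas add = add_groupD[OF add_group]
lemmas mul = mult_groupD[OF mult_group]

lemma divide_in: "a \<in> \<Lambda> \<Longrightarrow> x \<in> \<Gamma> \<Longrightarrow> x / a \<in> \<Gamma>"
  using stable[of "inverse a" x] mul by (simp add: divide_inverse mult.commute)

lemma scale_iff: "a \<in> \<Lambda> \<Longrightarrow> a * x \<in> \<Gamma> \<longleftrightarrow> x \<in> \<Gamma>"
  using divide_in[of a "a * x"] stable[of a x] mul(2)[of a] by auto

lemma between: "x < y \<Longrightarrow> \<exists>z\<in>\<Gamma>. x < z \<and> z < y"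
proof -
  assume "x < y"
  then have "open {x<..<y}" "{x<..<y} \<noteq> {}" by (auto simp: dense_le)
  then have "{x<..<y} \<inter> \<Gamma> \<noteq> {}"
    using dense open_Int_closure_eq_empty[of "{x<..<y}" \<Gamma>] by auto
  then show ?thesis by auto
qed

lemma between2: "x < y \<Longrightarrow> \<exists>p\<in>\<Gamma>. \<exists>q\<in>\<Gamma>. x < p \<and> p < q \<and> q < y"
  using between by (meson less_trans)

end

section \<open>The algebra of finite unions of intervals\<close>

text \<open>
  The finite unions of half-open intervals with endpoints in \<open>\<Gamma>\<close>.
\<close>

definition interval_algebra :: "real set \<Rightarrow> real \<Rightarrow> real set set" where
  "interval_algebra \<Gamma> l = {B. B \<subseteq> {0..<l} \<and>
     piecewise \<Gamma> 0 l (\<lambda>p q. {p..<q} \<subseteq> B \<or> {p..<q} \<inter> B = {})}"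

lemma interval_algebra_subset: "B \<in> interval_algebra \<Gamma> l \<Longrightarrow> B \<subseteq> {0..<l}"
  by (simp add: interval_algebra_def)

lemma interval_algebra_interval:
  assumes "p \<in> \<Gamma>" "q \<in> \<Gamma>" "0 \<le> p" "q \<le> l"
  shows "{p..<q} \<in> interval_algebra \<Gamma> l"
proof -
  have "piecewise \<Gamma> 0 l (\<lambda>x y. {x..<y} \<subseteq> {p..<q} \<or> {x..<y} \<inter> {p..<q} = {})"
  proof (rule piecewiseI[of "{p,q}"])
    fix x y assume "{x<..<y} \<inter> {p,q} = {}" "x < y"
    then have "p \<notin> {x<..<y}" "q \<notin> {x<..<y}" by blast+
    then have "y \<le> p \<or> q \<le> x \<or> (p \<le> x \<and> y \<le> q)" using \<open>x < y\<close> by auto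
    then show "{x..<y} \<subseteq> {p..<q} \<or> {x..<y} \<inter> {p..<q} = {}" by auto
  qed (use assms in auto)
  then show ?thesis using assms by (auto simp: interval_algebra_def)
qed

lemma interval_algebra_empty: "{} \<in> interval_algebra \<Gamma> l"
  by (auto simp: interval_algebra_def intro: piecewise_trivial)

lemma interval_algebra_binary:
  assumes B: "B \<in> interval_algebra \<Gamma> l" and C: "C \<in> interval_algebra \<Gamma> l"
  shows "B \<union> C \<in> interval_algebra \<Gamma> l" "B \<inter> C \<in> interval_algebra \<Gamma> l"
    "B - C \<in> interval_algebra \<Gamma> l"
proof -
  have P: "piecewise \<Gamma> 0 l (\<lambda>p q. ({p..<q} \<subseteq> B \<or> {p..<q} \<inter> B = {}) \<and> ({p..<q} \<subseteq> C \<or> {p..<q} \<inter> C = {}))"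
    using assms by (intro piecewise_conj) (auto simp: interval_algebra_def)
  have "piecewise \<Gamma> 0 l (\<lambda>p q. {p..<q} \<subseteq> B \<union> C \<or> {p..<q} \<inter> (B \<union> C) = {})"
    using P by (rule piecewise_mono) blast
  moreover have "piecewise \<Gamma> 0 l (\<lambda>p q. {p..<q} \<subseteq> B \<inter> C \<or> {p..<q} \<inter> (B \<inter> C) = {})"
    using P by (rule piecewise_mono) blast
  moreover have "piecewise \<Gamma> 0 l (\<lambda>p q. {p..<q} \<subseteq> B - C \<or> {p..<q} \<inter> (B - C) = {})"
    using P by (rule piecewise_mono) blast
  ultimately show "B \<union> C \<in> interval_algebra \<Gamma> l" "B \<inter> C \<in> interval_algebra \<Gamma> l"
    "B - C \<in> interval_algebra \<Gamma> l"
    using assms by (auto simp: interval_algebra_def)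
qed

text \<open>
  Pieces are half-open, so the one that contains \<open>x\<close> extends beyond \<open>x\<close> to the right.
\<close>

lemma piecewise_right_germ:
  fixes x :: real
  assumes "piecewise \<Gamma> 0 l Q" "add_group \<Gamma>" "closure \<Gamma> = UNIV" "l \<in> \<Gamma>" "0 \<le> x" "x < l"
  shows "\<exists>p q. p \<in> \<Gamma> \<and> q \<in> \<Gamma> \<and> 0 \<le> p \<and> p \<le> x \<and> x < q \<and> q \<le> l \<and> Q p q"
proof -
  define R where "R = (\<lambda>a b. \<forall>x. a \<le> x \<longrightarrow> x < b \<longrightarrow>
    (\<exists>p q. p \<in> \<Gamma> \<and> q \<in> \<Gamma> \<and> 0 \<le> p \<and> p \<le> x \<and> x < q \<and> q \<le> l \<and> Q p q))"
  have "R 0 l" using assms(1)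
  proof (rule piecewise_glue)
    fix a b assume "a \<in> \<Gamma>" "b \<in> \<Gamma>" "0 \<le> a" "a < b" "b \<le> l" "Q a b"
    then show "R a b" unfolding R_def by blast
  next
    fix a c b assume "R a c" "R c b"
    then show "R a b" unfolding R_def by (meson not_less)
  qed (use assms add_groupD[OF assms(2)] in auto)
  then show ?thesis using assms unfolding R_def by auto
qed

context stein
begin

abbreviation \<B> where "\<B> \<equiv> interval_algebra \<Gamma> l"

lemma algebra_right_open:
  assumes "B \<in> \<B>" "x \<in> B"
  shows "\<exists>p q. p \<in> \<Gamma> \<and> q \<in> \<Gamma> \<and> 0 \<le> p \<and> p \<le> x \<and> x < q \<and> q \<le> l \<and> {p..<q} \<subseteq> B"
proof -
  have "piecewise \<Gamma> 0 l (\<lambda>p q. {p..<q} \<subseteq> B \<or> {p..<q} \<inter> B = {})"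
    using assms by (auto simp: interval_algebra_def)
  moreover have "0 \<le> x" "x < l" using assms interval_algebra_subset by fastforce+
  ultimately obtain p q where pq: "p \<in> \<Gamma>" "q \<in> \<Gamma>" "0 \<le> p" "p \<le> x" "x < q" "q \<le> l"
    "{p..<q} \<subseteq> B \<or> {p..<q} \<inter> B = {}"
    using piecewise_right_germ[of \<Gamma> l] add_group dense l_in by blast
  have "x \<in> {p..<q}" using pq by simp
  then have "{p..<q} \<subseteq> B" using pq assms(2) by blast
  then show ?thesis using pq by blast
qed

lemma algebra_nonempty:
  assumes "B \<in> \<B>" "B \<noteq> {}"
  obtains p q where "p \<in> \<Gamma>" "q \<in> \<Gamma>" "0 \<le> p" "p < q" "q \<le> l" "{p..<q} \<subseteq> B"
proof -
  obtain x where "x \<in> B" using assms by blast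
  then obtain p q where "p \<in> \<Gamma>" "q \<in> \<Gamma>" "0 \<le> p" "p \<le> x" "x < q" "q \<le> l" "{p..<q} \<subseteq> B"
    using algebra_right_open[OF assms(1)] by meson
  then show thesis using that[of p q] by auto
qed

lemma algebraI:
  assumes "B \<subseteq> {0..<l}" "piecewise \<Gamma> 0 l (\<lambda>p q. {p..<q} \<subseteq> B \<or> {p..<q} \<inter> B = {})"
  shows "B \<in> \<B>"
  using assms by (simp add: interval_algebra_def)

lemma space_in: "{0..<l} \<in> \<B>"
  by (rule interval_algebra_interval) (use add l_in in auto)

end

section \<open>Piecewise affine maps\<close>

definition paffine :: "real set \<Rightarrow> real set \<Rightarrow> real set \<Rightarrow> real \<Rightarrow> (real \<Rightarrow> real) \<Rightarrow> bool" where
  "paffine \<Gamma> A \<Gamma>' l f \<longleftrightarrow>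
     piecewise \<Gamma> 0 l (\<lambda>p q. \<exists>a\<in>A. \<exists>s\<in>\<Gamma>'. \<forall>x\<in>{p..<q}. f x = a * x + s)"

lemma paffine_cong:
  assumes "paffine \<Gamma> A \<Gamma>' l f" "\<And>x. 0 \<le> x \<Longrightarrow> x < l \<Longrightarrow> g x = f x"
  shows "paffine \<Gamma> A \<Gamma>' l g"
  using assms(1) unfolding paffine_def
  by (rule piecewise_mono) (metis assms(2) atLeastLessThan_iff order.strict_trans2 order_trans)

lemma paffine_mono:
  assumes "paffine \<Gamma> A \<Gamma>' l f" "A \<subseteq> A'"
  shows "paffine \<Gamma> A' \<Gamma>' l f"
  using assms(1) unfolding paffine_def by (rule piecewise_mono) (use assms(2) in blast)

lemma paffine_point:
  assumes "paffine \<Gamma> A \<Gamma>' l f" "add_group \<Gamma>" "closure \<Gamma> = UNIV" "l \<in> \<Gamma>" "0 \<le> x" "x < l"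
  shows "\<exists>p q a s. p \<in> \<Gamma> \<and> q \<in> \<Gamma> \<and> 0 \<le> p \<and> p \<le> x \<and> x < q \<and> q \<le> l \<and> a \<in> A \<and> s \<in> \<Gamma>' \<and>
           (\<forall>x\<in>{p..<q}. f x = a * x + s)"
  using piecewise_right_germ[OF assms(1)[unfolded paffine_def] assms(2-6)] by metis

text \<open>
  The breakpoints of a composition are those of the inner map and the preimages of those of
  the outer map.
\<close>

lemma paffine_compose:
  assumes f: "paffine \<Gamma> A \<Gamma>' l f" and g: "paffine \<Gamma>' A' \<Gamma>'' l' g"
    and dom: "add_group \<Gamma>" "closure \<Gamma> = UNIV" "l \<in> \<Gamma>" and \<Gamma>': "add_group \<Gamma>'"
    and \<Gamma>'': "add_group \<Gamma>''"
    and bij: "bij_betw f {0..<l} {0..<l'}"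
    and A: "\<And>a. a \<in> A \<Longrightarrow> 0 < a" "\<And>a x. a \<in> A \<Longrightarrow> a * x \<in> \<Gamma>' \<longleftrightarrow> x \<in> \<Gamma>"
    and A': "\<And>a x. a \<in> A' \<Longrightarrow> x \<in> \<Gamma>' \<Longrightarrow> a * x \<in> \<Gamma>''"
    and A'': "\<And>a b. a \<in> A' \<Longrightarrow> b \<in> A \<Longrightarrow> a * b \<in> A''"
  shows "paffine \<Gamma> A'' \<Gamma>'' l (\<lambda>x. g (f x))"
proof -
  obtain D where D: "finite D" "D \<subseteq> \<Gamma>"
    "\<forall>p\<in>\<Gamma>. \<forall>q\<in>\<Gamma>. 0 \<le> p \<longrightarrow> p < q \<longrightarrow> q \<le> l \<longrightarrow> {p<..<q} \<inter> D = {} \<longrightarrow> (\<exists>a\<in>A. \<exists>s\<in>\<Gamma>'. \<forall>x\<in>{p..<q}. f x = a * x + s)"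
    using f unfolding paffine_def piecewise_def by (elim exE conjE) (rule that)
  obtain E where E: "finite E" "E \<subseteq> \<Gamma>'"
    "\<forall>p\<in>\<Gamma>'. \<forall>q\<in>\<Gamma>'. 0 \<le> p \<longrightarrow> p < q \<longrightarrow> q \<le> l' \<longrightarrow> {p<..<q} \<inter> E = {} \<longrightarrow> (\<exists>a\<in>A'. \<exists>s\<in>\<Gamma>''. \<forall>x\<in>{p..<q}. g x = a * x + s)"
    using g unfolding paffine_def piecewise_def by (elim exE conjE) (rule that)
  define F where "F = {x \<in> {0..<l}. f x \<in> E}"
  have "finite F"
  proof -
    have "F = f -` E \<inter> {0..<l}" by (auto simp: F_def)
    then show ?thesis using finite_vimage_IntI[of E f "{0..<l}"] E(1) bij by (simp add: bij_betw_def)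
  qed
  moreover have "F \<subseteq> \<Gamma>"
  proof
    fix x assume "x \<in> F"
    then have x: "0 \<le> x" "x < l" "f x \<in> \<Gamma>'" using E(2) by (auto simp: F_def)
    then obtain a s where "a \<in> A" "s \<in> \<Gamma>'" "f x = a * x + s"
      using paffine_point[OF f dom x(1,2)] by (metis atLeastLessThan_iff)
    then show "x \<in> \<Gamma>" using x(3) A(2)[of a x] add_groupD(4)[OF \<Gamma>', of "f x" s] by simp
  qed
  ultimately show ?thesis unfolding paffine_def
  proof (intro piecewiseI[of "D \<union> F"])
    fix p q assume pq: "p \<in> \<Gamma>" "q \<in> \<Gamma>" "0 \<le> p" "p < q" "q \<le> l" "{p<..<q} \<inter> (D \<union> F) = {}"
    then obtain a s where a: "a \<in> A" "s \<in> \<Gamma>'" and fa: "\<And>x. x \<in> {p..<q} \<Longrightarrow> f x = a * x + s"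
      using D(3)[rule_format, of p q] by (metis Int_Un_distrib sup_bot.eq_neutr_iff)
    have a0: "0 < a" using A a by auto
    have img: "f x \<in> {0..<l'}" if "x \<in> {0..<l}" for x using bij that by (auto simp: bij_betw_def)
    have up: "a * q + s \<le> l'"
    proof (rule ccontr)
      assume "\<not> a * q + s \<le> l'"
      then have "l' < a * q + s" by simp
      define x where "x = max p ((l' - s) / a)"
      have "x \<in> {p..<q}" using \<open>l' < a * q + s\<close> a0 pq by (auto simp: x_def field_simps)
      moreover have "a * x + s \<ge> l'" using a0 by (auto simp: x_def field_simps max_def)
      ultimately show False using fa[of x] img[of x] pq by auto
    qed
    have lo: "0 \<le> a * p + s" using fa[of p] img[of p] pq by auto
    have "{a * p + s<..<a * q + s} \<inter> E = {}"
    proof (rule ccontr)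
      assume "\<not> ?thesis"
      then obtain y where y: "y \<in> E" "a * p + s < y" "y < a * q + s" by auto
      define x where "x = (y - s) / a"
      have x: "p < x" "x < q" "a * x + s = y" using y a0 by (auto simp: x_def field_simps)
      then have "x \<in> F" using fa[of x] y pq by (auto simp: F_def)
      then show False using pq x by auto
    qed
    moreover have "a * p + s \<in> \<Gamma>'" "a * q + s \<in> \<Gamma>'"
      using add_groupD[OF \<Gamma>'] A(2) a pq by auto
    ultimately obtain b r where b: "b \<in> A'" "r \<in> \<Gamma>''" and gb: "\<And>x. x \<in> {a * p + s..<a * q + s} \<Longrightarrow> g x = b * x + r"
      using E(3)[rule_format, of "a * p + s" "a * q + s"] lo up pq a0 by (auto simp: mult_less_cancel_left)
    have "g (f x) = (b * a) * x + (b * s + r)" if x: "x \<in> {p..<q}" for x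
    proof -
      have "a * x + s \<in> {a * p + s..<a * q + s}" using x a0 by simp
      then show ?thesis using fa[OF x] gb by (simp add: algebra_simps)
    qed
    moreover have "b * a \<in> A''" "b * s + r \<in> \<Gamma>''" using A'' A' a b add_groupD[OF \<Gamma>''] by auto
    ultimately show "\<exists>a\<in>A''. \<exists>s\<in>\<Gamma>''. \<forall>x\<in>{p..<q}. g (f x) = a * x + s" by blast
  qed (use D in auto)
qed

section \<open>Recovering supports from the group structure\<close>

definition commutator :: "('a, 'b) monoid_scheme \<Rightarrow> 'a \<Rightarrow> 'a \<Rightarrow> 'a" where
  "commutator G x y = x \<otimes>\<^bsub>G\<^esub> y \<otimes>\<^bsub>G\<^esub> inv\<^bsub>G\<^esub> x \<otimes>\<^bsub>G\<^esub> inv\<^bsub>G\<^esub> y"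

definition commute :: "('a, 'b) monoid_scheme \<Rightarrow> 'a \<Rightarrow> 'a \<Rightarrow> bool" where
  "commute G x y \<longleftrightarrow> x \<otimes>\<^bsub>G\<^esub> y = y \<otimes>\<^bsub>G\<^esub> x"

text \<open>
  A substitute for disjointness of supports in the language of groups, exact up to replacing \<open>g\<close> by
  its twelfth power: see \<open>disjoint_supp_algebraically_disjoint\<close> and
  \<open>algebraically_disjoint_supp\<close>.
\<close>

definition algebraically_disjoint :: "('a, 'b) monoid_scheme \<Rightarrow> 'a \<Rightarrow> 'a \<Rightarrow> bool" where
  "algebraically_disjoint G f g \<longleftrightarrow>
     (\<forall>h\<in>carrier G. \<not> commute G f h \<longrightarrow>
        (\<exists>f1\<in>carrier G. \<exists>f2\<in>carrier G. commute G f1 g \<and> commute G f2 g \<and>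
           commutator G f1 (commutator G f2 h) \<noteq> \<one>\<^bsub>G\<^esub> \<and>
           commute G (commutator G f1 (commutator G f2 h)) g))"

text \<open>
  For permutation groups as below this says that the support of \<open>h\<close> lies in that of \<open>f\<close>. The
  exponent \<open>12\<close> is a common multiple of \<open>1\<close>, \<open>2\<close>, \<open>3\<close> and \<open>4\<close>, the exponents that the argument
  for algebraic disjointness uses.
\<close>

definition supported_within :: "('a, 'b) monoid_scheme \<Rightarrow> 'a \<Rightarrow> 'a \<Rightarrow> bool" where
  "supported_within G h f \<longleftrightarrow>
     (\<forall>g\<in>carrier G. algebraically_disjoint G f g \<longrightarrow> commute G h (g [^]\<^bsub>G\<^esub> (12::nat)))"

context
  fixes G :: "('a, 'c) monoid_scheme" and H :: "('b, 'd) monoid_scheme" and \<Phi>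
  assumes G: "group G" and H: "group H" and \<Phi>: "\<Phi> \<in> iso G H"
begin

lemma iso_group_hom: "group_hom G H \<Phi>"
  using G H \<Phi> by (simp add: group_hom_def group_hom_axioms_def iso_def)

lemma iso_eq_iff: "x \<in> carrier G \<Longrightarrow> y \<in> carrier G \<Longrightarrow> \<Phi> x = \<Phi> y \<longleftrightarrow> x = y"
  using \<Phi> by (auto simp: iso_def bij_betw_def inj_on_def)

lemma iso_carrier: "\<Phi> ` carrier G = carrier H"
  using \<Phi> by (simp add: iso_def bij_betw_def)

lemma iso_mem: "x \<in> carrier G \<Longrightarrow> \<Phi> x \<in> carrier H"
  using iso_carrier by blast

lemma iso_commute: "x \<in> carrier G \<Longrightarrow> y \<in> carrier G \<Longrightarrow> commute H (\<Phi> x) (\<Phi> y) \<longleftrightarrow> commute G x y"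
proof -
  interpret group_hom G H \<Phi> by (rule iso_group_hom)
  show "x \<in> carrier G \<Longrightarrow> y \<in> carrier G \<Longrightarrow> ?thesis"
    unfolding commute_def by (simp flip: hom_mult add: iso_eq_iff)
qed

lemma iso_commutator:
  "x \<in> carrier G \<Longrightarrow> y \<in> carrier G \<Longrightarrow> commutator H (\<Phi> x) (\<Phi> y) = \<Phi> (commutator G x y)"
proof -
  interpret group_hom G H \<Phi> by (rule iso_group_hom)
  show "x \<in> carrier G \<Longrightarrow> y \<in> carrier G \<Longrightarrow> ?thesis"
    unfolding commutator_def by simp
qed

lemma commutator_closed: "x \<in> carrier G \<Longrightarrow> y \<in> carrier G \<Longrightarrow> commutator G x y \<in> carrier G"
proof -
  interpret group G by (rule G)
  show "x \<in> carrier G \<Longrightarrow> y \<in> carrier G \<Longrightarrow> ?thesis" unfolding commutator_def by simp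
qed

lemma iso_algebraically_disjoint:
  assumes "f \<in> carrier G" "g \<in> carrier G"
  shows "algebraically_disjoint H (\<Phi> f) (\<Phi> g) \<longleftrightarrow> algebraically_disjoint G f g"
proof -
  interpret group_hom G H \<Phi> by (rule iso_group_hom)
  have one: "\<Phi> x = \<one>\<^bsub>H\<^esub> \<longleftrightarrow> x = \<one>\<^bsub>G\<^esub>" if "x \<in> carrier G" for x
    using iso_eq_iff[OF that, of "\<one>\<^bsub>G\<^esub>"] by simp
  show ?thesis
    unfolding algebraically_disjoint_def iso_carrier[symmetric] ball_simps bex_simps
    by (intro ball_cong bex_cong imp_cong conj_cong refl)
       (use assms in \<open>simp_all add: iso_commute iso_commutator commutator_closed one\<close>)
qed

lemma iso_supported_within:
  assumes "f \<in> carrier G" "h \<in> carrier G"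
  shows "supported_within H (\<Phi> h) (\<Phi> f) \<longleftrightarrow> supported_within G h f"
proof -
  interpret group_hom G H \<Phi> by (rule iso_group_hom)
  show ?thesis
    unfolding supported_within_def iso_carrier[symmetric] ball_simps
    by (intro ball_cong imp_cong refl)
       (use assms in \<open>simp_all add: iso_algebraically_disjoint iso_commute flip: hom_nat_pow\<close>)
qed

end

text \<open>
  Permutations of \<open>X\<close> with supports in an algebra \<open>\<A>\<close>. \<open>supp f\<close> is a regularised support:
  \<open>displace\<close> asks that the points that are really moved are dense in it, in the sense of \<open>\<A>\<close>.
  The last two assumptions say that there are many elements with small support.
\<close>

locale support_group =
  fixes X :: "'a set" and H :: "('a \<Rightarrow> 'a) set" and \<A> :: "'a set set"
    and supp :: "('a \<Rightarrow> 'a) \<Rightarrow> 'a set"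
  assumes subgroup: "subgroup H (BijGroup X)"
    and alg: "\<And>B. B \<in> \<A> \<Longrightarrow> B \<subseteq> X" "\<And>B C. B \<in> \<A> \<Longrightarrow> C \<in> \<A> \<Longrightarrow> B - C \<in> \<A>"
    and image: "\<And>h B. h \<in> H \<Longrightarrow> B \<in> \<A> \<Longrightarrow> h ` B \<in> \<A>"
    and supp_in: "\<And>f. f \<in> H \<Longrightarrow> supp f \<in> \<A>"
    and supp_fix: "\<And>f x. f \<in> H \<Longrightarrow> x \<in> X \<Longrightarrow> x \<notin> supp f \<Longrightarrow> f x = x"
    and displace: "\<And>f B. f \<in> H \<Longrightarrow> B \<in> \<A> \<Longrightarrow> B \<noteq> {} \<Longrightarrow> B \<subseteq> supp f \<Longrightarrow>
           \<exists>C\<in>\<A>. C \<noteq> {} \<and> C \<subseteq> B \<and> f ` C \<inter> C = {}"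
    and noncommuting: "\<And>B. B \<in> \<A> \<Longrightarrow> B \<noteq> {} \<Longrightarrow>
           \<exists>f\<in>H. \<exists>g\<in>H. supp f \<subseteq> B \<and> supp g \<subseteq> B \<and> (\<exists>x\<in>X. f (g x) \<noteq> g (f x))"
    and high_order: "\<And>B. B \<in> \<A> \<Longrightarrow> B \<noteq> {} \<Longrightarrow>
           \<exists>g\<in>H. supp g \<subseteq> B \<and> (\<exists>x\<in>X. (g ^^ 12) x \<noteq> x)"
begin

definition G where "G = (BijGroup X)\<lparr>carrier := H\<rparr>"

lemma group_G: "group G"
  unfolding G_def using subgroup group_BijGroup by (rule subgroup.subgroup_is_group)

sublocale group G by (rule group_G)

lemma carrier_G [simp]: "carrier G = H" by (simp add: G_def)

lemma in_Bij: "f \<in> H \<Longrightarrow> f \<in> Bij X"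
  using subgroup.subset[OF subgroup] by (auto simp: BijGroup_def)

lemma app_closed: "f \<in> H \<Longrightarrow> x \<in> X \<Longrightarrow> f x \<in> X"
  using in_Bij Bij_imp_funcset by fastforce

lemma mult_app: "f \<in> H \<Longrightarrow> g \<in> H \<Longrightarrow> x \<in> X \<Longrightarrow> (f \<otimes>\<^bsub>G\<^esub> g) x = f (g x)"
  using in_Bij by (simp add: G_def BijGroup_def compose_def)

lemma one_app: "x \<in> X \<Longrightarrow> \<one>\<^bsub>G\<^esub> x = x"
  by (simp add: G_def BijGroup_def)

lemma ext_eq: "f \<in> H \<Longrightarrow> g \<in> H \<Longrightarrow> (\<And>x. x \<in> X \<Longrightarrow> f x = g x) \<Longrightarrow> f = g"
  using in_Bij Bij_imp_extensional by (metis extensionalityI)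

lemma inv_in: "f \<in> H \<Longrightarrow> inv\<^bsub>G\<^esub> f \<in> H" using inv_closed[of f] by simp

lemma mult_in: "f \<in> H \<Longrightarrow> g \<in> H \<Longrightarrow> f \<otimes>\<^bsub>G\<^esub> g \<in> H" using m_closed[of f g] by simp

lemma inv_app: "f \<in> H \<Longrightarrow> x \<in> X \<Longrightarrow> (inv\<^bsub>G\<^esub> f) (f x) = x"
  using mult_app[of "inv\<^bsub>G\<^esub> f" f x] inv_in l_inv[of f] one_app by simp

lemma app_inv: "f \<in> H \<Longrightarrow> x \<in> X \<Longrightarrow> f ((inv\<^bsub>G\<^esub> f) x) = x"
  using mult_app[of f "inv\<^bsub>G\<^esub> f" x] inv_in r_inv[of f] one_app by simp

lemma pow_app: "f \<in> H \<Longrightarrow> x \<in> X \<Longrightarrow> (f [^]\<^bsub>G\<^esub> (n::nat)) x = (f ^^ n) x"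
proof (induction n arbitrary: x)
  case 0
  then show ?case by (simp add: one_app)
next
  case (Suc n)
  have "f [^]\<^bsub>G\<^esub> n \<in> H" using nat_pow_closed[of f n] Suc by simp
  then show ?case using Suc mult_app[of "f [^]\<^bsub>G\<^esub> n" f x] app_closed funpow_swap1[of f n x] by simp
qed

lemma funpow_closed: "f \<in> H \<Longrightarrow> x \<in> X \<Longrightarrow> (f ^^ n) x \<in> X"
  by (induction n) (auto simp: app_closed)

lemma pow_in: "f \<in> H \<Longrightarrow> f [^]\<^bsub>G\<^esub> (n::nat) \<in> H"
  using nat_pow_closed[of f n] by simp

lemma app_inj: "f \<in> H \<Longrightarrow> x \<in> X \<Longrightarrow> y \<in> X \<Longrightarrow> f x = f y \<Longrightarrow> x = y"
  by (metis inv_app)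

lemma commute_iff: "f \<in> H \<Longrightarrow> g \<in> H \<Longrightarrow> commute G f g \<longleftrightarrow> (\<forall>x\<in>X. f (g x) = g (f x))"
  unfolding commute_def by (metis ext_eq mult_app mult_in)

lemma ne_one_iff: "f \<in> H \<Longrightarrow> f \<noteq> \<one>\<^bsub>G\<^esub> \<longleftrightarrow> (\<exists>x\<in>X. f x \<noteq> x)"
  using ext_eq[of f "\<one>\<^bsub>G\<^esub>"] one_app one_closed by auto

text \<open>Together with displacement this characterises the support.\<close>

lemma supp_minimal:
  assumes "f \<in> H" "B \<in> \<A>" "\<And>x. x \<in> X \<Longrightarrow> x \<notin> B \<Longrightarrow> f x = x"
  shows "supp f \<subseteq> B"
proof (rule ccontr)
  assume "\<not> supp f \<subseteq> B"
  then obtain C where C: "C \<in> \<A>" "C \<noteq> {}" "C \<subseteq> supp f - B" "f ` C \<inter> C = {}"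
    using displace[of f "supp f - B"] alg(2) supp_in assms by blast
  then obtain x where "x \<in> C" by blast
  have "x \<in> X" using alg(1)[OF C(1)] \<open>x \<in> C\<close> by (rule subsetD)
  then have "f x = x" using C(3) assms(3) \<open>x \<in> C\<close> by (metis DiffD2 subsetD)
  then show False using C(4) \<open>x \<in> C\<close> by (metis disjoint_iff imageI)
qed

lemma app_supp: "f \<in> H \<Longrightarrow> x \<in> supp f \<Longrightarrow> f x \<in> supp f"
proof (rule ccontr)
  assume a: "f \<in> H" "x \<in> supp f" "f x \<notin> supp f"
  then have x: "x \<in> X" using alg(1) supp_in by blast
  then have "f (f x) = f x" using a supp_fix app_closed by blast
  then have "f x = x" using app_inj a x app_closed by blast
  then show False using a by simp
qed

lemma disjoint_supp_commute:
  assumes "f \<in> H" "g \<in> H" "supp f \<inter> supp g = {}"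
  shows "commute G f g"
  unfolding commute_iff[OF assms(1,2)]
proof
  fix x assume x: "x \<in> X"
  consider "x \<in> supp f" | "x \<in> supp g" | "x \<notin> supp f" "x \<notin> supp g" by blast
  then show "f (g x) = g (f x)"
  proof cases
    case 1
    then have "g x = x" "g (f x) = f x"
      using assms app_supp supp_fix x app_closed by (metis disjoint_iff)+
    then show ?thesis by simp
  next
    case 2
    then have "f x = x" "f (g x) = g x"
      using assms app_supp supp_fix x app_closed by (metis disjoint_iff)+
    then show ?thesis by simp
  next
    case 3
    then show ?thesis using assms supp_fix x by metis
  qed
qed

lemma inv_fix:
  assumes "f \<in> H" "x \<in> X" "x \<notin> supp f"
  shows "(inv\<^bsub>G\<^esub> f) x = x"
  using inv_app[OF assms(1,2)] supp_fix[OF assms] by simp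

lemma commutator_app:
  assumes "f \<in> H" "g \<in> H" "x \<in> X"
  shows "commutator G f g x = f (g ((inv\<^bsub>G\<^esub> f) ((inv\<^bsub>G\<^esub> g) x)))"
  using assms by (simp add: commutator_def mult_app mult_in inv_in app_closed)

lemma commutator_in: "f \<in> H \<Longrightarrow> g \<in> H \<Longrightarrow> commutator G f g \<in> H"
  by (simp add: commutator_def mult_in inv_in)

text \<open>
  On \<open>C\<close>, which \<open>h\<close> moves off itself, the commutator of \<open>f2\<close> and \<open>h\<close> agrees with \<open>f2\<close>; so the
  double commutator has support in \<open>C\<close> and is there the commutator of \<open>f1\<close> and \<open>f2\<close>.
\<close>

lemma disjoint_supp_algebraically_disjoint:
  assumes f: "f \<in> H" and g: "g \<in> H" and disj: "supp f \<inter> supp g = {}"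
  shows "algebraically_disjoint G f g"
  unfolding algebraically_disjoint_def
proof (intro ballI impI)
  fix h assume "h \<in> carrier G" and nc: "\<not> commute G f h"
  then have h: "h \<in> H" by simp
  define B where "B = supp f - (supp f - supp h)"
  have "B \<in> \<A>" unfolding B_def using alg(2) supp_in f h by blast
  moreover have "B \<noteq> {}" using disjoint_supp_commute[OF f h] nc by (auto simp: B_def)
  moreover have "B \<subseteq> supp h" by (auto simp: B_def)
  ultimately obtain C where C: "C \<in> \<A>" "C \<noteq> {}" "C \<subseteq> B" "h ` C \<inter> C = {}"
    using displace[OF h] by blast
  have CX: "C \<subseteq> X" using C alg by blast
  obtain f1 f2 x where f12: "f1 \<in> H" "f2 \<in> H" "supp f1 \<subseteq> C" "supp f2 \<subseteq> C" "x \<in> X" "f1 (f2 x) \<noteq> f2 (f1 x)"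
    using noncommuting[OF C(1,2)] by blast
  let ?k = "commutator G f1 (commutator G f2 h)"
  have supp_g: "supp f1 \<inter> supp g = {}" "supp f2 \<inter> supp g = {}"
    using f12 C disj by (auto simp: B_def)
  have k: "?k \<in> H" using f12 h commutator_in by blast
  have hC: "h y \<notin> C" if "y \<in> C" for y using C that by blast
  let ?w = "commutator G f2 h"
  have w: "?w \<in> H" using f12 h commutator_in by blast
  \<comment> \<open>On \<open>C\<close> the commutator with \<open>h\<close> agrees with \<open>f2\<close>, because \<open>h\<close> moves \<open>C\<close> off itself.\<close>
  have w_C: "?w y = f2 y" if y: "y \<in> C" for y
  proof -
    have yX: "y \<in> X" using y CX by blast
    have "(inv\<^bsub>G\<^esub> h) y \<notin> C" using hC app_inv[OF h yX] y by metis
    then have "(inv\<^bsub>G\<^esub> f2) ((inv\<^bsub>G\<^esub> h) y) = (inv\<^bsub>G\<^esub> h) y"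
      using inv_fix[OF f12(2)] app_closed[OF inv_in[OF h] yX] f12(4) by blast
    then show ?thesis using commutator_app[OF f12(2) h yX] app_inv[OF h yX] by simp
  qed
  have f2C: "f2 y \<in> C" if "y \<in> C" for y
    using app_supp[OF f12(2), of y] f12(4) that supp_fix[OF f12(2), of y] CX by (metis subsetD)
  have f1C: "f1 y \<in> C" if "y \<in> C" for y
    using app_supp[OF f12(1), of y] f12(3) that supp_fix[OF f12(1), of y] CX by (metis subsetD)
  have xC: "x \<in> C"
  proof (rule ccontr)
    assume "x \<notin> C"
    then have "f1 x = x" "f2 x = x" using f12 supp_fix by blast+
    then show False using f12 by simp
  qed
  have "?k (f2 (f1 x)) = f1 (f2 x)"
  proof -
    have y: "f1 x \<in> C" "f2 (f1 x) \<in> X" "x \<in> X" "f1 x \<in> X"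
      using f1C xC f2C CX by blast+
    have 1: "(inv\<^bsub>G\<^esub> ?w) (f2 (f1 x)) = f1 x"
      using w_C[OF y(1)] inv_app[OF w y(4)] by simp
    show ?thesis
      using commutator_app[OF f12(1) w y(2)] 1 inv_app[OF f12(1) y(3)] w_C[OF xC] by simp
  qed
  then have "?k \<noteq> \<one>\<^bsub>G\<^esub>"
    using ne_one_iff[OF k] f12(6) f1C f2C xC CX by (metis subsetD)
  moreover have "commute G ?k g"
  proof -
    have "?k y = y" if y: "y \<in> X" "y \<notin> C" for y
    proof -
      let ?z = "(inv\<^bsub>G\<^esub> ?w) y"
      have z: "?z \<in> X" "?w ?z = y" using app_closed[OF inv_in[OF w] y(1)] app_inv[OF w y(1)] by auto
      have "?z \<notin> C" using w_C[of ?z] f2C[of ?z] z(2) y(2) by auto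
      then have "(inv\<^bsub>G\<^esub> f1) ?z = ?z" "f1 y = y"
        using inv_fix[OF f12(1) z(1)] supp_fix[OF f12(1) y(1)] f12(3) y(2) by blast+
      then show ?thesis using commutator_app[OF f12(1) w y(1)] z(2) by simp
    qed
    then have "supp ?k \<subseteq> C" using supp_minimal[OF k C(1)] by blast
    then show ?thesis using disjoint_supp_commute[OF k g] C(3) disj by (auto simp: B_def)
  qed
  ultimately show "\<exists>f1\<in>carrier G. \<exists>f2\<in>carrier G. commute G f1 g \<and> commute G f2 g \<and>
      commutator G f1 (commutator G f2 h) \<noteq> \<one>\<^bsub>G\<^esub> \<and> commute G (commutator G f1 (commutator G f2 h)) g"
    using f12 disjoint_supp_commute[OF _ g] supp_g by (metis carrier_G)
qed

text \<open>
  Divisors of \<open>12\<close> have larger supports, so inside the support of the twelfth power all of the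
  first four powers can displace sets.
\<close>

lemma supp_pow_dvd:
  assumes "g \<in> H" "d dvd n"
  shows "supp (g [^]\<^bsub>G\<^esub> (n::nat)) \<subseteq> supp (g [^]\<^bsub>G\<^esub> (d::nat))"
proof (rule supp_minimal)
  fix x assume x: "x \<in> X" "x \<notin> supp (g [^]\<^bsub>G\<^esub> d)"
  then have fixed: "(g ^^ d) x = x" using pow_app[OF assms(1) x(1)] supp_fix[OF pow_in[OF assms(1)] x] by simp
  obtain k where k: "n = d * k" using assms(2) by auto
  have "((g ^^ d) ^^ k) x = x" by (induction k) (auto simp: fixed)
  then show "(g [^]\<^bsub>G\<^esub> n) x = x" using pow_app[OF assms(1) x(1)] by (simp add: k funpow_mult)
qed (use assms pow_in supp_in in auto)

lemma displace_pow:
  assumes "g \<in> H" "B \<in> \<A>" "B \<noteq> {}" "B \<subseteq> supp (g [^]\<^bsub>G\<^esub> (12::nat))" "d dvd 12"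
  shows "\<exists>C\<in>\<A>. C \<noteq> {} \<and> C \<subseteq> B \<and> (\<forall>x\<in>C. (g ^^ d) x \<notin> C)"
proof -
  have "B \<subseteq> supp (g [^]\<^bsub>G\<^esub> d)" using supp_pow_dvd[OF assms(1,5)] assms(4) by blast
  then obtain C where C: "C \<in> \<A>" "C \<noteq> {}" "C \<subseteq> B" "(g [^]\<^bsub>G\<^esub> d) ` C \<inter> C = {}"
    using displace[OF pow_in[OF assms(1)] assms(2,3)] by blast
  have "(g ^^ d) x \<notin> C" if "x \<in> C" for x
  proof -
    have "x \<in> X" using that C alg(1) by blast
    then show ?thesis using pow_app[OF assms(1), of x d] C(4) that by (metis disjoint_iff imageI)
  qed
  then show ?thesis using C by blast
qed

text \<open>
  If the supports of \<open>f\<close> and \<open>g ^ 12\<close> met, some nonempty \<open>A\<close> inside both would be moved off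
  itself by \<open>f\<close> and by the first four powers of \<open>g\<close>. An \<open>h\<close> supported in \<open>A\<close> does not
  commute with \<open>f\<close>, so a nontrivial double commutator \<open>k\<close> as in the definition exists. It is
  supported in the union of four translates of \<open>A\<close> by elements commuting with \<open>g\<close>, and its
  support is \<open>g\<close>-invariant; but five successive points of a \<open>g\<close>-orbit cannot fit into four
  such translates.
\<close>

lemma algebraically_disjoint_supp:
  assumes f: "f \<in> H" and g: "g \<in> H" and ad: "algebraically_disjoint G f g"
  shows "supp f \<inter> supp (g [^]\<^bsub>G\<^esub> (12::nat)) = {}"
proof (rule ccontr)
  assume ne: "supp f \<inter> supp (g [^]\<^bsub>G\<^esub> (12::nat)) \<noteq> {}"
  let ?S = "supp (g [^]\<^bsub>G\<^esub> (12::nat))"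
  have S: "?S \<in> \<A>" using g pow_in supp_in by blast
  define B where "B = ?S - (?S - supp f)"
  have "B \<in> \<A>" unfolding B_def using alg(2) supp_in f S by blast
  moreover have "B \<noteq> {}" "B \<subseteq> supp f" using ne by (auto simp: B_def)
  ultimately obtain C0 where C0: "C0 \<in> \<A>" "C0 \<noteq> {}" "C0 \<subseteq> B" "f ` C0 \<inter> C0 = {}"
    using displace[OF f] by blast
  have C0S: "C0 \<subseteq> ?S" using C0 by (auto simp: B_def)
  obtain C1 where C1: "C1 \<in> \<A>" "C1 \<noteq> {}" "C1 \<subseteq> C0" "\<forall>x\<in>C1. (g ^^ 1) x \<notin> C1"
    using displace_pow[OF g C0(1,2) C0S, of 1] by auto
  obtain C2 where C2: "C2 \<in> \<A>" "C2 \<noteq> {}" "C2 \<subseteq> C1" "\<forall>x\<in>C2. (g ^^ 2) x \<notin> C2"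
    using displace_pow[OF g C1(1,2), of 2] C1(3) C0S by auto
  obtain C3 where C3: "C3 \<in> \<A>" "C3 \<noteq> {}" "C3 \<subseteq> C2" "\<forall>x\<in>C3. (g ^^ 3) x \<notin> C3"
    using displace_pow[OF g C2(1,2), of 3] C2(3) C1(3) C0S by auto
  have C3S: "C3 \<subseteq> ?S" using C3(3) C2(3) C1(3) C0S by (meson subset_trans)
  obtain A where A: "A \<in> \<A>" "A \<noteq> {}" "A \<subseteq> C3" "\<forall>x\<in>A. (g ^^ 4) x \<notin> A"
    using displace_pow[OF g C3(1,2) C3S, of 4] by auto
  have gA: "(g ^^ d) x \<notin> A" if "x \<in> A" "1 \<le> d" "d \<le> 4" for x d
  proof -
    have "d = 1 \<or> d = 2 \<or> d = 3 \<or> d = 4" using that by auto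
    moreover have "x \<in> C3" "x \<in> C2" "x \<in> C1" using that(1) A(3) C3(3) C2(3) by (meson subsetD)+
    ultimately show ?thesis using that(1) A(3,4) C3(3,4) C2(3,4) C1(4) by (metis subsetD)
  qed
  have AX: "A \<subseteq> X" using A alg by blast
  have fA: "f x \<notin> A" if "x \<in> A" for x
  proof -
    have "A \<subseteq> C0" using A(3) C3(3) C2(3) C1(3) by (meson subset_trans)
    then show ?thesis using that C0(4) by (metis disjoint_iff imageI subsetD)
  qed
  obtain h x where h: "h \<in> H" "supp h \<subseteq> A" "x \<in> X" "(h ^^ 12) x \<noteq> x"
    using high_order[OF A(1,2)] by blast
  have hx: "h x \<noteq> x"
  proof
    assume "h x = x"
    then have "(h ^^ n) x = x" for n by (induction n) auto
    then show False using h by blast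
  qed
  have "\<not> commute G f h"
  proof
    assume "commute G f h"
    then have "f (h x) = h (f x)" using commute_iff f h by blast
    moreover have "x \<in> A" using hx h supp_fix by blast
    then have "h (f x) = f x" using supp_fix[OF h(1), of "f x"] app_closed[OF f] fA h by blast
    ultimately show False using app_inj[OF f, of "h x" x] app_closed h hx by simp
  qed
  then obtain f1 f2 where F: "f1 \<in> H" "f2 \<in> H" "commute G f1 g" "commute G f2 g"
    and k1: "commutator G f1 (commutator G f2 h) \<noteq> \<one>\<^bsub>G\<^esub>"
    and k2: "commute G (commutator G f1 (commutator G f2 h)) g"
    using ad h unfolding algebraically_disjoint_def carrier_G by blast
  let ?w = "commutator G f2 h" let ?k = "commutator G f1 ?w"
  have w: "?w \<in> H" and k: "?k \<in> H" using F h commutator_in by blast+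
  have w_fix: "?w y = y" if y: "y \<in> X" "y \<notin> A" "(inv\<^bsub>G\<^esub> f2) y \<notin> A" for y
  proof -
    have z: "(inv\<^bsub>G\<^esub> f2) y \<in> X" using app_closed inv_in F y by blast
    have "(inv\<^bsub>G\<^esub> h) y = y" "h ((inv\<^bsub>G\<^esub> f2) y) = (inv\<^bsub>G\<^esub> f2) y"
      using inv_fix[OF h(1) y(1)] supp_fix[OF h(1) z] h y by blast+
    then show ?thesis using commutator_app[OF F(2) h(1) y(1)] app_inv[OF F(2) y(1)] by simp
  qed
  have k_fix: "?k y = y" if y: "y \<in> X" "y \<notin> A" "(inv\<^bsub>G\<^esub> f2) y \<notin> A" "(inv\<^bsub>G\<^esub> f1) y \<notin> A"
      "(inv\<^bsub>G\<^esub> f2) ((inv\<^bsub>G\<^esub> f1) y) \<notin> A" for y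
  proof -
    have z: "(inv\<^bsub>G\<^esub> f1) y \<in> X" using app_closed inv_in F y by blast
    have "(inv\<^bsub>G\<^esub> ?w) y = y" using w_fix[of y] inv_app[OF w y(1)] y by simp
    moreover have "?w ((inv\<^bsub>G\<^esub> f1) y) = (inv\<^bsub>G\<^esub> f1) y" using w_fix z y by blast
    ultimately show ?thesis using commutator_app[OF F(1) w y(1)] app_inv[OF F(1) y(1)] by simp
  qed
  obtain y where y: "y \<in> X" "?k y \<noteq> y" using ne_one_iff[OF k] k1 by blast
  define P where "P = {\<one>\<^bsub>G\<^esub>, f1, f2, f1 \<otimes>\<^bsub>G\<^esub> f2}"
  have P: "e \<in> H" "commute G e g" if "e \<in> P" for e
  proof -
    have "commute G \<one>\<^bsub>G\<^esub> g" using g by (simp add: commute_def)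
    moreover have "commute G (f1 \<otimes>\<^bsub>G\<^esub> f2) g"
      using F g by (simp add: commute_iff mult_in mult_app app_closed)
    ultimately show "e \<in> H" "commute G e g" using that F mult_in one_closed by (auto simp: P_def)
  qed
  have moved: "?k ((g ^^ n) y) \<noteq> (g ^^ n) y" for n
  proof (induction n)
    case (Suc n)
    have yn: "(g ^^ n) y \<in> X" using funpow_closed g y by blast
    have "?k (g ((g ^^ n) y)) = g (?k ((g ^^ n) y))" using commute_iff[OF k g] k2 yn by blast
    then show ?case using app_inj[OF g app_closed[OF k yn] yn] Suc by auto
  qed (use y in simp)
  have "\<exists>e\<in>P. (inv\<^bsub>G\<^esub> e) ((g ^^ n) y) \<in> A" for n
  proof -
    let ?z = "(g ^^ n) y"
    have z: "?z \<in> X" using funpow_closed g y by blast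
    have "(inv\<^bsub>G\<^esub> (f1 \<otimes>\<^bsub>G\<^esub> f2)) ?z = (inv\<^bsub>G\<^esub> f2) ((inv\<^bsub>G\<^esub> f1) ?z)"
      using F z by (simp add: inv_mult_group mult_app inv_in)
    moreover have "(inv\<^bsub>G\<^esub> \<one>\<^bsub>G\<^esub>) ?z = ?z" using z by (simp add: one_app)
    ultimately show ?thesis using k_fix[OF z] moved[of n] by (auto simp: P_def)
  qed
  then obtain e where e: "\<And>n. e n \<in> P" "\<And>n. (inv\<^bsub>G\<^esub> (e n)) ((g ^^ n) y) \<in> A" by metis
  have "\<not> inj_on e {0..4::nat}"
  proof
    assume "inj_on e {0..4::nat}"
    then have "card {0..4::nat} \<le> card P" using e(1) by (intro card_inj_on_le[of e]) (auto simp: P_def)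
    moreover have "card P \<le> 4" unfolding P_def by (simp add: card_insert_if)
    ultimately show False by simp
  qed
  then obtain i j where "i \<noteq> j" "i \<le> 4" "j \<le> 4" "e i = e j" by (auto simp: inj_on_def)
  then obtain i j where ij: "i < j" "j \<le> 4" "e i = e j" by (metis linorder_neqE_nat)
  define z where "z = (inv\<^bsub>G\<^esub> (e i)) ((g ^^ i) y)"
  have eH: "e i \<in> H" using P e by blast
  have yi: "(g ^^ i) y \<in> X" using funpow_closed g y by blast
  have z: "z \<in> A" "z \<in> X" "e i z = (g ^^ i) y"
    using e(2)[of i] AX app_inv[OF eH yi] by (auto simp: z_def)
  have "e i ((g ^^ d) z) = (g ^^ d) ((g ^^ i) y)" for d
  proof (induction d)
    case (Suc d)
    have "e i (g ((g ^^ d) z)) = g (e i ((g ^^ d) z))"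
      using P(2)[OF e(1)] commute_iff[OF eH g] funpow_closed[OF g z(2)] by blast
    then show ?case using Suc by simp
  qed (use z in simp)
  from this[of "j - i"] have "e i ((g ^^ (j - i)) z) = (g ^^ j) y"
    using ij by (simp flip: funpow_add[THEN fun_cong, unfolded o_def])
  then have "(inv\<^bsub>G\<^esub> (e j)) ((g ^^ j) y) = (g ^^ (j - i)) z"
    using inv_app[OF eH funpow_closed[OF g z(2)]] ij by metis
  then have "(g ^^ (j - i)) z \<in> A" using e(2)[of j] by simp
  then show False using gA[OF z(1), of "j - i"] ij by simp
qed

text \<open>
  If \<open>supp h\<close> is not contained in \<open>supp f\<close>, an element \<open>g\<close> with small support in the difference
  is disjoint from \<open>f\<close>, but its twelfth power is displaced by \<open>h\<close> and does not commute with it.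
\<close>

lemma supported_within_iff:
  assumes f: "f \<in> H" and h: "h \<in> H"
  shows "supported_within G h f \<longleftrightarrow> supp h \<subseteq> supp f"
proof
  assume sub: "supp h \<subseteq> supp f"
  have "commute G h (g [^]\<^bsub>G\<^esub> (12::nat))" if "g \<in> H" "algebraically_disjoint G f g" for g
    using disjoint_supp_commute[OF h pow_in] algebraically_disjoint_supp[OF f that] sub that by blast
  then show "supported_within G h f" by (simp add: supported_within_def)
next
  assume sw: "supported_within G h f"
  show "supp h \<subseteq> supp f"
  proof (rule ccontr)
    assume "\<not> supp h \<subseteq> supp f"
    then obtain C where C: "C \<in> \<A>" "C \<noteq> {}" "C \<subseteq> supp h - supp f" "h ` C \<inter> C = {}"
      using displace[OF h, of "supp h - supp f"] alg(2) supp_in f h by blast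
    obtain g x where g: "g \<in> H" "supp g \<subseteq> C" "x \<in> X" "(g ^^ 12) x \<noteq> x"
      using high_order[OF C(1,2)] by blast
    have "algebraically_disjoint G f g"
      by (rule disjoint_supp_algebraically_disjoint) (use f g C in auto)
    then have "commute G h (g [^]\<^bsub>G\<^esub> (12::nat))" using sw g by (simp add: supported_within_def)
    then have c: "h ((g ^^ 12) y) = (g ^^ 12) (h y)" if "y \<in> X" for y
      using commute_iff[OF h pow_in[OF g(1)]] pow_app[OF g(1)] app_closed[OF h] that by simp
    have fixed: "(g ^^ n) y = y" if "y \<in> X" "y \<notin> C" for y n
    proof -
      have "g y = y" using supp_fix g that by blast
      then show ?thesis by (induction n) auto
    qed
    have "x \<in> C" using fixed g by blast
    then have "h x \<notin> C" using C by blast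
    then have "(g ^^ 12) (h x) = h x" using fixed app_closed[OF h g(3)] by blast
    then show False using c[OF g(3)] app_inj[OF h funpow_closed[OF g(1,3)] g(3)] g(4) by auto
  qed
qed

lemma supp_conjugate:
  assumes h: "h \<in> H" and f: "f \<in> H"
  shows "supp (h \<otimes>\<^bsub>G\<^esub> f \<otimes>\<^bsub>G\<^esub> inv\<^bsub>G\<^esub> h) = h ` supp f"
proof -
  have sub: "supp (h \<otimes>\<^bsub>G\<^esub> f \<otimes>\<^bsub>G\<^esub> inv\<^bsub>G\<^esub> h) \<subseteq> h ` supp f" if h: "h \<in> H" and f: "f \<in> H" for h f
  proof (rule supp_minimal)
    fix x assume x: "x \<in> X" "x \<notin> h ` supp f"
    let ?y = "(inv\<^bsub>G\<^esub> h) x"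
    have y: "?y \<in> X" "h ?y = x" using app_closed inv_in app_inv h x by auto
    then have "?y \<notin> supp f" using x by (metis imageI)
    then have "f ?y = ?y" using supp_fix[OF f y(1)] by blast
    then show "(h \<otimes>\<^bsub>G\<^esub> f \<otimes>\<^bsub>G\<^esub> inv\<^bsub>G\<^esub> h) x = x" using y h f x by (simp add: mult_app mult_in inv_in)
  qed (use h f mult_in inv_in image supp_in in auto)
  have "f = inv\<^bsub>G\<^esub> h \<otimes>\<^bsub>G\<^esub> (h \<otimes>\<^bsub>G\<^esub> f \<otimes>\<^bsub>G\<^esub> inv\<^bsub>G\<^esub> h) \<otimes>\<^bsub>G\<^esub> inv\<^bsub>G\<^esub> (inv\<^bsub>G\<^esub> h)"
    using h f by (simp add: m_assoc inv_solve_left mult_in inv_in)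
  then have "supp f \<subseteq> (inv\<^bsub>G\<^esub> h) ` supp (h \<otimes>\<^bsub>G\<^esub> f \<otimes>\<^bsub>G\<^esub> inv\<^bsub>G\<^esub> h)"
    using sub[of "inv\<^bsub>G\<^esub> h" "h \<otimes>\<^bsub>G\<^esub> f \<otimes>\<^bsub>G\<^esub> inv\<^bsub>G\<^esub> h"] h f mult_in inv_in by metis
  then have "h ` supp f \<subseteq> supp (h \<otimes>\<^bsub>G\<^esub> f \<otimes>\<^bsub>G\<^esub> inv\<^bsub>G\<^esub> h)"
  proof -
    assume a: "supp f \<subseteq> (inv\<^bsub>G\<^esub> h) ` supp (h \<otimes>\<^bsub>G\<^esub> f \<otimes>\<^bsub>G\<^esub> inv\<^bsub>G\<^esub> h)" (is "_ \<subseteq> _ ` ?T")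
    have "?T \<subseteq> X" using alg(1) supp_in mult_in inv_in h f by metis
    then show ?thesis using a app_inv[OF h] by (fastforce simp: image_iff subset_iff)
  qed
  then show ?thesis using sub h f by blast
qed

end

text \<open>
  The order of supports is visible in the group, so if every member of the algebra is a
  support, an isomorphism of the groups induces one of the algebras, and it is equivariant.
\<close>

lemma support_group_iso:
  assumes A: "support_group X H \<A> supp" and B: "support_group Y K \<C> supp'"
    and surjA: "\<A> = supp ` H" and surjB: "\<C> = supp' ` K"
    and \<Phi>: "\<Phi> \<in> iso ((BijGroup X)\<lparr>carrier := H\<rparr>) ((BijGroup Y)\<lparr>carrier := K\<rparr>)"
  obtains \<theta> where "bij_betw \<theta> \<A> \<C>"
    "\<And>U V. U \<in> \<A> \<Longrightarrow> V \<in> \<A> \<Longrightarrow> \<theta> U \<subseteq> \<theta> V \<longleftrightarrow> U \<subseteq> V"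
    "\<And>h U. h \<in> H \<Longrightarrow> U \<in> \<A> \<Longrightarrow> \<theta> (h ` U) = \<Phi> h ` \<theta> U"
proof -
  interpret A: support_group X H \<A> supp by (rule A)
  interpret B: support_group Y K \<C> supp' by (rule B)
  have iso: "\<Phi> \<in> iso A.G B.G" using \<Phi> by (simp add: A.G_def B.G_def)
  interpret hom: group_hom A.G B.G \<Phi> by (rule iso_group_hom[OF A.group_G B.group_G iso])
  have mem: "\<Phi> f \<in> K" if "f \<in> H" for f using iso_mem[OF A.group_G B.group_G iso] that by simp
  have ord: "supp' (\<Phi> h) \<subseteq> supp' (\<Phi> f) \<longleftrightarrow> supp h \<subseteq> supp f" if "h \<in> H" "f \<in> H" for h f
    using iso_supported_within[OF A.group_G B.group_G iso, of f h] that
      A.supported_within_iff B.supported_within_iff mem by simp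
  define \<theta> where "\<theta> U = supp' (\<Phi> (SOME f. f \<in> H \<and> supp f = U))" for U
  have \<theta>: "\<theta> (supp f) = supp' (\<Phi> f)" if "f \<in> H" for f
  proof -
    let ?g = "SOME g. g \<in> H \<and> supp g = supp f"
    have "?g \<in> H \<and> supp ?g = supp f" by (rule someI[of _ f]) (use that in auto)
    then show ?thesis using ord[of ?g f] ord[of f ?g] that by (auto simp: \<theta>_def)
  qed
  have order: "\<theta> U \<subseteq> \<theta> V \<longleftrightarrow> U \<subseteq> V" if UV: "U \<in> \<A>" "V \<in> \<A>" for U V
  proof -
    obtain f g where "f \<in> H" "U = supp f" "g \<in> H" "V = supp g" using UV surjA by auto
    then show ?thesis using ord \<theta> by simp
  qed
  have "\<theta> ` \<A> = \<C>"
  proof -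
    have "\<theta> ` \<A> = (\<lambda>f. supp' (\<Phi> f)) ` H" unfolding surjA image_image by (rule image_cong) (auto simp: \<theta>)
    also have "\<dots> = supp' ` (\<Phi> ` H)" by (simp add: image_image)
    finally show ?thesis using iso_carrier[OF A.group_G B.group_G iso] surjB by simp
  qed
  moreover have "inj_on \<theta> \<A>" using order by (intro inj_onI) (metis subset_antisym subset_refl)
  ultimately have "bij_betw \<theta> \<A> \<C>" by (simp add: bij_betw_def)
  moreover have "\<theta> (h ` U) = \<Phi> h ` \<theta> U" if h: "h \<in> H" and U: "U \<in> \<A>" for h U
  proof -
    obtain f where f: "f \<in> H" "U = supp f" using U surjA by auto
    have "h ` U = supp (h \<otimes>\<^bsub>A.G\<^esub> f \<otimes>\<^bsub>A.G\<^esub> inv\<^bsub>A.G\<^esub> h)" using A.supp_conjugate h f by simp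
    then have "\<theta> (h ` U) = supp' (\<Phi> (h \<otimes>\<^bsub>A.G\<^esub> f \<otimes>\<^bsub>A.G\<^esub> inv\<^bsub>A.G\<^esub> h))"
      using \<theta> A.mult_in A.inv_in h f by simp
    also have "\<dots> = \<Phi> h ` supp' (\<Phi> f)"
      using B.supp_conjugate[OF mem mem] h f A.inv_in A.mult_in by simp
    finally show ?thesis using \<theta> f by simp
  qed
  ultimately show thesis using that order by blast
qed

section \<open>Reduction modulo a period\<close>

text \<open>
  The representative of \<open>y\<close> in \<open>[0, e)\<close> modulo \<open>e\<close>.
\<close>

definition wrap :: "real \<Rightarrow> real \<Rightarrow> real" where
  "wrap e y = y - of_int \<lfloor>y / e\<rfloor> * e"

lemma wrap_bounds: "0 < e \<Longrightarrow> 0 \<le> wrap e y" "0 < e \<Longrightarrow> wrap e y < e"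
proof -
  assume e: "0 < e"
  have 1: "of_int \<lfloor>y / e\<rfloor> \<le> y / e" "y / e < of_int \<lfloor>y / e\<rfloor> + 1" by linarith+
  have "of_int \<lfloor>y / e\<rfloor> * e \<le> y" using 1(1) by (simp only: pos_le_divide_eq[OF e])
  moreover have "y < (of_int \<lfloor>y / e\<rfloor> + 1) * e" using 1(2) by (simp only: pos_divide_less_eq[OF e])
  ultimately show "0 \<le> wrap e y" "wrap e y < e" by (simp_all add: wrap_def distrib_right)
qed

lemma wrap_id: "0 \<le> y \<Longrightarrow> y < e \<Longrightarrow> wrap e y = y"
proof -
  assume "0 \<le> y" "y < e"
  then have "\<lfloor>y / e\<rfloor> = 0" by (simp add: floor_eq_iff)
  then show ?thesis by (simp add: wrap_def)
qed

lemma wrap_shift: "0 < e \<Longrightarrow> wrap e (y + of_int k * e) = wrap e y"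
  by (simp add: wrap_def add_divide_distrib algebra_simps)

lemma wrap_diff: "y = wrap e y + of_int \<lfloor>y / e\<rfloor> * e"
  by (simp add: wrap_def)

lemma periodic_multiple:
  assumes "add_group \<Gamma>" "e \<in> \<Gamma>" "\<And>y. y \<in> \<Gamma> \<Longrightarrow> f (y + e) = f y" "y \<in> \<Gamma>"
  shows "f (y + of_int k * e) = f y"
proof -
  have nat: "f (y + of_nat n * e) = f y" if "y \<in> \<Gamma>" for n y
  proof (induction n)
    case (Suc n)
    have "f (y + of_nat (Suc n) * e) = f ((y + of_nat n * e) + e)" by (simp add: algebra_simps)
    also have "\<dots> = f (y + of_nat n * e)"
      by (intro assms(3) add_groupD(3)[OF assms(1)] add_groupD(5)[OF assms(1)] assms(2) that)
    finally show ?case using Suc by simp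
  qed simp
  show ?thesis
  proof (cases k rule: int_cases2)
    case (nonneg n)
    then show ?thesis using nat[OF assms(4)] by simp
  next
    case (nonpos n)
    have "y - of_nat n * e \<in> \<Gamma>"
      by (intro add_groupD(4)[OF assms(1)] add_groupD(5)[OF assms(1)] assms(2,4))
    from nat[OF this, of n] show ?thesis using nonpos by simp
  qed
qed

section \<open>Almost invariant functions on a group of rank at least two\<close>

text \<open>
  A positive function on the circle \<open>\<Gamma>\<close> modulo \<open>e\<close> that every translation changes at finitely
  many points only. \<open>indep\<close> says that \<open>t0\<close> has infinite order modulo \<open>e\<close>. Without the last
  assumption \<open>u\<close> could have different limits at the two ends of an orbit: if \<open>t0\<close> and \<open>e\<close> generate
  \<open>\<Gamma>\<close>, the function with value \<open>2\<close> at the classes of \<open>n * t0\<close> with \<open>0 \<le> n\<close>, and \<open>1\<close> elsewhere,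
  has the other properties.
\<close>

locale almost_invariant =
  fixes \<Gamma> :: "real set" and e t0 :: real and u :: "real \<Rightarrow> real"
  assumes grp: "add_group \<Gamma>" and e: "e \<in> \<Gamma>" "0 < e" and t0: "t0 \<in> \<Gamma>"
    and indep: "\<And>n k :: int. of_int n * t0 = of_int k * e \<Longrightarrow> n = 0"
    and pos: "\<And>y. y \<in> \<Gamma> \<Longrightarrow> 0 < u y"
    and per: "\<And>y. y \<in> \<Gamma> \<Longrightarrow> u (y + e) = u y"
    and fin: "\<And>t. t \<in> \<Gamma> \<Longrightarrow> finite {y \<in> \<Gamma>. 0 \<le> y \<and> y < e \<and> u (y + t) \<noteq> u y}"
    and total: "(\<Prod>y\<in>{y \<in> \<Gamma>. 0 \<le> y \<and> y < e \<and> u (y + t0) \<noteq> u y}. u (y + t0) / u y) = 1"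
begin

lemmas grpD = add_groupD[OF grp]

abbreviation w where "w \<equiv> wrap e"
definition orb :: "real \<Rightarrow> int \<Rightarrow> real" where "orb y n = y + of_int n * t0"

lemma orb_in: "y \<in> \<Gamma> \<Longrightarrow> orb y n \<in> \<Gamma>"
  unfolding orb_def by (intro grpD(3) grpD(6) t0)

lemma orb_succ: "orb y n + t0 = orb y (n + 1)"
  by (simp add: orb_def algebra_simps)

lemma orb_0 [simp]: "orb y 0 = y" by (simp add: orb_def)

lemma w_in: "y \<in> \<Gamma> \<Longrightarrow> w y \<in> \<Gamma>"
  unfolding wrap_def by (intro grpD(4) grpD(6) e(1))

lemma u_w: "y \<in> \<Gamma> \<Longrightarrow> t \<in> \<Gamma> \<Longrightarrow> u (w y + t) = u (y + t)"
proof -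
  assume "y \<in> \<Gamma>" "t \<in> \<Gamma>"
  then have "u (y + t + of_int (- \<lfloor>y / e\<rfloor>) * e) = u (y + t)"
    by (intro periodic_multiple[OF grp e(1), of u] per grpD(3))
  moreover have "w y + t = y + t + of_int (- \<lfloor>y / e\<rfloor>) * e" by (simp add: wrap_def)
  ultimately show ?thesis by (simp only:)
qed

lemma u_w0: "y \<in> \<Gamma> \<Longrightarrow> u (w y) = u y" using u_w[of y 0] grpD(1) by simp

lemma inj_orb: "inj (\<lambda>n. w (orb y n))"
proof (rule injI)
  fix n m assume "w (orb y n) = w (orb y m)"
  then have "of_int (n - m) * t0 = of_int (\<lfloor>orb y n / e\<rfloor> - \<lfloor>orb y m / e\<rfloor>) * e"
    by (simp add: wrap_def orb_def algebra_simps)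
  then have "n - m = 0" by (rule indep)
  then show "n = m" by simp
qed

text \<open>
  Periodicity allows changes along an orbit to be located in the fundamental domain.
\<close>

lemma w_orb_change:
  assumes "y \<in> \<Gamma>"
  shows "w (orb y n) \<in> {y \<in> \<Gamma>. 0 \<le> y \<and> y < e \<and> u (y + t0) \<noteq> u y} \<longleftrightarrow> u (orb y (n + 1)) \<noteq> u (orb y n)"
  using w_in[OF orb_in[OF assms]] wrap_bounds[OF e(2)] u_w[OF orb_in[OF assms] t0]
    u_w0[OF orb_in[OF assms]] by (simp add: orb_succ)

lemma finite_changes:
  assumes y: "y \<in> \<Gamma>" and t: "t \<in> \<Gamma>"
  shows "finite {n. u (orb y n + t) \<noteq> u (orb y n)}"
proof (rule inj_on_finite)
  show "inj_on (\<lambda>n. w (orb y n)) {n. u (orb y n + t) \<noteq> u (orb y n)}"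
    using inj_orb by (rule inj_on_subset) auto
  show "(\<lambda>n. w (orb y n)) ` {n. u (orb y n + t) \<noteq> u (orb y n)} \<subseteq> {y \<in> \<Gamma>. 0 \<le> y \<and> y < e \<and> u (y + t) \<noteq> u y}"
    using w_in orb_in[OF y] wrap_bounds e u_w[OF orb_in[OF y]] u_w0[OF orb_in[OF y]] t by auto
qed (rule fin[OF t])

lemma eventually_agree:
  assumes "y \<in> \<Gamma>" "t \<in> \<Gamma>"
  shows "\<exists>N\<ge>0. \<forall>n. \<bar>n\<bar> \<ge> N \<longrightarrow> u (orb y n + t) = u (orb y n)"
proof -
  let ?S = "{n. u (orb y n + t) \<noteq> u (orb y n)}"
  define N where "N = Max (insert 0 (abs ` ?S)) + 1"
  have "finite ?S" using finite_changes[OF assms] .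
  then have "\<bar>n\<bar> < N" if "n \<in> ?S" for n
    using that Max_ge[of "insert 0 (abs ` ?S)" "\<bar>n\<bar>"] by (auto simp: N_def)
  moreover have "0 \<le> N" using \<open>finite ?S\<close> Max_ge[of "insert 0 (abs ` ?S)" 0] by (auto simp: N_def)
  ultimately have "0 \<le> N \<and> (\<forall>n. N \<le> \<bar>n\<bar> \<longrightarrow> u (orb y n + t) = u (orb y n))" by force
  then show ?thesis by blast
qed

lemma limits_exist:
  assumes y: "y \<in> \<Gamma>"
  shows "\<exists>N\<ge>0. (\<forall>n\<ge>N. u (orb y n) = u (orb y N)) \<and> (\<forall>n\<le>-N. u (orb y n) = u (orb y (-N)))"
proof -
  obtain N where N: "N \<ge> 0" "\<And>n. \<bar>n\<bar> \<ge> N \<Longrightarrow> u (orb y n + t0) = u (orb y n)"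
    using eventually_agree[OF y t0] by blast
  have A: "u (orb y n) = u (orb y N)" if "n \<ge> N" for n using that
  proof (induction n rule: int_ge_induct)
    case (step i)
    then show ?case using N(2)[of i] N(1) orb_succ[of y i] by simp
  qed simp
  have B: "u (orb y n) = u (orb y (-N-1))" if "n \<le> -N-1" for n using that
  proof (induction n rule: int_le_induct)
    case (step i)
    then show ?case using N(1) N(2)[of "i - 1"] orb_succ[of y "i - 1"] by simp
  qed simp
  have "\<forall>n\<ge>N+1. u (orb y n) = u (orb y (N+1))"
  proof (intro allI impI)
    fix n assume "N + 1 \<le> n"
    then show "u (orb y n) = u (orb y (N+1))" using A[of n] A[of "N+1"] by simp
  qed
  moreover have "\<forall>n\<le>-(N+1). u (orb y n) = u (orb y (-(N+1)))"
  proof (intro allI impI)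
    fix n assume "n \<le> -(N+1)"
    then have "u (orb y n) = u (orb y (-N-1))" by (intro B) linarith
    moreover have "-N-1 = -(N+1)" by simp
    ultimately show "u (orb y n) = u (orb y (-(N+1)))" by (simp only:)
  qed
  moreover have "0 \<le> N + 1" using N(1) by simp
  ultimately show ?thesis by blast
qed

text \<open>
  The limits along the two ends of a \<open>t0\<close>-orbit do not depend on the orbit, since any two
  orbits differ by a translation, which changes \<open>u\<close> in finitely many places only.
\<close>

lemma common_limits:
  obtains kp km where "0 < kp" "0 < km" "kp \<in> u ` \<Gamma>"
    "\<And>y. y \<in> \<Gamma> \<Longrightarrow> \<exists>N\<ge>0. (\<forall>n\<ge>N. u (orb y n) = kp) \<and> (\<forall>n\<le>-N. u (orb y n) = km)"
proof -
  have z: "0 \<in> \<Gamma>" using grpD by blast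
  obtain N0 where N0: "N0 \<ge> 0" "\<forall>n\<ge>N0. u (orb 0 n) = u (orb 0 N0)" "\<forall>n\<le>-N0. u (orb 0 n) = u (orb 0 (-N0))"
    using limits_exist[OF z] by blast
  have "\<exists>N\<ge>0. (\<forall>n\<ge>N. u (orb y n) = u (orb 0 N0)) \<and> (\<forall>n\<le>-N. u (orb y n) = u (orb 0 (-N0)))" if y: "y \<in> \<Gamma>" for y
  proof -
    obtain N where N: "N \<ge> 0" "\<forall>n. \<bar>n\<bar> \<ge> N \<longrightarrow> u (orb 0 n + y) = u (orb 0 n)"
      using eventually_agree[OF z y] by blast
    have agree: "u (orb y n) = u (orb 0 n)" if "\<bar>n\<bar> \<ge> N" for n
      using N(2)[rule_format, OF that] by (simp add: orb_def add.commute)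
    have "u (orb y n) = u (orb 0 N0)" if "max N N0 \<le> n" for n
      using agree[of n] N0(2)[rule_format, of n] that N(1) by simp
    moreover have "u (orb y n) = u (orb 0 (-N0))" if "n \<le> - max N N0" for n
    proof -
      have "\<bar>n\<bar> \<ge> N" "n \<le> - N0" using that N(1) by auto
      then show ?thesis using agree N0(3)[rule_format, of n] by (simp only:)
    qed
    moreover have "0 \<le> max N N0" using N0(1) by simp
    ultimately show ?thesis by blast
  qed
  moreover have "0 < u (orb 0 N0)" "0 < u (orb 0 (-N0))" "u (orb 0 N0) \<in> u ` \<Gamma>"
    using pos orb_in[OF z] by auto
  ultimately show thesis using that by presburger
qed

abbreviation F where "F \<equiv> {y \<in> \<Gamma>. 0 \<le> y \<and> y < e \<and> u (y + t0) \<noteq> u y}"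

text \<open>
  Summing the logarithmic changes of \<open>u\<close> over one orbit telescopes to the difference of the
  two limits, so the total change is a positive multiple of it as soon as there is a change. By the last
  assumption on \<open>u\<close> the total change vanishes.
\<close>

lemma limits_agree:
  assumes lim: "\<And>y. y \<in> \<Gamma> \<Longrightarrow> \<exists>N\<ge>0. (\<forall>n\<ge>N. u (orb y n) = kp) \<and> (\<forall>n\<le>-N. u (orb y n) = km)"
    and k: "0 < kp" "0 < km"
  shows "kp = km"
proof (cases "F = {}")
  case True
  then have inv: "u (y + t0) = u y" if "y \<in> \<Gamma>" for y
    using w_orb_change[OF that, of 0] True orb_succ[of y 0] by auto
  obtain N where N: "N \<ge> 0" "\<forall>n\<ge>N. u (orb 0 n) = kp" "\<forall>n\<le>-N. u (orb 0 n) = km"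
    using lim[OF grpD(1)] by blast
  have "u (orb 0 N) = u (orb 0 0)" "u (orb 0 (-N)) = u (orb 0 0)"
    using periodic_multiple[OF grp t0, of u 0 N] periodic_multiple[OF grp t0, of u 0 "-N"] inv grpD(1)
    by (auto simp: orb_def)
  then show ?thesis using N by auto
next
  case False
  define g where "g y = ln (u (y + t0)) - ln (u y)" for y
  have orbit_sum: "(\<Sum>y\<in>F \<inter> range (\<lambda>n. w (orb f n)). g y) = ln kp - ln km" if f: "f \<in> \<Gamma>" for f
  proof -
    obtain N where N: "N \<ge> 0" "\<forall>n\<ge>N. u (orb f n) = kp" "\<forall>n\<le>-N. u (orb f n) = km"
      using lim[OF f] by blast
    define v where "v i = orb f (int i - N)" for i :: nat
    define I where "I = {i. i < nat (2 * N) \<and> u (v (Suc i)) \<noteq> u (v i)}"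
    have succ1: "v (Suc i) = orb f (int i - N + 1)" for i
      unfolding v_def by (rule arg_cong[where f = "orb f"]) simp
    have succ: "v (Suc i) = orb f (int i - N + 1)" "v i + t0 = v (Suc i)" for i
      using succ1[of i] orb_succ[of f "int i - N"] by (simp_all only: v_def)
    have v_in: "v i \<in> \<Gamma>" for i using orb_in[OF f] by (simp add: v_def)
    have "F \<inter> range (\<lambda>n. w (orb f n)) = (\<lambda>i. w (v i)) ` I"
    proof (intro equalityI subsetI)
      fix y assume "y \<in> F \<inter> range (\<lambda>n. w (orb f n))"
      then obtain n where n: "y = w (orb f n)" "u (orb f (n + 1)) \<noteq> u (orb f n)"
        using w_orb_change[OF f] by auto
      have "n < N"
      proof (rule ccontr)
        assume "\<not> n < N"
        then have "u (orb f (n + 1)) = kp" "u (orb f n) = kp" using N(2) by auto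
        then show False using n(2) by simp
      qed
      moreover have "- N \<le> n"
      proof (rule ccontr)
        assume "\<not> - N \<le> n"
        then have "u (orb f (n + 1)) = km" "u (orb f n) = km" using N(3) by auto
        then show False using n(2) by simp
      qed
      ultimately have i: "int (nat (n + N)) - N = n" "nat (n + N) < nat (2 * N)" by auto
      then have "v (nat (n + N)) = orb f n" "v (Suc (nat (n + N))) = orb f (n + 1)"
        using succ(1)[of "nat (n + N)"] by (simp_all add: v_def)
      then show "y \<in> (\<lambda>i. w (v i)) ` I"
        using n i(2) by (intro image_eqI[of _ _ "nat (n + N)"]) (auto simp: I_def)
    next
      fix y assume "y \<in> (\<lambda>i. w (v i)) ` I"
      then obtain i where "i \<in> I" "y = w (orb f (int i - N))" by (auto simp: v_def)
      then show "y \<in> F \<inter> range (\<lambda>n. w (orb f n))"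
        using w_orb_change[OF f, of "int i - N"] succ(1)[of i] by (simp add: I_def v_def[of i])
    qed
    moreover have "inj_on (\<lambda>i. w (v i)) I"
    proof (rule inj_onI)
      fix i j assume "w (v i) = w (v j)"
      then have "int i - N = int j - N" using inj_orb[of f] by (simp add: inj_def v_def)
      then show "i = j" by simp
    qed
    ultimately have "(\<Sum>y\<in>F \<inter> range (\<lambda>n. w (orb f n)). g y) = (\<Sum>i\<in>I. g (w (v i)))"
      by (simp add: sum.reindex)
    also have "\<dots> = (\<Sum>i\<in>I. ln (u (v (Suc i))) - ln (u (v i)))"
      using u_w[OF v_in t0] u_w0[OF v_in] succ(2) by (intro sum.cong refl) (simp add: g_def)
    also have "\<dots> = (\<Sum>i<nat (2 * N). ln (u (v (Suc i))) - ln (u (v i)))"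
      by (intro sum.mono_neutral_left) (auto simp: I_def)
    also have "\<dots> = ln (u (v (nat (2 * N)))) - ln (u (v 0))" by (rule sum_lessThan_telescope)
    also have "\<dots> = ln kp - ln km" using N by (simp add: v_def)
    finally show ?thesis .
  qed
  \<comment> \<open>Remove the orbits that meet \<open>F\<close> one at a time; \<open>r\<close> counts them.\<close>
  have "\<exists>r::nat. (\<Sum>y\<in>F'. g y) = of_nat r * (ln kp - ln km) \<and> (F' \<noteq> {} \<longrightarrow> 0 < r)"
    if "F' \<subseteq> F" "\<forall>y\<in>F'. \<forall>n. w (orb y n) \<in> F \<longrightarrow> w (orb y n) \<in> F'" for F'
    using finite_subset[OF that(1) fin[OF t0]] that
  proof (induction F' rule: finite_psubset_induct)
    case (psubset F')
    show ?case
    proof (cases "F' = {}")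
      case False
      then obtain f where f: "f \<in> F'" by blast
      then have f\<Gamma>: "f \<in> \<Gamma>" "f \<in> F" using psubset by auto
      let ?C = "F \<inter> range (\<lambda>n. w (orb f n))"
      have C: "?C \<subseteq> F'" using psubset.prems(2) f by auto
      have "w f = f" using f\<Gamma> by (intro wrap_id) auto
      then have "f \<in> ?C" using f\<Gamma> by (intro IntI rangeI[of _ 0, THEN back_subst[of "\<lambda>x. x \<in> _"]]) auto
      then have sm: "F' - ?C \<subset> F'" using f by blast
      moreover have "\<forall>y\<in>F' - ?C. \<forall>n. w (orb y n) \<in> F \<longrightarrow> w (orb y n) \<in> F' - ?C"
      proof (intro ballI allI impI)
        fix y n assume y: "y \<in> F' - ?C" "w (orb y n) \<in> F"
        have "w (orb y n) \<notin> ?C"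
        proof
          assume "w (orb y n) \<in> ?C"
          then obtain m where "w (orb y n) = w (orb f m)" by auto
          then have eq: "y = orb f (m - n) + of_int (\<lfloor>orb y n / e\<rfloor> - \<lfloor>orb f m / e\<rfloor>) * e"
            by (simp add: wrap_def orb_def algebra_simps)
          have "w y = y" using y psubset.prems by (intro wrap_id) auto
          then have "y = w (orb f (m - n))" using eq wrap_shift[OF e(2)] by metis
          then show False using y psubset.prems by auto
        qed
        then show "w (orb y n) \<in> F' - ?C" using psubset.prems(2) y by blast
      qed
      ultimately obtain r where r: "(\<Sum>y\<in>F' - ?C. g y) = of_nat r * (ln kp - ln km)"
        using psubset.IH[of "F' - ?C"] psubset.prems(1) by blast
      have "(\<Sum>y\<in>F'. g y) = (\<Sum>y\<in>F' - ?C. g y) + (\<Sum>y\<in>?C. g y)"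
        using psubset.hyps C by (rule sum.subset_diff[rotated])
      then show ?thesis using r orbit_sum[OF f\<Gamma>(1)] by (intro exI[of _ "Suc r"]) (auto simp: algebra_simps)
    qed simp
  qed
  from this[of F] obtain r :: nat where r: "(\<Sum>y\<in>F. g y) = of_nat r * (ln kp - ln km)" "0 < r"
    using False by blast
  have "(\<Sum>y\<in>F. g y) = (\<Sum>y\<in>F. ln (u (y + t0) / u y))"
  proof (intro sum.cong refl)
    fix y assume "y \<in> F"
    then have "0 < u y" "0 < u (y + t0)" using pos grpD(3) t0 by auto
    then show "g y = ln (u (y + t0) / u y)" by (simp add: g_def ln_div)
  qed
  also have "\<dots> = ln (\<Prod>y\<in>F. u (y + t0) / u y)"
  proof (rule ln_prod[symmetric])
    show "finite F" by (rule fin[OF t0])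
    fix y assume "y \<in> F"
    then have "0 < u y" "0 < u (y + t0)" using pos grpD(3) t0 by auto
    then show "u (y + t0) / u y \<noteq> 0" by simp
  qed
  also have "\<dots> = 0" using total by simp
  finally show ?thesis using r k by simp
qed

text \<open>
  On each orbit \<open>u\<close> equals the common limit \<open>k\<close> at both ends, so its exceptional points on an
  orbit lie between two changes. There are finitely many changes, hence finitely many orbits
  with exceptional points and finitely many such points on each.
\<close>

lemma constant_off_finite:
  "\<exists>k. 0 < k \<and> k \<in> u ` \<Gamma> \<and> finite {y \<in> \<Gamma>. 0 \<le> y \<and> y < e \<and> u y \<noteq> k}"
proof -
  obtain k km where k: "0 < k" "0 < km" "k \<in> u ` \<Gamma>" and lim0:
    "\<And>y. y \<in> \<Gamma> \<Longrightarrow> \<exists>N\<ge>0. (\<forall>n\<ge>N. u (orb y n) = k) \<and> (\<forall>n\<le>-N. u (orb y n) = km)"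
    using common_limits by blast
  have "k = km" using limits_agree[OF lim0 k(1,2)] .
  then have lim: "\<exists>N\<ge>0. (\<forall>n\<ge>N. u (orb y n) = k) \<and> (\<forall>n\<le>-N. u (orb y n) = k)" if "y \<in> \<Gamma>" for y
    using lim0[OF that] by simp
  let ?T = "\<lambda>f. {n. u (orb f n) \<noteq> k}"
  have "{y \<in> \<Gamma>. 0 \<le> y \<and> y < e \<and> u y \<noteq> k} \<subseteq> (\<Union>f\<in>F. (\<lambda>n. w (orb f n)) ` ?T f)"
  proof
    fix y assume "y \<in> {y \<in> \<Gamma>. 0 \<le> y \<and> y < e \<and> u y \<noteq> k}"
    then have y: "y \<in> \<Gamma>" "0 \<le> y" "y < e" "u y \<noteq> k" by auto
    obtain N where N: "N \<ge> 0" "\<forall>n\<le>-N. u (orb y n) = k" using lim[OF y(1)] by blast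
    \<comment> \<open>Walking back from the exceptional point \<open>y\<close>, the first return to the value \<open>k\<close> is a change.\<close>
    define n where "n = (LEAST n::nat. u (orb y (- int n)) = k)"
    have n: "u (orb y (- int n)) = k"
      unfolding n_def by (rule LeastI[of _ "nat N"]) (use N in auto)
    have n0: "n \<noteq> 0" using n y by (cases n) auto
    have n1: "u (orb y (- int (n - 1))) \<noteq> k"
      using not_less_Least[of "n - 1" "\<lambda>n. u (orb y (- int n)) = k"] n0 by (simp add: n_def)
    let ?f = "w (orb y (- int n))"
    have "- int n + 1 = - int (n - 1)" using n0 by simp
    then have f: "?f \<in> F"
      using w_orb_change[OF y(1), of "- int n"] n n1 by metis
    have eq: "orb ?f (int n) = y + of_int (- \<lfloor>orb y (- int n) / e\<rfloor>) * e"
      by (simp add: wrap_def orb_def algebra_simps)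
    have "w (orb ?f (int n)) = y" unfolding eq wrap_shift[OF e(2)] using y by (intro wrap_id)
    moreover have "u (orb ?f (int n)) \<noteq> k"
      unfolding eq using periodic_multiple[OF grp e(1), of u y] per y(1,4) by metis
    ultimately show "y \<in> (\<Union>f\<in>F. (\<lambda>n. w (orb f n)) ` ?T f)" using f by (intro UN_I[OF f]) force
  qed
  moreover have "finite (?T f)" if "f \<in> F" for f
  proof -
    have "f \<in> \<Gamma>" using that by blast
    then obtain N where N: "N \<ge> 0" "\<forall>n\<ge>N. u (orb f n) = k" "\<forall>n\<le>-N. u (orb f n) = k" using lim by blast
    have "-N \<le> n \<and> n \<le> N" if "u (orb f n) \<noteq> k" for n
      using N(2,3) that by (meson linorder_linear)
    then have "?T f \<subseteq> {-N..N}" by auto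
    then show ?thesis by (rule finite_subset) simp
  qed
  ultimately show ?thesis using k fin[OF t0] by (meson finite_UN_I finite_imageI finite_subset)
qed

end

section \<open>Piecewise scaling of a distribution function\<close>

definition scaled :: "real set \<Rightarrow> (real \<Rightarrow> real) \<Rightarrow> (real \<Rightarrow> real) \<Rightarrow> real \<Rightarrow> real \<Rightarrow> real \<Rightarrow> bool" where
  "scaled \<Gamma> m f c p q \<longleftrightarrow>
     (\<forall>x\<in>\<Gamma>. \<forall>y\<in>\<Gamma>. p \<le> x \<longrightarrow> x \<le> y \<longrightarrow> y \<le> q \<longrightarrow> m (f y) - m (f x) = c * (m y - m x))"

lemma scaledD:
  "scaled \<Gamma> m f c p q \<Longrightarrow> x \<in> \<Gamma> \<Longrightarrow> y \<in> \<Gamma> \<Longrightarrow> p \<le> x \<Longrightarrow> x \<le> y \<Longrightarrow> y \<le> q \<Longrightarrow>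
   m (f y) - m (f x) = c * (m y - m x)"
  by (simp add: scaled_def)

lemma scaledI:
  assumes "\<And>x y. x \<in> \<Gamma> \<Longrightarrow> y \<in> \<Gamma> \<Longrightarrow> p \<le> x \<Longrightarrow> x \<le> y \<Longrightarrow> y \<le> q \<Longrightarrow> m (f y) - m (f x) = c * (m y - m x)"
  shows "scaled \<Gamma> m f c p q"
  using assms by (simp add: scaled_def)

lemma scaled_concat:
  assumes "scaled \<Gamma> m f c p r" "scaled \<Gamma> m f c r q" "r \<in> \<Gamma>"
  shows "scaled \<Gamma> m f c p q"
proof (rule scaledI)
  fix x y assume xy: "x \<in> \<Gamma>" "y \<in> \<Gamma>" "p \<le> x" "x \<le> y" "y \<le> q"
  consider "y \<le> r" | "r \<le> x" | "x \<le> r" "r \<le> y" by linarith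
  then show "m (f y) - m (f x) = c * (m y - m x)"
  proof cases
    case 3
    then have "m (f r) - m (f x) = c * (m r - m x)" "m (f y) - m (f r) = c * (m y - m r)"
      using assms xy by (auto intro: scaledD)
    then show ?thesis by (simp add: algebra_simps)
  qed (use assms xy in \<open>auto intro: scaledD\<close>)
qed

text \<open>
  Makes a step function out of its jumps: the product over \<open>D\<close> is \<open>1\<close> plus its increments.
\<close>

lemma step_product_telescope:
  fixes r :: "real \<Rightarrow> real"
  assumes "finite D"
  shows "1 + (\<Sum>d\<in>D. (\<Prod>d'\<in>{d'\<in>D. d' \<le> d}. r d') - (\<Prod>d'\<in>{d'\<in>D. d' < d}. r d')) = prod r D"
  using assms
proof (induction D rule: finite_linorder_max_induct)
  case (insert b A)
  have "(\<Prod>d'\<in>{d'\<in>insert b A. d' \<le> d}. r d') = (\<Prod>d'\<in>{d'\<in>A. d' \<le> d}. r d')"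
    "(\<Prod>d'\<in>{d'\<in>insert b A. d' < d}. r d') = (\<Prod>d'\<in>{d'\<in>A. d' < d}. r d')" if "d \<in> A" for d
    using insert.hyps(2) that by (auto intro!: prod.cong)
  moreover have "{d'\<in>insert b A. d' \<le> b} = insert b A" "{d'\<in>insert b A. d' < b} = A"
    using insert.hyps(2) by (auto intro: less_imp_le)
  moreover have "b \<notin> A" using insert.hyps(2) by blast
  ultimately show ?case using insert by simp
qed simp

text \<open>
  A distribution function \<open>M\<close> for which all translations are piecewise scalings. \<open>rank\<close> provides a
  translation of infinite order modulo the period \<open>e\<close>.
\<close>

locale scaling =
  fixes \<Gamma> A :: "real set" and e :: real and M :: "real \<Rightarrow> real"
  assumes grp: "add_group \<Gamma>" and dense: "closure \<Gamma> = UNIV" and slopes: "mult_group A"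
    and e: "e \<in> \<Gamma>" "0 < e"
    and rank: "\<exists>t\<in>\<Gamma>. \<forall>n k :: int. of_int n * t = of_int k * e \<longrightarrow> n = 0"
    and mono: "\<And>x y. x \<in> \<Gamma> \<Longrightarrow> y \<in> \<Gamma> \<Longrightarrow> x < y \<Longrightarrow> M x < M y"
    and periodic: "\<And>x. x \<in> \<Gamma> \<Longrightarrow> M (x + e) = M x + M e"
    and translation: "\<And>t u v. t \<in> \<Gamma> \<Longrightarrow> u \<in> \<Gamma> \<Longrightarrow> v \<in> \<Gamma> \<Longrightarrow>
       piecewise \<Gamma> u v (\<lambda>p q. \<exists>c\<in>A. scaled \<Gamma> M (\<lambda>x. x + t) c p q)"
begin

lemmas grpD = add_groupD[OF grp]
lemmas slopesD = mult_groupD[OF slopes]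

lemma dense_between: "x < y \<Longrightarrow> \<exists>z\<in>\<Gamma>. x < z \<and> z < y"
proof -
  assume "x < y"
  then have "open {x<..<y}" "{x<..<y} \<noteq> {}" by (auto simp: dense_le)
  then have "{x<..<y} \<inter> \<Gamma> \<noteq> {}"
    using dense open_Int_closure_eq_empty[of "{x<..<y}" \<Gamma>] by auto
  then show ?thesis by auto
qed

text \<open>
  The one-sided derivatives of the translation from \<open>0\<close> to \<open>y\<close>, measured with \<open>M\<close>.
\<close>

definition right_ratio :: "real \<Rightarrow> real" where
  "right_ratio y = (SOME c. c \<in> A \<and> (\<exists>\<delta>\<in>\<Gamma>. 0 < \<delta> \<and> scaled \<Gamma> M (\<lambda>x. x + y) c 0 \<delta>))"

definition left_ratio :: "real \<Rightarrow> real" where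
  "left_ratio y = (SOME c. c \<in> A \<and> (\<exists>\<delta>\<in>\<Gamma>. 0 < \<delta> \<and> scaled \<Gamma> M (\<lambda>x. x + y) c (-\<delta>) 0))"

definition jump :: "real \<Rightarrow> real" where
  "jump y = right_ratio y / left_ratio y"

lemma right_ratio:
  assumes "y \<in> \<Gamma>"
  shows "right_ratio y \<in> A" "\<exists>\<delta>\<in>\<Gamma>. 0 < \<delta> \<and> scaled \<Gamma> M (\<lambda>x. x + y) (right_ratio y) 0 \<delta>"
proof -
  have "\<exists>q\<in>\<Gamma>. 0 < q \<and> q < e \<and> (\<exists>c\<in>A. scaled \<Gamma> M (\<lambda>x. x + y) c 0 q)"
    by (rule piecewise_right_end[OF translation]) (use assms grpD e dense in auto)
  then have "\<exists>c. c \<in> A \<and> (\<exists>\<delta>\<in>\<Gamma>. 0 < \<delta> \<and> scaled \<Gamma> M (\<lambda>x. x + y) c 0 \<delta>)" by blast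
  then have "right_ratio y \<in> A \<and> (\<exists>\<delta>\<in>\<Gamma>. 0 < \<delta> \<and> scaled \<Gamma> M (\<lambda>x. x + y) (right_ratio y) 0 \<delta>)"
    unfolding right_ratio_def by (rule someI_ex)
  then show "right_ratio y \<in> A" "\<exists>\<delta>\<in>\<Gamma>. 0 < \<delta> \<and> scaled \<Gamma> M (\<lambda>x. x + y) (right_ratio y) 0 \<delta>" by auto
qed

lemma left_ratio:
  assumes "y \<in> \<Gamma>"
  shows "left_ratio y \<in> A" "\<exists>\<delta>\<in>\<Gamma>. 0 < \<delta> \<and> scaled \<Gamma> M (\<lambda>x. x + y) (left_ratio y) (-\<delta>) 0"
proof -
  have "\<exists>q\<in>\<Gamma>. -e < q \<and> q < 0 \<and> (\<exists>c\<in>A. scaled \<Gamma> M (\<lambda>x. x + y) c q 0)"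
    by (rule piecewise_left_end[OF translation]) (use assms grpD e dense in auto)
  then obtain q c where "q \<in> \<Gamma>" "q < 0" "c \<in> A" "scaled \<Gamma> M (\<lambda>x. x + y) c q 0" by blast
  then have "\<exists>c. c \<in> A \<and> (\<exists>\<delta>\<in>\<Gamma>. 0 < \<delta> \<and> scaled \<Gamma> M (\<lambda>x. x + y) c (-\<delta>) 0)"
    using grpD(2) by (intro exI[of _ c] conjI bexI[of _ "-q"]) auto
  then have "left_ratio y \<in> A \<and> (\<exists>\<delta>\<in>\<Gamma>. 0 < \<delta> \<and> scaled \<Gamma> M (\<lambda>x. x + y) (left_ratio y) (-\<delta>) 0)"
    unfolding left_ratio_def by (rule someI_ex)
  then show "left_ratio y \<in> A" "\<exists>\<delta>\<in>\<Gamma>. 0 < \<delta> \<and> scaled \<Gamma> M (\<lambda>x. x + y) (left_ratio y) (-\<delta>) 0" by auto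
qed

lemma ratio_pos: "y \<in> \<Gamma> \<Longrightarrow> 0 < right_ratio y" "y \<in> \<Gamma> \<Longrightarrow> 0 < left_ratio y"
  using right_ratio left_ratio slopesD(2) by blast+

lemma jump_in: "y \<in> \<Gamma> \<Longrightarrow> jump y \<in> A" "y \<in> \<Gamma> \<Longrightarrow> 0 < jump y"
  unfolding jump_def using right_ratio left_ratio slopesD(2,5) by blast+

lemma right_ratio_translate:
  assumes sc: "scaled \<Gamma> M (\<lambda>x. x + t) c p q" and in_\<Gamma>: "t \<in> \<Gamma>" "x \<in> \<Gamma>" and px: "p \<le> x" "x < q"
  shows "right_ratio (x + t) = c * right_ratio x"
proof -
  obtain d1 d2 where d: "0 < d1" "scaled \<Gamma> M (\<lambda>y. y + x) (right_ratio x) 0 d1"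
    "0 < d2" "scaled \<Gamma> M (\<lambda>y. y + (x + t)) (right_ratio (x + t)) 0 d2"
    using right_ratio(2) grpD(3) in_\<Gamma> by meson
  obtain d where d': "d \<in> \<Gamma>" "0 < d" "d < min (q - x) (min d1 d2)"
    using dense_between[of 0 "min (q - x) (min d1 d2)"] d px by auto
  have z: "0 \<in> \<Gamma>" "x + d \<in> \<Gamma>" using grpD(1) grpD(3) in_\<Gamma> d' by auto
  have "M (x + d) - M x = right_ratio x * (M d - M 0)"
    using scaledD[OF d(2), of 0 d] z d' by (simp add: add.commute)
  moreover have "M ((x + d) + t) - M (x + t) = right_ratio (x + t) * (M d - M 0)"
    using scaledD[OF d(4), of 0 d] z d' by (simp add: ac_simps)
  moreover have "M ((x + d) + t) - M (x + t) = c * (M (x + d) - M x)"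
    by (rule scaledD[OF sc]) (use z d' in_\<Gamma> px in auto)
  ultimately have "right_ratio (x + t) * (M d - M 0) = c * (right_ratio x * (M d - M 0))"
    by (simp only: mult.assoc)
  moreover have "M d - M 0 \<noteq> 0" using mono[OF z(1) d'(1,2)] by simp
  ultimately show ?thesis by simp
qed

lemma left_ratio_translate:
  assumes sc: "scaled \<Gamma> M (\<lambda>x. x + t) c p q" and in_\<Gamma>: "t \<in> \<Gamma>" "x \<in> \<Gamma>" and px: "p < x" "x \<le> q"
  shows "left_ratio (x + t) = c * left_ratio x"
proof -
  obtain d1 d2 where d: "0 < d1" "scaled \<Gamma> M (\<lambda>y. y + x) (left_ratio x) (-d1) 0"
    "0 < d2" "scaled \<Gamma> M (\<lambda>y. y + (x + t)) (left_ratio (x + t)) (-d2) 0"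
    using left_ratio(2) grpD(3) in_\<Gamma> by meson
  obtain d where d': "d \<in> \<Gamma>" "0 < d" "d < min (x - p) (min d1 d2)"
    using dense_between[of 0 "min (x - p) (min d1 d2)"] d px by auto
  have z: "0 \<in> \<Gamma>" "x - d \<in> \<Gamma>" "-d \<in> \<Gamma>" using grpD(1,2,4) in_\<Gamma> d' by auto
  have "M x - M (x - d) = left_ratio x * (M 0 - M (-d))"
    using scaledD[OF d(2), of "-d" 0] z d' by simp
  moreover have "M (x + t) - M ((x - d) + t) = left_ratio (x + t) * (M 0 - M (-d))"
    using scaledD[OF d(4), of "-d" 0] z d' by (simp add: algebra_simps)
  moreover have "M (x + t) - M ((x - d) + t) = c * (M x - M (x - d))"
    by (rule scaledD[OF sc]) (use z d' in_\<Gamma> px in auto)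
  ultimately have "left_ratio (x + t) * (M 0 - M (-d)) = c * (left_ratio x * (M 0 - M (-d)))"
    by (simp only: mult.assoc)
  moreover have "M 0 - M (-d) \<noteq> 0" using mono[OF z(3,1)] d'(2) by simp
  ultimately show ?thesis by simp
qed

lemma ratio_periodic:
  assumes "y \<in> \<Gamma>"
  shows "right_ratio (y + e) = right_ratio y" "left_ratio (y + e) = left_ratio y" "jump (y + e) = jump y"
proof -
  have "scaled \<Gamma> M (\<lambda>x. x + e) 1 (y - 1) (y + 1)"
    by (rule scaledI) (simp add: periodic)
  then show "right_ratio (y + e) = right_ratio y" "left_ratio (y + e) = left_ratio y"
    using right_ratio_translate[of e 1 "y - 1" "y + 1" y] left_ratio_translate[of e 1 "y - 1" "y + 1" y]
      assms e by auto
  then show "jump (y + e) = jump y" by (simp add: jump_def)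
qed

lemma jump_translate:
  assumes "scaled \<Gamma> M (\<lambda>x. x + t) c p q" "t \<in> \<Gamma>" "x \<in> \<Gamma>" "p < x" "x < q" "c \<in> A"
  shows "jump (x + t) = jump x"
  using right_ratio_translate[of t c p q x] left_ratio_translate[of t c p q x] assms slopesD(2)[of c]
  by (simp add: jump_def)

abbreviation changes :: "real \<Rightarrow> real \<Rightarrow> real \<Rightarrow> real set" where
  "changes t p q \<equiv> {y \<in> \<Gamma>. p < y \<and> y < q \<and> jump (y + t) \<noteq> jump y}"

text \<open>
  The jumps of the derivative of a translation, multiplied up over an interval, give the ratio
  of its derivatives at the two ends.
\<close>

lemma jump_changes:
  assumes t: "t \<in> \<Gamma>" and pq: "p \<in> \<Gamma>" "q \<in> \<Gamma>" "p < q"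
  shows "finite (changes t p q) \<and>
     right_ratio (p + t) / right_ratio p * (\<Prod>y\<in>changes t p q. jump (y + t) / jump y) =
     left_ratio (q + t) / left_ratio q"
proof -
  define R where "R p q \<longleftrightarrow> finite (changes t p q) \<and>
     right_ratio (p + t) / right_ratio p * (\<Prod>y\<in>changes t p q. jump (y + t) / jump y) =
     left_ratio (q + t) / left_ratio q" for p q
  have "R p q" using translation[OF t pq(1,2)]
  proof (rule piecewise_glue)
    fix x y assume xy: "x \<in> \<Gamma>" "y \<in> \<Gamma>" "x < y" "\<exists>c\<in>A. scaled \<Gamma> M (\<lambda>x. x + t) c x y"
    then obtain c where c: "c \<in> A" "scaled \<Gamma> M (\<lambda>x. x + t) c x y" by blast
    have "changes t x y = {}" using jump_translate[OF c(2) t _ _ _ c(1)] by blast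
    then show "R x y"
      unfolding R_def \<open>changes t x y = {}\<close>
      using right_ratio_translate[OF c(2) t xy(1)] left_ratio_translate[OF c(2) t xy(2)]
        ratio_pos[OF xy(1)] ratio_pos[OF xy(2)] xy(3) by simp
  next
    fix x z y assume xyz: "x \<in> \<Gamma>" "z \<in> \<Gamma>" "y \<in> \<Gamma>" "x < z" "z < y" and R: "R x z" "R z y"
    let ?P = "\<lambda>S. \<Prod>y\<in>S. jump (y + t) / jump y"
    have zt: "0 < right_ratio (z + t)" "0 < left_ratio (z + t)" "0 < right_ratio z" "0 < left_ratio z"
      using ratio_pos grpD(3) xyz t by blast+
    let ?Z = "{w::real. w = z \<and> jump (z + t) \<noteq> jump z}"
    have Z: "?P ?Z = jump (z + t) / jump z"
    proof (cases "jump (z + t) = jump z")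
      case True
      then have "?Z = {}" by simp
      then show ?thesis using True zt by (simp add: jump_def)
    next
      case False
      then have "?Z = {z}" by auto
      then show ?thesis by simp
    qed
    have fin: "finite (changes t x z)" "finite (changes t z y)" "finite ?Z"
      using R by (auto simp: R_def)
    have un: "changes t x y = (changes t x z \<union> changes t z y) \<union> ?Z"
    proof (rule Set.set_eqI)
      fix w show "w \<in> changes t x y \<longleftrightarrow> w \<in> (changes t x z \<union> changes t z y) \<union> ?Z"
        by (cases w z rule: linorder_cases) (use xyz in auto)
    qed
    have "?P (changes t x y) = ?P (changes t x z \<union> changes t z y) * ?P ?Z"
      unfolding un by (rule prod.union_disjoint) (use fin in auto)
    also have "?P (changes t x z \<union> changes t z y) = ?P (changes t x z) * ?P (changes t z y)"
      by (rule prod.union_disjoint) (use fin in auto)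
    finally have P: "?P (changes t x y) = ?P (changes t x z) * ?P (changes t z y) * (jump (z + t) / jump z)"
      by (simp only: Z)
    have "right_ratio (x + t) / right_ratio x * ?P (changes t x y)
        = (right_ratio (x + t) / right_ratio x * ?P (changes t x z)) * (jump (z + t) / jump z) * ?P (changes t z y)"
      unfolding P by (simp only: mult_ac)
    also have "right_ratio (x + t) / right_ratio x * ?P (changes t x z) = left_ratio (z + t) / left_ratio z"
      using R(1) by (simp only: R_def)
    also have "left_ratio (z + t) / left_ratio z * (jump (z + t) / jump z) = right_ratio (z + t) / right_ratio z"
      using zt by (simp add: jump_def field_simps)
    also have "right_ratio (z + t) / right_ratio z * ?P (changes t z y) = left_ratio (y + t) / left_ratio y"
      using R(2) by (simp only: R_def)
    finally show "R x y" using fin unfolding R_def un by blast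
  qed (use pq in auto)
  then show ?thesis by (simp only: R_def)
qed

text \<open>
  Over a full period the derivatives at the two ends are those at one point of the circle, so the
  changes of \<open>jump\<close> under a translation multiply to \<open>1\<close> and \<open>jump\<close> is almost invariant.
\<close>

lemma jump_constant_off_finite:
  "\<exists>k. 0 < k \<and> k \<in> A \<and> finite {y \<in> \<Gamma>. 0 \<le> y \<and> y < e \<and> jump y \<noteq> k}"
proof -
  obtain t0 where t0: "t0 \<in> \<Gamma>" "\<And>n k :: int. of_int n * t0 = of_int k * e \<Longrightarrow> n = 0"
    using rank by blast
  have z: "0 \<in> \<Gamma>" by (rule grpD(1))
  have decomp: "{y \<in> \<Gamma>. 0 \<le> y \<and> y < e \<and> jump (y + t) \<noteq> jump y} =
      changes t 0 e \<union> {y::real. y = 0 \<and> jump (0 + t) \<noteq> jump 0}" for t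
    using z e by (auto simp: order_less_le)
  have fin: "finite (changes t 0 e)" if "t \<in> \<Gamma>" for t
    using jump_changes[OF that z e] by blast
  interpret almost_invariant \<Gamma> e t0 jump
  proof
    show "finite {y \<in> \<Gamma>. 0 \<le> y \<and> y < e \<and> jump (y + t) \<noteq> jump y}" if "t \<in> \<Gamma>" for t
      unfolding decomp using fin[OF that] by simp
    let ?P = "\<lambda>S. \<Prod>y\<in>S. jump (y + t0) / jump y"
    let ?Z = "{y::real. y = 0 \<and> jump (0 + t0) \<noteq> jump 0}"
    have pos0: "0 < right_ratio t0" "0 < left_ratio t0" "0 < right_ratio 0" "0 < left_ratio 0"
      using ratio_pos t0 z by auto
    have Z: "?P ?Z = jump t0 / jump 0"
    proof (cases "jump t0 = jump 0")
      case True
      then show ?thesis using pos0 by (simp add: jump_def)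
    next
      case False
      then have "?Z = {0}" by auto
      then have "?P ?Z = ?P {0}" by (simp only:)
      then show ?thesis by simp
    qed
    have "?P {y \<in> \<Gamma>. 0 \<le> y \<and> y < e \<and> jump (y + t0) \<noteq> jump y} = ?P (changes t0 0 e) * ?P ?Z"
      unfolding decomp by (rule prod.union_disjoint) (use fin[OF t0(1)] in auto)
    moreover have "right_ratio t0 / right_ratio 0 * ?P (changes t0 0 e) = left_ratio t0 / left_ratio 0"
      using jump_changes[OF t0(1) z e] ratio_periodic(2)[OF z] ratio_periodic(2)[OF t0(1)]
      by (simp add: add.commute)
    ultimately show "?P {y \<in> \<Gamma>. 0 \<le> y \<and> y < e \<and> jump (y + t0) \<noteq> jump y} = 1"
      using pos0 unfolding Z by (simp add: jump_def field_simps)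
  qed (use grp e t0 jump_in ratio_periodic in auto)
  show ?thesis using constant_off_finite jump_in by auto
qed

end

section \<open>Distribution functions scaled uniformly by translations\<close>

text \<open>
  Here a translation by \<open>t\<close> has one scaling factor \<open>h t\<close> on all of its domain in \<open>[0, e]\<close>. The
  linear functions with \<open>h = 1\<close> and the exponential functions \<open>(b ^ x - 1) / (b - 1)\<close> have this
  property.
\<close>

locale uniform_scaling =
  fixes \<Gamma> :: "real set" and e :: real and N h :: "real \<Rightarrow> real"
  assumes grp: "add_group \<Gamma>" and dense: "closure \<Gamma> = UNIV" and e: "e \<in> \<Gamma>" "0 < e"
    and mono: "\<And>x y. x \<in> \<Gamma> \<Longrightarrow> y \<in> \<Gamma> \<Longrightarrow> 0 \<le> x \<Longrightarrow> x < y \<Longrightarrow> y \<le> e \<Longrightarrow> N x < N y"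
    and uniform: "\<And>t. t \<in> \<Gamma> \<Longrightarrow> 0 < t \<Longrightarrow> t < e \<Longrightarrow> scaled \<Gamma> N (\<lambda>x. x + t) (h t) 0 (e - t)"
begin

lemmas grpD = add_groupD[OF grp]

lemma dense_between: "x < y \<Longrightarrow> \<exists>z\<in>\<Gamma>. x < z \<and> z < y"
proof -
  assume "x < y"
  then have "open {x<..<y}" "{x<..<y} \<noteq> {}" by (auto simp: dense_le)
  then have "{x<..<y} \<inter> \<Gamma> \<noteq> {}"
    using dense open_Int_closure_eq_empty[of "{x<..<y}" \<Gamma>] by auto
  then show ?thesis by auto
qed

lemma shift:
  "t \<in> \<Gamma> \<Longrightarrow> 0 < t \<Longrightarrow> t < e \<Longrightarrow> x \<in> \<Gamma> \<Longrightarrow> y \<in> \<Gamma> \<Longrightarrow> 0 \<le> x \<Longrightarrow> x \<le> y \<Longrightarrow> y + t \<le> e \<Longrightarrow>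
   N (y + t) - N (x + t) = h t * (N y - N x)"
  by (rule scaledD[OF uniform]) auto

lemma h_pos:
  assumes "t \<in> \<Gamma>" "0 < t" "t < e"
  shows "0 < h t"
proof -
  obtain d where d: "d \<in> \<Gamma>" "0 < d" "d < e - t" using dense_between[of 0 "e - t"] assms by auto
  have "N (d + t) - N (0 + t) = h t * (N d - N 0)"
    by (rule shift) (use assms d grpD(1) in auto)
  moreover have "N (0 + t) < N (d + t)" "N 0 < N d"
    using mono[of "0 + t" "d + t"] mono[of 0 d] assms d grpD(1) grpD(3) by auto
  ultimately show ?thesis by (metis diff_gt_0_iff_gt zero_less_mult_pos2)
qed

lemma h_add:
  assumes "s \<in> \<Gamma>" "t \<in> \<Gamma>" "0 < s" "0 < t" "s + t < e"
  shows "h (s + t) = h s * h t"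
proof -
  obtain d where d: "d \<in> \<Gamma>" "0 < d" "d < e - (s + t)" using dense_between[of 0 "e - (s + t)"] assms by auto
  have z: "0 \<in> \<Gamma>" "s + t \<in> \<Gamma>" "d + s \<in> \<Gamma>" using grpD(1) grpD(3) assms d by auto
  have "N (d + (s + t)) - N (0 + (s + t)) = h (s + t) * (N d - N 0)"
    by (rule shift) (use assms d z in auto)
  moreover have "N ((d + s) + t) - N ((0 + s) + t) = h t * (N (d + s) - N (0 + s))"
    by (rule shift) (use assms d z in auto)
  moreover have "N (d + s) - N (0 + s) = h s * (N d - N 0)"
    by (rule shift) (use assms d z in auto)
  ultimately have "h (s + t) * (N d - N 0) = (h s * h t) * (N d - N 0)"
    by (simp add: ac_simps)
  moreover have "N d - N 0 \<noteq> 0" using mono[of 0 d] z d assms by simp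
  ultimately show ?thesis by simp
qed

lemma h_multiple:
  assumes "t \<in> \<Gamma>" "0 < t" "of_nat (Suc n) * t < e"
  shows "h (of_nat (Suc n) * t) = h t ^ Suc n"
  using assms(3)
proof (induction n)
  case (Suc n)
  have split: "of_nat (Suc (Suc n)) * t = of_nat (Suc n) * t + t" by (simp add: algebra_simps)
  have "h (of_nat (Suc n) * t + t) = h (of_nat (Suc n) * t) * h t"
  proof (rule h_add)
    show "of_nat (Suc n) * t \<in> \<Gamma>" by (rule grpD(5)[OF assms(1)])
    show "of_nat (Suc n) * t + t < e" using Suc.prems by (simp only: split)
  qed (use assms in auto)
  moreover have "h (of_nat (Suc n) * t) = h t ^ Suc n"
    by (rule Suc.IH) (use Suc.prems split assms(2) in linarith)
  ultimately show ?case unfolding split by simp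
qed simp

text \<open>
  The increments over \<open>[r, t + r]\<close> and \<open>[0, t]\<close> differ by the same amount as those over
  \<open>[t, t + r]\<close> and \<open>[0, r]\<close>, that is, \<open>(h r - 1) * (N t - N 0) = (h t - 1) * (N r - N 0)\<close>.
\<close>

lemma h_smaller:
  assumes "r \<in> \<Gamma>" "t \<in> \<Gamma>" "0 < r" "r < t" "r + t < e"
  shows "1 \<le> h t \<Longrightarrow> 1 \<le> h r" "h t \<le> 1 \<Longrightarrow> h r \<le> 1"
proof -
  have z: "0 \<in> \<Gamma>" by (rule grpD(1))
  have "N (t + r) - N (0 + r) = h r * (N t - N 0)"
    by (rule shift) (use assms z in auto)
  moreover have "N (r + t) - N (0 + t) = h t * (N r - N 0)"
    by (rule shift) (use assms z in auto)
  ultimately have eq: "h r * (N t - N 0) - (N t - N 0) = h t * (N r - N 0) - (N r - N 0)"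
    by (simp add: add.commute)
  have pos: "0 < N t - N 0" "0 < N r - N 0" using mono[of 0 t] mono[of 0 r] assms z by auto
  have eq: "(h r - 1) * (N t - N 0) = (h t - 1) * (N r - N 0)" using eq by (simp add: left_diff_distrib)
  show "1 \<le> h r" if "1 \<le> h t"
  proof -
    have "0 \<le> (h r - 1) * (N t - N 0)" unfolding eq using that pos by simp
    then show ?thesis using pos by (simp add: zero_le_mult_iff)
  qed
  show "h r \<le> 1" if "h t \<le> 1"
  proof -
    have "(h r - 1) * (N t - N 0) \<le> 0" unfolding eq using that pos by (simp add: mult_nonpos_nonneg)
    then show ?thesis using pos by (simp add: mult_le_0_iff)
  qed
qed

text \<open>
  The contraction conjugates the translation by \<open>t\<close> to that by \<open>lam * t\<close>, so \<open>h (lam * t) = h t\<close>.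
  If \<open>h t = a\<close> differs from \<open>1\<close>, iterate until \<open>t' = lam ^ n * t\<close> is less than \<open>t / 2\<close> and write
  \<open>t = K * t' + r\<close> with \<open>2 \<le> K\<close> and \<open>0 \<le> r < t'\<close>. Then \<open>a = a ^ K * h r\<close>, with \<open>h r\<close> replaced by
  \<open>1\<close> if \<open>r = 0\<close>; this is a contradiction, as \<open>h r\<close> and \<open>a\<close> lie on the same side of \<open>1\<close>.
\<close>

lemma h_trivial_of_contraction:
  assumes lam: "0 < lam" "lam < 1" "\<And>x. x \<in> \<Gamma> \<Longrightarrow> lam * x \<in> \<Gamma>" and \<tau>: "\<tau> \<in> \<Gamma>" and c: "0 < c"
    and pq: "p \<in> \<Gamma>" "q \<in> \<Gamma>" "0 \<le> p" "p < q" "q \<le> e" "0 \<le> lam * p + \<tau>" "lam * q + \<tau> \<le> e"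
    and sc: "scaled \<Gamma> N (\<lambda>x. lam * x + \<tau>) c p q"
  shows "\<exists>\<delta>>0. \<forall>t\<in>\<Gamma>. 0 < t \<longrightarrow> t < \<delta> \<longrightarrow> h t = 1"
proof -
  have inv: "h (lam * t) = h t" if t: "t \<in> \<Gamma>" "0 < t" "t < q - p" for t
  proof -
    obtain d where d: "d \<in> \<Gamma>" "0 < d" "d < q - p - t" using dense_between[of 0 "q - p - t"] t by auto
    have in_\<Gamma>: "p + d \<in> \<Gamma>" "p + t \<in> \<Gamma>" "p + d + t \<in> \<Gamma>" "lam * t \<in> \<Gamma>"
      "lam * p + \<tau> \<in> \<Gamma>" "lam * (p + d) + \<tau> \<in> \<Gamma>"
      by (intro grpD(3) lam(3) d t pq \<tau>)+
    have "lam * t < t" "0 < lam * t" using lam t by auto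
    have le: "lam * (p + d + t) \<le> lam * q" "lam * p \<le> lam * (p + d)"
      using lam d by (auto intro!: mult_left_mono)
    have "N (lam * (p + d + t) + \<tau>) - N (lam * (p + t) + \<tau>) = c * (N (p + d + t) - N (p + t))"
      by (rule scaledD[OF sc]) (use in_\<Gamma> d t in auto)
    moreover have "N (p + d + t) - N (p + t) = h t * (N (p + d) - N p)"
      by (rule shift) (use in_\<Gamma> d t pq in auto)
    moreover have "N ((lam * (p + d) + \<tau>) + lam * t) - N ((lam * p + \<tau>) + lam * t)
        = h (lam * t) * (N (lam * (p + d) + \<tau>) - N (lam * p + \<tau>))"
      by (rule shift) (use in_\<Gamma> d t pq le \<open>lam * t < t\<close> \<open>0 < lam * t\<close> in \<open>auto simp: algebra_simps\<close>)
    moreover have "N (lam * (p + d) + \<tau>) - N (lam * p + \<tau>) = c * (N (p + d) - N p)"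
      by (rule scaledD[OF sc]) (use in_\<Gamma> d t pq in auto)
    moreover have "lam * (p + d + t) + \<tau> = (lam * (p + d) + \<tau>) + lam * t"
      "lam * (p + t) + \<tau> = (lam * p + \<tau>) + lam * t" by (simp_all add: algebra_simps)
    ultimately have "h (lam * t) * (c * (N (p + d) - N p)) = h t * (c * (N (p + d) - N p))"
      by (simp add: ac_simps)
    moreover have "c * (N (p + d) - N p) \<noteq> 0" using mono[of p "p + d"] in_\<Gamma> pq d t c by simp
    ultimately show ?thesis by simp
  qed
  have pow: "lam ^ n * t \<in> \<Gamma> \<and> h (lam ^ n * t) = h t" if t: "t \<in> \<Gamma>" "0 < t" "t < q - p" for t n
  proof (induction n)
    case (Suc n)
    have "lam ^ n \<le> 1" "0 < lam ^ n" using lam by (auto simp: power_le_one)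
    then have "lam ^ n * t \<le> t" "0 < lam ^ n * t" using t by (auto simp: mult_le_cancel_right1 not_less)
    then have "lam ^ n * t < q - p" using t by linarith
    then show ?case using \<open>0 < lam ^ n * t\<close> using inv[of "lam ^ n * t"] Suc t lam(3)[of "lam ^ n * t"] by (simp add: mult.assoc)
  qed (use t in simp)
  have "h t = 1" if t: "t \<in> \<Gamma>" "0 < t" "t < q - p" for t
  proof (rule ccontr)
    assume ne: "h t \<noteq> 1"
    obtain n where n: "lam ^ n < 1 / 2" using real_arch_pow_inv[of "1/2" lam] lam by auto
    define t' where "t' = lam ^ n * t"
    define K where "K = nat \<lfloor>t / t'\<rfloor>"
    define r where "r = t - of_nat K * t'"
    define a where "a = h t"
    have t': "t' \<in> \<Gamma>" "h t' = a" "0 < t'" "2 * t' < t"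
      using pow[OF t, of n] lam t n by (auto simp: t'_def a_def)
    have te: "t < e" using t pq by simp
    have "2 < t / t'" using t' by (simp add: field_simps)
    then have K: "2 \<le> K" "of_nat K \<le> t / t'" "t / t' < of_nat K + 1" unfolding K_def by linarith+
    have r: "0 \<le> r" "r < t'" "r \<in> \<Gamma>" "t = of_nat K * t' + r"
    proof -
      show "0 \<le> r" "r < t'" using K(2,3) t'(3) by (simp_all add: r_def field_simps)
      show "r \<in> \<Gamma>" unfolding r_def by (intro grpD(4) grpD(5) t t')
      show "t = of_nat K * t' + r" by (simp add: r_def)
    qed
    obtain k where k: "K = Suc (Suc k)" using K(1) by (metis add_2_eq_Suc le_Suc_ex)
    have Kt: "of_nat K * t' \<in> \<Gamma>" "0 < of_nat K * t'" "of_nat K * t' < e"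
      using grpD(5)[OF t'(1)] K t' r te by auto
    have hK: "h (of_nat K * t') = a ^ K"
      using h_multiple[OF t'(1,3), of "Suc k"] Kt(3) t'(2) k by simp
    have apos: "0 < a" using h_pos[OF t(1,2) te] by (simp add: a_def)
    define \<rho> where "\<rho> = (if r = 0 then 1 else h r)"
    have "a = a ^ K * \<rho>"
    proof (cases "r = 0")
      case True
      then show ?thesis using hK r(4) by (simp add: \<rho>_def a_def)
    next
      case False
      have "h (of_nat K * t' + r) = h (of_nat K * t') * h r"
        by (rule h_add) (use False Kt r te in auto)
      then show ?thesis using False hK r(4) by (simp add: \<rho>_def a_def)
    qed
    then have one: "a ^ Suc k * \<rho> = 1" using apos k by simp
    have \<rho>: "1 \<le> a \<Longrightarrow> 1 \<le> \<rho>" "a \<le> 1 \<Longrightarrow> \<rho> \<le> 1"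
      using h_smaller[OF r(3) t'(1)] r t' te by (auto simp: \<rho>_def)
    have \<rho>0: "0 < \<rho>" using h_pos[of r] r t' te by (simp add: \<rho>_def)
    consider "1 < a" | "a < 1" using ne unfolding a_def by linarith
    then show False
    proof cases
      case 1
      have "1 < a ^ Suc k" using 1 by (rule one_less_power) simp
      moreover have "a ^ Suc k * 1 \<le> a ^ Suc k * \<rho>" using \<rho>(1) 1 apos by (intro mult_left_mono) auto
      ultimately show False using one by simp
    next
      case 2
      have "a ^ Suc k < 1" using 2 apos by (simp only: power_Suc_less_one)
      moreover have "0 < a ^ Suc k" using apos by simp
      moreover have "a ^ Suc k * \<rho> \<le> a ^ Suc k * 1" using \<rho>(2) 2 apos by (intro mult_left_mono) auto
      ultimately show False using one by simp
    qed
  qed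
  then show ?thesis using pq by (intro exI[of _ "q - p"]) auto
qed

text \<open>
  Increments over intervals of equal small length \<open>\<epsilon>\<close> coincide. Approximating two intervals
  by multiples of \<open>\<epsilon>\<close> therefore compares their increments up to an error that vanishes with
  \<open>\<epsilon>\<close>.
\<close>

lemma linear_of_h_trivial:
  assumes "\<exists>\<delta>>0. \<forall>t\<in>\<Gamma>. 0 < t \<longrightarrow> t < \<delta> \<longrightarrow> h t = 1"
  shows "\<exists>s>0. \<forall>x\<in>\<Gamma>. 0 \<le> x \<longrightarrow> x \<le> e \<longrightarrow> N x - N 0 = s * x"
proof -
  obtain \<delta> where \<delta>: "0 < \<delta>" "\<And>t. t \<in> \<Gamma> \<Longrightarrow> 0 < t \<Longrightarrow> t < \<delta> \<Longrightarrow> h t = 1" using assms by blast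
  have z: "0 \<in> \<Gamma>" by (rule grpD(1))
  define g where "g x = N x - N 0" for x
  have g_pos: "0 < g x" if "x \<in> \<Gamma>" "0 < x" "x \<le> e" for x using mono[of 0 x] that z by (simp add: g_def)
  have bounds: "\<epsilon> * g a \<le> (a + \<epsilon>) * g \<epsilon>" "(a - \<epsilon>) * g \<epsilon> \<le> \<epsilon> * g a"
    if \<epsilon>: "\<epsilon> \<in> \<Gamma>" "0 < \<epsilon>" "\<epsilon> < \<delta>" "\<epsilon> < e" and a: "a \<in> \<Gamma>" "0 \<le> a" "a \<le> e" for \<epsilon> a
  proof -
    have step: "N (y + \<epsilon>) = N y + g \<epsilon>" if "y \<in> \<Gamma>" "0 \<le> y" "y + \<epsilon> \<le> e" for y
      using shift[of \<epsilon> 0 y] \<epsilon> \<delta>(2) that z by (simp add: g_def)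
    have multi: "N (r + of_nat m * \<epsilon>) = N r + of_nat m * g \<epsilon>"
      if "r \<in> \<Gamma>" "0 \<le> r" "r + of_nat m * \<epsilon> \<le> e" for r m
      using that(3)
    proof (induction m)
      case (Suc m)
      have "N ((r + of_nat m * \<epsilon>) + \<epsilon>) = N (r + of_nat m * \<epsilon>) + g \<epsilon>"
      proof (rule step)
        show "r + of_nat m * \<epsilon> \<in> \<Gamma>" by (intro grpD(3) grpD(5) \<epsilon> that)
      qed (use Suc.prems \<epsilon> that in \<open>auto simp: algebra_simps\<close>)
      moreover have "r + of_nat m * \<epsilon> \<le> e" using Suc.prems \<epsilon> by (simp add: algebra_simps)
      ultimately show ?case using Suc.IH by (simp add: algebra_simps)
    qed simp
    define m where "m = nat \<lfloor>a / \<epsilon>\<rfloor>"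
    define r where "r = a - of_nat m * \<epsilon>"
    have "0 \<le> a / \<epsilon>" using a \<epsilon> by simp
    then have m: "of_nat m \<le> a / \<epsilon>" "a / \<epsilon> < of_nat m + 1" unfolding m_def by linarith+
    have r: "0 \<le> r" "r < \<epsilon>" "r \<in> \<Gamma>" "a = r + of_nat m * \<epsilon>"
    proof -
      show "0 \<le> r" "r < \<epsilon>" using m \<epsilon>(2) by (simp_all add: r_def field_simps)
      show "r \<in> \<Gamma>" unfolding r_def by (intro grpD(4) grpD(5) a \<epsilon>)
      show "a = r + of_nat m * \<epsilon>" by (simp add: r_def)
    qed
    have ga: "g a = g r + of_nat m * g \<epsilon>" using multi[of r m] r a by (simp add: g_def)
    have "0 \<le> g r" using g_pos[of r] r \<epsilon> by (cases "r = 0") (auto simp: g_def)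
    moreover have "g r \<le> g \<epsilon>" using mono[of r \<epsilon>] r \<epsilon> by (simp add: g_def)
    moreover have ge: "0 < g \<epsilon>" using g_pos \<epsilon> by simp
    ultimately have 1: "of_nat m * g \<epsilon> \<le> g a" "g a \<le> (of_nat m + 1) * g \<epsilon>" using ga by (auto simp: algebra_simps)
    have 2: "of_nat m * \<epsilon> \<le> a" "a - \<epsilon> \<le> of_nat m * \<epsilon>" using r by auto
    have "\<epsilon> * g a \<le> \<epsilon> * ((of_nat m + 1) * g \<epsilon>)" using 1(2) \<epsilon>(2) by simp
    also have "\<dots> = (of_nat m * \<epsilon> + \<epsilon>) * g \<epsilon>" by (simp add: algebra_simps)
    also have "\<dots> \<le> (a + \<epsilon>) * g \<epsilon>" using 2(1) ge by simp
    finally show "\<epsilon> * g a \<le> (a + \<epsilon>) * g \<epsilon>" .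
    have "(a - \<epsilon>) * g \<epsilon> \<le> (of_nat m * \<epsilon>) * g \<epsilon>" using 2(2) ge by (intro mult_right_mono) auto
    also have "\<dots> = \<epsilon> * (of_nat m * g \<epsilon>)" by simp
    also have "\<dots> \<le> \<epsilon> * g a" using 1(1) \<epsilon>(2) by simp
    finally show "(a - \<epsilon>) * g \<epsilon> \<le> \<epsilon> * g a" .
  qed
  have cross: "g a * b \<le> a * g b" if a: "a \<in> \<Gamma>" "0 < a" "a \<le> e" and b: "b \<in> \<Gamma>" "0 < b" "b \<le> e" for a b
  proof (rule ccontr)
    assume "\<not> g a * b \<le> a * g b"
    then have gap: "0 < g a * b - a * g b" by simp
    have gab: "0 < g a" "0 < g b" using g_pos a b by auto
    define \<eta> where "\<eta> = min (min \<delta> e) (min b ((g a * b - a * g b) / (g a + g b)))"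
    have "0 < \<eta>" using \<delta> e b gap gab by (simp add: \<eta>_def)
    then obtain \<epsilon> where \<epsilon>: "\<epsilon> \<in> \<Gamma>" "0 < \<epsilon>" "\<epsilon> < \<eta>" using dense_between by blast
    then have \<epsilon>': "\<epsilon> < \<delta>" "\<epsilon> < e" "\<epsilon> < b" "\<epsilon> < (g a * b - a * g b) / (g a + g b)" by (auto simp: \<eta>_def)
    have "\<epsilon> * g a * (b - \<epsilon>) \<le> ((a + \<epsilon>) * g \<epsilon>) * (b - \<epsilon>)"
      using bounds(1)[OF \<epsilon>(1,2) \<epsilon>'(1,2) a(1)] a \<epsilon>' by (intro mult_right_mono) auto
    also have "\<dots> = (a + \<epsilon>) * ((b - \<epsilon>) * g \<epsilon>)" by (simp add: algebra_simps)
    also have "\<dots> \<le> (a + \<epsilon>) * (\<epsilon> * g b)"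
      using bounds(2)[OF \<epsilon>(1,2) \<epsilon>'(1,2) b(1)] a b \<epsilon> by (intro mult_left_mono) auto
    finally have "\<epsilon> * (g a * (b - \<epsilon>)) \<le> \<epsilon> * ((a + \<epsilon>) * g b)" by (simp add: algebra_simps)
    then have "g a * (b - \<epsilon>) \<le> (a + \<epsilon>) * g b" using \<epsilon>(2) by simp
    then have "g a * b - a * g b \<le> \<epsilon> * (g a + g b)" by (simp add: algebra_simps)
    moreover have "\<epsilon> * (g a + g b) < g a * b - a * g b"
      using \<epsilon>'(4) gab by (simp add: pos_less_divide_eq)
    ultimately show False by simp
  qed
  have "g x = g e / e * x" if "x \<in> \<Gamma>" "0 \<le> x" "x \<le> e" for x
  proof (cases "x = 0")
    case False
    then have "g x * e = x * g e"
      using cross[of x e] cross[of e x] that e by (simp add: mult.commute)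
    then show ?thesis using e by (simp add: field_simps)
  qed (simp add: g_def)
  moreover have "0 < g e / e" using g_pos e by simp
  ultimately show ?thesis unfolding g_def by blast
qed

end


section \<open>Piecewise linearity of scaled distribution functions\<close>

context scaling
begin

text \<open>
  Weighting the increments of \<open>M\<close> with a step function whose jumps cancel the exceptional ones
  of \<open>jump\<close> gives a distribution function \<open>N\<close> that every translation scales by a single factor.
\<close>

lemma piecewise_linear:
  assumes cond: "(\<forall>a\<in>A. a = 1) \<or> (\<exists>lam \<tau> c p q. 0 < lam \<and> lam < 1 \<and> (\<forall>x. lam * x \<in> \<Gamma> \<longleftrightarrow> x \<in> \<Gamma>) \<and> \<tau> \<in> \<Gamma> \<and> 0 < c \<and>
      p \<in> \<Gamma> \<and> q \<in> \<Gamma> \<and> 0 \<le> p \<and> p < q \<and> q \<le> e \<and> 0 \<le> lam * p + \<tau> \<and> lam * q + \<tau> \<le> e \<and>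
      scaled \<Gamma> M (\<lambda>x. lam * x + \<tau>) c p q)"
  shows "\<exists>s>0. piecewise \<Gamma> 0 e (\<lambda>p q. \<exists>b\<in>A. \<forall>x\<in>\<Gamma>. \<forall>y\<in>\<Gamma>. p \<le> x \<longrightarrow> x \<le> y \<longrightarrow> y \<le> q \<longrightarrow>
           M y - M x = s * b * (y - x))"
proof -
  obtain k where k: "0 < k" "k \<in> A" and fin: "finite {y \<in> \<Gamma>. 0 \<le> y \<and> y < e \<and> jump y \<noteq> k}"
    using jump_constant_off_finite by blast
  define D where "D = {y \<in> \<Gamma>. 0 < y \<and> y < e \<and> jump y \<noteq> k}"
  have D: "finite D" "D \<subseteq> \<Gamma>" "\<And>d. d \<in> D \<Longrightarrow> 0 < d"
    by (rule finite_subset[OF _ fin]) (auto simp: D_def)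
  define \<beta> where "\<beta> y = (\<Prod>d\<in>{d\<in>D. d \<le> y}. k / jump d)" for y
  define \<beta>' where "\<beta>' y = (\<Prod>d\<in>{d\<in>D. d < y}. k / jump d)" for y
  \<comment> \<open>With \<open>\<beta>' d\<close> and \<open>\<beta> d\<close> the values of the step function before and after \<open>d\<close>, this \<open>N\<close> is the
    integral of \<open>\<beta>\<close> with respect to \<open>M\<close>.\<close>
  define N where "N y = M y + (\<Sum>d\<in>{d\<in>D. d \<le> y}. (\<beta> d - \<beta>' d) * (M y - M d))" for y
  have \<beta>A: "\<beta> y \<in> A" "\<beta>' y \<in> A" for y
    unfolding \<beta>_def \<beta>'_def using D(2) jump_in(1) slopesD(5) k(2) by (auto intro!: mult_group_prod[OF slopes])
  have \<beta>pos: "0 < \<beta> y" "0 < \<beta>' y" for y using \<beta>A slopesD(2) by blast+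
  have \<beta>_gap: "\<beta>' q = \<beta> p" if "{p<..<q} \<inter> D = {}" "p < q" for p q
  proof -
    have "{d\<in>D. d < q} = {d\<in>D. d \<le> p}" using that by force
    then show ?thesis by (simp add: \<beta>_def \<beta>'_def)
  qed
  \<comment> \<open>The jump of \<open>\<beta>\<close> at \<open>y\<close> compensates the deviation of \<open>jump y\<close> from \<open>k\<close>.\<close>
  have cancel: "jump y * \<beta> y = k * \<beta>' y" if y: "y \<in> \<Gamma>" "0 < y" "y < e" for y
  proof (cases "y \<in> D")
    case True
    have "{d\<in>D. d \<le> y} = insert y {d\<in>D. d < y}" using True by auto
    then have "\<beta> y = k / jump y * \<beta>' y" using D(1) by (simp add: \<beta>_def \<beta>'_def)
    then show ?thesis using jump_in(2)[OF y(1)] by simp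
  next
    case False
    then have "{d\<in>D. d \<le> y} = {d\<in>D. d < y}" by (auto simp: order_le_less)
    then show ?thesis using False y by (simp add: \<beta>_def \<beta>'_def D_def)
  qed
  have N_diff: "N y - N x = \<beta> p * (M y - M x)"
    if D': "{p<..<q} \<inter> D = {}" and xy: "p \<le> x" "x \<le> y" "y \<le> q" for p q x y
  proof -
    have N_eq: "N z = M z + (\<Sum>d\<in>{d\<in>D. d \<le> p}. (\<beta> d - \<beta>' d) * (M z - M d))" if z: "p \<le> z" "z \<le> q" for z
    proof -
      have "{d\<in>D. d \<le> p} \<subseteq> {d\<in>D. d \<le> z}" using z by auto
      moreover have "d = z" if "d \<in> {d\<in>D. d \<le> z} - {d\<in>D. d \<le> p}" for d
      proof (rule ccontr)
        assume "d \<noteq> z"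
        then have "d \<in> {p<..<q} \<inter> D" using that z by auto
        then show False using D' by blast
      qed
      ultimately have "(\<Sum>d\<in>{d\<in>D. d \<le> z}. (\<beta> d - \<beta>' d) * (M z - M d)) = (\<Sum>d\<in>{d\<in>D. d \<le> p}. (\<beta> d - \<beta>' d) * (M z - M d))"
        using D(1) by (intro sum.mono_neutral_right) auto
      then show ?thesis by (simp add: N_def)
    qed
    have "1 + (\<Sum>d\<in>{d\<in>D. d \<le> p}. \<beta> d - \<beta>' d) = \<beta> p"
    proof -
      let ?E = "{d\<in>D. d \<le> p}"
      have "(\<Sum>d\<in>?E. \<beta> d - \<beta>' d) = (\<Sum>d\<in>?E. (\<Prod>d'\<in>{d'\<in>?E. d' \<le> d}. k / jump d') - (\<Prod>d'\<in>{d'\<in>?E. d' < d}. k / jump d'))"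
      proof (rule sum.cong[OF refl])
        fix d assume "d \<in> ?E"
        then have "{d'\<in>?E. d' \<le> d} = {d'\<in>D. d' \<le> d}" "{d'\<in>?E. d' < d} = {d'\<in>D. d' < d}" by auto
        then show "\<beta> d - \<beta>' d = (\<Prod>d'\<in>{d'\<in>?E. d' \<le> d}. k / jump d') - (\<Prod>d'\<in>{d'\<in>?E. d' < d}. k / jump d')"
          by (simp only: \<beta>_def \<beta>'_def)
      qed
      then show ?thesis using step_product_telescope[of ?E "\<lambda>d. k / jump d"] D(1) by (simp add: \<beta>_def)
    qed
    moreover have "N y - N x = (1 + (\<Sum>d\<in>{d\<in>D. d \<le> p}. \<beta> d - \<beta>' d)) * (M y - M x)"
    proof -
      have "(\<Sum>d\<in>{d\<in>D. d \<le> p}. (\<beta> d - \<beta>' d) * (M z - M d)) =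
          (\<Sum>d\<in>{d\<in>D. d \<le> p}. \<beta> d - \<beta>' d) * M z - (\<Sum>d\<in>{d\<in>D. d \<le> p}. (\<beta> d - \<beta>' d) * M d)" for z
        by (simp add: right_diff_distrib left_diff_distrib sum_subtractf sum_distrib_right)
      then show ?thesis using N_eq[of x] N_eq[of y] xy by (simp add: left_diff_distrib distrib_right right_diff_distrib)
    qed
    ultimately show ?thesis by simp
  qed
  have avoid: "piecewise \<Gamma> u v (\<lambda>p q. {p<..<q} \<inter> D = {})" for u v
    by (rule piecewiseI[OF D(1,2)])
  have avoid_image: "piecewise \<Gamma> u v (\<lambda>p q. {lam * p + t<..<lam * q + t} \<inter> D = {})"
    if lam: "0 < lam" "\<And>x. x \<in> \<Gamma> \<Longrightarrow> x / lam \<in> \<Gamma>" and t: "t \<in> \<Gamma>" for u v lam t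
  proof (rule piecewiseI[of "(\<lambda>d. (d - t) / lam) ` D"])
    show "(\<lambda>d. (d - t) / lam) ` D \<subseteq> \<Gamma>" using D(2) lam(2) grpD(4) t by blast
    fix p q assume a: "{p<..<q} \<inter> (\<lambda>d. (d - t) / lam) ` D = {}"
    show "{lam * p + t<..<lam * q + t} \<inter> D = {}"
    proof (rule ccontr)
      assume "\<not> ?thesis"
      then obtain d where "d \<in> D" "lam * p + t < d" "d < lam * q + t" by auto
      then have "(d - t) / lam \<in> {p<..<q} \<inter> (\<lambda>d. (d - t) / lam) ` D"
        using lam(1) by (auto simp: field_simps)
      then show False using a by blast
    qed
  qed (use D in auto)
  have N_mono: "N x < N y" if xy: "x \<in> \<Gamma>" "y \<in> \<Gamma>" "x < y" for x y
    using avoid[of x y]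
  proof (rule piecewise_glue[where R = "\<lambda>x y. N x < N y"])
    fix p q assume pq: "p \<in> \<Gamma>" "q \<in> \<Gamma>" "p < q" "{p<..<q} \<inter> D = {}"
    have "0 < \<beta> p * (M q - M p)" using \<beta>pos[of p] mono[OF pq(1-3)] by simp
    then show "N p < N q" using N_diff[OF pq(4), of p q] pq(3) by simp
  qed (use xy in auto)
  define h where "h t = right_ratio t * \<beta> t / (right_ratio 0 * \<beta> 0)" for t
  have uniform: "scaled \<Gamma> N (\<lambda>x. x + t) (h t) 0 (e - t)" if t: "t \<in> \<Gamma>" "0 < t" "t < e" for t
  proof -
    \<comment> \<open>The factors by which the translation scales \<open>N\<close> to the right and to the left of a point. They
      agree at every breakpoint, since by \<open>cancel\<close> both jumps there equal \<open>k\<close>.\<close>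
    define rr where "rr p = (right_ratio (p + t) * \<beta> (p + t)) / (right_ratio p * \<beta> p)" for p
    define lr where "lr p = (left_ratio (p + t) * \<beta>' (p + t)) / (left_ratio p * \<beta>' p)" for p
    define R where "R p q \<longleftrightarrow> scaled \<Gamma> N (\<lambda>x. x + t) (rr p) p q \<and> rr p = lr q" for p q
    have et: "e - t \<in> \<Gamma>" using grpD(4) e t by blast
    have "piecewise \<Gamma> 0 (e - t) (\<lambda>p q. (\<exists>c\<in>A. scaled \<Gamma> M (\<lambda>x. x + t) c p q) \<and>
        {p<..<q} \<inter> D = {} \<and> {1 * p + t<..<1 * q + t} \<inter> D = {})"
      by (intro piecewise_conj translation avoid avoid_image) (use t et grpD(1) in auto)
    then have "R 0 (e - t)"
    proof (rule piecewise_glue)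
      fix p q assume pq: "p \<in> \<Gamma>" "q \<in> \<Gamma>" "p < q"
        "(\<exists>c\<in>A. scaled \<Gamma> M (\<lambda>x. x + t) c p q) \<and> {p<..<q} \<inter> D = {} \<and> {1 * p + t<..<1 * q + t} \<inter> D = {}"
      then obtain c where c: "c \<in> A" "scaled \<Gamma> M (\<lambda>x. x + t) c p q" by blast
      have gaps: "{p<..<q} \<inter> D = {}" "{p + t<..<q + t} \<inter> D = {}" using pq(4) by auto
      have r: "right_ratio (p + t) = c * right_ratio p" "left_ratio (q + t) = c * left_ratio q"
        using right_ratio_translate[OF c(2) t(1) pq(1)] left_ratio_translate[OF c(2) t(1) pq(2)] pq(3) by auto
      have pos: "0 < right_ratio p" "0 < left_ratio q" using ratio_pos pq by auto
      have "rr p = c * (\<beta> (p + t) / \<beta> p)" using r pos by (simp add: rr_def)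
      moreover have "lr q = c * (\<beta>' (q + t) / \<beta>' q)" using r pos by (simp add: lr_def)
      moreover have "\<beta>' (q + t) = \<beta> (p + t)" "\<beta>' q = \<beta> p" using \<beta>_gap gaps pq(3) by auto
      moreover have "scaled \<Gamma> N (\<lambda>x. x + t) (c * (\<beta> (p + t) / \<beta> p)) p q"
      proof (rule scaledI)
        fix x y assume xy: "x \<in> \<Gamma>" "y \<in> \<Gamma>" "p \<le> x" "x \<le> y" "y \<le> q"
        have "N (y + t) - N (x + t) = \<beta> (p + t) * (M (y + t) - M (x + t))"
          by (rule N_diff[OF gaps(2)]) (use xy in auto)
        also have "M (y + t) - M (x + t) = c * (M y - M x)" by (rule scaledD[OF c(2)]) (use xy in auto)
        also have "M y - M x = (N y - N x) / \<beta> p" using N_diff[OF gaps(1), of x y] xy \<beta>pos[of p] by simp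
        finally show "N (y + t) - N (x + t) = c * (\<beta> (p + t) / \<beta> p) * (N y - N x)" by simp
      qed
      ultimately show "R p q" by (simp add: R_def)
    next
      fix p z q assume pzq: "p \<in> \<Gamma>" "z \<in> \<Gamma>" "q \<in> \<Gamma>" "0 \<le> p" "p < z" "z < q" "q \<le> e - t" and R: "R p z" "R z q"
      have zt: "z + t \<in> \<Gamma>" "0 < z" "z < e" "0 < z + t" "z + t < e" using pzq t grpD(3) by auto
      have rl: "right_ratio y = jump y * left_ratio y" if "y \<in> \<Gamma>" for y
        using ratio_pos[OF that] by (simp add: jump_def)
      have r: "right_ratio y * \<beta> y = k * (left_ratio y * \<beta>' y)" if "y \<in> \<Gamma>" "0 < y" "y < e" for y
      proof -
        have "right_ratio y * \<beta> y = (jump y * \<beta> y) * left_ratio y" using rl[OF that(1)] by simp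
        then show ?thesis using cancel[OF that] by simp
      qed
      have "rr z = lr z"
        using r[of z] r[of "z + t"] zt pzq(2) k(1) by (simp add: rr_def lr_def)
      then have eq: "rr p = rr z" using R by (simp add: R_def)
      have "scaled \<Gamma> N (\<lambda>x. x + t) (rr p) p q"
        by (rule scaled_concat[of _ _ _ _ _ z]) (use R pzq eq in \<open>auto simp: R_def\<close>)
      then show "R p q" using R eq by (simp add: R_def)
    qed (use et t grpD(1) in auto)
    then have "scaled \<Gamma> N (\<lambda>x. x + t) (rr 0) 0 (e - t)" unfolding R_def by blast
    moreover have "rr 0 = h t" by (simp add: rr_def h_def)
    ultimately show ?thesis by (simp only:)
  qed
  have hA: "h t \<in> A" if "t \<in> \<Gamma>" for t
    unfolding h_def using right_ratio(1) \<beta>A slopesD(4,5) that grpD(1) by simp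
  interpret uniform_scaling \<Gamma> e N h
    by unfold_locales (use grp dense e N_mono uniform in auto)
  have "\<exists>\<delta>>0. \<forall>t\<in>\<Gamma>. 0 < t \<longrightarrow> t < \<delta> \<longrightarrow> h t = 1"
    using cond
  proof (elim disjE exE conjE)
    assume "\<forall>a\<in>A. a = 1"
    then show ?thesis using hA by (intro exI[of _ 1]) auto
  next
    fix lam \<tau> c p q
    assume lam: "0 < lam" "lam < 1" "\<forall>x. lam * x \<in> \<Gamma> \<longleftrightarrow> x \<in> \<Gamma>" and \<tau>: "\<tau> \<in> \<Gamma>" "0 < c"
      and pq: "p \<in> \<Gamma>" "q \<in> \<Gamma>" "0 \<le> p" "p < q" "q \<le> e" "0 \<le> lam * p + \<tau>" "lam * q + \<tau> \<le> e"
      and sc: "scaled \<Gamma> M (\<lambda>x. lam * x + \<tau>) c p q"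
    \<comment> \<open>On a subinterval that neither contains an exceptional point nor maps onto one, \<open>N\<close> is
      scaled as well.\<close>
    have div: "x / lam \<in> \<Gamma>" if "x \<in> \<Gamma>" for x using lam(3)[rule_format, of "x / lam"] lam(1) that by simp
    have "\<exists>q'\<in>\<Gamma>. p < q' \<and> q' < q \<and> ({p<..<q'} \<inter> D = {} \<and> {lam * p + \<tau><..<lam * q' + \<tau>} \<inter> D = {})"
      by (rule piecewise_right_end[OF piecewise_conj[OF avoid avoid_image]])
         (use lam \<tau> pq dense div in auto)
    then obtain q' where q': "q' \<in> \<Gamma>" "p < q'" "q' < q" "{p<..<q'} \<inter> D = {}"
      "{lam * p + \<tau><..<lam * q' + \<tau>} \<inter> D = {}" by blast
    define c' where "c' = c * (\<beta> (lam * p + \<tau>) / \<beta> p)"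
    have "scaled \<Gamma> N (\<lambda>x. lam * x + \<tau>) c' p q'"
    proof (rule scaledI)
      fix x y assume xy: "x \<in> \<Gamma>" "y \<in> \<Gamma>" "p \<le> x" "x \<le> y" "y \<le> q'"
      have "N (lam * y + \<tau>) - N (lam * x + \<tau>) = \<beta> (lam * p + \<tau>) * (M (lam * y + \<tau>) - M (lam * x + \<tau>))"
        by (rule N_diff[OF q'(5)]) (use xy lam in auto)
      also have "M (lam * y + \<tau>) - M (lam * x + \<tau>) = c * (M y - M x)"
        by (rule scaledD[OF sc]) (use xy q' in auto)
      also have "M y - M x = (N y - N x) / \<beta> p" using N_diff[OF q'(4), of x y] xy \<beta>pos[of p] by simp
      finally show "N (lam * y + \<tau>) - N (lam * x + \<tau>) = c' * (N y - N x)" by (simp add: c'_def)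
    qed
    moreover have "0 < c'" using \<tau> \<beta>pos by (simp add: c'_def)
    moreover have "lam * q' + \<tau> \<le> e" using pq(7) mult_left_mono[of q' q lam] q'(3) lam(1) by linarith
    ultimately show ?thesis
      using h_trivial_of_contraction[of lam \<tau> c' p q'] lam \<tau> pq q' by auto
  qed
  then obtain s where s: "0 < s" "\<And>x. x \<in> \<Gamma> \<Longrightarrow> 0 \<le> x \<Longrightarrow> x \<le> e \<Longrightarrow> N x - N 0 = s * x"
    using linear_of_h_trivial by blast
  have "piecewise \<Gamma> 0 e (\<lambda>p q. \<exists>b\<in>A. \<forall>x\<in>\<Gamma>. \<forall>y\<in>\<Gamma>. p \<le> x \<longrightarrow> x \<le> y \<longrightarrow> y \<le> q \<longrightarrow>
      M y - M x = s * b * (y - x))"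
    using avoid[of 0 e]
  proof (rule piecewise_mono)
    fix p q assume pq: "p \<in> \<Gamma>" "q \<in> \<Gamma>" "0 \<le> p" "p < q" "q \<le> e" "{p<..<q} \<inter> D = {}"
    have "M y - M x = s * (1 / \<beta> p) * (y - x)" if xy: "x \<in> \<Gamma>" "y \<in> \<Gamma>" "p \<le> x" "x \<le> y" "y \<le> q" for x y
    proof -
      have "\<beta> p * (M y - M x) = (N y - N 0) - (N x - N 0)" using N_diff[OF pq(6), of x y] xy by simp
      also have "\<dots> = s * (y - x)" using s(2)[of x] s(2)[of y] xy pq by (simp add: right_diff_distrib)
      finally show ?thesis using \<beta>pos[of p] by (simp add: field_simps)
    qed
    then show "\<exists>b\<in>A. \<forall>x\<in>\<Gamma>. \<forall>y\<in>\<Gamma>. p \<le> x \<longrightarrow> x \<le> y \<longrightarrow> y \<le> q \<longrightarrow> M y - M x = s * b * (y - x)"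
      using slopesD(6)[OF \<beta>A(1)] by blast
  qed
  then show ?thesis using s(1) by blast
qed

end

section \<open>Coinvariants\<close>

lemma group_module_group:
  assumes "add_group \<Gamma>"
  shows "group (module_group \<Gamma>)"
  by (rule groupI)
     (use add_groupD[OF assms] in \<open>auto simp: real_additive_def intro!: bexI[of _ "- x" for x]\<close>)

lemma inv_module_group:
  assumes "add_group \<Gamma>" "x \<in> \<Gamma>"
  shows "inv\<^bsub>module_group \<Gamma>\<^esub> x = - x"
  by (rule group.inv_equality[OF group_module_group[OF assms(1)]])
     (use add_groupD[OF assms(1)] assms(2) in \<open>auto simp: real_additive_def\<close>)

context stein
begin

abbreviation "I\<Gamma> \<equiv> coinvariant_relations \<Lambda> \<Gamma>"

lemma generators_subset: "{t - a * t |t a. t \<in> \<Gamma> \<and> a \<in> \<Lambda>} \<subseteq> carrier (module_group \<Gamma>)"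
  using add(4) stable by auto

lemma subgroup_coinvariant_relations: "subgroup I\<Gamma> (module_group \<Gamma>)"
  unfolding coinvariant_relations_def
  by (rule group.generate_is_subgroup[OF group_module_group[OF add_group] generators_subset])

lemma coinvariant_relations_subset: "I\<Gamma> \<subseteq> \<Gamma>"
  using subgroup.subset[OF subgroup_coinvariant_relations] by simp

lemma add_group_coinvariant_relations: "add_group I\<Gamma>"
  unfolding add_group_def
proof (intro conjI ballI)
  note sub = subgroup_coinvariant_relations
  show "0 \<in> I\<Gamma>" using subgroup.one_closed[OF sub] by (simp add: real_additive_def)
  fix x assume x: "x \<in> I\<Gamma>"
  then show "- x \<in> I\<Gamma>"
    using subgroup.m_inv_closed[OF sub x] inv_module_group[OF add_group] coinvariant_relations_subset by auto
  fix y assume "y \<in> I\<Gamma>"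
  then show "x + y \<in> I\<Gamma>" using subgroup.m_closed[OF sub x] by (simp add: real_additive_def)
qed

lemma coinvariant_relationsI: "t \<in> \<Gamma> \<Longrightarrow> a \<in> \<Lambda> \<Longrightarrow> t - a * t \<in> I\<Gamma>"
  unfolding coinvariant_relations_def by (rule generate.incl) blast

lemma H0_class_eq_one_iff:
  assumes "t \<in> \<Gamma>"
  shows "H0_class \<Lambda> \<Gamma> t = \<one>\<^bsub>H0 \<Lambda> \<Gamma>\<^esub> \<longleftrightarrow> t \<in> I\<Gamma>"
proof -
  interpret group "module_group \<Gamma>" by (rule group_module_group[OF add_group])
  have "I\<Gamma> #>\<^bsub>module_group \<Gamma>\<^esub> t = I\<Gamma> \<longleftrightarrow> t \<in> I\<Gamma>"
    using coset_join1[OF _ _ subgroup_coinvariant_relations, of t] coset_join2[OF _ subgroup_coinvariant_relations, of t]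
      assms subgroup.subset[OF subgroup_coinvariant_relations] by auto
  then show ?thesis by (simp add: H0_class_def H0_def FactGroup_def)
qed

end

section \<open>Recovering \<open>\<Lambda>\<close>, \<open>\<Gamma>\<close> and the length\<close>

lemma piecewise_piecewise:
  assumes "piecewise \<Gamma> u v (\<lambda>p q. piecewise \<Gamma> p q Q)" "u \<in> \<Gamma>" "v \<in> \<Gamma>" "u < v"
  shows "piecewise \<Gamma> u v Q"
  using assms(1)
proof (rule piecewise_glue[where R = "\<lambda>p q. piecewise \<Gamma> p q Q"])
  fix p c q assume "c \<in> \<Gamma>" "piecewise \<Gamma> p c Q" "piecewise \<Gamma> c q Q"
  then show "piecewise \<Gamma> p q Q" using piecewise_concat by blast
qed (use assms(2-) in simp_all)

lemma piecewise_avoid_multiples: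
  assumes "add_group \<Gamma>" "e \<in> \<Gamma>" "0 < e" "s \<in> \<Gamma>"
  shows "piecewise \<Gamma> u v (\<lambda>p q. \<forall>j::int. of_int j * e + s \<notin> {p<..<q})"
proof (rule piecewiseI[of "(\<lambda>j. of_int j * e + s) ` {\<lfloor>(u - s) / e\<rfloor>..\<lceil>(v - s) / e\<rceil>}"])
  let ?D = "(\<lambda>j. of_int j * e + s) ` {\<lfloor>(u - s) / e\<rfloor>..\<lceil>(v - s) / e\<rceil>}"
  fix p q assume pq: "u \<le> p" "q \<le> v" "{p<..<q} \<inter> ?D = {}"
  show "\<forall>j::int. of_int j * e + s \<notin> {p<..<q}"
  proof (intro allI notI)
    fix j :: int assume j: "of_int j * e + s \<in> {p<..<q}"
    then have "u - s < of_int j * e" "of_int j * e < v - s" using pq by auto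
    then have "(u - s) / e < of_int j" "of_int j < (v - s) / e"
      using assms(3) by (simp_all add: pos_divide_less_eq pos_less_divide_eq)
    then have "j \<in> {\<lfloor>(u - s) / e\<rfloor>..\<lceil>(v - s) / e\<rceil>}" by auto linarith+
    then show False using j pq(3) by blast
  qed
qed (use add_groupD(3,6)[OF assms(1)] assms in auto)

text \<open>
  What is left of an isomorphism in either setting: a distribution function \<open>m\<close> on \<open>[0, l\<^sub>2]\<close>
  whose values generate \<open>\<Gamma>\<^sub>1\<close> and for which affine maps with slopes in \<open>\<Lambda>\<^sub>2\<close> are piecewise scalings
  with factors in \<open>\<Lambda>\<^sub>1\<close>. Only short intervals disjoint from their images are considered, because
  for these the affine map extends to an element of the commutator subgroup.
\<close>

locale scaling_model = S1: stein \<Gamma>\<^sub>1 \<Lambda>\<^sub>1 l\<^sub>1 + S2: stein \<Gamma>\<^sub>2 \<Lambda>\<^sub>2 l\<^sub>2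
  for \<Gamma>\<^sub>1 \<Lambda>\<^sub>1 :: "real set" and l\<^sub>1 :: real and \<Gamma>\<^sub>2 \<Lambda>\<^sub>2 :: "real set" and l\<^sub>2 :: real +
  fixes m :: "real \<Rightarrow> real"
  assumes rank: "\<exists>t\<in>\<Gamma>\<^sub>2. \<forall>n k :: int. of_int n * t = of_int k * l\<^sub>2 \<longrightarrow> n = 0"
    and m_ends: "m 0 = 0" "m l\<^sub>2 = l\<^sub>1"
    and m_mono: "\<And>x y. x \<in> \<Gamma>\<^sub>2 \<Longrightarrow> y \<in> \<Gamma>\<^sub>2 \<Longrightarrow> 0 \<le> x \<Longrightarrow> x < y \<Longrightarrow> y \<le> l\<^sub>2 \<Longrightarrow> m x < m y"
    and m_in: "\<And>x. x \<in> \<Gamma>\<^sub>2 \<Longrightarrow> 0 \<le> x \<Longrightarrow> x \<le> l\<^sub>2 \<Longrightarrow> m x \<in> \<Gamma>\<^sub>1"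
    and m_generates: "\<And>H. add_group H \<Longrightarrow> (\<And>x. x \<in> \<Gamma>\<^sub>2 \<Longrightarrow> 0 \<le> x \<Longrightarrow> x \<le> l\<^sub>2 \<Longrightarrow> m x \<in> H) \<Longrightarrow> \<Gamma>\<^sub>1 \<subseteq> H"
    and m_scaled: "\<And>a. a \<in> \<Lambda>\<^sub>2 \<Longrightarrow> \<exists>\<epsilon>>0. \<forall>p\<in>\<Gamma>\<^sub>2. \<forall>q\<in>\<Gamma>\<^sub>2. \<forall>p'\<in>\<Gamma>\<^sub>2.
       0 \<le> p \<longrightarrow> p < q \<longrightarrow> q \<le> l\<^sub>2 \<longrightarrow> 0 \<le> p' \<longrightarrow> p' + a * (q - p) \<le> l\<^sub>2 \<longrightarrow> q - p < \<epsilon> \<longrightarrow>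
       q \<le> p' \<or> p' + a * (q - p) \<le> p \<longrightarrow>
       piecewise \<Gamma>\<^sub>2 p q (\<lambda>r s. \<exists>c\<in>\<Lambda>\<^sub>1. scaled \<Gamma>\<^sub>2 m (\<lambda>x. a * x + (p' - a * p)) c r s)"
begin

text \<open>
  The extension of \<open>m\<close> to the line that satisfies \<open>M (x + l\<^sub>2) = M x + l\<^sub>1\<close>.
\<close>

definition M :: "real \<Rightarrow> real" where
  "M x = m (wrap l\<^sub>2 x) + of_int \<lfloor>x / l\<^sub>2\<rfloor> * l\<^sub>1"

lemma M_eq:
  assumes "of_int k * l\<^sub>2 \<le> x" "x \<le> of_int (k + 1) * l\<^sub>2"
  shows "M x = m (x - of_int k * l\<^sub>2) + of_int k * l\<^sub>1"
proof (cases "x = of_int (k + 1) * l\<^sub>2")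
  case True
  then have "x / l\<^sub>2 = of_int (k + 1)" using S2.l_pos by simp
  then have "\<lfloor>x / l\<^sub>2\<rfloor> = k + 1" by simp
  then show ?thesis using True m_ends by (simp add: M_def wrap_def algebra_simps)
next
  case False
  then have "of_int k \<le> x / l\<^sub>2" "x / l\<^sub>2 < of_int k + 1"
    using assms S2.l_pos by (auto simp: pos_le_divide_eq pos_divide_less_eq)
  then have "\<lfloor>x / l\<^sub>2\<rfloor> = k" by (simp add: floor_eq_iff)
  then show ?thesis by (simp add: M_def wrap_def)
qed

lemma M_eq_m: "0 \<le> x \<Longrightarrow> x \<le> l\<^sub>2 \<Longrightarrow> M x = m x"
  using M_eq[of 0 x] by simp

lemma M_shift: "M (x + of_int k * l\<^sub>2) = M x + of_int k * l\<^sub>1"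
proof -
  have "(x + of_int k * l\<^sub>2) / l\<^sub>2 = x / l\<^sub>2 + of_int k" using S2.l_pos by (simp add: add_divide_distrib)
  then have "\<lfloor>(x + of_int k * l\<^sub>2) / l\<^sub>2\<rfloor> = \<lfloor>x / l\<^sub>2\<rfloor> + k" by simp
  then show ?thesis unfolding M_def wrap_shift[OF S2.l_pos] by (simp add: algebra_simps)
qed

lemma wrap_in: "x \<in> \<Gamma>\<^sub>2 \<Longrightarrow> wrap l\<^sub>2 x \<in> \<Gamma>\<^sub>2"
  unfolding wrap_def by (intro S2.add(4) S2.add(6) S2.l_in)

lemma M_mono:
  assumes "x \<in> \<Gamma>\<^sub>2" "y \<in> \<Gamma>\<^sub>2" "x < y"
  shows "M x < M y"
proof -
  note wb = wrap_bounds[OF S2.l_pos]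
  have bd: "0 \<le> m (wrap l\<^sub>2 z)" "m (wrap l\<^sub>2 z) < l\<^sub>1" if "z \<in> \<Gamma>\<^sub>2" for z
    using m_mono[of 0 "wrap l\<^sub>2 z"] m_mono[of "wrap l\<^sub>2 z" l\<^sub>2] m_ends wb[of z] wrap_in[OF that] S2.add(1) S2.l_in
    by (cases "wrap l\<^sub>2 z = 0"; simp)+
  have "x / l\<^sub>2 \<le> y / l\<^sub>2" using assms(3) S2.l_pos by (simp add: divide_right_mono)
  then have "\<lfloor>x / l\<^sub>2\<rfloor> \<le> \<lfloor>y / l\<^sub>2\<rfloor>" by (rule floor_mono)
  then consider "\<lfloor>x / l\<^sub>2\<rfloor> = \<lfloor>y / l\<^sub>2\<rfloor>" | "\<lfloor>x / l\<^sub>2\<rfloor> + 1 \<le> \<lfloor>y / l\<^sub>2\<rfloor>" by linarith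
  then show ?thesis
  proof cases
    case 1
    then have "wrap l\<^sub>2 x < wrap l\<^sub>2 y" using assms(3) by (simp add: wrap_def)
    then have "m (wrap l\<^sub>2 x) < m (wrap l\<^sub>2 y)"
      by (rule m_mono[OF wrap_in[OF assms(1)] wrap_in[OF assms(2)] wb(1)]) (use wb(2) in \<open>simp add: less_imp_le\<close>)
    then show ?thesis using 1 by (simp add: M_def)
  next
    case 2
    then have "(of_int \<lfloor>x / l\<^sub>2\<rfloor> + 1) * l\<^sub>1 \<le> of_int \<lfloor>y / l\<^sub>2\<rfloor> * l\<^sub>1"
      using S1.l_pos by (intro mult_right_mono) linarith+
    then show ?thesis using bd(2)[OF assms(1)] bd(1)[OF assms(2)] by (simp add: M_def distrib_right)
  qed
qed

text \<open>
  Cut at the points of \<open>l\<^sub>2 * \<int>\<close>, at those that the translation sends there, and at the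
  multiples of a small \<open>g\<close>. On each piece the translation is, modulo the periods, an affine map
  of slope \<open>1\<close> between short disjoint intervals, as in \<open>m_scaled\<close>.
\<close>

lemma M_translation:
  assumes t: "t \<in> \<Gamma>\<^sub>2" and uv: "u \<in> \<Gamma>\<^sub>2" "v \<in> \<Gamma>\<^sub>2"
  shows "piecewise \<Gamma>\<^sub>2 u v (\<lambda>p q. \<exists>c\<in>\<Lambda>\<^sub>1. scaled \<Gamma>\<^sub>2 M (\<lambda>x. x + t) c p q)"
proof (cases "u < v")
  case False
  then show ?thesis by (intro piecewise_trivial) auto
next
  case uv': True
  define t' where "t' = wrap l\<^sub>2 t"
  have t': "t' \<in> \<Gamma>\<^sub>2" "0 \<le> t'" "t' < l\<^sub>2" using wrap_in[OF t] wrap_bounds[OF S2.l_pos] by (auto simp: t'_def)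
  have Mt: "M (x + t) = M (x + t') + of_int \<lfloor>t / l\<^sub>2\<rfloor> * l\<^sub>1" for x
    using M_shift[of "x + t'" "\<lfloor>t / l\<^sub>2\<rfloor>"] by (simp add: t'_def wrap_def algebra_simps)
  have "piecewise \<Gamma>\<^sub>2 u v (\<lambda>p q. \<exists>c\<in>\<Lambda>\<^sub>1. scaled \<Gamma>\<^sub>2 M (\<lambda>x. x + t') c p q)"
  proof (cases "t' = 0")
    case True
    show ?thesis
      by (rule piecewise_trivial) (use True S1.mul(1) in \<open>auto simp: scaled_def\<close>)
  next
    case False
    obtain \<epsilon> where \<epsilon>: "0 < \<epsilon>" and sc: "\<And>p q p'. \<lbrakk>p \<in> \<Gamma>\<^sub>2; q \<in> \<Gamma>\<^sub>2; p' \<in> \<Gamma>\<^sub>2; 0 \<le> p; p < q; q \<le> l\<^sub>2; 0 \<le> p';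
        p' + (q - p) \<le> l\<^sub>2; q - p < \<epsilon>; q \<le> p' \<or> p' + (q - p) \<le> p\<rbrakk> \<Longrightarrow>
        piecewise \<Gamma>\<^sub>2 p q (\<lambda>r s. \<exists>c\<in>\<Lambda>\<^sub>1. scaled \<Gamma>\<^sub>2 m (\<lambda>x. x + (p' - p)) c r s)"
      using m_scaled[OF S2.mul(1)] by auto
    have "0 < min \<epsilon> (min t' (l\<^sub>2 - t'))" using \<epsilon> t' False by auto
    then obtain g where g: "g \<in> \<Gamma>\<^sub>2" "0 < g" "g < min \<epsilon> (min t' (l\<^sub>2 - t'))" using S2.between by blast
    have "piecewise \<Gamma>\<^sub>2 u v (\<lambda>p q. (\<forall>j::int. of_int j * g + 0 \<notin> {p<..<q}) \<and>
        (\<forall>j::int. of_int j * l\<^sub>2 + 0 \<notin> {p<..<q}) \<and> (\<forall>j::int. of_int j * l\<^sub>2 + (- t') \<notin> {p<..<q}))"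
      using S2.add_group S2.add(1) S2.add(2)[OF t'(1)] S2.l_in S2.l_pos g
      by (intro piecewise_conj piecewise_avoid_multiples)
    then have "piecewise \<Gamma>\<^sub>2 u v (\<lambda>p q. piecewise \<Gamma>\<^sub>2 p q (\<lambda>p q. \<exists>c\<in>\<Lambda>\<^sub>1. scaled \<Gamma>\<^sub>2 M (\<lambda>x. x + t') c p q))"
    proof (rule piecewise_mono, elim conjE)
      fix p q assume pq: "p \<in> \<Gamma>\<^sub>2" "q \<in> \<Gamma>\<^sub>2" "p < q"
        and gap: "\<forall>j::int. of_int j * g + 0 \<notin> {p<..<q}" "\<forall>j::int. of_int j * l\<^sub>2 + 0 \<notin> {p<..<q}"
          "\<forall>j::int. of_int j * l\<^sub>2 + (- t') \<notin> {p<..<q}"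
      have cell: "\<exists>k::int. of_int k * e \<le> p + s \<and> q + s \<le> of_int (k + 1) * e"
        if "0 < e" "\<forall>j::int. of_int j * e + (- s) \<notin> {p<..<q}" for e s
      proof (intro exI conjI)
        have "of_int \<lfloor>(p + s) / e\<rfloor> \<le> (p + s) / e" "(p + s) / e < of_int (\<lfloor>(p + s) / e\<rfloor> + 1)" by linarith+
        then have 1: "of_int \<lfloor>(p + s) / e\<rfloor> * e \<le> p + s" "p + s < of_int (\<lfloor>(p + s) / e\<rfloor> + 1) * e"
          using that(1) by (simp_all only: pos_le_divide_eq pos_divide_less_eq)
        then show "of_int \<lfloor>(p + s) / e\<rfloor> * e \<le> p + s" by simp
        show "q + s \<le> of_int (\<lfloor>(p + s) / e\<rfloor> + 1) * e"
          using that(2)[rule_format, of "\<lfloor>(p + s) / e\<rfloor> + 1"] 1(2) pq by auto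
      qed
      have "q - p \<le> g" using cell[of g 0] g(2) gap(1) by (auto simp: distrib_right)
      then have small: "q - p < \<epsilon>" "q - p < t'" "q - p < l\<^sub>2 - t'" using g(3) by auto
      obtain k where k: "of_int k * l\<^sub>2 \<le> p" "q \<le> of_int (k + 1) * l\<^sub>2"
        using cell[of l\<^sub>2 0] gap(2) S2.l_pos by auto
      obtain k' where k': "of_int k' * l\<^sub>2 \<le> p + t'" "q + t' \<le> of_int (k' + 1) * l\<^sub>2"
        using cell[of l\<^sub>2 t'] gap(3) S2.l_pos by auto
      define P where "P = p - of_int k * l\<^sub>2"
      define P' where "P' = p + t' - of_int k' * l\<^sub>2"
      define Q where "Q = q - of_int k * l\<^sub>2"
      have in_\<Gamma>: "P \<in> \<Gamma>\<^sub>2" "P' \<in> \<Gamma>\<^sub>2" "Q \<in> \<Gamma>\<^sub>2"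
        unfolding P_def P'_def Q_def by (intro S2.add(3) S2.add(4) S2.add(6) S2.l_in pq t')+
      have bds: "0 \<le> P" "P < Q" "Q \<le> l\<^sub>2" "0 \<le> P'" "P' + (Q - P) \<le> l\<^sub>2" "Q - P < \<epsilon>"
        using k k' pq small by (auto simp: P_def P'_def Q_def distrib_right)
      have "k' = k \<or> k' = k + 1"
      proof -
        have "of_int k' * l\<^sub>2 < of_int (k + 2) * l\<^sub>2" "of_int k * l\<^sub>2 < of_int (k' + 1) * l\<^sub>2"
          using k k' pq t' by (auto simp: distrib_right)
        then have "k' < k + 2" "k < k' + 1" using S2.l_pos by (auto simp only: mult_less_cancel_right_pos of_int_less_iff)
        then show ?thesis by linarith
      qed
      then have "Q \<le> P' \<or> P' + (Q - P) \<le> P"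
        using small by (auto simp: P_def P'_def Q_def distrib_right)
      from sc[OF in_\<Gamma>(1,3,2) bds this]
      obtain D where D: "finite D" "D \<subseteq> \<Gamma>\<^sub>2" "\<forall>x\<in>\<Gamma>\<^sub>2. \<forall>y\<in>\<Gamma>\<^sub>2. P \<le> x \<longrightarrow> x < y \<longrightarrow> y \<le> Q \<longrightarrow> {x<..<y} \<inter> D = {} \<longrightarrow>
          (\<exists>c\<in>\<Lambda>\<^sub>1. scaled \<Gamma>\<^sub>2 m (\<lambda>x. x + (P' - P)) c x y)"
        unfolding piecewise_def by (elim exE conjE) (rule that)
      show "piecewise \<Gamma>\<^sub>2 p q (\<lambda>p q. \<exists>c\<in>\<Lambda>\<^sub>1. scaled \<Gamma>\<^sub>2 M (\<lambda>x. x + t') c p q)"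
      proof (rule piecewiseI[of "(\<lambda>d. d + of_int k * l\<^sub>2) ` D"])
        show "(\<lambda>d. d + of_int k * l\<^sub>2) ` D \<subseteq> \<Gamma>\<^sub>2"
          using D(2) S2.add(3) S2.add(6)[OF S2.l_in] by blast
        fix x y assume xy: "x \<in> \<Gamma>\<^sub>2" "y \<in> \<Gamma>\<^sub>2" "p \<le> x" "x < y" "y \<le> q" "{x<..<y} \<inter> (\<lambda>d. d + of_int k * l\<^sub>2) ` D = {}"
        let ?x = "x - of_int k * l\<^sub>2" and ?y = "y - of_int k * l\<^sub>2"
        have "{?x<..<?y} \<inter> D = {}"
        proof (rule ccontr)
          assume "\<not> ?thesis"
          then obtain d where "d \<in> D" "?x < d" "d < ?y" by auto
          then have "d + of_int k * l\<^sub>2 \<in> {x<..<y} \<inter> (\<lambda>d. d + of_int k * l\<^sub>2) ` D" by auto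
          then show False using xy by blast
        qed
        moreover have "?x \<in> \<Gamma>\<^sub>2" "?y \<in> \<Gamma>\<^sub>2" using xy by (intro S2.add(4) S2.add(6) S2.l_in; simp)+
        ultimately obtain c where c: "c \<in> \<Lambda>\<^sub>1" "scaled \<Gamma>\<^sub>2 m (\<lambda>x. x + (P' - P)) c ?x ?y"
          using D(3)[rule_format, of ?x ?y] xy by (auto simp: P_def Q_def)
        have "scaled \<Gamma>\<^sub>2 M (\<lambda>x. x + t') c x y"
        proof (rule scaledI)
          fix z w assume zw: "z \<in> \<Gamma>\<^sub>2" "w \<in> \<Gamma>\<^sub>2" "x \<le> z" "z \<le> w" "w \<le> y"
          have M1: "M a = m (a - of_int k * l\<^sub>2) + of_int k * l\<^sub>1"
            "M (a + t') = m ((a - of_int k * l\<^sub>2) + (P' - P)) + of_int k' * l\<^sub>1" if "z \<le> a" "a \<le> w" for a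
            using M_eq[of k a] M_eq[of k' "a + t'"] that zw xy k k' by (auto simp: P_def P'_def algebra_simps)
          have "m ((w - of_int k * l\<^sub>2) + (P' - P)) - m ((z - of_int k * l\<^sub>2) + (P' - P)) =
              c * (m (w - of_int k * l\<^sub>2) - m (z - of_int k * l\<^sub>2))"
            by (rule scaledD[OF c(2)]) (use zw in \<open>auto intro: S2.add(4) S2.add(6) S2.l_in\<close>)
          then show "M (w + t') - M (z + t') = c * (M w - M z)" using M1[of z] M1[of w] zw by simp
        qed
        then show "\<exists>c\<in>\<Lambda>\<^sub>1. scaled \<Gamma>\<^sub>2 M (\<lambda>x. x + t') c x y" using c by blast
      qed (use D in auto)
    qed
    then show ?thesis by (rule piecewise_piecewise) (use uv uv' in auto)
  qed
  then show ?thesis by (simp add: scaled_def Mt)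
qed

lemma scaling_M: "scaling \<Gamma>\<^sub>2 \<Lambda>\<^sub>1 l\<^sub>2 M"
proof
  show "M (x + l\<^sub>2) = M x + M l\<^sub>2" if "x \<in> \<Gamma>\<^sub>2" for x
    using M_shift[of x 1] M_eq_m[of l\<^sub>2] m_ends S2.l_pos by simp
qed (use S2.add_group S2.dense S1.mult_group S2.l_in S2.l_pos rank M_mono M_translation in auto)

text \<open>
  A slope below \<open>1\<close> in \<open>\<Lambda>\<^sub>2\<close> is what excludes exponential distribution functions, which are
  also scaled by every translation.
\<close>

definition rigid :: bool where
  "rigid \<longleftrightarrow> (\<forall>a\<in>\<Lambda>\<^sub>1. a = 1) \<or> (\<exists>a\<in>\<Lambda>\<^sub>2. a \<noteq> 1)"

lemma m_piecewise_linear: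
  assumes rigid
  shows "\<exists>s>0. piecewise \<Gamma>\<^sub>2 0 l\<^sub>2 (\<lambda>p q. \<exists>b\<in>\<Lambda>\<^sub>1. \<forall>x\<in>\<Gamma>\<^sub>2. \<forall>y\<in>\<Gamma>\<^sub>2. p \<le> x \<longrightarrow> x \<le> y \<longrightarrow> y \<le> q \<longrightarrow>
           m y - m x = s * b * (y - x))"
proof -
  interpret scaling \<Gamma>\<^sub>2 \<Lambda>\<^sub>1 l\<^sub>2 M by (rule scaling_M)
  have "(\<forall>a\<in>\<Lambda>\<^sub>1. a = 1) \<or> (\<exists>lam \<tau> c p q. 0 < lam \<and> lam < 1 \<and> (\<forall>x. lam * x \<in> \<Gamma>\<^sub>2 \<longleftrightarrow> x \<in> \<Gamma>\<^sub>2) \<and> \<tau> \<in> \<Gamma>\<^sub>2 \<and> 0 < c \<and>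
      p \<in> \<Gamma>\<^sub>2 \<and> q \<in> \<Gamma>\<^sub>2 \<and> 0 \<le> p \<and> p < q \<and> q \<le> l\<^sub>2 \<and> 0 \<le> lam * p + \<tau> \<and> lam * q + \<tau> \<le> l\<^sub>2 \<and>
      scaled \<Gamma>\<^sub>2 M (\<lambda>x. lam * x + \<tau>) c p q)"
  proof (cases "\<forall>a\<in>\<Lambda>\<^sub>1. a = 1")
    case False
    then obtain a where a: "a \<in> \<Lambda>\<^sub>2" "a \<noteq> 1" using assms by (auto simp: rigid_def)
    have "\<exists>lam\<in>\<Lambda>\<^sub>2. lam < 1"
    proof (cases "a < 1")
      case False
      then have "inverse a < 1" using a S2.mul(2)[OF a(1)] by (simp add: inverse_less_1_iff)
      then show ?thesis using S2.mul(3)[OF a(1)] by blast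
    qed (use a in blast)
    then obtain lam where lam: "lam \<in> \<Lambda>\<^sub>2" "lam < 1" by blast
    have lam0: "0 < lam" using S2.mul(2) lam by blast
    obtain \<epsilon> where \<epsilon>: "0 < \<epsilon>" and sc: "\<And>p q p'. \<lbrakk>p \<in> \<Gamma>\<^sub>2; q \<in> \<Gamma>\<^sub>2; p' \<in> \<Gamma>\<^sub>2; 0 \<le> p; p < q; q \<le> l\<^sub>2; 0 \<le> p';
        p' + lam * (q - p) \<le> l\<^sub>2; q - p < \<epsilon>; q \<le> p' \<or> p' + lam * (q - p) \<le> p\<rbrakk> \<Longrightarrow>
        piecewise \<Gamma>\<^sub>2 p q (\<lambda>r s. \<exists>c\<in>\<Lambda>\<^sub>1. scaled \<Gamma>\<^sub>2 m (\<lambda>x. lam * x + (p' - lam * p)) c r s)"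
      using m_scaled[OF lam(1)] by blast
    have "max (l\<^sub>2 / 2) (l\<^sub>2 - \<epsilon>) < l\<^sub>2" using S2.l_pos \<epsilon> by simp
    then obtain p q where pq: "p \<in> \<Gamma>\<^sub>2" "q \<in> \<Gamma>\<^sub>2" "max (l\<^sub>2 / 2) (l\<^sub>2 - \<epsilon>) < p" "p < q" "q < l\<^sub>2"
      using S2.between2 by blast
    have "lam * (q - p) \<le> 1 * (q - p)" using pq lam by (intro mult_right_mono) auto
    then have small: "lam * (q - p) \<le> q - p" by simp
    have "piecewise \<Gamma>\<^sub>2 p q (\<lambda>r s. \<exists>c\<in>\<Lambda>\<^sub>1. scaled \<Gamma>\<^sub>2 m (\<lambda>x. lam * x + (0 - lam * p)) c r s)"
    proof (rule sc)
      show "0 + lam * (q - p) \<le> l\<^sub>2" "q \<le> 0 \<or> 0 + lam * (q - p) \<le> p" using pq small by linarith+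
    qed (use pq S2.add(1) S2.l_pos \<epsilon> in auto)
    then have "\<exists>q'\<in>\<Gamma>\<^sub>2. p < q' \<and> q' < q \<and> (\<exists>c\<in>\<Lambda>\<^sub>1. scaled \<Gamma>\<^sub>2 m (\<lambda>x. lam * x + (0 - lam * p)) c p q')"
      by (rule piecewise_right_end[OF _ pq(1,4) S2.dense])
    then obtain q' c where q': "q' \<in> \<Gamma>\<^sub>2" "p < q'" "q' < q" "c \<in> \<Lambda>\<^sub>1"
      "scaled \<Gamma>\<^sub>2 m (\<lambda>x. lam * x + (- (lam * p))) c p q'" by auto
    have "lam * q' + (- (lam * p)) \<le> l\<^sub>2"
    proof -
      have "lam * (q' - p) \<le> lam * (q - p)" using lam0 q' by (intro mult_left_mono) auto
      then show ?thesis using small pq S2.l_pos by (simp add: right_diff_distrib)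
    qed
    have sc': "scaled \<Gamma>\<^sub>2 M (\<lambda>x. lam * x + (- (lam * p))) c p q'"
    proof (rule scaledI)
      fix x y assume xy: "x \<in> \<Gamma>\<^sub>2" "y \<in> \<Gamma>\<^sub>2" "p \<le> x" "x \<le> y" "y \<le> q'"
      have M1: "M (lam * z + (- (lam * p))) = m (lam * z + (- (lam * p)))" "M z = m z" if "p \<le> z" "z \<le> q'" for z
      proof -
        have "lam * p \<le> lam * z" "lam * z \<le> lam * q'" using lam0 that by (auto intro: mult_left_mono)
        then show "M (lam * z + (- (lam * p))) = m (lam * z + (- (lam * p)))" "M z = m z"
          using \<open>lam * q' + (- (lam * p)) \<le> l\<^sub>2\<close> that q' pq S2.l_pos by (auto intro!: M_eq_m)
      qed
      show "M (lam * y + (- (lam * p))) - M (lam * x + (- (lam * p))) = c * (M y - M x)"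
        using scaledD[OF q'(5), of x y] M1[of x] M1[of y] xy by simp
    qed
    have fwd: "- (lam * p) \<in> \<Gamma>\<^sub>2" using S2.add(2) S2.stable lam pq by blast
    show ?thesis
      apply (rule disjI2)
      apply (rule exI[of _ lam], rule exI[of _ "- (lam * p)"], rule exI[of _ c], rule exI[of _ p], rule exI[of _ q'])
      using lam lam0 fwd S2.scale_iff[OF lam(1)] S1.mul(2)[OF q'(4)] q' pq S2.l_pos sc'
        \<open>lam * q' + (- (lam * p)) \<le> l\<^sub>2\<close> by auto
  qed blast
  from piecewise_linear[OF this]
  obtain s where s: "0 < s" and pl: "piecewise \<Gamma>\<^sub>2 0 l\<^sub>2 (\<lambda>p q. \<exists>b\<in>\<Lambda>\<^sub>1. \<forall>x\<in>\<Gamma>\<^sub>2. \<forall>y\<in>\<Gamma>\<^sub>2. p \<le> x \<longrightarrow> x \<le> y \<longrightarrow> y \<le> q \<longrightarrow>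
      M y - M x = s * b * (y - x))" by blast
  show ?thesis
  proof (intro exI[of _ s] conjI s)
    show "piecewise \<Gamma>\<^sub>2 0 l\<^sub>2 (\<lambda>p q. \<exists>b\<in>\<Lambda>\<^sub>1. \<forall>x\<in>\<Gamma>\<^sub>2. \<forall>y\<in>\<Gamma>\<^sub>2. p \<le> x \<longrightarrow> x \<le> y \<longrightarrow> y \<le> q \<longrightarrow>
        m y - m x = s * b * (y - x))"
      using pl
    proof (rule piecewise_mono)
      fix p q assume pq: "0 \<le> p" "q \<le> l\<^sub>2" and "\<exists>b\<in>\<Lambda>\<^sub>1. \<forall>x\<in>\<Gamma>\<^sub>2. \<forall>y\<in>\<Gamma>\<^sub>2. p \<le> x \<longrightarrow> x \<le> y \<longrightarrow> y \<le> q \<longrightarrow>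
        M y - M x = s * b * (y - x)"
      then obtain b where b: "b \<in> \<Lambda>\<^sub>1" "\<forall>x\<in>\<Gamma>\<^sub>2. \<forall>y\<in>\<Gamma>\<^sub>2. p \<le> x \<longrightarrow> x \<le> y \<longrightarrow> y \<le> q \<longrightarrow>
        M y - M x = s * b * (y - x)" by blast
      have "m y - m x = s * b * (y - x)" if "x \<in> \<Gamma>\<^sub>2" "y \<in> \<Gamma>\<^sub>2" "p \<le> x" "x \<le> y" "y \<le> q" for x y
        using b(2)[rule_format, OF that] M_eq_m[of x] M_eq_m[of y] that pq by simp
      then show "\<exists>b\<in>\<Lambda>\<^sub>1. \<forall>x\<in>\<Gamma>\<^sub>2. \<forall>y\<in>\<Gamma>\<^sub>2. p \<le> x \<longrightarrow> x \<le> y \<longrightarrow> y \<le> q \<longrightarrow> m y - m x = s * b * (y - x)"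
        using b(1) by blast
    qed
  qed
qed

text \<open>
  Where \<open>m\<close> is linear near \<open>0\<close> and near another point \<open>p'\<close>, comparing its slopes \<open>s * b0\<close> and
  \<open>s * b1\<close> with the factor of the affine map of slope \<open>a\<close> from the first point to the second
  expresses \<open>a\<close> by \<open>b0\<close>, \<open>b1\<close> and that factor.
\<close>

lemma slopes_subset:
  assumes rigid
  shows "\<Lambda>\<^sub>2 \<subseteq> \<Lambda>\<^sub>1"
proof
  fix a assume a: "a \<in> \<Lambda>\<^sub>2"
  then have a0: "0 < a" using S2.mul(2) by blast
  obtain s where s: "0 < s" and pl: "piecewise \<Gamma>\<^sub>2 0 l\<^sub>2 (\<lambda>p q. \<exists>b\<in>\<Lambda>\<^sub>1. \<forall>x\<in>\<Gamma>\<^sub>2. \<forall>y\<in>\<Gamma>\<^sub>2. p \<le> x \<longrightarrow> x \<le> y \<longrightarrow> y \<le> q \<longrightarrow>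
      m y - m x = s * b * (y - x))" using m_piecewise_linear[OF assms] by blast
  obtain q0 b0 where q0: "q0 \<in> \<Gamma>\<^sub>2" "0 < q0" "q0 < l\<^sub>2" "b0 \<in> \<Lambda>\<^sub>1"
    "\<And>x y. x \<in> \<Gamma>\<^sub>2 \<Longrightarrow> y \<in> \<Gamma>\<^sub>2 \<Longrightarrow> 0 \<le> x \<Longrightarrow> x \<le> y \<Longrightarrow> y \<le> q0 \<Longrightarrow> m y - m x = s * b0 * (y - x)"
    using piecewise_right_end[OF pl S2.add(1) S2.l_pos S2.dense] by blast
  obtain p' where p': "p' \<in> \<Gamma>\<^sub>2" "0 < p'" "p' < l\<^sub>2" using S2.between[OF S2.l_pos] by blast
  obtain q1 b1 where q1: "q1 \<in> \<Gamma>\<^sub>2" "p' < q1" "q1 < l\<^sub>2" "b1 \<in> \<Lambda>\<^sub>1"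
    "\<And>x y. x \<in> \<Gamma>\<^sub>2 \<Longrightarrow> y \<in> \<Gamma>\<^sub>2 \<Longrightarrow> p' \<le> x \<Longrightarrow> x \<le> y \<Longrightarrow> y \<le> q1 \<Longrightarrow> m y - m x = s * b1 * (y - x)"
    using piecewise_right_end[OF piecewise_subinterval[OF pl] p'(1,3) S2.dense] p'(2) by auto
  obtain \<epsilon> where \<epsilon>: "0 < \<epsilon>" and sc: "\<And>p q p'. \<lbrakk>p \<in> \<Gamma>\<^sub>2; q \<in> \<Gamma>\<^sub>2; p' \<in> \<Gamma>\<^sub>2; 0 \<le> p; p < q; q \<le> l\<^sub>2; 0 \<le> p';
      p' + a * (q - p) \<le> l\<^sub>2; q - p < \<epsilon>; q \<le> p' \<or> p' + a * (q - p) \<le> p\<rbrakk> \<Longrightarrow>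
      piecewise \<Gamma>\<^sub>2 p q (\<lambda>r s. \<exists>c\<in>\<Lambda>\<^sub>1. scaled \<Gamma>\<^sub>2 m (\<lambda>x. a * x + (p' - a * p)) c r s)"
    using m_scaled[OF a] by blast
  have "0 < min (min q0 p') (min \<epsilon> ((q1 - p') / a))" using q0 p' \<epsilon> q1 a0 by simp
  then obtain q where q: "q \<in> \<Gamma>\<^sub>2" "0 < q" "q < min (min q0 p') (min \<epsilon> ((q1 - p') / a))" using S2.between by blast
  then have q': "q < q0" "q < p'" "q < \<epsilon>" "a * q < q1 - p'" using a0 by (auto simp: pos_less_divide_eq mult.commute)
  have "piecewise \<Gamma>\<^sub>2 0 q (\<lambda>r s. \<exists>c\<in>\<Lambda>\<^sub>1. scaled \<Gamma>\<^sub>2 m (\<lambda>x. a * x + (p' - a * 0)) c r s)"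
    by (rule sc) (use q q' q0 q1 p' S2.add(1) in auto)
  then obtain r c where r: "r \<in> \<Gamma>\<^sub>2" "0 < r" "r < q" "c \<in> \<Lambda>\<^sub>1" "scaled \<Gamma>\<^sub>2 m (\<lambda>x. a * x + (p' - a * 0)) c 0 r"
    using piecewise_right_end[OF _ S2.add(1) q(2) S2.dense] by blast
  have ar: "a * r < a * q" "0 < a * r" using r a0 by auto
  have "m (a * r + p') - m p' = c * (m r - m 0)"
    using scaledD[OF r(5), of 0 r] r S2.add(1) by simp
  moreover have "m (a * r + p') - m p' = s * b1 * (a * r)"
    using q1(5)[of p' "a * r + p'"] p' S2.add(3) S2.stable[OF a r(1)] ar q' by simp
  moreover have "m r - m 0 = s * b0 * r" using q0(5)[of 0 r] r q' S2.add(1) by simp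
  ultimately have "b1 * a = c * b0" using s r(2) by simp
  then have "a = c * b0 / b1" using S1.mul(2)[OF q1(4)] by (simp add: field_simps)
  then show "a \<in> \<Lambda>\<^sub>1" using S1.mul(4,5) r(4) q0(4) q1(4) by blast
qed

text \<open>
  The slopes of \<open>m\<close> are \<open>s * b\<close> with \<open>b\<close> in \<open>\<Lambda>\<^sub>1\<close>, so its values lie in \<open>s \<Gamma>\<^sub>2\<close>; conversely they
  contain the small elements of \<open>s \<Gamma>\<^sub>2\<close> up to a factor in \<open>\<Lambda>\<^sub>1\<close>. A piece of length \<open>t\<close> contributes
  \<open>s * b * t - s * t\<close> to \<open>l\<^sub>1 - s * l\<^sub>2\<close>, which is a coinvariant relation.
\<close>

theorem invariants_recovered:
  assumes rigid and eq: "\<Lambda>\<^sub>1 = \<Lambda>\<^sub>2"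
  shows "\<exists>s>0. \<Gamma>\<^sub>1 = (\<lambda>t. s * t) ` \<Gamma>\<^sub>2 \<and> l\<^sub>1 - s * l\<^sub>2 \<in> coinvariant_relations \<Lambda>\<^sub>1 \<Gamma>\<^sub>1"
proof -
  obtain s where s: "0 < s" and pl: "piecewise \<Gamma>\<^sub>2 0 l\<^sub>2 (\<lambda>p q. \<exists>b\<in>\<Lambda>\<^sub>1. \<forall>x\<in>\<Gamma>\<^sub>2. \<forall>y\<in>\<Gamma>\<^sub>2. p \<le> x \<longrightarrow> x \<le> y \<longrightarrow> y \<le> q \<longrightarrow>
      m y - m x = s * b * (y - x))" using m_piecewise_linear[OF assms(1)] by blast
  define H where "H = (\<lambda>t. s * t) ` \<Gamma>\<^sub>2"
  have H: "add_group H"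
    unfolding add_group_def
  proof (intro conjI ballI)
    show "0 \<in> H" using imageI[OF S2.add(1), of "\<lambda>t. s * t"] by (simp add: H_def)
    fix x assume "x \<in> H"
    then obtain t where t: "t \<in> \<Gamma>\<^sub>2" "x = s * t" by (auto simp: H_def)
    show "- x \<in> H" using imageI[OF S2.add(2)[OF t(1)], of "\<lambda>t. s * t"] t by (simp add: H_def)
    fix y assume "y \<in> H"
    then obtain t' where t': "t' \<in> \<Gamma>\<^sub>2" "y = s * t'" by (auto simp: H_def)
    show "x + y \<in> H"
      using imageI[OF S2.add(3)[OF t(1) t'(1)], of "\<lambda>t. s * t"] t t' by (simp add: H_def distrib_left)
  qed
  have mono_in: "m q - m p \<in> K" if "add_group K" "p \<in> \<Gamma>\<^sub>2" "q \<in> \<Gamma>\<^sub>2" "0 \<le> p" "p < q" "q \<le> l\<^sub>2"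
      "\<And>b x. b \<in> \<Lambda>\<^sub>1 \<Longrightarrow> x \<in> \<Gamma>\<^sub>2 \<Longrightarrow> s * b * x \<in> K" for K p q
    using pl
  proof (rule piecewise_glue[where R = "\<lambda>p q. m q - m p \<in> K"])
    fix p q assume pq: "p \<in> \<Gamma>\<^sub>2" "q \<in> \<Gamma>\<^sub>2" "p < q" "\<exists>b\<in>\<Lambda>\<^sub>1. \<forall>x\<in>\<Gamma>\<^sub>2. \<forall>y\<in>\<Gamma>\<^sub>2. p \<le> x \<longrightarrow> x \<le> y \<longrightarrow> y \<le> q \<longrightarrow>
      m y - m x = s * b * (y - x)"
    then obtain b where "b \<in> \<Lambda>\<^sub>1" "m q - m p = s * b * (q - p)" by force
    then show "m q - m p \<in> K" using that(7)[of b "q - p"] S2.add(4) pq by simp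
  next
    fix p c q assume "m c - m p \<in> K" "m q - m c \<in> K"
    then have "(m c - m p) + (m q - m c) \<in> K" by (rule add_groupD(3)[OF that(1)])
    then show "m q - m p \<in> K" by simp
  qed (use that in auto)
  have H_mem: "s * b * x \<in> H" if "b \<in> \<Lambda>\<^sub>1" "x \<in> \<Gamma>\<^sub>2" for b x
    unfolding H_def mult.assoc using S2.stable[of b x] that eq by blast
  have "\<Gamma>\<^sub>1 \<subseteq> H"
  proof (rule m_generates[OF H])
    fix x assume "x \<in> \<Gamma>\<^sub>2" "0 \<le> x" "x \<le> l\<^sub>2"
    then show "m x \<in> H"
      using mono_in[OF H S2.add(1), of x] H_mem m_ends add_groupD(1)[OF H] by (cases "x = 0") auto
  qed
  moreover have "H \<subseteq> \<Gamma>\<^sub>1"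
  proof
    obtain q0 b0 where q0: "q0 \<in> \<Gamma>\<^sub>2" "0 < q0" "q0 < l\<^sub>2" "b0 \<in> \<Lambda>\<^sub>1"
      "\<And>x y. x \<in> \<Gamma>\<^sub>2 \<Longrightarrow> y \<in> \<Gamma>\<^sub>2 \<Longrightarrow> 0 \<le> x \<Longrightarrow> x \<le> y \<Longrightarrow> y \<le> q0 \<Longrightarrow> m y - m x = s * b0 * (y - x)"
      using piecewise_right_end[OF pl S2.add(1) S2.l_pos S2.dense] by blast
    have small: "s * x \<in> \<Gamma>\<^sub>1" if "x \<in> \<Gamma>\<^sub>2" "0 \<le> x" "x \<le> q0" for x
    proof -
      have "m x = b0 * (s * x)" using q0(5)[of 0 x] that S2.add(1) m_ends by simp
      then show ?thesis using m_in[of x] that q0 S1.scale_iff[OF q0(4)] by simp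
    qed
    fix y assume "y \<in> H"
    then obtain t where t: "t \<in> \<Gamma>\<^sub>2" "y = s * t" by (auto simp: H_def)
    have "wrap q0 t \<in> \<Gamma>\<^sub>2" unfolding wrap_def by (intro S2.add(4) S2.add(6) t q0)
    then have "s * wrap q0 t \<in> \<Gamma>\<^sub>1" using small wrap_bounds[OF q0(2), of t] by simp
    moreover have "of_int \<lfloor>t / q0\<rfloor> * (s * q0) \<in> \<Gamma>\<^sub>1" by (rule S1.add(6)) (use small q0 in auto)
    moreover have "y = s * wrap q0 t + of_int \<lfloor>t / q0\<rfloor> * (s * q0)"
      unfolding t(2) by (simp add: wrap_def algebra_simps)
    ultimately show "y \<in> \<Gamma>\<^sub>1" using S1.add(3) by simp
  qed
  ultimately have \<Gamma>: "\<Gamma>\<^sub>1 = H" by blast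
  have "(m l\<^sub>2 - m 0) - s * (l\<^sub>2 - 0) \<in> S1.I\<Gamma>"
    using pl
  proof (rule piecewise_glue[where R = "\<lambda>p q. (m q - m p) - s * (q - p) \<in> S1.I\<Gamma>"])
    fix p q assume pq: "p \<in> \<Gamma>\<^sub>2" "q \<in> \<Gamma>\<^sub>2" "p < q" "\<exists>b\<in>\<Lambda>\<^sub>1. \<forall>x\<in>\<Gamma>\<^sub>2. \<forall>y\<in>\<Gamma>\<^sub>2. p \<le> x \<longrightarrow> x \<le> y \<longrightarrow> y \<le> q \<longrightarrow>
      m y - m x = s * b * (y - x)"
    then obtain b where b: "b \<in> \<Lambda>\<^sub>1" "m q - m p = s * b * (q - p)" by force
    let ?T = "s * (q - p)"
    have "?T \<in> \<Gamma>\<^sub>1" using \<Gamma> pq S2.add(4) by (auto simp: H_def)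
    then have "- (?T - b * ?T) \<in> S1.I\<Gamma>"
      using add_groupD(2)[OF S1.add_group_coinvariant_relations S1.coinvariant_relationsI] b by blast
    then show "(m q - m p) - s * (q - p) \<in> S1.I\<Gamma>" using b(2) by (simp add: mult_ac)
  next
    fix p c q assume "(m c - m p) - s * (c - p) \<in> S1.I\<Gamma>" "(m q - m c) - s * (q - c) \<in> S1.I\<Gamma>"
    then have "((m c - m p) - s * (c - p)) + ((m q - m c) - s * (q - c)) \<in> S1.I\<Gamma>"
      by (rule add_groupD(3)[OF S1.add_group_coinvariant_relations])
    then show "(m q - m p) - s * (q - p) \<in> S1.I\<Gamma>" by (simp add: algebra_simps)
  qed (use S2.add(1) S2.l_in S2.l_pos in auto)
  then show ?thesis using \<Gamma> s m_ends by (auto simp: H_def)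
qed

end

text \<open>
  If \<open>\<Lambda>\<^sub>2\<close> is trivial, the model in the second direction is rigid, and then \<open>\<Lambda>\<^sub>1\<close> is trivial too.
  Otherwise the first model is rigid, so \<open>\<Lambda>\<^sub>1\<close> contains \<open>\<Lambda>\<^sub>2\<close> and is not trivial either. In both
  cases both models are rigid.
\<close>

theorem invariants_of_two_models:
  assumes "scaling_model \<Gamma>\<^sub>1 \<Lambda>\<^sub>1 l\<^sub>1 \<Gamma>\<^sub>2 \<Lambda>\<^sub>2 l\<^sub>2 m" "scaling_model \<Gamma>\<^sub>2 \<Lambda>\<^sub>2 l\<^sub>2 \<Gamma>\<^sub>1 \<Lambda>\<^sub>1 l\<^sub>1 m'"
  shows "\<Lambda>\<^sub>1 = \<Lambda>\<^sub>2 \<and> (\<exists>s>0. \<Gamma>\<^sub>1 = (\<lambda>t. s * t) ` \<Gamma>\<^sub>2 \<and> l\<^sub>1 - s * l\<^sub>2 \<in> coinvariant_relations \<Lambda>\<^sub>1 \<Gamma>\<^sub>1)"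
proof -
  interpret A: scaling_model \<Gamma>\<^sub>1 \<Lambda>\<^sub>1 l\<^sub>1 \<Gamma>\<^sub>2 \<Lambda>\<^sub>2 l\<^sub>2 m by (rule assms(1))
  interpret B: scaling_model \<Gamma>\<^sub>2 \<Lambda>\<^sub>2 l\<^sub>2 \<Gamma>\<^sub>1 \<Lambda>\<^sub>1 l\<^sub>1 m' by (rule assms(2))
  have "A.rigid \<and> B.rigid"
  proof (cases "\<forall>a\<in>\<Lambda>\<^sub>2. a = 1")
    case True
    then have "B.rigid" by (simp add: B.rigid_def)
    then have "\<Lambda>\<^sub>1 \<subseteq> \<Lambda>\<^sub>2" by (rule B.slopes_subset)
    then show ?thesis using True \<open>B.rigid\<close> by (auto simp: A.rigid_def)
  next
    case False
    then have "A.rigid" by (auto simp: A.rigid_def)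
    then have "\<Lambda>\<^sub>2 \<subseteq> \<Lambda>\<^sub>1" by (rule A.slopes_subset)
    then show ?thesis using False \<open>A.rigid\<close> by (auto simp: B.rigid_def)
  qed
  then have "\<Lambda>\<^sub>1 = \<Lambda>\<^sub>2" using A.slopes_subset B.slopes_subset by blast
  then show ?thesis using A.invariants_recovered \<open>A.rigid \<and> B.rigid\<close> by blast
qed

section \<open>Distribution functions from isomorphisms of interval algebras\<close>

context stein
begin

text \<open>
  The algebra is generated by intervals under disjoint unions; this is how additive quantities
  are computed.
\<close>

lemma algebra_induct:
  assumes "B \<in> \<B>" "R {}"
    and "\<And>p q. p \<in> \<Gamma> \<Longrightarrow> q \<in> \<Gamma> \<Longrightarrow> 0 \<le> p \<Longrightarrow> p < q \<Longrightarrow> q \<le> l \<Longrightarrow> R {p..<q}"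
    and "\<And>U V. U \<in> \<B> \<Longrightarrow> V \<in> \<B> \<Longrightarrow> U \<inter> V = {} \<Longrightarrow> R U \<Longrightarrow> R V \<Longrightarrow> R (U \<union> V)"
  shows "R B"
proof -
  have "R (B \<inter> {0..<l})"
  proof (rule piecewise_glue[where R = "\<lambda>p q. R (B \<inter> {p..<q})"])
    show "piecewise \<Gamma> 0 l (\<lambda>p q. {p..<q} \<subseteq> B \<or> {p..<q} \<inter> B = {})"
      using assms(1) by (simp add: interval_algebra_def)
  next
    fix p q assume pq: "p \<in> \<Gamma>" "q \<in> \<Gamma>" "0 \<le> p" "p < q" "q \<le> l" "{p..<q} \<subseteq> B \<or> {p..<q} \<inter> B = {}"
    then have "B \<inter> {p..<q} = {p..<q} \<or> B \<inter> {p..<q} = {}" by blast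
    then show "R (B \<inter> {p..<q})" using assms(2,3) pq by metis
  next
    fix p c q assume pcq: "p \<in> \<Gamma>" "c \<in> \<Gamma>" "q \<in> \<Gamma>" "0 \<le> p" "p < c" "c < q" "q \<le> l"
      and R: "R (B \<inter> {p..<c})" "R (B \<inter> {c..<q})"
    have "B \<inter> {p..<q} = (B \<inter> {p..<c}) \<union> (B \<inter> {c..<q})" using pcq by auto
    moreover have "B \<inter> {p..<c} \<in> \<B>" "B \<inter> {c..<q} \<in> \<B>"
      using pcq by (auto intro!: interval_algebra_binary(2)[OF assms(1)] interval_algebra_interval)
    moreover have "(B \<inter> {p..<c}) \<inter> (B \<inter> {c..<q}) = {}" by auto
    ultimately show "R (B \<inter> {p..<q})" using R assms(4)[of "B \<inter> {p..<c}" "B \<inter> {c..<q}"] by simp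
  qed (use add(1) l_in l_pos in auto)
  moreover have "B \<inter> {0..<l} = B" using interval_algebra_subset[OF assms(1)] by blast
  ultimately show ?thesis by simp
qed

lemma algebra_measurable:
  assumes "B \<in> \<B>"
  shows "B \<in> sets lebesgue" "emeasure lebesgue B \<noteq> \<infinity>"
proof -
  show s: "B \<in> sets lebesgue"
    by (rule algebra_induct[OF assms, where R = "\<lambda>B. B \<in> sets lebesgue"]) auto
  have "bounded B" using interval_algebra_subset[OF assms] bounded_subset[of "{0..l}" B] by force
  then have "B \<in> lmeasurable" using s by (rule bounded_set_imp_lmeasurable)
  then show "emeasure lebesgue B \<noteq> \<infinity>" by (auto simp: fmeasurable_def)
qed

abbreviation len :: "real set \<Rightarrow> real" where "len \<equiv> measure lebesgue"

lemma len_disjoint: "U \<in> \<B> \<Longrightarrow> V \<in> \<B> \<Longrightarrow> U \<inter> V = {} \<Longrightarrow> len (U \<union> V) = len U + len V"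
  using measure_Union[of lebesgue U V] algebra_measurable by auto

lemma len_in: "B \<in> \<B> \<Longrightarrow> len B \<in> \<Gamma>"
  by (rule algebra_induct[where R = "\<lambda>B. len B \<in> \<Gamma>"]) (auto simp: len_disjoint intro: add)

lemma len_pos:
  assumes "B \<in> \<B>" "B \<noteq> {}"
  shows "0 < len B"
proof -
  obtain p q where pq: "p \<in> \<Gamma>" "q \<in> \<Gamma>" "0 \<le> p" "p < q" "q \<le> l" "{p..<q} \<subseteq> B"
    using algebra_nonempty[OF assms] by blast
  have I: "{p..<q} \<in> \<B>" using pq by (auto intro: interval_algebra_interval)
  have "B = {p..<q} \<union> (B - {p..<q})" using pq by blast
  then have "len B = len {p..<q} + len (B - {p..<q})"
    using len_disjoint[OF I interval_algebra_binary(3)[OF assms(1) I]] by auto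
  moreover have "0 \<le> len (B - {p..<q})" by (rule measure_nonneg)
  moreover have "0 < len {p..<q}" using pq(4) by simp
  ultimately show ?thesis by linarith
qed

end

text \<open>
  Lebesgue measure transported by the isomorphism is an additive and strictly positive function
  on the algebra, and \<open>m\<close> is its distribution function. Since every interval \<open>[0, x)\<close> with \<open>x\<close> in
  \<open>\<Gamma>\<^sub>1\<close> is the image of a finite union of intervals, the values of \<open>m\<close> generate \<open>\<Gamma>\<^sub>1\<close>.
\<close>

lemma scaling_model_of_algebra_iso:
  assumes S1: "stein \<Gamma>\<^sub>1 \<Lambda>\<^sub>1 l\<^sub>1" and S2: "stein \<Gamma>\<^sub>2 \<Lambda>\<^sub>2 l\<^sub>2"
    and rank: "\<exists>t\<in>\<Gamma>\<^sub>2. \<forall>n k :: int. of_int n * t = of_int k * l\<^sub>2 \<longrightarrow> n = 0"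
    and bij: "bij_betw \<kappa> (interval_algebra \<Gamma>\<^sub>2 l\<^sub>2) (interval_algebra \<Gamma>\<^sub>1 l\<^sub>1)"
    and order: "\<And>U V. U \<in> interval_algebra \<Gamma>\<^sub>2 l\<^sub>2 \<Longrightarrow> V \<in> interval_algebra \<Gamma>\<^sub>2 l\<^sub>2 \<Longrightarrow> \<kappa> U \<subseteq> \<kappa> V \<longleftrightarrow> U \<subseteq> V"
    and scal: "\<And>a. a \<in> \<Lambda>\<^sub>2 \<Longrightarrow> \<exists>\<epsilon>>0. \<forall>p\<in>\<Gamma>\<^sub>2. \<forall>q\<in>\<Gamma>\<^sub>2. \<forall>p'\<in>\<Gamma>\<^sub>2.
       0 \<le> p \<longrightarrow> p < q \<longrightarrow> q \<le> l\<^sub>2 \<longrightarrow> 0 \<le> p' \<longrightarrow> p' + a * (q - p) \<le> l\<^sub>2 \<longrightarrow> q - p < \<epsilon> \<longrightarrow>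
       q \<le> p' \<or> p' + a * (q - p) \<le> p \<longrightarrow>
       piecewise \<Gamma>\<^sub>2 p q (\<lambda>r s. \<exists>c\<in>\<Lambda>\<^sub>1. \<forall>x\<in>\<Gamma>\<^sub>2. \<forall>y\<in>\<Gamma>\<^sub>2. r \<le> x \<longrightarrow> x < y \<longrightarrow> y \<le> s \<longrightarrow>
         measure lebesgue (\<kappa> {a * x + (p' - a * p)..<a * y + (p' - a * p)}) = c * measure lebesgue (\<kappa> {x..<y}))"
  shows "scaling_model \<Gamma>\<^sub>1 \<Lambda>\<^sub>1 l\<^sub>1 \<Gamma>\<^sub>2 \<Lambda>\<^sub>2 l\<^sub>2 (\<lambda>x. measure lebesgue (\<kappa> {0..<x}))"
proof -
  interpret A: stein \<Gamma>\<^sub>1 \<Lambda>\<^sub>1 l\<^sub>1 by (rule S1)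
  interpret B: stein \<Gamma>\<^sub>2 \<Lambda>\<^sub>2 l\<^sub>2 by (rule S2)
  define m where "m x = measure lebesgue (\<kappa> {0..<x})" for x
  have mem: "\<kappa> U \<in> A.\<B>" if "U \<in> B.\<B>" for U using bij that by (auto simp: bij_betw_def)
  have surj: "\<exists>U\<in>B.\<B>. \<kappa> U = W" if "W \<in> A.\<B>" for W
    using that bij_betw_imp_surj_on[OF bij] by (metis imageE)
  have empty: "\<kappa> {} = {}"
  proof -
    obtain U where U: "U \<in> B.\<B>" "\<kappa> U = {}" using surj[OF interval_algebra_empty] by blast
    then have "\<kappa> {} \<subseteq> \<kappa> U" using order[OF interval_algebra_empty U(1)] by simp
    then show ?thesis using U by simp
  qed
  have whole: "\<kappa> {0..<l\<^sub>2} = {0..<l\<^sub>1}"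
  proof -
    obtain U where U: "U \<in> B.\<B>" "\<kappa> U = {0..<l\<^sub>1}" using surj[OF A.space_in] by blast
    then have "\<kappa> U \<subseteq> \<kappa> {0..<l\<^sub>2}" using order[OF U(1) B.space_in] interval_algebra_subset[OF U(1)] by simp
    moreover have "\<kappa> {0..<l\<^sub>2} \<subseteq> {0..<l\<^sub>1}" using interval_algebra_subset[OF mem[OF B.space_in]] .
    ultimately show ?thesis using U by simp
  qed
  have union: "\<kappa> (U \<union> V) = \<kappa> U \<union> \<kappa> V" if UV: "U \<in> B.\<B>" "V \<in> B.\<B>" for U V
  proof (rule subset_antisym)
    note UnV = interval_algebra_binary(1)[OF UV]
    obtain W where W: "W \<in> B.\<B>" "\<kappa> W = \<kappa> U \<union> \<kappa> V"
      using surj[OF interval_algebra_binary(1)[OF mem mem]] UV by blast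
    have "U \<subseteq> W" "V \<subseteq> W" using order[of _ W] UV W by blast+
    then show "\<kappa> (U \<union> V) \<subseteq> \<kappa> U \<union> \<kappa> V" using order[OF UnV W(1)] W(2) by auto
    show "\<kappa> U \<union> \<kappa> V \<subseteq> \<kappa> (U \<union> V)" using order[OF UV(1) UnV] order[OF UV(2) UnV] by auto
  qed
  have disj: "\<kappa> U \<inter> \<kappa> V = {}" if UV: "U \<in> B.\<B>" "V \<in> B.\<B>" "U \<inter> V = {}" for U V
  proof -
    obtain W where W: "W \<in> B.\<B>" "\<kappa> W = \<kappa> U \<inter> \<kappa> V"
      using surj[OF interval_algebra_binary(2)[OF mem mem]] UV by blast
    then have "W \<subseteq> U" "W \<subseteq> V" using order[OF W(1)] UV by blast+
    then have "W = {}" using UV by blast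
    then show ?thesis using W empty by simp
  qed
  define \<mu> where "\<mu> U = measure lebesgue (\<kappa> U)" for U
  have \<mu>_add: "\<mu> (U \<union> V) = \<mu> U + \<mu> V" if "U \<in> B.\<B>" "V \<in> B.\<B>" "U \<inter> V = {}" for U V
    unfolding \<mu>_def union[OF that(1,2)] by (rule A.len_disjoint) (use that mem disj in auto)
  have \<mu>_empty: "\<mu> {} = 0" by (simp add: \<mu>_def empty)
  have \<mu>_int: "\<mu> {x..<y} = m y - m x" if "x \<in> \<Gamma>\<^sub>2" "y \<in> \<Gamma>\<^sub>2" "0 \<le> x" "x \<le> y" "y \<le> l\<^sub>2" for x y
  proof -
    have "\<mu> ({0..<x} \<union> {x..<y}) = \<mu> {0..<x} + \<mu> {x..<y}"
      by (rule \<mu>_add) (use that B.add(1) in \<open>auto intro!: interval_algebra_interval\<close>)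
    moreover have "{0..<x} \<union> {x..<y} = {0..<y}" using that by auto
    ultimately show ?thesis by (simp add: m_def \<mu>_def)
  qed
  have \<mu>_pos: "0 < \<mu> U" if "U \<in> B.\<B>" "U \<noteq> {}" for U
  proof -
    have "\<kappa> U \<noteq> {}" using order[OF that(1) interval_algebra_empty] that(2) empty by auto
    then show ?thesis using A.len_pos mem that(1) by (simp add: \<mu>_def)
  qed
  have "scaling_model \<Gamma>\<^sub>1 \<Lambda>\<^sub>1 l\<^sub>1 \<Gamma>\<^sub>2 \<Lambda>\<^sub>2 l\<^sub>2 m"
  proof (intro scaling_model.intro scaling_model_axioms.intro S1 S2)
    show "m 0 = 0" "m l\<^sub>2 = l\<^sub>1" using A.l_pos by (simp_all add: m_def empty whole)
    show "m x < m y" if "x \<in> \<Gamma>\<^sub>2" "y \<in> \<Gamma>\<^sub>2" "0 \<le> x" "x < y" "y \<le> l\<^sub>2" for x y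
      using \<mu>_pos[of "{x..<y}"] \<mu>_int[of x y] that by (auto intro!: interval_algebra_interval)
    show "m x \<in> \<Gamma>\<^sub>1" if "x \<in> \<Gamma>\<^sub>2" "0 \<le> x" "x \<le> l\<^sub>2" for x
      unfolding m_def using that B.add(1) by (auto intro!: A.len_in mem interval_algebra_interval)
    show "\<Gamma>\<^sub>1 \<subseteq> H" if H: "add_group H" and m: "\<And>x. x \<in> \<Gamma>\<^sub>2 \<Longrightarrow> 0 \<le> x \<Longrightarrow> x \<le> l\<^sub>2 \<Longrightarrow> m x \<in> H" for H
    proof
      have \<mu>_in: "\<mu> U \<in> H" if "U \<in> B.\<B>" for U using that
      proof (rule B.algebra_induct[where R = "\<lambda>U. \<mu> U \<in> H"])
        show "\<mu> {} \<in> H" using add_groupD(1)[OF H] by (simp add: \<mu>_empty)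
        show "\<mu> {p..<q} \<in> H" if "p \<in> \<Gamma>\<^sub>2" "q \<in> \<Gamma>\<^sub>2" "0 \<le> p" "p < q" "q \<le> l\<^sub>2" for p q
          using \<mu>_int[of p q] that m add_groupD(4)[OF H] by auto
        show "\<mu> (U \<union> V) \<in> H" if "U \<in> B.\<B>" "V \<in> B.\<B>" "U \<inter> V = {}" "\<mu> U \<in> H" "\<mu> V \<in> H" for U V
          using \<mu>_add that add_groupD(3)[OF H] by simp
      qed
      have small: "x \<in> H" if "x \<in> \<Gamma>\<^sub>1" "0 \<le> x" "x \<le> l\<^sub>1" for x
      proof -
        have "{0..<x} \<in> A.\<B>" using that A.add(1) by (auto intro!: interval_algebra_interval)
        then obtain U where "U \<in> B.\<B>" "\<kappa> U = {0..<x}" using surj by blast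
        then show ?thesis using \<mu>_in[of U] that by (simp add: \<mu>_def)
      qed
      fix x assume x: "x \<in> \<Gamma>\<^sub>1"
      have "wrap l\<^sub>1 x \<in> \<Gamma>\<^sub>1" unfolding wrap_def by (intro A.add(4) A.add(6) x A.l_in)
      then have "wrap l\<^sub>1 x \<in> H" using small wrap_bounds[OF A.l_pos, of x] by simp
      moreover have "of_int \<lfloor>x / l\<^sub>1\<rfloor> * l\<^sub>1 \<in> H"
        by (rule add_groupD(6)[OF H small]) (use A.l_in A.l_pos in auto)
      ultimately show "x \<in> H" using add_groupD(3)[OF H] wrap_diff[of x l\<^sub>1] by metis
    qed
    show "\<exists>\<epsilon>>0. \<forall>p\<in>\<Gamma>\<^sub>2. \<forall>q\<in>\<Gamma>\<^sub>2. \<forall>p'\<in>\<Gamma>\<^sub>2.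
       0 \<le> p \<longrightarrow> p < q \<longrightarrow> q \<le> l\<^sub>2 \<longrightarrow> 0 \<le> p' \<longrightarrow> p' + a * (q - p) \<le> l\<^sub>2 \<longrightarrow> q - p < \<epsilon> \<longrightarrow>
       q \<le> p' \<or> p' + a * (q - p) \<le> p \<longrightarrow>
       piecewise \<Gamma>\<^sub>2 p q (\<lambda>r s. \<exists>c\<in>\<Lambda>\<^sub>1. scaled \<Gamma>\<^sub>2 m (\<lambda>x. a * x + (p' - a * p)) c r s)" if a: "a \<in> \<Lambda>\<^sub>2" for a
    proof -
      obtain \<epsilon> where \<epsilon>: "0 < \<epsilon>" and sc: "\<And>p q p'. \<lbrakk>p \<in> \<Gamma>\<^sub>2; q \<in> \<Gamma>\<^sub>2; p' \<in> \<Gamma>\<^sub>2; 0 \<le> p; p < q; q \<le> l\<^sub>2; 0 \<le> p';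
          p' + a * (q - p) \<le> l\<^sub>2; q - p < \<epsilon>; q \<le> p' \<or> p' + a * (q - p) \<le> p\<rbrakk> \<Longrightarrow>
          piecewise \<Gamma>\<^sub>2 p q (\<lambda>r s. \<exists>c\<in>\<Lambda>\<^sub>1. \<forall>x\<in>\<Gamma>\<^sub>2. \<forall>y\<in>\<Gamma>\<^sub>2. r \<le> x \<longrightarrow> x < y \<longrightarrow> y \<le> s \<longrightarrow>
            measure lebesgue (\<kappa> {a * x + (p' - a * p)..<a * y + (p' - a * p)}) = c * measure lebesgue (\<kappa> {x..<y}))"
        using scal[OF a] by blast
      have a0: "0 < a" using B.mul(2) a by blast
      have "piecewise \<Gamma>\<^sub>2 p q (\<lambda>r s. \<exists>c\<in>\<Lambda>\<^sub>1. scaled \<Gamma>\<^sub>2 m (\<lambda>x. a * x + (p' - a * p)) c r s)"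
        if pq: "p \<in> \<Gamma>\<^sub>2" "q \<in> \<Gamma>\<^sub>2" "p' \<in> \<Gamma>\<^sub>2" "0 \<le> p" "p < q" "q \<le> l\<^sub>2" "0 \<le> p'"
          "p' + a * (q - p) \<le> l\<^sub>2" "q - p < \<epsilon>" "q \<le> p' \<or> p' + a * (q - p) \<le> p" for p q p'
        using sc[OF that]
      proof (rule piecewise_mono)
        fix r s assume rs: "p \<le> r" "s \<le> q" and "\<exists>c\<in>\<Lambda>\<^sub>1. \<forall>x\<in>\<Gamma>\<^sub>2. \<forall>y\<in>\<Gamma>\<^sub>2. r \<le> x \<longrightarrow> x < y \<longrightarrow> y \<le> s \<longrightarrow>
            measure lebesgue (\<kappa> {a * x + (p' - a * p)..<a * y + (p' - a * p)}) = c * measure lebesgue (\<kappa> {x..<y})"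
        then obtain c where c: "c \<in> \<Lambda>\<^sub>1" "\<And>x y. x \<in> \<Gamma>\<^sub>2 \<Longrightarrow> y \<in> \<Gamma>\<^sub>2 \<Longrightarrow> r \<le> x \<Longrightarrow> x < y \<Longrightarrow> y \<le> s \<Longrightarrow>
            \<mu> {a * x + (p' - a * p)..<a * y + (p' - a * p)} = c * \<mu> {x..<y}" unfolding \<mu>_def by blast
        have "scaled \<Gamma>\<^sub>2 m (\<lambda>x. a * x + (p' - a * p)) c r s"
        proof (rule scaledI)
          fix x y assume xy: "x \<in> \<Gamma>\<^sub>2" "y \<in> \<Gamma>\<^sub>2" "r \<le> x" "x \<le> y" "y \<le> s"
          show "m (a * y + (p' - a * p)) - m (a * x + (p' - a * p)) = c * (m y - m x)"
          proof (cases "x = y")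
            case False
            have in_\<Gamma>: "a * z + (p' - a * p) \<in> \<Gamma>\<^sub>2" if "z \<in> \<Gamma>\<^sub>2" for z
              by (intro B.add(3) B.add(4) B.stable a pq(1,3) that)
            have "a * p \<le> a * x" "a * x \<le> a * y" "a * y \<le> a * q"
              using a0 xy rs by (auto intro!: mult_left_mono)
            then have "\<mu> {a * x + (p' - a * p)..<a * y + (p' - a * p)} = m (a * y + (p' - a * p)) - m (a * x + (p' - a * p))"
              using pq by (intro \<mu>_int in_\<Gamma> xy) (auto simp: right_diff_distrib)
            moreover have "\<mu> {x..<y} = m y - m x" using pq rs xy by (intro \<mu>_int) auto
            ultimately show ?thesis using c(2)[of x y] xy False by simp
          qed simp
        qed
        then show "\<exists>c\<in>\<Lambda>\<^sub>1. scaled \<Gamma>\<^sub>2 m (\<lambda>x. a * x + (p' - a * p)) c r s" using c(1) by blast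
      qed
      then show ?thesis using \<epsilon> by blast
    qed
  qed (rule rank)
  then show ?thesis by (simp add: m_def[abs_def])
qed

section \<open>Stein's groups as groups of piecewise affine maps\<close>

lemma interval_index:
  fixes t :: "nat \<Rightarrow> real"
  assumes "t 0 \<le> x" "x < t m"
  shows "\<exists>i<m. t i \<le> x \<and> x < t (Suc i)"
  using assms(2)
proof (induction m)
  case (Suc m)
  then show ?case by (cases "x < t m") (auto intro: less_SucI)
qed (use assms(1) in simp)

lemma paffine_iff_indexed:
  assumes "0 \<in> \<Gamma>" "l \<in> \<Gamma>" "0 < l"
  shows "paffine \<Gamma> A \<Gamma>' l f \<longleftrightarrow>
    (\<exists>(m::nat) t a s. t 0 = 0 \<and> t m = l \<and> (\<forall>i\<le>m. t i \<in> \<Gamma>) \<and>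
        (\<forall>i<m. t i < t (Suc i) \<and> a i \<in> A \<and> s i \<in> \<Gamma>' \<and> (\<forall>x\<in>{t i..<t (Suc i)}. f x = a i * x + s i)))"
proof
  define R where "R p q \<longleftrightarrow> (\<exists>(m::nat) t a s. t 0 = p \<and> t m = q \<and> (\<forall>i\<le>m. t i \<in> \<Gamma>) \<and>
        (\<forall>i<m. t i < t (Suc i) \<and> a i \<in> A \<and> s i \<in> \<Gamma>' \<and> (\<forall>x\<in>{t i..<t (Suc i)}. f x = a i * x + s i)))" for p q
  assume "paffine \<Gamma> A \<Gamma>' l f"
  then have "R 0 l" unfolding paffine_def
  proof (rule piecewise_glue)
    fix p q assume pq: "p \<in> \<Gamma>" "q \<in> \<Gamma>" "p < q" "\<exists>a\<in>A. \<exists>s\<in>\<Gamma>'. \<forall>x\<in>{p..<q}. f x = a * x + s"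
    then obtain a s where as: "a \<in> A" "s \<in> \<Gamma>'" "\<forall>x\<in>{p..<q}. f x = a * x + s" by blast
    show "R p q" unfolding R_def
      by (rule exI[of _ 1], rule exI[of _ "\<lambda>i. if i = 0 then p else q"], rule exI[of _ "\<lambda>_. a"], rule exI[of _ "\<lambda>_. s"])
         (use pq as in simp)
  next
    fix p c q assume R: "R p c" "R c q"
    obtain m t a s where
      1: "t 0 = p" "t m = c" "\<forall>i\<le>m. t i \<in> \<Gamma>" "\<forall>i<m. t i < t (Suc i) \<and> a i \<in> A \<and> s i \<in> \<Gamma>' \<and> (\<forall>x\<in>{t i..<t (Suc i)}. f x = a i * x + s i)"
      using R(1) unfolding R_def by (elim exE conjE) (rule that)
    obtain m' t' a' s' where
      2: "t' 0 = c" "t' m' = q" "\<forall>i\<le>m'. t' i \<in> \<Gamma>" "\<forall>i<m'. t' i < t' (Suc i) \<and> a' i \<in> A \<and> s' i \<in> \<Gamma>' \<and> (\<forall>x\<in>{t' i..<t' (Suc i)}. f x = a' i * x + s' i)"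
      using R(2) unfolding R_def by (elim exE conjE) (rule that)
    let ?t = "\<lambda>i. if i \<le> m then t i else t' (i - m)"
    let ?a = "\<lambda>i. if i < m then a i else a' (i - m)"
    let ?s = "\<lambda>i. if i < m then s i else s' (i - m)"
    have "?t i < ?t (Suc i) \<and> ?a i \<in> A \<and> ?s i \<in> \<Gamma>' \<and> (\<forall>x\<in>{?t i..<?t (Suc i)}. f x = ?a i * x + ?s i)"
      if "i < m + m'" for i
    proof (cases "i < m")
      case True
      then show ?thesis using 1(4) by simp
    next
      case False
      define j where "j = i - m"
      have j: "i = m + j" "j < m'" using False that by (auto simp: j_def)
      have eqs: "?t i = t' j" "?t (Suc i) = t' (Suc j)" "?a i = a' j" "?s i = s' j"
        using j 1(2) 2(1) by (auto simp: Suc_diff_le)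
      show ?thesis unfolding eqs by (rule 2(4)[rule_format, OF j(2)])
    qed
    moreover have "?t (m + m') = q" using 1(2) 2(1,2) by (cases "m' = 0") auto
    moreover have "\<forall>i\<le>m + m'. ?t i \<in> \<Gamma>" using 1(3) 2(3) by auto
    ultimately show "R p q" unfolding R_def using 1(1)
      by (intro exI[of _ "m + m'"] exI[of _ ?t] exI[of _ ?a] exI[of _ ?s]) simp
  qed (use assms in auto)
  then show "\<exists>(m::nat) t a s. t 0 = 0 \<and> t m = l \<and> (\<forall>i\<le>m. t i \<in> \<Gamma>) \<and>
        (\<forall>i<m. t i < t (Suc i) \<and> a i \<in> A \<and> s i \<in> \<Gamma>' \<and> (\<forall>x\<in>{t i..<t (Suc i)}. f x = a i * x + s i))"
    by (simp only: R_def)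
next
  assume "\<exists>(m::nat) t a s. t 0 = 0 \<and> t m = l \<and> (\<forall>i\<le>m. t i \<in> \<Gamma>) \<and>
        (\<forall>i<m. t i < t (Suc i) \<and> a i \<in> A \<and> s i \<in> \<Gamma>' \<and> (\<forall>x\<in>{t i..<t (Suc i)}. f x = a i * x + s i))"
  then obtain m t a s where t: "t 0 = 0" "t m = l" "\<forall>i\<le>m::nat. t i \<in> \<Gamma>"
    "\<And>i. i < m \<Longrightarrow> t i < t (Suc i) \<and> a i \<in> A \<and> s i \<in> \<Gamma>' \<and> (\<forall>x\<in>{t i..<t (Suc i)}. f x = a i * x + s i)" by blast
  show "paffine \<Gamma> A \<Gamma>' l f" unfolding paffine_def
  proof (rule piecewiseI[of "t ` {..m}"])
    fix p q assume pq: "0 \<le> p" "p < q" "q \<le> l" "{p<..<q} \<inter> t ` {..m} = {}"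
    then obtain i where i: "i < m" "t i \<le> p" "p < t (Suc i)" using interval_index[of t p m] t by auto
    have "t (Suc i) \<notin> {p<..<q}" using pq(4) i(1) by auto
    then have "{p..<q} \<subseteq> {t i..<t (Suc i)}" using i by auto
    then show "\<exists>a\<in>A. \<exists>s\<in>\<Gamma>'. \<forall>x\<in>{p..<q}. f x = a * x + s" using t(4)[OF i(1)] by blast
  qed (use t in auto)
qed

lemma affine_piece_bound:
  fixes a s L p q :: real
  assumes "0 < a" "p < q" "\<And>x. p \<le> x \<Longrightarrow> x < q \<Longrightarrow> a * x + s < L"
  shows "a * q + s \<le> L"
proof (rule ccontr)
  assume "\<not> ?thesis"
  then have c: "(L - s) / a < q" using assms(1) by (simp add: pos_divide_less_eq mult.commute)
  define x where "x = max p ((L - s) / a)"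
  have "a * x + s < L" using assms(2,3) c by (auto simp: x_def)
  moreover have "a * ((L - s) / a) \<le> a * x" using assms(1) by (intro mult_left_mono) (auto simp: x_def)
  ultimately show False using assms(1) by simp
qed

text \<open>The breakpoints of the inverse are among the right ends of the images of the pieces.\<close>

lemma paffine_inverse:
  assumes f: "paffine \<Gamma> A \<Gamma>' l f" and bij: "bij_betw f {0..<l} {0..<l'}"
    and l: "0 \<in> \<Gamma>" "l \<in> \<Gamma>" "0 < l" and \<Gamma>: "add_group \<Gamma>" "add_group \<Gamma>'"
    and A: "\<And>a. a \<in> A \<Longrightarrow> 0 < a" "\<And>a x. a \<in> A \<Longrightarrow> a * x \<in> \<Gamma>' \<longleftrightarrow> x \<in> \<Gamma>"
    and g: "\<And>x. 0 \<le> x \<Longrightarrow> x < l \<Longrightarrow> g (f x) = x"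
  shows "paffine \<Gamma>' (inverse ` A) \<Gamma> l' g"
proof -
  obtain m t a s where t: "t 0 = 0" "t m = l" "\<forall>i\<le>m::nat. t i \<in> \<Gamma>"
    "\<And>i. i < m \<Longrightarrow> t i < t (Suc i) \<and> a i \<in> A \<and> s i \<in> \<Gamma>' \<and> (\<forall>x\<in>{t i..<t (Suc i)}. f x = a i * x + s i)"
    using f unfolding paffine_iff_indexed[OF l] by blast
  let ?D = "(\<lambda>i. a i * t (Suc i) + s i) ` {..<m}"
  have mono: "i \<le> j \<Longrightarrow> j \<le> m \<Longrightarrow> t i \<le> t j" for i j
  proof (induction j rule: dec_induct)
    case (step n)
    then show ?case using t(4)[of n] by simp
  qed simp
  show ?thesis unfolding paffine_def
  proof (rule piecewiseI[of ?D])
    show "?D \<subseteq> \<Gamma>'" using t(3,4) A(2) add_groupD(3)[OF \<Gamma>(2)] by (auto simp: Suc_le_eq)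
    fix p q assume pq: "0 \<le> p" "p < q" "q \<le> l'" "{p<..<q} \<inter> ?D = {}"
    then have "p \<in> f ` {0..<l}" using bij by (simp add: bij_betw_def)
    then obtain x where x: "0 \<le> x" "x < l" "f x = p" by auto
    then obtain i where i: "i < m" "t i \<le> x" "x < t (Suc i)" using interval_index[of t x m] t by auto
    note ti = t(4)[OF i(1)]
    have a0: "0 < a i" using A(1) ti by blast
    have px: "p = a i * x + s i" using x(3) ti i by auto
    then have "p < a i * t (Suc i) + s i" using a0 i(3) by simp
    moreover have "a i * t (Suc i) + s i \<notin> {p<..<q}" using pq(4) i(1) by blast
    ultimately have q: "q \<le> a i * t (Suc i) + s i" by simp
    have "g y = inverse (a i) * y + (- (inverse (a i) * s i))" if y: "y \<in> {p..<q}" for y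
    proof -
      define z where "z = (y - s i) / a i"
      have yz: "y = a i * z + s i" using a0 by (simp add: z_def)
      have "a i * x \<le> a i * z" "a i * z < a i * t (Suc i)" using y px yz q by auto
      then have z: "x \<le> z" "z < t (Suc i)" using a0 by auto
      then have "f z = y" using ti i yz by auto
      moreover have "0 \<le> z" "z < l" using z x mono[of "Suc i" m] i(1) t(2) by auto
      ultimately have "g y = z" using g by metis
      then show ?thesis by (simp add: z_def divide_inverse algebra_simps)
    qed
    moreover have "- (inverse (a i) * s i) \<in> \<Gamma>"
    proof (rule add_groupD(2)[OF \<Gamma>(1)])
      have "a i * (inverse (a i) * s i) = s i" using a0 by simp
      then show "inverse (a i) * s i \<in> \<Gamma>" using A(2)[of "a i" "inverse (a i) * s i"] ti by metis
    qed
    ultimately show "\<exists>b\<in>inverse ` A. \<exists>s\<in>\<Gamma>. \<forall>x\<in>{p..<q}. g x = b * x + s" using ti by blast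
  qed auto
qed

context stein
begin

abbreviation "V \<equiv> stein_maps \<Gamma> \<Lambda> l"
abbreviation "X \<equiv> {0..<l}"

lemma V_iff: "f \<in> V \<longleftrightarrow> f \<in> Bij X \<and> paffine \<Gamma> \<Lambda> \<Gamma> l f"
  unfolding stein_maps_def paffine_iff_indexed[OF add(1) l_in l_pos] by simp

lemma V_bij: "f \<in> V \<Longrightarrow> bij_betw f X X"
  by (auto simp: V_iff Bij_def)

lemma V_paffine: "f \<in> V \<Longrightarrow> paffine \<Gamma> \<Lambda> \<Gamma> l f"
  by (simp add: V_iff)

lemma subgroup_V: "subgroup V (BijGroup X)"
proof (rule subgroup.intro)
  show "V \<subseteq> carrier (BijGroup X)" by (auto simp: V_iff BijGroup_def)
  show "\<one>\<^bsub>BijGroup X\<^esub> \<in> V"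
  proof -
    have "paffine \<Gamma> \<Lambda> \<Gamma> l (\<lambda>x\<in>X. x)" unfolding paffine_def
    proof (rule piecewise_trivial)
      fix p q :: real assume "0 \<le> p" "q \<le> l"
      then have "\<forall>x\<in>{p..<q}. (\<lambda>x\<in>X. x) x = 1 * x + 0" by auto
      then show "\<exists>a\<in>\<Lambda>. \<exists>s\<in>\<Gamma>. \<forall>x\<in>{p..<q}. (\<lambda>x\<in>X. x) x = a * x + s"
        using mul(1) add(1) by blast
    qed
    then show ?thesis by (simp add: V_iff BijGroup_def id_Bij)
  qed
  show "f \<otimes>\<^bsub>BijGroup X\<^esub> g \<in> V" if "f \<in> V" "g \<in> V" for f g
  proof -
    have "paffine \<Gamma> \<Lambda> \<Gamma> l (\<lambda>x. f (g x))"
      by (rule paffine_compose[OF V_paffine[OF that(2)] V_paffine[OF that(1)]])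
         (use V_bij[OF that(2)] add_group dense l_in mul stable scale_iff in auto)
    then have "paffine \<Gamma> \<Lambda> \<Gamma> l (compose X f g)" by (rule paffine_cong) (simp add: compose_def)
    then show ?thesis using that by (simp add: V_iff BijGroup_def compose_Bij)
  qed
  show "inv\<^bsub>BijGroup X\<^esub> f \<in> V" if f: "f \<in> V" for f
  proof -
    have B: "f \<in> Bij X" using f by (simp add: V_iff)
    have "inverse ` \<Lambda> \<subseteq> \<Lambda>" using mul(3) by blast
    have "paffine \<Gamma> (inverse ` \<Lambda>) \<Gamma> l (\<lambda>x\<in>X. inv_into X f x)"
    proof (rule paffine_inverse[OF V_paffine[OF f] V_bij[OF f] add(1) l_in l_pos add_group add_group mul(2) scale_iff])
      show "(\<lambda>x\<in>X. inv_into X f x) (f x) = x" if "0 \<le> x" "x < l" for x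
        using that V_bij[OF f] by (auto simp: bij_betw_def)
    qed
    then have "paffine \<Gamma> \<Lambda> \<Gamma> l (\<lambda>x\<in>X. inv_into X f x)" using \<open>inverse ` \<Lambda> \<subseteq> \<Lambda>\<close> by (rule paffine_mono)
    then show ?thesis using inv_BijGroup[OF B] restrict_inv_into_Bij[OF B] by (simp add: V_iff)
  qed
qed

abbreviation "SG \<equiv> stein_group \<Gamma> \<Lambda> l"

lemma group_SG: "group SG"
  unfolding stein_group_def using subgroup_V group_BijGroup by (rule subgroup.subgroup_is_group)

lemma carrier_SG: "carrier SG = V" by (simp add: stein_group_def)

definition DV :: "(real \<Rightarrow> real) set" where "DV = derived SG V"

lemma commutator_subgroup_SG: "commutator_subgroup SG = (BijGroup X)\<lparr>carrier := DV\<rparr>"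
  by (simp add: commutator_subgroup_def DV_def stein_group_def)

lemma subgroup_DV_SG: "subgroup DV SG"
  unfolding DV_def using group.derived_is_subgroup[OF group_SG, of V] by (simp add: carrier_SG)

lemma DV_subset: "DV \<subseteq> V"
  using subgroup.subset[OF subgroup_DV_SG] by (simp add: carrier_SG)

lemma subgroup_DV: "subgroup DV (BijGroup X)"
  using group.incl_subgroup[OF group_BijGroup subgroup_V] subgroup_DV_SG by (simp add: stein_group_def)

subsection \<open>Supports\<close>

text \<open>
  Closed under limits from the right. An affine map other than the identity may fix a single
  point of a piece; with this closure the support is still a union of pieces.
\<close>

definition supp :: "(real \<Rightarrow> real) \<Rightarrow> real set" where
  "supp f = {x \<in> X. \<forall>\<epsilon>>0. \<exists>y. x \<le> y \<and> y < x + \<epsilon> \<and> y < l \<and> f y \<noteq> y}"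

lemma suppD: "x \<in> supp f \<Longrightarrow> 0 < \<epsilon> \<Longrightarrow> \<exists>y. x \<le> y \<and> y < x + \<epsilon> \<and> y < l \<and> f y \<noteq> y"
  by (simp add: supp_def)

lemma supp_fix: "x \<in> X \<Longrightarrow> x \<notin> supp f \<Longrightarrow> f x = x"
  by (force simp: supp_def)

lemma supp_in:
  assumes "f \<in> V"
  shows "supp f \<in> \<B>"
proof (rule algebraI)
  show "supp f \<subseteq> X" by (auto simp: supp_def)
  show "piecewise \<Gamma> 0 l (\<lambda>p q. {p..<q} \<subseteq> supp f \<or> {p..<q} \<inter> supp f = {})"
    using V_paffine[OF assms] unfolding paffine_def
  proof (rule piecewise_mono)
    fix p q assume pq: "0 \<le> p" "q \<le> l" and "\<exists>a\<in>\<Lambda>. \<exists>s\<in>\<Gamma>. \<forall>x\<in>{p..<q}. f x = a * x + s"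
    then obtain a s where f: "\<And>x. x \<in> {p..<q} \<Longrightarrow> f x = a * x + s" by blast
    show "{p..<q} \<subseteq> supp f \<or> {p..<q} \<inter> supp f = {}"
    proof (cases "a = 1 \<and> s = 0")
      case True
      have "x \<notin> supp f" if x: "x \<in> {p..<q}" for x
      proof
        assume "x \<in> supp f"
        then obtain y where "x \<le> y" "y < x + (q - x)" "f y \<noteq> y"
          using suppD[of x f "q - x"] x by auto
        then show False using f[of y] True x by auto
      qed
      then show ?thesis by blast
    next
      case False
      have "x \<in> supp f" if x: "x \<in> {p..<q}" for x
        unfolding supp_def
      proof (intro CollectI conjI allI impI)
        show "x \<in> X" using x pq by auto
        fix \<epsilon> :: real assume "0 < \<epsilon>"
        define y where "y = (x + min (x + \<epsilon>) q) / 2"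
        have y: "x < y" "y < x + \<epsilon>" "y < q" using x \<open>0 < \<epsilon>\<close> by (auto simp: y_def)
        show "\<exists>y. x \<le> y \<and> y < x + \<epsilon> \<and> y < l \<and> f y \<noteq> y"
        proof (cases "f x = x")
          case True
          have "f y \<noteq> y"
          proof
            assume "f y = y"
            then have 1: "a * y + s = y" "a * x + s = x" using f[of x] f[of y] True x y by auto
            then have "(a - 1) * (y - x) = 0" by (simp add: algebra_simps)
            then have "a = 1" using y by simp
            then show False using 1 False by simp
          qed
          then show ?thesis using y pq by (intro exI[of _ y]) auto
        next
          case False
          then show ?thesis using x pq \<open>0 < \<epsilon>\<close> by (intro exI[of _ x]) auto
        qed
      qed
      then show ?thesis by blast
    qed
  qed
qed

lemma supp_subset:
  assumes B: "B \<in> \<B>" and fixed: "\<And>x. x \<in> X \<Longrightarrow> x \<notin> B \<Longrightarrow> f x = x"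
  shows "supp f \<subseteq> B"
proof
  fix x assume x: "x \<in> supp f"
  show "x \<in> B"
  proof (rule ccontr)
    assume "x \<notin> B"
    then have "x \<in> X - B" using x by (auto simp: supp_def)
    then obtain p q where "p \<le> x" "x < q" "{p..<q} \<subseteq> X - B"
      using algebra_right_open[OF interval_algebra_binary(3)[OF space_in B], of x] by metis
    moreover have "{x..<q} \<subseteq> {p..<q}" using \<open>p \<le> x\<close> by auto
    ultimately have q: "x < q" "{x..<q} \<subseteq> X - B" by (blast, meson subset_trans)
    then obtain y where "x \<le> y" "y < x + (q - x)" "f y \<noteq> y"
      using suppD[OF x, of "q - x"] by auto
    then show False using fixed[of y] q by (auto simp: subset_iff)
  qed
qed

lemma image_in:
  assumes h: "h \<in> V" and B: "B \<in> \<B>"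
  shows "h ` B \<in> \<B>"
  using B
proof (rule algebra_induct[where R = "\<lambda>B. h ` B \<in> \<B>"])
  show "h ` {} \<in> \<B>" using interval_algebra_empty by simp
  show "h ` (U \<union> W) \<in> \<B>" if "h ` U \<in> \<B>" "h ` W \<in> \<B>" for U W
    unfolding image_Un by (rule interval_algebra_binary(1)[OF that])
  fix p q assume pq: "p \<in> \<Gamma>" "q \<in> \<Gamma>" "0 \<le> p" "p < q" "q \<le> l"
  show "h ` {p..<q} \<in> \<B>"
    using V_paffine[OF h] unfolding paffine_def
  proof (rule piecewise_glue[where R = "\<lambda>p q. h ` {p..<q} \<in> \<B>"])
    fix p q assume pq: "p \<in> \<Gamma>" "q \<in> \<Gamma>" "0 \<le> p" "p < q" "q \<le> l" "\<exists>a\<in>\<Lambda>. \<exists>s\<in>\<Gamma>. \<forall>x\<in>{p..<q}. h x = a * x + s"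
    then obtain a s where as: "a \<in> \<Lambda>" "s \<in> \<Gamma>" and hx: "\<And>x. x \<in> {p..<q} \<Longrightarrow> h x = a * x + s" by blast
    have a0: "0 < a" using mul(2) as by blast
    have in_X: "h x \<in> X" if "x \<in> X" for x using V_bij[OF h] that by (auto simp: bij_betw_def)
    have "h ` {p..<q} = {a * p + s..<a * q + s}"
    proof (intro equalityI subsetI)
      fix y assume "y \<in> {a * p + s..<a * q + s}"
      then have "(y - s) / a \<in> {p..<q}" using a0 by (auto simp: pos_le_divide_eq pos_divide_less_eq mult.commute)
      moreover have "h ((y - s) / a) = y" using hx[OF calculation] a0 by simp
      ultimately show "y \<in> h ` {p..<q}" by (metis imageI)
    qed (use hx a0 in auto)
    moreover have "a * q + s \<le> l"
    proof (rule affine_piece_bound[OF a0 pq(4)])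
      fix x assume "p \<le> x" "x < q"
      then show "a * x + s < l" using hx[of x] in_X[of x] pq by auto
    qed
    moreover have "0 \<le> a * p + s" using hx[of p] in_X[of p] pq by auto
    ultimately show "h ` {p..<q} \<in> \<B>" using add(3) stable as pq by (auto intro!: interval_algebra_interval)
  next
    fix p c q assume pcq: "p < c" "c < q" and R: "h ` {p..<c} \<in> \<B>" "h ` {c..<q} \<in> \<B>"
    have "h ` {p..<q} = h ` {p..<c} \<union> h ` {c..<q}" using pcq by (simp add: ivl_disj_un flip: image_Un)
    then show "h ` {p..<q} \<in> \<B>" using interval_algebra_binary(1)[OF R] by simp
  qed (use pq in auto)
qed

text \<open>
  To the right of a moved point \<open>y\<close> the map moves an interval by almost \<open>f y - y\<close>, provided that
  the interval is short compared with this distance.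
\<close>

lemma displace:
  assumes f: "f \<in> V" and B: "B \<in> \<B>" "B \<noteq> {}" "B \<subseteq> supp f"
  shows "\<exists>C\<in>\<B>. C \<noteq> {} \<and> C \<subseteq> B \<and> f ` C \<inter> C = {}"
proof -
  obtain p q where pq: "p \<in> \<Gamma>" "q \<in> \<Gamma>" "0 \<le> p" "p < q" "q \<le> l" "{p..<q} \<subseteq> B"
    using algebra_nonempty[OF B(1,2)] by blast
  have "p \<in> supp f" using pq B(3) by auto
  then obtain y where y: "p \<le> y" "y < p + (q - p)" "f y \<noteq> y"
    using suppD[of p f "q - p"] pq(4) by auto
  have "y \<in> X" using y pq by auto
  then obtain p1 q1 a s where 1: "p1 \<le> y" "y < q1" "a \<in> \<Lambda>" "\<forall>x\<in>{p1..<q1}. f x = a * x + s"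
    using paffine_point[OF V_paffine[OF f] add_group dense l_in] by (metis atLeastLessThan_iff)
  have a0: "0 < a" using mul(2) 1 by blast
  define \<delta> where "\<delta> = \<bar>f y - y\<bar> / (a + 1)"
  have \<delta>: "0 < \<delta>" "(a + 1) * \<delta> = \<bar>f y - y\<bar>" using y a0 by (auto simp: \<delta>_def)
  have "y < min (min q q1) (y + \<delta>)" using y 1 \<delta> by auto
  then obtain r t where rt: "r \<in> \<Gamma>" "t \<in> \<Gamma>" "y < r" "r < t" "t < min (min q q1) (y + \<delta>)" using between2 by blast
  have "f z \<noteq> w" if zw: "z \<in> {r..<t}" "w \<in> {r..<t}" for z w
  proof
    assume eq: "f z = w"
    have "f z = a * z + s" "f y = a * y + s" using 1 zw rt by auto
    then have "f y - y = (w - y) - a * (z - y)" using eq by (simp add: algebra_simps)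
    moreover have "0 < w - y" "w - y < \<delta>" "0 < z - y" "z - y < \<delta>" using zw rt by auto
    moreover have "0 < a * (z - y)" "a * (z - y) < a * \<delta>" using calculation a0 by auto
    moreover have "a * \<delta> + \<delta> = \<bar>f y - y\<bar>" using \<delta>(2) by (simp add: distrib_right)
    moreover have "0 < a * \<delta>" using a0 \<delta>(1) by simp
    ultimately have "\<bar>f y - y\<bar> < \<bar>f y - y\<bar>" using \<delta>(1) unfolding abs_less_iff by (intro conjI; linarith)
    then show False by simp
  qed
  then have "f ` {r..<t} \<inter> {r..<t} = {}" by blast
  moreover have "{r..<t} \<in> \<B>" using rt y pq by (intro interval_algebra_interval) auto
  moreover have "{r..<t} \<subseteq> B" using rt y pq by (auto simp: subset_iff)
  ultimately show ?thesis using rt by (intro bexI[of _ "{r..<t}"]) auto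
qed

end

section \<open>Three-cycles of intervals\<close>

context stein
begin

definition swap :: "real \<Rightarrow> real \<Rightarrow> real \<Rightarrow> real \<Rightarrow> real \<Rightarrow> real" where
  "swap p d q a = (\<lambda>x\<in>X. if p \<le> x \<and> x < p + d then q + a * (x - p)
     else if q \<le> x \<and> x < q + a * d then p + (x - q) / a else x)"

definition swappable :: "real \<Rightarrow> real \<Rightarrow> real \<Rightarrow> real \<Rightarrow> bool" where
  "swappable p d q a \<longleftrightarrow> p \<in> \<Gamma> \<and> d \<in> \<Gamma> \<and> q \<in> \<Gamma> \<and> a \<in> \<Lambda> \<and> 0 < d \<and> 0 \<le> p \<and> p + d \<le> l \<and>
     0 \<le> q \<and> q + a * d \<le> l \<and> (p + d \<le> q \<or> q + a * d \<le> p)"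

context
  fixes p d q a
  assumes sw: "swappable p d q a"
begin

lemma swap_a: "0 < a" using sw mul(2) by (auto simp: swappable_def)

lemma swap_first: "p \<le> x \<Longrightarrow> x < p + d \<Longrightarrow> swap p d q a x = q + a * (x - p)"
  using sw by (auto simp: swap_def swappable_def)

lemma swap_second: "q \<le> x \<Longrightarrow> x < q + a * d \<Longrightarrow> swap p d q a x = p + (x - q) / a"
  using sw by (auto simp: swap_def swappable_def)

lemma swap_other: "x \<in> X \<Longrightarrow> \<not> (p \<le> x \<and> x < p + d) \<Longrightarrow> \<not> (q \<le> x \<and> x < q + a * d) \<Longrightarrow> swap p d q a x = x"
  by (auto simp: swap_def)

lemma first_image: "p \<le> x \<Longrightarrow> x < p + d \<Longrightarrow> q \<le> q + a * (x - p) \<and> q + a * (x - p) < q + a * d"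
  using swap_a by simp

lemma second_image: "q \<le> x \<Longrightarrow> x < q + a * d \<Longrightarrow> p \<le> p + (x - q) / a \<and> p + (x - q) / a < p + d"
  using swap_a by (simp add: pos_divide_less_eq mult.commute)

lemma swap_involution: "x \<in> X \<Longrightarrow> swap p d q a x \<in> X \<and> swap p d q a (swap p d q a x) = x"
proof -
  assume x: "x \<in> X"
  have b: "0 \<le> p" "p + d \<le> l" "0 \<le> q" "q + a * d \<le> l" using sw by (auto simp: swappable_def)
  consider "p \<le> x" "x < p + d" | "q \<le> x" "x < q + a * d"
    | "\<not> (p \<le> x \<and> x < p + d)" "\<not> (q \<le> x \<and> x < q + a * d)" by blast
  then show ?thesis
  proof cases
    case 1
    then have "swap p d q a x = q + a * (x - p)" "q \<le> q + a * (x - p)" "q + a * (x - p) < q + a * d"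
      using swap_first first_image by blast+
    moreover have "swap p d q a (q + a * (x - p)) = x"
      using swap_second[OF calculation(2,3)] swap_a by simp
    moreover have "q + a * (x - p) \<in> X"
      unfolding atLeastLessThan_iff using calculation(2,3) b by (intro conjI; linarith)
    ultimately show ?thesis by (simp only:)
  next
    case 2
    then have "swap p d q a x = p + (x - q) / a" "p \<le> p + (x - q) / a" "p + (x - q) / a < p + d"
      using swap_second second_image by blast+
    then show ?thesis using swap_first[of "p + (x - q) / a"] swap_a b by auto
  next
    case 3
    then show ?thesis using swap_other x by simp
  qed
qed

lemma swap_in_V: "swap p d q a \<in> V"
proof -
  have "bij_betw (swap p d q a) X X"
    by (rule bij_betw_byWitness[where f' = "swap p d q a"]) (use swap_involution in auto)
  then have "swap p d q a \<in> Bij X" by (simp add: Bij_def swap_def)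
  moreover have "paffine \<Gamma> \<Lambda> \<Gamma> l (swap p d q a)" unfolding paffine_def
  proof (rule piecewiseI[of "{p, p + d, q, q + a * d}"])
    have in_\<Gamma>: "p \<in> \<Gamma>" "d \<in> \<Gamma>" "q \<in> \<Gamma>" "a \<in> \<Lambda>" using sw by (auto simp: swappable_def)
    then show "{p, p + d, q, q + a * d} \<subseteq> \<Gamma>" using add(3) stable by auto
    fix r s assume rs: "0 \<le> r" "r < s" "s \<le> l" and gap: "{r<..<s} \<inter> {p, p + d, q, q + a * d} = {}"
    have g: "p \<notin> {r<..<s}" "p + d \<notin> {r<..<s}" "q \<notin> {r<..<s}" "q + a * d \<notin> {r<..<s}" using gap by blast+
    consider "p \<le> r" "s \<le> p + d" | "q \<le> r" "s \<le> q + a * d"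
      | "s \<le> p \<or> p + d \<le> r" "s \<le> q \<or> q + a * d \<le> r" using g rs(2) by fastforce
    then show "\<exists>a'\<in>\<Lambda>. \<exists>s'\<in>\<Gamma>. \<forall>x\<in>{r..<s}. swap p d q a x = a' * x + s'"
    proof cases
      case 1
      then have "\<forall>x\<in>{r..<s}. swap p d q a x = a * x + (q - a * p)"
        using swap_first by (auto simp: right_diff_distrib)
      moreover have "q - a * p \<in> \<Gamma>" using in_\<Gamma> add(4) stable by blast
      ultimately show ?thesis using in_\<Gamma> by blast
    next
      case 2
      then have "\<forall>x\<in>{r..<s}. swap p d q a x = (1 / a) * x + (p - q / a)"
        using swap_second by (auto simp: diff_divide_distrib)
      moreover have "p - q / a \<in> \<Gamma>" using in_\<Gamma> add(4) divide_in by blast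
      moreover have "1 / a \<in> \<Lambda>" using mul(6) in_\<Gamma> by blast
      ultimately show ?thesis by blast
    next
      case 3
      then have "\<forall>x\<in>{r..<s}. swap p d q a x = 1 * x + 0" using rs by (auto intro!: swap_other)
      then show ?thesis using mul(1) add(1) by blast
    qed
  qed auto
  ultimately show ?thesis by (simp add: V_iff)
qed

end

lemma mult_app: "f \<in> V \<Longrightarrow> g \<in> V \<Longrightarrow> x \<in> X \<Longrightarrow> (f \<otimes>\<^bsub>SG\<^esub> g) x = f (g x)"
  by (simp add: stein_group_def BijGroup_def V_iff compose_def)

lemma inv_swap:
  assumes "swappable p d q a"
  shows "inv\<^bsub>SG\<^esub> (swap p d q a) = swap p d q a"
proof (rule group.inv_equality[OF group_SG])
  let ?f = "swap p d q a"
  have f: "?f \<in> V" using swap_in_V[OF assms] .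
  show "?f \<otimes>\<^bsub>SG\<^esub> ?f = \<one>\<^bsub>SG\<^esub>"
  proof (rule extensionalityI[of _ X])
    show "?f \<otimes>\<^bsub>SG\<^esub> ?f \<in> extensional X" using f by (simp add: stein_group_def BijGroup_def V_iff)
    show "\<one>\<^bsub>SG\<^esub> \<in> extensional X" by (simp add: stein_group_def BijGroup_def)
    show "(?f \<otimes>\<^bsub>SG\<^esub> ?f) x = \<one>\<^bsub>SG\<^esub> x" if "x \<in> X" for x
      using mult_app[OF f f that] swap_involution[OF assms that] that by (simp add: stein_group_def BijGroup_def)
  qed
qed (use swap_in_V[OF assms] carrier_SG in auto)

text \<open>
  A commutator of two exchanges of intervals, one interval being common to both, permutes
  the three intervals cyclically.
\<close>

lemma three_cycle:
  assumes sw: "swappable x d y a" "swappable x d z b" and disj: "y + a * d \<le> z \<or> z + b * d \<le> y"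
  obtains c where "c \<in> DV"
    "\<And>u. x \<le> u \<Longrightarrow> u < x + d \<Longrightarrow> c u = y + a * (u - x)"
    "\<And>u. y \<le> u \<Longrightarrow> u < y + a * d \<Longrightarrow> c u = z + b * ((u - y) / a)"
    "\<And>u. z \<le> u \<Longrightarrow> u < z + b * d \<Longrightarrow> c u = x + (u - z) / b"
    "\<And>u. u \<in> X \<Longrightarrow> \<not> (x \<le> u \<and> u < x + d) \<Longrightarrow> \<not> (y \<le> u \<and> u < y + a * d) \<Longrightarrow>
        \<not> (z \<le> u \<and> u < z + b * d) \<Longrightarrow> c u = u"
proof -
  let ?\<sigma> = "swap x d y a" and ?\<tau> = "swap x d z b"
  let ?c = "?\<sigma> \<otimes>\<^bsub>SG\<^esub> ?\<tau> \<otimes>\<^bsub>SG\<^esub> inv\<^bsub>SG\<^esub> ?\<sigma> \<otimes>\<^bsub>SG\<^esub> inv\<^bsub>SG\<^esub> ?\<tau>"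
  have in_V: "?\<sigma> \<in> V" "?\<tau> \<in> V" using sw swap_in_V by auto
  have "?c \<in> DV" unfolding DV_def derived_def
    by (intro generate.incl UN_I[OF in_V(1)] UN_I[OF in_V(2)] singletonI)
  have app: "?c u = ?\<sigma> (?\<tau> (?\<sigma> (?\<tau> u)))" if "u \<in> X" for u
  proof -
    interpret group SG by (rule group_SG)
    have "f \<otimes>\<^bsub>SG\<^esub> g \<in> V" if "f \<in> V" "g \<in> V" for f g using m_closed[of f g] that by (simp add: carrier_SG)
    then have 1: "?\<sigma> \<otimes>\<^bsub>SG\<^esub> ?\<tau> \<in> V" "?\<sigma> \<otimes>\<^bsub>SG\<^esub> ?\<tau> \<otimes>\<^bsub>SG\<^esub> ?\<sigma> \<in> V" using in_V by blast+
    have 2: "?\<tau> u \<in> X" using swap_involution[OF sw(2) that] by blast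
    then have 3: "?\<sigma> (?\<tau> u) \<in> X" using swap_involution[OF sw(1)] by blast
    show ?thesis
      unfolding inv_swap[OF sw(1)] inv_swap[OF sw(2)]
      by (simp only: mult_app[OF 1(2) in_V(2) that] mult_app[OF 1(1) in_V(1) 2] mult_app[OF in_V 3])
  qed
  have bounds: "0 \<le> x" "x + d \<le> l" "0 \<le> y" "y + a * d \<le> l" "0 \<le> z" "z + b * d \<le> l"
    "x + d \<le> y \<or> y + a * d \<le> x" "x + d \<le> z \<or> z + b * d \<le> x" "0 < a" "0 < b"
    using sw swap_a by (auto simp: swappable_def)
  show thesis
  proof (rule that[of ?c])
    show "?c \<in> DV" by fact
    show "?c u = y + a * (u - x)" if u: "x \<le> u" "u < x + d" for u
    proof -
      let ?w = "z + b * (u - x)"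
      have w: "z \<le> ?w" "?w < z + b * d" using first_image[OF sw(2) u] by auto
      have \<tau>: "?\<tau> u = ?w" by (rule swap_first[OF sw(2) u])
      have \<tau>': "?\<tau> ?w = u" unfolding swap_second[OF sw(2) w] using bounds(10) by simp
      have "?\<sigma> v = v" if "z \<le> v" "v < z + b * d" for v
        by (rule swap_other[OF sw(1)]) (use that bounds disj in auto)
      then have \<sigma>: "?\<sigma> ?w = ?w" using w by blast
      have uX: "u \<in> X" using u bounds by auto
      show ?thesis by (simp only: app[OF uX] \<tau> \<tau>' \<sigma> swap_first[OF sw(1) u])
    qed
    show "?c u = z + b * ((u - y) / a)" if u: "y \<le> u" "u < y + a * d" for u
    proof -
      let ?w = "x + (u - y) / a"
      have w: "x \<le> ?w" "?w < x + d" using second_image[OF sw(1) u] by auto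
      have "?\<tau> u = u" by (rule swap_other[OF sw(2)]) (use u bounds disj in auto)
      moreover have "?\<sigma> u = ?w" using swap_second[OF sw(1) u] .
      moreover have "?\<tau> ?w = z + b * (?w - x)" using swap_first[OF sw(2) w] .
      moreover have "?\<sigma> (z + b * (?w - x)) = z + b * (?w - x)"
        by (rule swap_other[OF sw(1)]) (use first_image[OF sw(2) w] bounds disj in auto)
      ultimately show ?thesis using app[of u] u bounds by auto
    qed
    show "?c u = x + (u - z) / b" if u: "z \<le> u" "u < z + b * d" for u
    proof -
      let ?w = "x + (u - z) / b"
      have w: "x \<le> ?w" "?w < x + d" using second_image[OF sw(2) u] by auto
      let ?v = "y + a * (?w - x)"
      have v: "y \<le> ?v" "?v < y + a * d" using first_image[OF sw(1) w] by auto
      have "?\<tau> u = ?w" using swap_second[OF sw(2) u] .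
      moreover have "?\<sigma> ?w = ?v" using swap_first[OF sw(1) w] .
      moreover have "?\<tau> ?v = ?v" by (rule swap_other[OF sw(2)]) (use v bounds disj in auto)
      moreover have "?\<sigma> ?v = ?w" using swap_second[OF sw(1) v] bounds by simp
      ultimately show ?thesis using app[of u] u bounds by auto
    qed
    show "?c u = u" if "u \<in> X" "\<not> (x \<le> u \<and> u < x + d)" "\<not> (y \<le> u \<and> u < y + a * d)" "\<not> (z \<le> u \<and> u < z + b * d)" for u
      using app[OF that(1)] swap_other[OF sw(1) that(1,2,3)] swap_other[OF sw(2) that(1,2,4)] by simp
  qed
qed

lemma consecutive_cycle:
  assumes "p \<in> \<Gamma>" "d \<in> \<Gamma>" "0 < d" "0 \<le> p" "p + 3 * d \<le> l"
  obtains c where "c \<in> DV"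
    "\<And>u. p \<le> u \<Longrightarrow> u < p + 2 * d \<Longrightarrow> c u = u + d"
    "\<And>u. p + 2 * d \<le> u \<Longrightarrow> u < p + 3 * d \<Longrightarrow> c u = u - 2 * d"
    "\<And>u. u \<in> X \<Longrightarrow> \<not> (p \<le> u \<and> u < p + 3 * d) \<Longrightarrow> c u = u"
proof -
  have in_\<Gamma>: "p + d \<in> \<Gamma>" "p + 2 * d \<in> \<Gamma>" using assms add(3) add(7) by auto
  have sw: "swappable p d (p + d) 1" "swappable p d (p + 2 * d) 1"
    using assms in_\<Gamma> mul(1) by (auto simp: swappable_def)
  have "(p + d) + 1 * d \<le> p + 2 * d \<or> (p + 2 * d) + 1 * d \<le> p + d" by simp
  from sw this show thesis
  proof (rule three_cycle)
    fix c assume c: "c \<in> DV"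
    "\<And>u. p \<le> u \<Longrightarrow> u < p + d \<Longrightarrow> c u = (p + d) + 1 * (u - p)"
    "\<And>u. p + d \<le> u \<Longrightarrow> u < (p + d) + 1 * d \<Longrightarrow> c u = (p + 2 * d) + 1 * ((u - (p + d)) / 1)"
    "\<And>u. p + 2 * d \<le> u \<Longrightarrow> u < (p + 2 * d) + 1 * d \<Longrightarrow> c u = p + (u - (p + 2 * d)) / 1"
    "\<And>u. u \<in> X \<Longrightarrow> \<not> (p \<le> u \<and> u < p + d) \<Longrightarrow> \<not> (p + d \<le> u \<and> u < (p + d) + 1 * d) \<Longrightarrow>
        \<not> (p + 2 * d \<le> u \<and> u < (p + 2 * d) + 1 * d) \<Longrightarrow> c u = u"
  show thesis
  proof (rule that[of c])
    show "c \<in> DV" by fact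
    show "c u = u + d" if "p \<le> u" "u < p + 2 * d" for u
      using c(2)[of u] c(3)[of u] that by (cases "u < p + d") auto
    show "c u = u - 2 * d" if "p + 2 * d \<le> u" "u < p + 3 * d" for u
      using c(4)[of u] that by simp
    show "c u = u" if "u \<in> X" "\<not> (p \<le> u \<and> u < p + 3 * d)" for u
      by (rule c(5)) (use that assms(3) in auto)
  qed
  qed
qed

text \<open>
  Two three-cycles of intervals of length \<open>d\<close> with one interval in common. They do not commute,
  and their product permutes five intervals cyclically; so its order on \<open>p\<close> is \<open>5\<close>, which does not
  divide \<open>12\<close>.
\<close>

lemma two_cycles_within:
  assumes "B \<in> \<B>" "B \<noteq> {}"
  obtains p d f g where "p \<in> \<Gamma>" "0 < d" "0 \<le> p" "p + 5 * d \<le> l" "{p..<p + 5 * d} \<subseteq> B" "f \<in> DV" "g \<in> DV"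
    "supp f \<subseteq> B" "supp g \<subseteq> B" "\<And>x. x \<in> X \<Longrightarrow> x \<notin> B \<Longrightarrow> f x = x" "\<And>x. x \<in> X \<Longrightarrow> x \<notin> B \<Longrightarrow> g x = x"
    "f p = p + d" "f (p + d) = p + 2 * d" "f (p + 2 * d) = p" "f (p + 3 * d) = p + 3 * d" "f (p + 4 * d) = p + 4 * d"
    "g p = p" "g (p + d) = p + d" "g (p + 2 * d) = p + 3 * d" "g (p + 3 * d) = p + 4 * d" "g (p + 4 * d) = p + 2 * d"
proof -
  obtain p q where pq: "p \<in> \<Gamma>" "q \<in> \<Gamma>" "0 \<le> p" "p < q" "q \<le> l" "{p..<q} \<subseteq> B"
    using algebra_nonempty[OF assms] by blast
  obtain d where d: "d \<in> \<Gamma>" "0 < d" "d < (q - p) / 5" using between[of 0 "(q - p) / 5"] pq by auto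
  have dq: "p + 5 * d \<le> q" using d(3) by simp
  have sub: "{p..<p + 5 * d} \<subseteq> B" using pq(6) dq by (auto simp: subset_iff)
  obtain f where f: "f \<in> DV" "\<And>u. p \<le> u \<Longrightarrow> u < p + 2 * d \<Longrightarrow> f u = u + d"
    "\<And>u. p + 2 * d \<le> u \<Longrightarrow> u < p + 3 * d \<Longrightarrow> f u = u - 2 * d"
    "\<And>u. u \<in> X \<Longrightarrow> \<not> (p \<le> u \<and> u < p + 3 * d) \<Longrightarrow> f u = u"
    by (rule consecutive_cycle[OF pq(1) d(1,2) pq(3)]) (use pq dq d in auto)
  have p2: "p + 2 * d \<in> \<Gamma>" using add(3) add(7) pq(1) d(1) by blast
  obtain g where g: "g \<in> DV" "\<And>u. p + 2 * d \<le> u \<Longrightarrow> u < p + 2 * d + 2 * d \<Longrightarrow> g u = u + d"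
    "\<And>u. p + 2 * d + 2 * d \<le> u \<Longrightarrow> u < p + 2 * d + 3 * d \<Longrightarrow> g u = u - 2 * d"
    "\<And>u. u \<in> X \<Longrightarrow> \<not> (p + 2 * d \<le> u \<and> u < p + 2 * d + 3 * d) \<Longrightarrow> g u = u"
    by (rule consecutive_cycle[OF p2 d(1,2)]) (use pq dq d in auto)
  have fB: "f x = x" if "x \<in> X" "x \<notin> B" for x
  proof -
    have "x \<notin> {p..<p + 5 * d}" using that sub by blast
    then show ?thesis using f(4)[OF that(1)] d(2) by auto
  qed
  have gB: "g x = x" if "x \<in> X" "x \<notin> B" for x
  proof -
    have "x \<notin> {p..<p + 5 * d}" using that sub by blast
    then show ?thesis using g(4)[OF that(1)] d(2) by auto
  qed
  have ev: "f p = p + d" "f (p + d) = p + 2 * d" "f (p + 2 * d) = p" "f (p + 3 * d) = p + 3 * d" "f (p + 4 * d) = p + 4 * d"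
    using f(2)[of p] f(2)[of "p + d"] f(3)[of "p + 2 * d"] f(4)[of "p + 3 * d"] f(4)[of "p + 4 * d"] pq d(2) dq by auto
  have ev': "g p = p" "g (p + d) = p + d" "g (p + 2 * d) = p + 3 * d" "g (p + 3 * d) = p + 4 * d" "g (p + 4 * d) = p + 2 * d"
    using g(4)[of p] g(4)[of "p + d"] g(2)[of "p + 2 * d"] g(2)[of "p + 3 * d"] g(3)[of "p + 4 * d"] pq d(2) dq by auto
  have "p + 5 * d \<le> l" using dq pq(5) by simp
  from that[OF pq(1) d(2) pq(3) this sub f(1) g(1) supp_subset[OF assms(1) fB] supp_subset[OF assms(1) gB] fB gB ev ev']
  show thesis .
qed

lemma support_group_DV: "support_group X DV \<B> supp"
proof (rule support_group.intro)
  show "subgroup DV (BijGroup X)" by (rule subgroup_DV)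
  show "B \<subseteq> X" if "B \<in> \<B>" for B using that by (rule interval_algebra_subset)
  show "B - C \<in> \<B>" if "B \<in> \<B>" "C \<in> \<B>" for B C using that by (rule interval_algebra_binary(3))
  show "h ` B \<in> \<B>" if "h \<in> DV" "B \<in> \<B>" for h B using that DV_subset image_in by blast
  show "supp f \<in> \<B>" if "f \<in> DV" for f using that DV_subset supp_in by blast
  show "f x = x" if "f \<in> DV" "x \<in> X" "x \<notin> supp f" for f x using that supp_fix by blast
  show "\<exists>C\<in>\<B>. C \<noteq> {} \<and> C \<subseteq> B \<and> f ` C \<inter> C = {}"
    if "f \<in> DV" "B \<in> \<B>" "B \<noteq> {}" "B \<subseteq> supp f" for f B using that DV_subset displace by blast
next
  fix B assume B: "B \<in> \<B>" "B \<noteq> {}"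
  then show "\<exists>f\<in>DV. \<exists>g\<in>DV. supp f \<subseteq> B \<and> supp g \<subseteq> B \<and> (\<exists>x\<in>X. f (g x) \<noteq> g (f x))"
  proof (rule two_cycles_within)
    fix p d f g
    assume pd: "0 < d" "0 \<le> p" "p + 5 * d \<le> l" and fg: "f \<in> DV" "g \<in> DV" "supp f \<subseteq> B" "supp g \<subseteq> B"
      and ev: "f (p + 2 * d) = p" "f (p + 3 * d) = p + 3 * d" "g p = p" "g (p + 2 * d) = p + 3 * d"
    have "f (g (p + 2 * d)) \<noteq> g (f (p + 2 * d))" using ev pd by simp
    moreover have "p + 2 * d \<in> X" using pd by auto
    ultimately show ?thesis using fg by blast
  qed
next
  fix B assume B: "B \<in> \<B>" "B \<noteq> {}"
  then show "\<exists>g\<in>DV. supp g \<subseteq> B \<and> (\<exists>x\<in>X. (g ^^ 12) x \<noteq> x)"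
  proof (rule two_cycles_within)
    fix p d f g
    assume pd: "0 < d" "0 \<le> p" "p + 5 * d \<le> l" and fg: "f \<in> DV" "g \<in> DV"
      and fixed: "\<And>x. x \<in> X \<Longrightarrow> x \<notin> B \<Longrightarrow> f x = x" "\<And>x. x \<in> X \<Longrightarrow> x \<notin> B \<Longrightarrow> g x = x"
      and ev: "f p = p + d" "f (p + d) = p + 2 * d" "f (p + 2 * d) = p" "f (p + 3 * d) = p + 3 * d" "f (p + 4 * d) = p + 4 * d"
        "g p = p" "g (p + d) = p + d" "g (p + 2 * d) = p + 3 * d" "g (p + 3 * d) = p + 4 * d" "g (p + 4 * d) = p + 2 * d"
    let ?h = "f \<otimes>\<^bsub>SG\<^esub> g"
    have h: "?h \<in> DV" using subgroup.m_closed[OF subgroup_DV_SG fg(1,2)] .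
    have app: "?h x = f (g x)" if "x \<in> X" for x using mult_app fg DV_subset that by blast
    have "supp ?h \<subseteq> B" by (rule supp_subset[OF B(1)]) (simp add: app fixed)
    moreover have "(?h ^^ 12) p = p + 2 * d"
    proof -
      have h: "?h p = p + d" "?h (p + d) = p + 2 * d" "?h (p + 2 * d) = p + 3 * d" "?h (p + 3 * d) = p + 4 * d"
        "?h (p + 4 * d) = p"
        using pd by (subst app; simp add: ev)+
      have "(12::nat) = Suc (Suc (Suc (Suc (Suc (Suc (Suc (Suc (Suc (Suc (Suc (Suc 0)))))))))))" by simp
      then show ?thesis by (simp only: funpow.simps o_apply id_apply h)
    qed
    moreover have "p \<in> X" using pd by auto
    ultimately show ?thesis using h pd by (intro bexI[of _ ?h]) (auto intro!: bexI[of _ p])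
  qed
qed

text \<open>
  Two overlapping three-cycles of intervals of the same length \<open>d\<close> move every point of the
  interval they cover: their displacements \<open>d\<close> and \<open>- 2 * d\<close> never cancel.
\<close>

lemma interval_is_support:
  assumes pq: "p \<in> \<Gamma>" "q \<in> \<Gamma>" "0 \<le> p" "p < q" "q \<le> l"
  shows "\<exists>f\<in>DV. supp f = {p..<q}"
proof -
  obtain d where d: "d \<in> \<Gamma>" "(q - p) / 6 < d" "d < (q - p) / 3" using between[of "(q - p) / 6" "(q - p) / 3"] pq by auto
  have d0: "0 < d" "p + 3 * d < q" "q < p + 6 * d" using d pq by auto
  obtain f where f: "f \<in> DV" "\<And>u. p \<le> u \<Longrightarrow> u < p + 2 * d \<Longrightarrow> f u = u + d"
    "\<And>u. p + 2 * d \<le> u \<Longrightarrow> u < p + 3 * d \<Longrightarrow> f u = u - 2 * d"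
    "\<And>u. u \<in> X \<Longrightarrow> \<not> (p \<le> u \<and> u < p + 3 * d) \<Longrightarrow> f u = u"
    by (rule consecutive_cycle[OF pq(1) d(1) d0(1) pq(3)]) (use pq d0 in auto)
  let ?r = "q - 3 * d"
  have r: "?r \<in> \<Gamma>" "p \<le> ?r" "0 \<le> ?r" using add(4) add(7) pq d d0 by auto
  obtain g where g: "g \<in> DV" "\<And>u. ?r \<le> u \<Longrightarrow> u < ?r + 2 * d \<Longrightarrow> g u = u + d"
    "\<And>u. ?r + 2 * d \<le> u \<Longrightarrow> u < ?r + 3 * d \<Longrightarrow> g u = u - 2 * d"
    "\<And>u. u \<in> X \<Longrightarrow> \<not> (?r \<le> u \<and> u < ?r + 3 * d) \<Longrightarrow> g u = u"
    by (rule consecutive_cycle[OF r(1) d(1) d0(1) r(3)]) (use pq d0 in auto)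
  let ?h = "g \<otimes>\<^bsub>SG\<^esub> f"
  have h: "?h \<in> DV" using subgroup.m_closed[OF subgroup_DV_SG g(1) f(1)] .
  have app: "?h x = g (f x)" if "x \<in> X" for x using mult_app f(1) g(1) DV_subset that by blast
  have fX: "f x \<in> X" if "x \<in> X" for x using bij_betwE[OF V_bij[OF subsetD[OF DV_subset f(1)]]] that by blast
  have move: "f x = x + d \<or> f x = x - 2 * d \<or> (f x = x \<and> \<not> (p \<le> x \<and> x < p + 3 * d))" if "x \<in> X" for x
    using f(2)[of x] f(3)[of x] f(4)[OF that] by (metis not_less)
  have move': "g x = x + d \<or> g x = x - 2 * d \<or> (g x = x \<and> \<not> (?r \<le> x \<and> x < ?r + 3 * d))" if "x \<in> X" for x
    using g(2)[of x] g(3)[of x] g(4)[OF that] by (metis not_less)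
  have moved: "?h x \<noteq> x" if x: "x \<in> {p..<q}" for x
  proof -
    have xX: "x \<in> X" using x pq by auto
    have r3: "?r + 3 * d = q" by simp
    have "\<not> (f x = x \<and> g x = x \<and> \<not> (p \<le> x \<and> x < p + 3 * d) \<and> \<not> (?r \<le> x \<and> x < ?r + 3 * d))"
      using x d0 unfolding r3 by auto
    then show ?thesis
      unfolding app[OF xX] using move[OF xX] move'[OF fX[OF xX]] d0(1) by auto
  qed
  have fixed: "?h x = x" if "x \<in> X" "x \<notin> {p..<q}" for x
  proof -
    have "f x = x" by (rule f(4)[OF that(1)]) (use that d0 in auto)
    moreover have "g x = x" by (rule g(4)[OF that(1)]) (use that r in auto)
    ultimately show ?thesis using app[OF that(1)] by simp
  qed
  have "supp ?h \<subseteq> {p..<q}" by (rule supp_subset) (use pq fixed in \<open>auto intro!: interval_algebra_interval\<close>)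
  moreover have "{p..<q} \<subseteq> supp ?h"
  proof
    fix x assume x: "x \<in> {p..<q}"
    then show "x \<in> supp ?h" unfolding supp_def using moved[OF x] pq by (auto intro!: exI[of _ x])
  qed
  ultimately show ?thesis using h by (intro bexI[of _ ?h]) auto
qed

text \<open>
  Elements with disjoint supports multiply to an element whose support is the union.
\<close>

lemma supp_image_DV: "\<B> = supp ` DV"
proof (intro equalityI subsetI)
  interpret S: support_group X DV \<B> supp by (rule support_group_DV)
  fix B assume "B \<in> \<B>"
  then have "\<exists>f\<in>DV. supp f = B"
  proof (rule algebra_induct[where R = "\<lambda>B. \<exists>f\<in>DV. supp f = B"])
    have "supp \<one>\<^bsub>SG\<^esub> \<subseteq> {}"
      by (rule supp_subset[OF interval_algebra_empty]) (simp add: stein_group_def BijGroup_def)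
    then show "\<exists>f\<in>DV. supp f = {}" using subgroup.one_closed[OF subgroup_DV_SG] by blast
  next
    fix U W assume UW: "U \<inter> W = {}" "\<exists>f\<in>DV. supp f = U" "\<exists>f\<in>DV. supp f = W"
    then obtain f g where f: "f \<in> DV" "supp f = U" and g: "g \<in> DV" "supp g = W" by blast
    let ?h = "f \<otimes>\<^bsub>S.G\<^esub> g"
    have h: "?h \<in> DV" using S.mult_in f g by blast
    have UW\<B>: "supp f \<union> supp g \<in> \<B>" using interval_algebra_binary(1)[OF S.supp_in S.supp_in] f(1) g(1) by blast
    have "supp ?h \<subseteq> supp f \<union> supp g"
      by (rule S.supp_minimal[OF h UW\<B>]) (use f g in \<open>simp add: S.mult_app S.supp_fix\<close>)
    moreover have "supp f \<subseteq> supp ?h"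
    proof -
      have "supp f - (supp f - supp ?h) = supp f"
      proof (rule ccontr)
        assume "\<not> ?thesis"
        then have "supp f - supp ?h \<noteq> {}" by blast
        moreover have "supp f - supp ?h \<in> \<B>" using interval_algebra_binary(3)[OF S.supp_in S.supp_in] f(1) h by blast
        ultimately obtain C where C: "C \<in> \<B>" "C \<noteq> {}" "C \<subseteq> supp f - supp ?h" "f ` C \<inter> C = {}"
          using S.displace[OF f(1), of "supp f - supp ?h"] by blast
        then obtain x where x: "x \<in> C" by blast
        have "x \<in> X" using x C(1) interval_algebra_subset by blast
        have "g x = x" using S.supp_fix[OF g(1) \<open>x \<in> X\<close>] x C(3) UW(1) f g by blast
        moreover have "?h x = x" using S.supp_fix[OF h \<open>x \<in> X\<close>] x C(3) by blast
        ultimately have "f x = x" using S.mult_app[OF f(1) g(1) \<open>x \<in> X\<close>] by simp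
        then show False using C(4) x by force
      qed
      then show ?thesis by blast
    qed
    moreover have "supp g \<subseteq> supp ?h"
    proof -
      have "commute S.G f g" by (rule S.disjoint_supp_commute) (use f g UW in auto)
      then have eq: "?h x = g (f x)" if "x \<in> X" for x
        using S.commute_iff[OF f(1) g(1)] S.mult_app[OF f(1) g(1) that] that by simp
      show ?thesis
      proof (rule ccontr)
        assume "\<not> ?thesis"
        then have "supp g - supp ?h \<noteq> {}" by blast
        moreover have "supp g - supp ?h \<in> \<B>" using interval_algebra_binary(3)[OF S.supp_in S.supp_in] g(1) h by blast
        ultimately obtain C where C: "C \<in> \<B>" "C \<noteq> {}" "C \<subseteq> supp g - supp ?h" "g ` C \<inter> C = {}"
          using S.displace[OF g(1), of "supp g - supp ?h"] by blast
        then obtain x where x: "x \<in> C" by blast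
        have "x \<in> X" using x C(1) interval_algebra_subset by blast
        have "f x = x" using S.supp_fix[OF f(1) \<open>x \<in> X\<close>] x C(3) UW(1) f g by blast
        moreover have "?h x = x" using S.supp_fix[OF h \<open>x \<in> X\<close>] x C(3) by blast
        ultimately have "g x = x" using eq[OF \<open>x \<in> X\<close>] by simp
        then show False using C(4) x by force
      qed
    qed
    ultimately show "\<exists>h\<in>DV. supp h = U \<union> W" using h f g by blast
  qed (use interval_is_support in blast)
  then show "B \<in> supp ` DV" by blast
qed (use supp_in DV_subset in blast)

end

section \<open>From the groups to their interval algebras\<close>

text \<open>
  Inside an interval, an affine map onto a disjoint interval is the restriction of a
  three-cycle; a third interval to move through exists as soon as the first two are short.
\<close>

lemma (in stein) affine_by_three_cycle:
  assumes a: "a \<in> \<Lambda>" and pq: "p \<in> \<Gamma>" "q \<in> \<Gamma>" "p' \<in> \<Gamma>" "0 \<le> p" "p < q" "q \<le> l" "0 \<le> p'" "p' + a * (q - p) \<le> l"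
    and small: "5 * (q - p) \<le> l" "5 * (a * (q - p)) \<le> l" and disj: "q \<le> p' \<or> p' + a * (q - p) \<le> p"
  shows "\<exists>c\<in>DV. \<forall>x. p \<le> x \<longrightarrow> x < q \<longrightarrow> c x = a * x + (p' - a * p)"
proof -
  define d where "d = q - p"
  define w where "w = max d (a * d)"
  have d: "d \<in> \<Gamma>" "0 < d" using pq add(4) by (auto simp: d_def)
  have w: "w \<in> \<Gamma>" "d \<le> w" "a * d \<le> w" "0 < w" "5 * w \<le> l" using d stable[OF a d(1)] small by (auto simp: w_def d_def max_def)
  \<comment> \<open>An interval of length at most \<open>w\<close> meets at most one of \<open>[0, w)\<close>, \<open>[2 * w, 3 * w)\<close> and
    \<open>[4 * w, 5 * w)\<close>, so one of the three is disjoint from both given intervals.\<close>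
  have "\<exists>k\<in>{0,2,4::real}. (k * w + w \<le> p \<or> p + w \<le> k * w) \<and> (k * w + w \<le> p' \<or> p' + w \<le> k * w)"
  proof (rule ccontr)
    assume "\<not> ?thesis"
    then have "\<And>k. k \<in> {0,2,4::real} \<Longrightarrow> (p < k * w + w \<and> k * w < p + w) \<or> (p' < k * w + w \<and> k * w < p' + w)" by force
    from this[of 0] this[of 2] this[of 4] show False using w(4) by auto
  qed
  then obtain k where k: "k \<in> {0,2,4::real}" "k * w + w \<le> p \<or> p + w \<le> k * w" "k * w + w \<le> p' \<or> p' + w \<le> k * w" by blast
  define z where "z = k * w"
  have z: "z \<in> \<Gamma>" "0 \<le> z" "z + w \<le> l" using k(1) w add(1) add(7)[OF w(1)] by (auto simp: z_def)
  have sw: "swappable p d p' a" using pq a d disj by (auto simp: swappable_def d_def)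
  have sw': "swappable p d z 1" using pq d z w k(2) mul(1) by (auto simp: swappable_def d_def z_def)
  have "p' + a * d \<le> z \<or> z + 1 * d \<le> p'" using k(3) w by (auto simp: z_def)
  from sw sw' this show ?thesis
  proof (rule three_cycle)
    fix c assume c: "c \<in> DV" "\<And>u. p \<le> u \<Longrightarrow> u < p + d \<Longrightarrow> c u = p' + a * (u - p)"
    then show ?thesis by (intro bexI[of _ c]) (auto simp: d_def algebra_simps)
  qed
qed

text \<open>
  The isomorphism of algebras is equivariant and every short affine map is realised by an element
  of the commutator subgroup, whose image under the isomorphism scales Lebesgue measure
  piecewise.
\<close>

lemma scaling_model_of_commutator_iso:
  assumes S1: "stein \<Gamma>\<^sub>1 \<Lambda>\<^sub>1 l\<^sub>1" and S2: "stein \<Gamma>\<^sub>2 \<Lambda>\<^sub>2 l\<^sub>2"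
    and rank: "\<exists>t\<in>\<Gamma>\<^sub>2. \<forall>n k :: int. of_int n * t = of_int k * l\<^sub>2 \<longrightarrow> n = 0"
    and iso: "commutator_subgroup (stein_group \<Gamma>\<^sub>2 \<Lambda>\<^sub>2 l\<^sub>2) \<cong> commutator_subgroup (stein_group \<Gamma>\<^sub>1 \<Lambda>\<^sub>1 l\<^sub>1)"
  shows "\<exists>m. scaling_model \<Gamma>\<^sub>1 \<Lambda>\<^sub>1 l\<^sub>1 \<Gamma>\<^sub>2 \<Lambda>\<^sub>2 l\<^sub>2 m"
proof -
  interpret A: stein \<Gamma>\<^sub>1 \<Lambda>\<^sub>1 l\<^sub>1 by (rule S1)
  interpret B: stein \<Gamma>\<^sub>2 \<Lambda>\<^sub>2 l\<^sub>2 by (rule S2)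
  obtain \<Phi> where \<Phi>: "\<Phi> \<in> Group.iso ((BijGroup B.X)\<lparr>carrier := B.DV\<rparr>) ((BijGroup A.X)\<lparr>carrier := A.DV\<rparr>)"
    using iso unfolding is_iso_def A.commutator_subgroup_SG B.commutator_subgroup_SG by blast
  have \<Phi>_in: "\<Phi> h \<in> A.DV" if "h \<in> B.DV" for h
    using \<Phi> that by (auto simp: iso_def bij_betw_def)
  obtain \<kappa> where \<kappa>: "bij_betw \<kappa> B.\<B> A.\<B>"
    "\<And>U W. U \<in> B.\<B> \<Longrightarrow> W \<in> B.\<B> \<Longrightarrow> \<kappa> U \<subseteq> \<kappa> W \<longleftrightarrow> U \<subseteq> W"
    "\<And>h U. h \<in> B.DV \<Longrightarrow> U \<in> B.\<B> \<Longrightarrow> \<kappa> (h ` U) = \<Phi> h ` \<kappa> U"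
    using support_group_iso[OF B.support_group_DV A.support_group_DV B.supp_image_DV A.supp_image_DV \<Phi>] by metis
  have mem: "\<kappa> U \<in> A.\<B>" if "U \<in> B.\<B>" for U using \<kappa>(1) that by (auto simp: bij_betw_def)
  have surj: "\<exists>U\<in>B.\<B>. \<kappa> U = W" if "W \<in> A.\<B>" for W
    using that bij_betw_imp_surj_on[OF \<kappa>(1)] by (metis imageE)
  \<comment> \<open>The pieces of \<open>\<Phi> h\<close> correspond to finitely many sets of the other algebra, and a common
    refinement of these is a partition into pieces on which \<open>h\<close> scales the transported length.\<close>
  have pieces: "piecewise \<Gamma>\<^sub>2 0 l\<^sub>2 (\<lambda>r s. \<exists>c\<in>\<Lambda>\<^sub>1. \<forall>U\<in>B.\<B>. U \<subseteq> {r..<s} \<longrightarrow>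
      measure lebesgue (\<kappa> (h ` U)) = c * measure lebesgue (\<kappa> U))" if h: "h \<in> B.DV" for h
  proof -
    have "\<Phi> h \<in> A.V" using \<Phi>_in[OF h] A.DV_subset by blast
    then obtain m t a s where t: "t 0 = 0" "t m = l\<^sub>1" "\<forall>i\<le>m::nat. t i \<in> \<Gamma>\<^sub>1"
      "\<And>i. i < m \<Longrightarrow> t i < t (Suc i) \<and> a i \<in> \<Lambda>\<^sub>1 \<and> s i \<in> \<Gamma>\<^sub>1 \<and> (\<forall>x\<in>{t i..<t (Suc i)}. \<Phi> h x = a i * x + s i)"
      unfolding stein_maps_def by blast
    have mono: "i \<le> j \<Longrightarrow> j \<le> m \<Longrightarrow> t i \<le> t j" for i j
    proof (induction j rule: dec_induct)
      case (step n)
      then show ?case using t(4)[of n] by simp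
    qed simp
    have piece: "{t i..<t (Suc i)} \<in> A.\<B>" if "i < m" for i
      using that t(1,2,3) mono[of 0 i] mono[of "Suc i" m] by (intro interval_algebra_interval) auto
    have "\<exists>U\<in>B.\<B>. \<kappa> U = {t i..<t (Suc i)}" if "i < m" for i using surj[OF piece[OF that]] .
    then obtain U where U: "\<And>i. i < m \<Longrightarrow> U i \<in> B.\<B>" "\<And>i. i < m \<Longrightarrow> \<kappa> (U i) = {t i..<t (Suc i)}" by metis
    have cover: "\<exists>i<m. W \<inter> U i \<noteq> {}" if W: "W \<in> B.\<B>" "W \<noteq> {}" for W
    proof -
      have "\<kappa> W \<noteq> {}"
      proof
        assume "\<kappa> W = {}"
        then have "W \<subseteq> {}" using \<kappa>(2)[OF W(1) interval_algebra_empty] by simp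
        then show False using W by simp
      qed
      then obtain x where x: "x \<in> \<kappa> W" by blast
      have "0 \<le> x" "x < l\<^sub>1" using x interval_algebra_subset[OF mem[OF W(1)]] by auto
      then obtain i where i: "i < m" "t i \<le> x" "x < t (Suc i)" using interval_index[of t x m] t by auto
      have "W \<inter> U i \<noteq> {}"
      proof
        assume disj: "W \<inter> U i = {}"
        obtain C where C: "C \<in> B.\<B>" "\<kappa> C = \<kappa> W \<inter> \<kappa> (U i)"
          using surj[OF interval_algebra_binary(2)[OF mem[OF W(1)] mem[OF U(1)[OF i(1)]]]] by blast
        have "C \<subseteq> W" "C \<subseteq> U i" using \<kappa>(2)[OF C(1) W(1)] \<kappa>(2)[OF C(1) U(1)[OF i(1)]] C(2) by auto
        then have "C \<subseteq> {}" using disj by blast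
        then have "\<kappa> C \<subseteq> \<kappa> {}" using \<kappa>(2)[OF C(1) interval_algebra_empty] by simp
        moreover obtain E where E: "E \<in> B.\<B>" "\<kappa> E = {}" using surj[OF interval_algebra_empty] by blast
        moreover have "\<kappa> {} \<subseteq> \<kappa> E" using \<kappa>(2)[OF interval_algebra_empty E(1)] by simp
        ultimately have "\<kappa> C = {}" by blast
        then show False using C(2) U(2)[OF i(1)] x i by auto
      qed
      then show ?thesis using i by blast
    qed
    have "piecewise \<Gamma>\<^sub>2 0 l\<^sub>2 (\<lambda>r s. \<forall>i\<in>{..<m}. {r..<s} \<subseteq> U i \<or> {r..<s} \<inter> U i = {})"
      by (rule piecewise_all) (use U(1) in \<open>auto simp: interval_algebra_def\<close>)
    then show ?thesis
    proof (rule piecewise_mono)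
      fix r r' assume r: "r \<in> \<Gamma>\<^sub>2" "r' \<in> \<Gamma>\<^sub>2" "0 \<le> r" "r < r'" "r' \<le> l\<^sub>2"
        and sep: "\<forall>i\<in>{..<m}. {r..<r'} \<subseteq> U i \<or> {r..<r'} \<inter> U i = {}"
      have "{r..<r'} \<in> B.\<B>" "{r..<r'} \<noteq> {}" using r by (auto intro!: interval_algebra_interval)
      then obtain i where i: "i < m" "{r..<r'} \<subseteq> U i" using cover sep by blast
      note ti = t(4)[OF i(1)]
      have "measure lebesgue (\<kappa> (h ` W)) = a i * measure lebesgue (\<kappa> W)" if W: "W \<in> B.\<B>" "W \<subseteq> {r..<r'}" for W
      proof -
        have "\<kappa> W \<subseteq> {t i..<t (Suc i)}" using \<kappa>(2)[OF W(1) U(1)[OF i(1)]] U(2)[OF i(1)] i(2) W(2) by auto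
        then have "\<Phi> h ` \<kappa> W = (\<lambda>x. a i *\<^sub>R x + s i) ` \<kappa> W" using ti by (intro image_cong) auto
        moreover have "0 < a i" using A.mul(2) ti by blast
        ultimately show ?thesis
          using \<kappa>(3)[OF h W(1)] measure_lebesgue_affine[of "a i" "s i" "\<kappa> W"] by simp
      qed
      then show "\<exists>c\<in>\<Lambda>\<^sub>1. \<forall>W\<in>B.\<B>. W \<subseteq> {r..<r'} \<longrightarrow> measure lebesgue (\<kappa> (h ` W)) = c * measure lebesgue (\<kappa> W)"
        using ti by blast
    qed
  qed
  have "scaling_model \<Gamma>\<^sub>1 \<Lambda>\<^sub>1 l\<^sub>1 \<Gamma>\<^sub>2 \<Lambda>\<^sub>2 l\<^sub>2 (\<lambda>x. measure lebesgue (\<kappa> {0..<x}))"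
  proof (rule scaling_model_of_algebra_iso[OF S1 S2 rank \<kappa>(1,2)])
    fix a assume a: "a \<in> \<Lambda>\<^sub>2"
    then have a0: "0 < a" using B.mul(2) by blast
    define \<epsilon> where "\<epsilon> = min (l\<^sub>2 / 5) (l\<^sub>2 / (5 * a))"
    have "0 < \<epsilon>" using B.l_pos a0 by (simp add: \<epsilon>_def)
    have "piecewise \<Gamma>\<^sub>2 p q (\<lambda>r s. \<exists>c\<in>\<Lambda>\<^sub>1. \<forall>x\<in>\<Gamma>\<^sub>2. \<forall>y\<in>\<Gamma>\<^sub>2. r \<le> x \<longrightarrow> x < y \<longrightarrow> y \<le> s \<longrightarrow>
         measure lebesgue (\<kappa> {a * x + (p' - a * p)..<a * y + (p' - a * p)}) = c * measure lebesgue (\<kappa> {x..<y}))"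
      if pq: "p \<in> \<Gamma>\<^sub>2" "q \<in> \<Gamma>\<^sub>2" "p' \<in> \<Gamma>\<^sub>2" "0 \<le> p" "p < q" "q \<le> l\<^sub>2" "0 \<le> p'"
        "p' + a * (q - p) \<le> l\<^sub>2" "q - p < \<epsilon>" "q \<le> p' \<or> p' + a * (q - p) \<le> p" for p q p'
    proof -
      have small: "5 * (q - p) \<le> l\<^sub>2" "5 * (a * (q - p)) \<le> l\<^sub>2"
        using pq(9) a0 by (auto simp: \<epsilon>_def pos_less_divide_eq mult_ac)
      obtain h where h: "h \<in> B.DV" "\<And>x. p \<le> x \<Longrightarrow> x < q \<Longrightarrow> h x = a * x + (p' - a * p)"
        using B.affine_by_three_cycle[OF a pq(1-8) small pq(10)] by blast
      have "piecewise \<Gamma>\<^sub>2 p q (\<lambda>r s. \<exists>c\<in>\<Lambda>\<^sub>1. \<forall>U\<in>B.\<B>. U \<subseteq> {r..<s} \<longrightarrow>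
          measure lebesgue (\<kappa> (h ` U)) = c * measure lebesgue (\<kappa> U))"
        using pieces[OF h(1)] pq by (rule_tac piecewise_subinterval) auto
      then show ?thesis
      proof (rule piecewise_mono)
        fix r s assume rs: "p \<le> r" "s \<le> q" and "\<exists>c\<in>\<Lambda>\<^sub>1. \<forall>U\<in>B.\<B>. U \<subseteq> {r..<s} \<longrightarrow>
          measure lebesgue (\<kappa> (h ` U)) = c * measure lebesgue (\<kappa> U)"
        then obtain c where c: "c \<in> \<Lambda>\<^sub>1" "\<And>U. U \<in> B.\<B> \<Longrightarrow> U \<subseteq> {r..<s} \<Longrightarrow>
          measure lebesgue (\<kappa> (h ` U)) = c * measure lebesgue (\<kappa> U)" by blast
        have "measure lebesgue (\<kappa> {a * x + (p' - a * p)..<a * y + (p' - a * p)}) = c * measure lebesgue (\<kappa> {x..<y})"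
          if xy: "x \<in> \<Gamma>\<^sub>2" "y \<in> \<Gamma>\<^sub>2" "r \<le> x" "x < y" "y \<le> s" for x y
        proof -
          have "{x..<y} \<in> B.\<B>" using xy rs pq by (intro interval_algebra_interval) auto
          moreover have "{x..<y} \<subseteq> {r..<s}" using xy by auto
          moreover have "h ` {x..<y} = {a * x + (p' - a * p)..<a * y + (p' - a * p)}"
          proof (intro equalityI subsetI)
            fix z assume z: "z \<in> {a * x + (p' - a * p)..<a * y + (p' - a * p)}"
            define u where "u = (z - (p' - a * p)) / a"
            have u: "z = a * u + (p' - a * p)" using a0 by (simp add: u_def)
            then have "x \<le> u" "u < y" using z a0 by auto
            then have "u \<in> {x..<y}" "h u = z" using h(2)[of u] u xy rs by auto
            then show "z \<in> h ` {x..<y}" by blast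
          qed (use h(2) xy rs a0 in auto)
          ultimately show ?thesis using c(2) by metis
        qed
        then show "\<exists>c\<in>\<Lambda>\<^sub>1. \<forall>x\<in>\<Gamma>\<^sub>2. \<forall>y\<in>\<Gamma>\<^sub>2. r \<le> x \<longrightarrow> x < y \<longrightarrow> y \<le> s \<longrightarrow>
           measure lebesgue (\<kappa> {a * x + (p' - a * p)..<a * y + (p' - a * p)}) = c * measure lebesgue (\<kappa> {x..<y})"
          using c(1) by blast
      qed
    qed
    then show "\<exists>\<epsilon>>0. \<forall>p\<in>\<Gamma>\<^sub>2. \<forall>q\<in>\<Gamma>\<^sub>2. \<forall>p'\<in>\<Gamma>\<^sub>2. 0 \<le> p \<longrightarrow> p < q \<longrightarrow> q \<le> l\<^sub>2 \<longrightarrow> 0 \<le> p' \<longrightarrow>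
       p' + a * (q - p) \<le> l\<^sub>2 \<longrightarrow> q - p < \<epsilon> \<longrightarrow> q \<le> p' \<or> p' + a * (q - p) \<le> p \<longrightarrow>
       piecewise \<Gamma>\<^sub>2 p q (\<lambda>r s. \<exists>c\<in>\<Lambda>\<^sub>1. \<forall>x\<in>\<Gamma>\<^sub>2. \<forall>y\<in>\<Gamma>\<^sub>2. r \<le> x \<longrightarrow> x < y \<longrightarrow> y \<le> s \<longrightarrow>
         measure lebesgue (\<kappa> {a * x + (p' - a * p)..<a * y + (p' - a * p)}) = c * measure lebesgue (\<kappa> {x..<y}))"
      using \<open>0 < \<epsilon>\<close> by blast
  qed
  then show ?thesis by blast
qed

section \<open>Piecewise linear homeomorphisms of the line\<close>

text \<open>
  Increasing piecewise linear homeomorphisms of the line. Having cuts in \<open>\<Gamma>\<close> and translation parts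
  in \<open>\<Gamma>'\<close> they map \<open>\<Gamma>\<close> onto \<open>\<Gamma>'\<close> if the slopes do.
\<close>

definition pl_homeo :: "real set \<Rightarrow> real set \<Rightarrow> real set \<Rightarrow> (real \<Rightarrow> real) \<Rightarrow> bool" where
  "pl_homeo \<Gamma> A \<Gamma>' F \<longleftrightarrow> strict_mono F \<and> surj F \<and> (\<exists>D. finite D \<and> D \<subseteq> \<Gamma> \<and>
     (\<forall>p q. p < q \<longrightarrow> {p<..<q} \<inter> D = {} \<longrightarrow> (\<exists>a\<in>A. \<exists>s\<in>\<Gamma>'. \<forall>x\<in>{p..q}. F x = a * x + s)))"

definition slope_set :: "real set \<Rightarrow> real set \<Rightarrow> real set \<Rightarrow> bool" where
  "slope_set \<Gamma> A \<Gamma>' \<longleftrightarrow> (\<forall>a\<in>A. 0 < a \<and> (\<forall>x. a * x \<in> \<Gamma>' \<longleftrightarrow> x \<in> \<Gamma>))"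

lemma slope_setD: "slope_set \<Gamma> A \<Gamma>' \<Longrightarrow> a \<in> A \<Longrightarrow> 0 < a" "slope_set \<Gamma> A \<Gamma>' \<Longrightarrow> a \<in> A \<Longrightarrow> a * x \<in> \<Gamma>' \<longleftrightarrow> x \<in> \<Gamma>"
  by (auto simp: slope_set_def)

lemma slope_set_inverse:
  assumes "slope_set \<Gamma> A \<Gamma>'"
  shows "slope_set \<Gamma>' (inverse ` A) \<Gamma>"
  unfolding slope_set_def
proof (intro ballI conjI allI)
  fix b assume "b \<in> inverse ` A"
  then obtain a where a: "a \<in> A" "b = inverse a" by blast
  then show "0 < b" using slope_setD(1)[OF assms] by simp
  fix x
  have "a * (b * x) = x" using slope_setD(1)[OF assms a(1)] a(2) by simp
  then show "b * x \<in> \<Gamma> \<longleftrightarrow> x \<in> \<Gamma>'" using slope_setD(2)[OF assms a(1), of "b * x"] by metis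
qed

lemma pl_homeoE:
  assumes "pl_homeo \<Gamma> A \<Gamma>' F"
  obtains D where "finite D" "D \<subseteq> \<Gamma>" "\<forall>p q. p < q \<longrightarrow> {p<..<q} \<inter> D = {} \<longrightarrow> (\<exists>a\<in>A. \<exists>s\<in>\<Gamma>'. \<forall>x\<in>{p..q}. F x = a * x + s)"
  using assms unfolding pl_homeo_def by (elim exE conjE) (rule that)

lemma pl_homeoD: "pl_homeo \<Gamma> A \<Gamma>' F \<Longrightarrow> strict_mono F" "pl_homeo \<Gamma> A \<Gamma>' F \<Longrightarrow> surj F"
  by (simp_all add: pl_homeo_def)

lemma finite_gap_right:
  fixes x :: real
  assumes "finite D"
  shows "\<exists>q>x. {x<..<q} \<inter> D = {}"
proof -
  define q where "q = Min (insert (x + 1) (D \<inter> {x<..}))"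
  have "x < q" unfolding q_def using assms by (simp add: Min_gr_iff)
  moreover have "{x<..<q} \<inter> D = {}"
  proof (rule ccontr)
    assume "\<not> ?thesis"
    then obtain d where d: "d \<in> D" "x < d" "d < q" by auto
    then have "q \<le> d" unfolding q_def using assms by (intro Min_le) auto
    then show False using d by simp
  qed
  ultimately show ?thesis by blast
qed

lemma finite_gap_left:
  fixes x :: real
  assumes "finite D"
  shows "\<exists>p<x. {p<..<x} \<inter> D = {}"
proof -
  define p where "p = Max (insert (x - 1) (D \<inter> {..<x}))"
  have "p < x" unfolding p_def using assms by (simp add: Max_less_iff)
  moreover have "{p<..<x} \<inter> D = {}"
  proof (rule ccontr)
    assume "\<not> ?thesis"
    then obtain d where d: "d \<in> D" "p < d" "d < x" by auto
    then have "d \<le> p" unfolding p_def using assms by (intro Max_ge) auto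
    then show False using d by simp
  qed
  ultimately show ?thesis by blast
qed

lemma pl_homeo_mem_iff:
  assumes F: "pl_homeo \<Gamma> A \<Gamma>' F" and A: "slope_set \<Gamma> A \<Gamma>'" and \<Gamma>': "add_group \<Gamma>'"
  shows "F x \<in> \<Gamma>' \<longleftrightarrow> x \<in> \<Gamma>"
proof -
  obtain D where D: "finite D" "\<forall>p q. p < q \<longrightarrow> {p<..<q} \<inter> D = {} \<longrightarrow> (\<exists>a\<in>A. \<exists>s\<in>\<Gamma>'. \<forall>x\<in>{p..q}. F x = a * x + s)"
    using pl_homeoE[OF F] by metis
  obtain q where "x < q" "{x<..<q} \<inter> D = {}" using finite_gap_right[OF D(1)] by blast
  then obtain a s where as: "a \<in> A" "s \<in> \<Gamma>'" "\<forall>z\<in>{x..q}. F z = a * z + s" using D(2) by blast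
  then have "F x = a * x + s" using \<open>x < q\<close> by simp
  moreover have "a * x + s \<in> \<Gamma>' \<longleftrightarrow> a * x \<in> \<Gamma>'"
    using add_groupD(3,4)[OF \<Gamma>'] as(2) by (metis add_diff_cancel_right')
  ultimately show ?thesis using slope_setD(2)[OF A as(1)] by simp
qed

lemma pl_homeo_compose:
  assumes F: "pl_homeo \<Gamma> A \<Gamma>' F" and G: "pl_homeo \<Gamma>' A' \<Gamma>'' G"
    and A: "slope_set \<Gamma> A \<Gamma>'" "slope_set \<Gamma>' A' \<Gamma>''" and grp: "add_group \<Gamma>'" "add_group \<Gamma>''"
    and A'': "\<And>a b. a \<in> A' \<Longrightarrow> b \<in> A \<Longrightarrow> a * b \<in> A''"
  shows "pl_homeo \<Gamma> A'' \<Gamma>'' (\<lambda>x. G (F x))"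
proof -
  obtain D where D: "finite D" "D \<subseteq> \<Gamma>" "\<forall>p q. p < q \<longrightarrow> {p<..<q} \<inter> D = {} \<longrightarrow> (\<exists>a\<in>A. \<exists>s\<in>\<Gamma>'. \<forall>x\<in>{p..q}. F x = a * x + s)"
    by (rule pl_homeoE[OF F])
  obtain E where E: "finite E" "E \<subseteq> \<Gamma>'" "\<forall>p q. p < q \<longrightarrow> {p<..<q} \<inter> E = {} \<longrightarrow> (\<exists>a\<in>A'. \<exists>s\<in>\<Gamma>''. \<forall>x\<in>{p..q}. G x = a * x + s)"
    by (rule pl_homeoE[OF G])
  have mono: "strict_mono F" "strict_mono G" and surj: "surj F" "surj G" using pl_homeoD F G by auto
  have "strict_mono (\<lambda>x. G (F x))" using mono by (simp add: strict_mono_def)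
  moreover have "surj (\<lambda>x. G (F x))" using comp_surj[OF surj] by (simp add: o_def)
  moreover have "finite (D \<union> F -` E)"
    using D(1) E(1) strict_mono_imp_inj_on[OF mono(1)] by (simp add: finite_vimageI)
  moreover have "D \<union> F -` E \<subseteq> \<Gamma>" using D(2) E(2) pl_homeo_mem_iff[OF F A(1) grp(1)] by blast
  moreover have "\<exists>a\<in>A''. \<exists>s\<in>\<Gamma>''. \<forall>x\<in>{p..q}. G (F x) = a * x + s"
    if pq: "p < q" "{p<..<q} \<inter> (D \<union> F -` E) = {}" for p q
  proof -
    have "{p<..<q} \<inter> D = {}" using pq by blast
    then obtain a s where as: "a \<in> A" "s \<in> \<Gamma>'" "\<forall>x\<in>{p..q}. F x = a * x + s" using D(3) pq(1) by blast
    have "{F p<..<F q} \<inter> E = {}"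
    proof (rule ccontr)
      assume "\<not> ?thesis"
      then obtain y where y: "y \<in> E" "F p < y" "y < F q" by auto
      then obtain x where "y = F x" using surj(1) by blast
      then have "x \<in> {p<..<q} \<inter> (D \<union> F -` E)" using y strict_mono_less[OF mono(1)] by auto
      then show False using pq by blast
    qed
    then obtain b r where br: "b \<in> A'" "r \<in> \<Gamma>''" "\<forall>x\<in>{F p..F q}. G x = b * x + r"
      using E(3) pq(1) strict_mono_less[OF mono(1)] by blast
    have "G (F x) = (b * a) * x + (b * s + r)" if "x \<in> {p..q}" for x
    proof -
      have "F x \<in> {F p..F q}" using that strict_mono_less_eq[OF mono(1)] by auto
      then show ?thesis using br(3) as(3) that by (simp add: algebra_simps)
    qed
    moreover have "b * s + r \<in> \<Gamma>''" using slope_setD(2)[OF A(2) br(1)] as(2) br(2) add_groupD(3)[OF grp(2)] by blast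
    ultimately show ?thesis using A'' as(1) br(1) by blast
  qed
  ultimately show ?thesis unfolding pl_homeo_def by blast
qed

lemma pl_homeo_inverse:
  assumes F: "pl_homeo \<Gamma> A \<Gamma>' F" and A: "slope_set \<Gamma> A \<Gamma>'" and grp: "add_group \<Gamma>" "add_group \<Gamma>'"
  shows "pl_homeo \<Gamma>' (inverse ` A) \<Gamma> (inv_into UNIV F)"
proof -
  obtain D where D: "finite D" "D \<subseteq> \<Gamma>" "\<forall>p q. p < q \<longrightarrow> {p<..<q} \<inter> D = {} \<longrightarrow> (\<exists>a\<in>A. \<exists>s\<in>\<Gamma>'. \<forall>x\<in>{p..q}. F x = a * x + s)"
    by (rule pl_homeoE[OF F])
  have mono: "strict_mono F" and surj: "surj F" using pl_homeoD F by auto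
  have inj: "inj F" using mono by (rule strict_mono_imp_inj_on)
  have Finv: "F (inv_into UNIV F y) = y" for y using surj by (rule surj_f_inv_f)
  have imono: "inv_into UNIV F x < inv_into UNIV F y \<longleftrightarrow> x < y" "inv_into UNIV F x \<le> inv_into UNIV F y \<longleftrightarrow> x \<le> y" for x y
    using strict_mono_less[OF mono, of "inv_into UNIV F x" "inv_into UNIV F y"] strict_mono_less_eq[OF mono, of "inv_into UNIV F x" "inv_into UNIV F y"]
    by (simp_all add: Finv)
  have "strict_mono (inv_into UNIV F)" by (simp add: strict_mono_def imono)
  moreover have "surj (inv_into UNIV F)" using inj by (rule inj_imp_surj_inv)
  moreover have "F ` D \<subseteq> \<Gamma>'" using D(2) pl_homeo_mem_iff[OF F A grp(2)] by blast
  moreover have "\<exists>b\<in>inverse ` A. \<exists>s\<in>\<Gamma>. \<forall>y\<in>{p..q}. inv_into UNIV F y = b * y + s"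
    if pq: "p < q" "{p<..<q} \<inter> F ` D = {}" for p q
  proof -
    have "{inv_into UNIV F p<..<inv_into UNIV F q} \<inter> D = {}"
    proof (rule ccontr)
      assume "\<not> ?thesis"
      then obtain d where d: "d \<in> D" "inv_into UNIV F p < d" "d < inv_into UNIV F q" by auto
      then have "F d \<in> {p<..<q} \<inter> F ` D"
        using strict_mono_less[OF mono, of "inv_into UNIV F p" d] strict_mono_less[OF mono, of d "inv_into UNIV F q"] by (simp add: Finv)
      then show False using pq by blast
    qed
    then obtain a s where as: "a \<in> A" "s \<in> \<Gamma>'" "\<forall>x\<in>{inv_into UNIV F p..inv_into UNIV F q}. F x = a * x + s"
      using D(3) imono(1)[of p q] pq(1) by blast
    have a0: "0 < a" using slope_setD(1)[OF A as(1)] .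
    have "inv_into UNIV F y = inverse a * y + (- (inverse a * s))" if "y \<in> {p..q}" for y
    proof -
      have "inv_into UNIV F y \<in> {inv_into UNIV F p..inv_into UNIV F q}" using that imono(2) by auto
      then have "y = a * inv_into UNIV F y + s" using as(3) Finv by metis
      then have "inverse a * y = inv_into UNIV F y + inverse a * s" using a0 by (simp add: field_simps)
      then show ?thesis by simp
    qed
    moreover have "inverse a * s \<in> \<Gamma>"
    proof -
      have "a * (inverse a * s) = s" using a0 by simp
      then show ?thesis using slope_setD(2)[OF A as(1), of "inverse a * s"] as(2) by metis
    qed
    ultimately show ?thesis using as(1) add_groupD(2)[OF grp(1)] by blast
  qed
  ultimately show ?thesis unfolding pl_homeo_def using D(1) by blast
qed

context stein
begin

lemma slope_set_\<Lambda>: "slope_set \<Gamma> \<Lambda> \<Gamma>"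
  by (simp add: slope_set_def mul(2) scale_iff)

definition pl_equivalent :: "real \<Rightarrow> real \<Rightarrow> bool" where
  "pl_equivalent k k' \<longleftrightarrow> (\<exists>F. pl_homeo \<Gamma> \<Lambda> \<Gamma> F \<and> F 0 = 0 \<and> F k = k')"

lemma pl_equivalent_refl: "pl_equivalent k k"
proof -
  have "\<forall>x\<in>{p..q}. x = 1 * x + 0" for p q :: real by simp
  then have "\<exists>a\<in>\<Lambda>. \<exists>s\<in>\<Gamma>. \<forall>x\<in>{p..q}. x = a * x + s" for p q using mul(1) add(1) by blast
  then have "pl_homeo \<Gamma> \<Lambda> \<Gamma> (\<lambda>x. x)"
    unfolding pl_homeo_def using mul(1) add(1) by (auto simp: strict_mono_def intro!: exI[of _ "{}"])
  then show ?thesis unfolding pl_equivalent_def by auto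
qed

lemma pl_equivalent_trans: "pl_equivalent k k' \<Longrightarrow> pl_equivalent k' k'' \<Longrightarrow> pl_equivalent k k''"
  unfolding pl_equivalent_def
  using pl_homeo_compose[OF _ _ slope_set_\<Lambda> slope_set_\<Lambda> add_group add_group mul(4)] by (metis (no_types, lifting))

lemma pl_equivalent_sym: "pl_equivalent k k' \<Longrightarrow> pl_equivalent k' k"
proof -
  assume "pl_equivalent k k'"
  then obtain F where F: "pl_homeo \<Gamma> \<Lambda> \<Gamma> F" "F 0 = 0" "F k = k'" unfolding pl_equivalent_def by blast
  have "inverse ` \<Lambda> = \<Lambda>"
  proof (intro equalityI subsetI)
    fix a assume "a \<in> \<Lambda>"
    then have "inverse (inverse a) \<in> inverse ` \<Lambda>" using mul(3) by blast
    then show "a \<in> inverse ` \<Lambda>" by simp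
  qed (use mul(3) in blast)
  then have "pl_homeo \<Gamma> \<Lambda> \<Gamma> (inv_into UNIV F)"
    using pl_homeo_inverse[OF F(1) slope_set_\<Lambda> add_group add_group] by simp
  moreover have "inj F" using pl_homeoD(1)[OF F(1)] by (rule strict_mono_imp_inj_on)
  then have "inv_into UNIV F 0 = 0" "inv_into UNIV F k' = k" using F(2,3) inv_f_f by metis+
  ultimately show ?thesis unfolding pl_equivalent_def by blast
qed

text \<open>
  Stretch the initial piece of length \<open>t\<close> by the factor \<open>a\<close> and translate the rest.
\<close>

lemma pl_equivalent_stretch:
  assumes a: "a \<in> \<Lambda>" and t: "t \<in> \<Gamma>" "0 < t" "t \<le> k"
  shows "pl_equivalent k (k + (a - 1) * t)"
proof -
  define F where "F x = (if x \<le> 0 then x else if x \<le> t then a * x else x + (a - 1) * t)" for x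
  have a0: "0 < a" using mul(2) a .
  have at: "0 < a * t" using a0 t by simp
  have "strict_mono F"
  proof (rule strict_monoI)
    fix x y :: real assume xy: "x < y"
    have "a * x < a * y" using xy a0 by simp
    moreover have "0 < x \<Longrightarrow> 0 < a * x" "x \<le> t \<Longrightarrow> a * x \<le> a * t" "0 < y \<Longrightarrow> 0 < a * y" using a0 by auto
    ultimately show "F x < F y" using xy t at unfolding F_def by (auto simp: left_diff_distrib)
  qed
  moreover have "surj F"
  proof (rule surjI)
    fix y
    consider "y \<le> 0" | "0 < y" "y \<le> a * t" | "a * t < y" "0 < y" using at by linarith
    then show "F (if y \<le> 0 then y else if y \<le> a * t then y / a else y - (a - 1) * t) = y"
    proof cases
      case 2
      have "\<not> y / a \<le> 0" using 2 a0 by (simp add: not_le)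
      moreover have "y / a \<le> t" using 2 a0 by (simp add: pos_divide_le_eq mult.commute)
      ultimately have "F (y / a) = a * (y / a)" by (simp only: F_def if_False if_True)
      then show ?thesis using 2 a0 by simp
    next
      case 3
      then have "t < y - (a - 1) * t" by (simp add: left_diff_distrib)
      then show ?thesis using 3 t by (simp add: F_def)
    qed (simp add: F_def)
  qed
  moreover have "\<exists>b\<in>\<Lambda>. \<exists>s\<in>\<Gamma>. \<forall>x\<in>{p..q}. F x = b * x + s" if pq: "p < q" "{p<..<q} \<inter> {0, t} = {}" for p q
  proof -
    have "0 \<notin> {p<..<q}" "t \<notin> {p<..<q}" using pq by blast+
    then consider "q \<le> 0" | "0 \<le> p" "q \<le> t" | "t \<le> p" using pq(1) t by fastforce
    then show ?thesis
    proof cases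
      case 1
      then have "\<forall>x\<in>{p..q}. F x = 1 * x + 0" by (auto simp: F_def)
      then show ?thesis using mul(1) add(1) by blast
    next
      case 2
      then have "\<forall>x\<in>{p..q}. F x = a * x + 0" by (auto simp: F_def)
      then show ?thesis using a add(1) by blast
    next
      case 3
      have "F x = 1 * x + (a * t - t)" if "x \<in> {p..q}" for x
      proof (cases "x = t")
        case False
        then show ?thesis using that 3 t by (simp add: F_def left_diff_distrib)
      qed (use t in \<open>simp add: F_def\<close>)
      then have "\<forall>x\<in>{p..q}. F x = 1 * x + (a * t - t)" by blast
      moreover have "a * t - t \<in> \<Gamma>" using add(4) stable a t by blast
      ultimately show ?thesis using mul(1) by blast
    qed
  qed
  ultimately have "pl_homeo \<Gamma> \<Lambda> \<Gamma> F"
    unfolding pl_homeo_def using add(1) t by (intro conjI exI[of _ "{0, t}"]) auto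
  moreover have "F k = k + (a - 1) * t" using t by (auto simp: F_def left_diff_distrib)
  moreover have "F 0 = 0" by (simp add: F_def)
  ultimately show ?thesis unfolding pl_equivalent_def by blast
qed

text \<open>
  For \<open>t > k\<close> first stretch the whole interval to length \<open>a * k\<close>. What is left to add is
  \<open>(a - 1) * (t - k)\<close>, so after finitely many steps the previous lemma applies.
\<close>

lemma pl_equivalent_add_positive:
  assumes a: "a \<in> \<Lambda>" "1 < a" and t: "t \<in> \<Gamma>" "0 < t" and k: "k \<in> \<Gamma>" "0 < k"
  shows "pl_equivalent k (k + (a - 1) * t)"
proof -
  obtain n :: nat where "t \<le> of_nat n * k" using ex_less_of_nat_mult[OF k(2), of t] by (meson less_imp_le)
  then show ?thesis using t k
  proof (induction n arbitrary: t k)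
    case (Suc n)
    show ?case
    proof (cases "t \<le> k")
      case True
      then show ?thesis using pl_equivalent_stretch[OF a(1)] Suc.prems by blast
    next
      case False
      have ak: "a * k \<in> \<Gamma>" "k < a * k" using stable a Suc.prems by auto
      have "pl_equivalent k (k + (a - 1) * k)" using pl_equivalent_stretch[OF a(1), of k k] Suc.prems by simp
      then have 1: "pl_equivalent k (a * k)" by (simp add: left_diff_distrib)
      have "of_nat n * k \<le> of_nat n * (a * k)" using ak by (intro mult_left_mono) auto
      then have "t - k \<le> of_nat n * (a * k)" using Suc.prems(1) by (simp add: distrib_right)
      then have "pl_equivalent (a * k) (a * k + (a - 1) * (t - k))"
        using Suc.IH[of "t - k" "a * k"] Suc.prems ak False add(4) by simp
      moreover have "a * k + (a - 1) * (t - k) = k + (a - 1) * t" by (simp add: algebra_simps)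
      ultimately show ?thesis using pl_equivalent_trans[OF 1] by simp
    qed
  qed simp
qed

text \<open>
  The lengths that may be added to every interval without leaving its class form a monoid, and
  the differences of its elements form a group containing the generators of the coinvariant
  relations.
\<close>

lemma pl_equivalent_of_coinvariant:
  assumes k: "k \<in> \<Gamma>" "0 < k" "k' \<in> \<Gamma>" "0 < k'" and rel: "k - k' \<in> I\<Gamma>"
  shows "pl_equivalent k k'"
proof -
  define C where "C = {c \<in> \<Gamma>. 0 \<le> c \<and> (\<forall>k\<in>\<Gamma>. 0 < k \<longrightarrow> pl_equivalent k (k + c))}"
  define K where "K = {x. \<exists>c\<in>C. \<exists>c'\<in>C. x = c - c'}"
  have C0: "0 \<in> C" using add(1) pl_equivalent_refl by (simp add: C_def)
  have CD: "c \<in> \<Gamma>" "0 \<le> c" "\<And>k. k \<in> \<Gamma> \<Longrightarrow> 0 < k \<Longrightarrow> pl_equivalent k (k + c)" if "c \<in> C" for c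
    using that unfolding C_def by blast+
  have Cadd: "c + c' \<in> C" if cc: "c \<in> C" "c' \<in> C" for c c'
  proof -
    have "pl_equivalent k (k + (c + c'))" if k: "k \<in> \<Gamma>" "0 < k" for k
    proof -
      have "pl_equivalent k (k + c)" using CD(3)[OF cc(1)] k by blast
      moreover have "k + c \<in> \<Gamma>" "0 < k + c" using CD(1,2)[OF cc(1)] k add(3) by auto
      then have "pl_equivalent (k + c) ((k + c) + c')" using CD(3)[OF cc(2)] by blast
      ultimately show ?thesis using pl_equivalent_trans by (simp only: add.assoc)
    qed
    moreover have "c + c' \<in> \<Gamma>" "0 \<le> c + c'" using CD(1,2) cc add(3) by auto
    ultimately show ?thesis unfolding C_def by blast
  qed
  have pos: "(a - 1) * t \<in> C" if at: "a \<in> \<Lambda>" "t \<in> \<Gamma>" "0 < (a - 1) * t" for a t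
  proof -
    have a0: "0 < a" using mul(2) at by blast
    have "pl_equivalent k (k + (a - 1) * t)" if k: "k \<in> \<Gamma>" "0 < k" for k
    proof (cases "1 < a")
      case True
      then have "0 < t" using at(3) by (simp add: zero_less_mult_iff)
      then show ?thesis using pl_equivalent_add_positive True at k by blast
    next
      case False
      then have "t < 0" "a < 1" using at(3) by (auto simp: zero_less_mult_iff)
      then have "1 < inverse a" "0 < - (a * t)" using a0 by (auto simp: one_less_inverse_iff mult_pos_neg)
      moreover have "inverse a \<in> \<Lambda>" "- (a * t) \<in> \<Gamma>" using mul(3) stable add(2) at by auto
      ultimately have "pl_equivalent k (k + (inverse a - 1) * (- (a * t)))"
        using pl_equivalent_add_positive k by blast
      moreover have "(inverse a - 1) * (- (a * t)) = (a - 1) * t" using a0 by (simp add: algebra_simps)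
      ultimately show ?thesis by (simp only:)
    qed
    moreover have "(a - 1) * t \<in> \<Gamma>" using add(4) stable at by (simp add: left_diff_distrib)
    ultimately show ?thesis using at(3) by (simp add: C_def)
  qed
  have "subgroup K (module_group \<Gamma>)"
  proof (rule subgroup.intro)
    show "K \<subseteq> carrier (module_group \<Gamma>)" using add(4) by (auto simp: K_def C_def)
    show "\<one>\<^bsub>module_group \<Gamma>\<^esub> \<in> K" using C0 by (force simp: K_def real_additive_def)
    fix x assume x: "x \<in> K"
    then obtain c c' where c: "c \<in> C" "c' \<in> C" "x = c - c'" by (auto simp: K_def)
    then have "x \<in> \<Gamma>" using add(4) by (auto simp: C_def)
    have "- x = c' - c" using c(3) by simp
    then show "inv\<^bsub>module_group \<Gamma>\<^esub> x \<in> K"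
      using inv_module_group[OF add_group \<open>x \<in> \<Gamma>\<close>] c by (auto simp: K_def)
    fix y assume "y \<in> K"
    then obtain d d' where d: "d \<in> C" "d' \<in> C" "y = d - d'" by (auto simp: K_def)
    have "x + y = (c + d) - (c' + d')" using c d by simp
    then have "x + y \<in> K" unfolding K_def using Cadd[OF c(1) d(1)] Cadd[OF c(2) d(2)] by blast
    then show "x \<otimes>\<^bsub>module_group \<Gamma>\<^esub> y \<in> K" by (simp add: real_additive_def)
  qed
  moreover have "{t - a * t |t a. t \<in> \<Gamma> \<and> a \<in> \<Lambda>} \<subseteq> K"
  proof clarify
    fix t a assume ta: "t \<in> \<Gamma>" "a \<in> \<Lambda>"
    consider "0 < (a - 1) * t" | "0 < (a - 1) * (- t)" | "(a - 1) * t = 0" by (cases "(a - 1) * t" "0::real" rule: linorder_cases) auto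
    then show "t - a * t \<in> K"
    proof cases
      case 1
      have "t - a * t = 0 - (a - 1) * t" by (simp add: left_diff_distrib)
      then show ?thesis unfolding K_def using pos[OF ta(2,1) 1] C0 by blast
    next
      case 2
      have "t - a * t = (a - 1) * (- t) - 0" by (simp add: left_diff_distrib)
      then show ?thesis using pos[OF ta(2) add(2)[OF ta(1)] 2] C0 unfolding K_def by blast
    next
      case 3
      have "t - a * t = 0 - 0" using 3 by (simp add: left_diff_distrib)
      then show ?thesis using C0 unfolding K_def by blast
    qed
  qed
  ultimately have "I\<Gamma> \<subseteq> K"
    unfolding coinvariant_relations_def
    by (intro group.generate_subgroup_incl[OF group_module_group[OF add_group]])
  then obtain c c' where c: "c \<in> C" "c' \<in> C" "k - k' = c - c'" using rel by (auto simp: K_def)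
  have "pl_equivalent k (k + c')" "pl_equivalent k' (k' + c)" using c k by (auto simp: C_def)
  moreover have "k + c' = k' + c" using c(3) by simp
  ultimately show ?thesis using pl_equivalent_trans pl_equivalent_sym by metis
qed

end

text \<open>
  The slopes of \<open>F\<close> lie in one coset of \<open>\<Lambda>\<close> (\<open>ratio\<close>): by this, maps and arrows conjugated by
  \<open>F\<close> have slopes in \<open>\<Lambda>\<close> again.
\<close>

locale pl_equivalence = S1: stein \<Gamma>\<^sub>1 \<Lambda> l\<^sub>1 + S2: stein \<Gamma>\<^sub>2 \<Lambda> l\<^sub>2
  for \<Gamma>\<^sub>1 \<Lambda> :: "real set" and l\<^sub>1 :: real and \<Gamma>\<^sub>2 :: "real set" and l\<^sub>2 :: real +
  fixes A :: "real set" and F :: "real \<Rightarrow> real"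
  assumes homeo: "pl_homeo \<Gamma>\<^sub>1 A \<Gamma>\<^sub>2 F" and slopes: "slope_set \<Gamma>\<^sub>1 A \<Gamma>\<^sub>2"
    and ratio: "\<And>a b c. a \<in> A \<Longrightarrow> b \<in> A \<Longrightarrow> c \<in> \<Lambda> \<Longrightarrow> a * c / b \<in> \<Lambda>"
    and ends: "F 0 = 0" "F l\<^sub>1 = l\<^sub>2"
begin

lemma mono: "strict_mono F" and surj: "surj F"
  using pl_homeoD[OF homeo] by auto

lemma inj: "inj F" using mono by (rule strict_mono_imp_inj_on)

lemma inverse_equivalence: "pl_equivalence \<Gamma>\<^sub>2 \<Lambda> l\<^sub>2 \<Gamma>\<^sub>1 l\<^sub>1 (inverse ` A) (inv_into UNIV F)"
proof
  show "pl_homeo \<Gamma>\<^sub>2 (inverse ` A) \<Gamma>\<^sub>1 (inv_into UNIV F)"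
    by (rule pl_homeo_inverse[OF homeo slopes S1.add_group S2.add_group])
  show "slope_set \<Gamma>\<^sub>2 (inverse ` A) \<Gamma>\<^sub>1" by (rule slope_set_inverse[OF slopes])
  show "a * c / b \<in> \<Lambda>" if abc: "a \<in> inverse ` A" "b \<in> inverse ` A" "c \<in> \<Lambda>" for a b c
  proof -
    obtain a' b' where "a' \<in> A" "b' \<in> A" "a = inverse a'" "b = inverse b'" using abc by blast
    then show ?thesis using ratio[of b' a' c] abc(3) by (simp add: divide_inverse mult_ac)
  qed
  show "inv_into UNIV F 0 = 0" "inv_into UNIV F l\<^sub>2 = l\<^sub>1" using inv_f_f[OF inj, of 0] inv_f_f[OF inj, of l\<^sub>1] ends by auto
qed

lemma F_bij: "bij_betw F S1.X S2.X"
proof -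
  have "F ` S1.X = S2.X"
  proof (intro equalityI subsetI)
    fix y assume y: "y \<in> S2.X"
    obtain x where x: "y = F x" using surj by blast
    then have "0 \<le> x" "x < l\<^sub>1"
      using y ends strict_mono_less_eq[OF mono, of 0 x] strict_mono_less[OF mono, of x l\<^sub>1] by auto
    then show "y \<in> F ` S1.X" using x by auto
  next
    fix y assume "y \<in> F ` S1.X"
    then obtain x where "0 \<le> x" "x < l\<^sub>1" "y = F x" by auto
    then show "y \<in> S2.X" using ends strict_mono_less_eq[OF mono, of 0 x] strict_mono_less[OF mono, of x l\<^sub>1] by auto
  qed
  then show ?thesis using inj by (auto simp: bij_betw_def inj_on_def inj_def)
qed

lemma F_paffine: "paffine \<Gamma>\<^sub>1 A \<Gamma>\<^sub>2 l\<^sub>1 F"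
proof -
  obtain D where D: "finite D" "D \<subseteq> \<Gamma>\<^sub>1" "\<forall>p q. p < q \<longrightarrow> {p<..<q} \<inter> D = {} \<longrightarrow> (\<exists>a\<in>A. \<exists>s\<in>\<Gamma>\<^sub>2. \<forall>x\<in>{p..q}. F x = a * x + s)"
    by (rule pl_homeoE[OF homeo])
  show ?thesis unfolding paffine_def
  proof (rule piecewiseI[OF D(1,2)])
    fix p q assume "p < q" "{p<..<q} \<inter> D = {}"
    then obtain a s where as: "a \<in> A" "s \<in> \<Gamma>\<^sub>2" "\<forall>x\<in>{p..q}. F x = a * x + s" using D(3) by blast
    then have "\<forall>x\<in>{p..<q}. F x = a * x + s" by simp
    then show "\<exists>a\<in>A. \<exists>s\<in>\<Gamma>\<^sub>2. \<forall>x\<in>{p..<q}. F x = a * x + s" using as by blast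
  qed
qed

definition conjugated :: "(real \<Rightarrow> real) \<Rightarrow> real \<Rightarrow> real" where
  "conjugated f = (\<lambda>x\<in>S2.X. F (f (inv_into UNIV F x)))"

lemma F_in: "x \<in> S1.X \<Longrightarrow> F x \<in> S2.X" using F_bij by (auto simp: bij_betw_def)

lemma F_inv: "F (inv_into UNIV F y) = y" using surj by (rule surj_f_inv_f)

lemma inv_F: "inv_into UNIV F (F x) = x" using inj by (rule inv_f_f)

lemma inv_F_in: "y \<in> S2.X \<Longrightarrow> inv_into UNIV F y \<in> S1.X"
  using pl_equivalence.F_in[OF inverse_equivalence] .

lemma conjugated_in:
  assumes f: "f \<in> S1.V"
  shows "conjugated f \<in> S2.V"
proof -
  interpret I: pl_equivalence \<Gamma>\<^sub>2 \<Lambda> l\<^sub>2 \<Gamma>\<^sub>1 l\<^sub>1 "inverse ` A" "inv_into UNIV F" by (rule inverse_equivalence)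
  have 1: "paffine \<Gamma>\<^sub>2 {c / b |b c. b \<in> A \<and> c \<in> \<Lambda>} \<Gamma>\<^sub>1 l\<^sub>2 (\<lambda>x. f (inv_into UNIV F x))"
  proof (rule paffine_compose[OF I.F_paffine S1.V_paffine[OF f] S2.add_group S2.dense S2.l_in S1.add_group S1.add_group I.F_bij])
    fix a b assume "a \<in> \<Lambda>" "b \<in> inverse ` A"
    then show "a * b \<in> {c / b |b c. b \<in> A \<and> c \<in> \<Lambda>}" by (auto simp: divide_inverse)
  qed (use slope_setD[OF I.slopes] S1.stable in auto)
  have bij1: "bij_betw (\<lambda>x. f (inv_into UNIV F x)) S2.X S1.X"
    using bij_betw_trans[OF I.F_bij S1.V_bij[OF f]] by (simp add: o_def)
  have 2: "paffine \<Gamma>\<^sub>2 \<Lambda> \<Gamma>\<^sub>2 l\<^sub>2 (\<lambda>x. F (f (inv_into UNIV F x)))"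
  proof (rule paffine_compose[OF 1 F_paffine S2.add_group S2.dense S2.l_in S1.add_group S2.add_group bij1])
    fix a assume "a \<in> {c / b |b c. b \<in> A \<and> c \<in> \<Lambda>}"
    then obtain b c where a: "b \<in> A" "c \<in> \<Lambda>" "a = c / b" by blast
    have b0: "0 < b" and c0: "0 < c" using slope_setD(1)[OF slopes] S1.mul(2) a by auto
    then show "0 < a" using a by simp
    fix x
    have "a * x \<in> \<Gamma>\<^sub>1 \<longleftrightarrow> c * (x / b) \<in> \<Gamma>\<^sub>1" using a by simp
    also have "\<dots> \<longleftrightarrow> b * (x / b) \<in> \<Gamma>\<^sub>2" using S1.scale_iff[OF a(2)] slope_setD(2)[OF slopes a(1)] by blast
    finally show "a * x \<in> \<Gamma>\<^sub>1 \<longleftrightarrow> x \<in> \<Gamma>\<^sub>2" using b0 by simp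
  next
    fix a b assume "a \<in> A" "b \<in> {c / b |b c. b \<in> A \<and> c \<in> \<Lambda>}"
    then show "a * b \<in> \<Lambda>" using ratio by auto
  qed (use slope_setD[OF slopes] in auto)
  have "bij_betw (\<lambda>x. F (f (inv_into UNIV F x))) S2.X S2.X"
    using bij_betw_trans[OF bij1 F_bij] by (simp add: o_def)
  then have "bij_betw (conjugated f) S2.X S2.X" by (rule bij_betw_cong[THEN iffD1, rotated]) (simp add: conjugated_def)
  then have "conjugated f \<in> Bij S2.X" by (simp add: Bij_def conjugated_def)
  moreover have "paffine \<Gamma>\<^sub>2 \<Lambda> \<Gamma>\<^sub>2 l\<^sub>2 (conjugated f)" by (rule paffine_cong[OF 2]) (simp add: conjugated_def)
  ultimately show ?thesis by (simp add: S2.V_iff)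
qed

lemma V_app_in: "f \<in> S1.V \<Longrightarrow> x \<in> S1.X \<Longrightarrow> f x \<in> S1.X"
  using bij_betwE[OF S1.V_bij] by blast

lemma stein_groups_isomorphic: "S1.SG \<cong> S2.SG"
proof (rule is_isoI, rule isoI)
  interpret I: pl_equivalence \<Gamma>\<^sub>2 \<Lambda> l\<^sub>2 \<Gamma>\<^sub>1 l\<^sub>1 "inverse ` A" "inv_into UNIV F" by (rule inverse_equivalence)
  have invinv: "inv_into UNIV (inv_into UNIV F) = F" using inj surj by (intro inv_inv_eq) (simp add: bij_def)
  show "conjugated \<in> hom S1.SG S2.SG"
  proof (rule homI)
    fix f g assume "f \<in> carrier S1.SG" "g \<in> carrier S1.SG"
    then have fg: "f \<in> S1.V" "g \<in> S1.V" by (auto simp: S1.carrier_SG)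
    have B: "f \<in> Bij S1.X" "g \<in> Bij S1.X" "conjugated f \<in> Bij S2.X" "conjugated g \<in> Bij S2.X"
      using fg conjugated_in S1.V_iff S2.V_iff by auto
    have "conjugated (compose S1.X f g) = compose S2.X (conjugated f) (conjugated g)"
    proof (rule extensionalityI[of _ S2.X])
      fix x assume x: "x \<in> S2.X"
      have "F (g (inv_into UNIV F x)) \<in> S2.X" using F_in V_app_in fg inv_F_in x by blast
      then show "conjugated (compose S1.X f g) x = compose S2.X (conjugated f) (conjugated g) x"
        using x inv_F_in[OF x] by (simp add: conjugated_def compose_def inv_F)
    qed (simp_all add: conjugated_def)
    then show "conjugated (f \<otimes>\<^bsub>S1.SG\<^esub> g) = conjugated f \<otimes>\<^bsub>S2.SG\<^esub> conjugated g"
      using B by (simp add: stein_group_def BijGroup_def)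
  qed (use conjugated_in S1.carrier_SG S2.carrier_SG in auto)
  have cancel: "I.conjugated (conjugated f) = f" if f: "f \<in> S1.V" for f
  proof (rule extensionalityI[of _ S1.X])
    show "f \<in> extensional S1.X" using f S1.V_iff Bij_imp_extensional by blast
    fix x assume x: "x \<in> S1.X"
    then show "I.conjugated (conjugated f) x = f x"
      using F_in[OF x] by (simp add: I.conjugated_def conjugated_def invinv inv_F)
  qed (simp add: I.conjugated_def)
  have cancel': "conjugated (I.conjugated f) = f" if f: "f \<in> S2.V" for f
  proof (rule extensionalityI[of _ S2.X])
    show "f \<in> extensional S2.X" using f S2.V_iff Bij_imp_extensional by blast
    fix x assume x: "x \<in> S2.X"
    then show "conjugated (I.conjugated f) x = f x"
      using inv_F_in[OF x] by (simp add: I.conjugated_def conjugated_def invinv F_inv)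
  qed (simp add: conjugated_def)
  show "bij_betw conjugated (carrier S1.SG) (carrier S2.SG)"
    unfolding S1.carrier_SG S2.carrier_SG
    by (rule bij_betw_byWitness[where f' = I.conjugated]) (use cancel cancel' conjugated_in I.conjugated_in in auto)
qed

end

text \<open>
  Carry \<open>l\<^sub>1\<close> to \<open>s * l\<^sub>2\<close> inside \<open>\<Gamma>\<^sub>1\<close>, then divide by \<open>s\<close>.
\<close>

lemma pl_equivalence_exists:
  assumes S1: "stein \<Gamma>\<^sub>1 \<Lambda> l\<^sub>1" and S2: "stein \<Gamma>\<^sub>2 \<Lambda> l\<^sub>2" and s: "0 < s" "\<Gamma>\<^sub>1 = (\<lambda>t. s * t) ` \<Gamma>\<^sub>2"
    and rel: "l\<^sub>1 - s * l\<^sub>2 \<in> coinvariant_relations \<Lambda> \<Gamma>\<^sub>1"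
  shows "\<exists>A F. pl_equivalence \<Gamma>\<^sub>1 \<Lambda> l\<^sub>1 \<Gamma>\<^sub>2 l\<^sub>2 A F"
proof -
  interpret A: stein \<Gamma>\<^sub>1 \<Lambda> l\<^sub>1 by (rule S1)
  interpret B: stein \<Gamma>\<^sub>2 \<Lambda> l\<^sub>2 by (rule S2)
  have "A.pl_equivalent l\<^sub>1 (s * l\<^sub>2)"
    by (rule A.pl_equivalent_of_coinvariant) (use A.l_in A.l_pos B.l_in B.l_pos s rel in auto)
  then obtain F0 where F0: "pl_homeo \<Gamma>\<^sub>1 \<Lambda> \<Gamma>\<^sub>1 F0" "F0 0 = 0" "F0 l\<^sub>1 = s * l\<^sub>2"
    unfolding A.pl_equivalent_def by blast
  let ?G = "\<lambda>x. (1 / s) * x"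
  have slope: "slope_set \<Gamma>\<^sub>1 {1 / s} \<Gamma>\<^sub>2"
    unfolding slope_set_def
  proof (intro ballI conjI allI)
    fix a x assume a: "a \<in> {1 / s}"
    show "0 < a" using a s by simp
    show "a * x \<in> \<Gamma>\<^sub>2 \<longleftrightarrow> x \<in> \<Gamma>\<^sub>1"
    proof
      assume "a * x \<in> \<Gamma>\<^sub>2"
      then have "s * (a * x) \<in> \<Gamma>\<^sub>1" unfolding s(2) by blast
      then show "x \<in> \<Gamma>\<^sub>1" using a s(1) by simp
    next
      assume "x \<in> \<Gamma>\<^sub>1"
      then obtain t where "t \<in> \<Gamma>\<^sub>2" "x = s * t" unfolding s(2) by blast
      then show "a * x \<in> \<Gamma>\<^sub>2" using a s(1) by simp
    qed
  qed
  have sj: "surj ?G" by (rule surjI[of _ "\<lambda>x. s * x"]) (use s in simp)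
  have sm: "strict_mono ?G" using s by (simp add: strict_mono_def divide_strict_right_mono)
  have "\<forall>x\<in>{p..q}. ?G x = (1 / s) * x + 0" for p q by simp
  then have af: "\<exists>a\<in>{1 / s}. \<exists>r\<in>\<Gamma>\<^sub>2. \<forall>x\<in>{p..q}. ?G x = a * x + r" for p q using B.add(1) by blast
  have G: "pl_homeo \<Gamma>\<^sub>1 {1 / s} \<Gamma>\<^sub>2 ?G"
    unfolding pl_homeo_def by (intro conjI exI[of _ "{}"] allI impI sm sj af) simp_all
  let ?A = "(\<lambda>b. (1 / s) * b) ` \<Lambda>"
  have H: "pl_homeo \<Gamma>\<^sub>1 ?A \<Gamma>\<^sub>2 (\<lambda>x. ?G (F0 x))"
    by (rule pl_homeo_compose[OF F0(1) G A.slope_set_\<Lambda> slope A.add_group B.add_group]) auto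
  have slope': "slope_set \<Gamma>\<^sub>1 ?A \<Gamma>\<^sub>2"
    unfolding slope_set_def
  proof (intro ballI conjI allI)
    fix a x assume "a \<in> ?A"
    then obtain b where b: "b \<in> \<Lambda>" "a = (1 / s) * b" by blast
    show "0 < a" using b s A.mul(2) by simp
    have "(1 / s) * (b * x) \<in> \<Gamma>\<^sub>2 \<longleftrightarrow> b * x \<in> \<Gamma>\<^sub>1" by (rule slope_setD(2)[OF slope]) simp
    then show "a * x \<in> \<Gamma>\<^sub>2 \<longleftrightarrow> x \<in> \<Gamma>\<^sub>1" using A.scale_iff[OF b(1)] b(2) by simp
  qed
  have "a * c / b \<in> \<Lambda>" if abc: "a \<in> ?A" "b \<in> ?A" "c \<in> \<Lambda>" for a b c
  proof -
    obtain a' b' where "a' \<in> \<Lambda>" "b' \<in> \<Lambda>" "a = (1 / s) * a'" "b = (1 / s) * b'" using abc by blast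
    then show ?thesis using s(1) A.mul(4,5) abc(3) by simp
  qed
  then have "pl_equivalence \<Gamma>\<^sub>1 \<Lambda> l\<^sub>1 \<Gamma>\<^sub>2 l\<^sub>2 ?A (\<lambda>x. ?G (F0 x))"
    using S1 S2 H slope' F0 s
    by (intro pl_equivalence.intro pl_equivalence_axioms.intro) auto
  then show ?thesis by blast
qed

section \<open>Cells in the split line\<close>

text \<open>
  The compact open set written \<open>[p\<^sub>+, q\<^sub>-]\<close>.
\<close>

definition cell :: "real set \<Rightarrow> real \<Rightarrow> real \<Rightarrow> split_real set" where
  "cell \<Gamma> p q = {z \<in> split_points \<Gamma>. Plus p \<le> z \<and> z \<le> Minus q}"

lemma split_points_iff [simp]:
  "Regular x \<in> split_points \<Gamma> \<longleftrightarrow> x \<notin> \<Gamma>" "Minus x \<in> split_points \<Gamma> \<longleftrightarrow> x \<in> \<Gamma>" "Plus x \<in> split_points \<Gamma> \<longleftrightarrow> x \<in> \<Gamma>"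
  by (auto simp: split_points_def)

lemma cell_iff:
  "Regular x \<in> cell \<Gamma> p q \<longleftrightarrow> x \<notin> \<Gamma> \<and> p < x \<and> x < q"
  "Minus x \<in> cell \<Gamma> p q \<longleftrightarrow> x \<in> \<Gamma> \<and> p < x \<and> x \<le> q"
  "Plus x \<in> cell \<Gamma> p q \<longleftrightarrow> x \<in> \<Gamma> \<and> p \<le> x \<and> x < q"
  by (auto simp: cell_def less_eq_split_real_def)

lemma cell_Int_iff: "z \<in> cell \<Gamma> (max p p') (min q q') \<longleftrightarrow> z \<in> cell \<Gamma> p q \<and> z \<in> cell \<Gamma> p' q'"
  by (cases z) (auto simp: cell_iff)

lemma cell_mono: "p' \<le> p \<Longrightarrow> q \<le> q' \<Longrightarrow> cell \<Gamma> p q \<subseteq> cell \<Gamma> p' q'"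
proof
  fix z assume "p' \<le> p" "q \<le> q'" "z \<in> cell \<Gamma> p q"
  then show "z \<in> cell \<Gamma> p' q'" by (cases z) (auto simp: cell_iff)
qed

lemma cell_less: "z \<in> cell \<Gamma> p q \<Longrightarrow> p < q"
  by (cases z) (auto simp: cell_iff)

lemma cell_collapse: "z \<in> cell \<Gamma> p q \<Longrightarrow> p \<le> collapse z \<and> collapse z \<le> q"
  by (cases z) (auto simp: cell_iff)

lemma cell_split_points: "cell \<Gamma> p q \<subseteq> split_points \<Gamma>"
  by (auto simp: cell_def)

context stein
begin

lemma cell_below:
  assumes "z \<in> split_points \<Gamma>" "x \<in> split_points \<Gamma>" "z < x"
  shows "\<exists>p\<in>\<Gamma>. \<exists>q\<in>\<Gamma>. z \<in> cell \<Gamma> p q \<and> cell \<Gamma> p q \<subseteq> {y. y < x}"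
proof -
  obtain p where p: "p \<in> \<Gamma>" "p < collapse z" using between[of "collapse z - 1" "collapse z"] by auto
  show ?thesis
  proof (cases "collapse z < collapse x")
    case True
    then obtain q where q: "q \<in> \<Gamma>" "collapse z < q" "q < collapse x" using between by blast
    have "z \<in> cell \<Gamma> p q" using assms(1) p q by (cases z) (auto simp: cell_iff)
    moreover have "y < x" if "y \<in> cell \<Gamma> p q" for y
      using cell_collapse[OF that] q by (auto simp: less_split_real_def)
    ultimately show ?thesis using p q by blast
  next
    case False
    then have "z = Minus (collapse z)" "x = Plus (collapse z)"
      using assms by (cases z; cases x; auto simp: less_split_real_def)+
    then obtain c where c: "z = Minus c" "x = Plus c" by blast
    have "z \<in> cell \<Gamma> p c" using assms(1) p c by (auto simp: cell_iff)
    moreover have "y < x" if "y \<in> cell \<Gamma> p c" for y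
      using that c by (cases y) (auto simp: cell_iff less_split_real_def)
    ultimately show ?thesis using p c assms(1) by auto
  qed
qed

lemma cell_above:
  assumes "z \<in> split_points \<Gamma>" "x \<in> split_points \<Gamma>" "x < z"
  shows "\<exists>p\<in>\<Gamma>. \<exists>q\<in>\<Gamma>. z \<in> cell \<Gamma> p q \<and> cell \<Gamma> p q \<subseteq> {y. x < y}"
proof -
  obtain q where q: "q \<in> \<Gamma>" "collapse z < q" using between[of "collapse z" "collapse z + 1"] by auto
  show ?thesis
  proof (cases "collapse x < collapse z")
    case True
    then obtain p where p: "p \<in> \<Gamma>" "collapse x < p" "p < collapse z" using between by blast
    have "z \<in> cell \<Gamma> p q" using assms(1) p q by (cases z) (auto simp: cell_iff)
    moreover have "x < y" if "y \<in> cell \<Gamma> p q" for y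
      using cell_collapse[OF that] p by (auto simp: less_split_real_def)
    ultimately show ?thesis using p q by blast
  next
    case False
    then have "x = Minus (collapse z)" "z = Plus (collapse z)"
      using assms by (cases z; cases x; auto simp: less_split_real_def)+
    then obtain c where c: "x = Minus c" "z = Plus c" by blast
    have "z \<in> cell \<Gamma> c q" using assms(1) q c by (auto simp: cell_iff)
    moreover have "x < y" if "y \<in> cell \<Gamma> c q" for y
      using that c by (cases y) (auto simp: cell_iff less_split_real_def)
    ultimately show ?thesis using q c assms(1) by auto
  qed
qed

lemma cell_exists: "z \<in> split_points \<Gamma> \<Longrightarrow> \<exists>p\<in>\<Gamma>. \<exists>q\<in>\<Gamma>. z \<in> cell \<Gamma> p q"
proof -
  assume z: "z \<in> split_points \<Gamma>"
  obtain x where "x \<in> \<Gamma>" "collapse z < x" using between[of "collapse z" "collapse z + 1"] by auto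
  then show ?thesis using cell_below[OF z, of "Plus x"] by (auto simp: less_split_real_def)
qed

lemma max_min_in: "p \<in> \<Gamma> \<Longrightarrow> q \<in> \<Gamma> \<Longrightarrow> max p q \<in> \<Gamma>" "p \<in> \<Gamma> \<Longrightarrow> q \<in> \<Gamma> \<Longrightarrow> min p q \<in> \<Gamma>"
  by (auto simp: max_def min_def)

text \<open>The cells with endpoints in \<open>\<Gamma>\<close> are a basis.\<close>

lemma openin_split_topology_iff:
  "openin (split_topology \<Gamma>) U \<longleftrightarrow>
     U \<subseteq> split_points \<Gamma> \<and> (\<forall>z\<in>U. \<exists>p\<in>\<Gamma>. \<exists>q\<in>\<Gamma>. z \<in> cell \<Gamma> p q \<and> cell \<Gamma> p q \<subseteq> U)"
proof
  assume "openin (split_topology \<Gamma>) U"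
  then have "generate_topology_on ((\<lambda>x. {y \<in> split_points \<Gamma>. y < x}) ` split_points \<Gamma> \<union>
      (\<lambda>x. {y \<in> split_points \<Gamma>. x < y}) ` split_points \<Gamma>) U"
    unfolding split_topology_def openin_topology_generated_by_iff .
  then show "U \<subseteq> split_points \<Gamma> \<and> (\<forall>z\<in>U. \<exists>p\<in>\<Gamma>. \<exists>q\<in>\<Gamma>. z \<in> cell \<Gamma> p q \<and> cell \<Gamma> p q \<subseteq> U)"
  proof induction
    case (Int a b)
    have "\<exists>p\<in>\<Gamma>. \<exists>q\<in>\<Gamma>. z \<in> cell \<Gamma> p q \<and> cell \<Gamma> p q \<subseteq> a \<inter> b" if z: "z \<in> a \<inter> b" for z
    proof -
      obtain p q where 1: "p \<in> \<Gamma>" "q \<in> \<Gamma>" "z \<in> cell \<Gamma> p q" "cell \<Gamma> p q \<subseteq> a" using Int.IH(1) z by blast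
      obtain p' q' where 2: "p' \<in> \<Gamma>" "q' \<in> \<Gamma>" "z \<in> cell \<Gamma> p' q'" "cell \<Gamma> p' q' \<subseteq> b" using Int.IH(2) z by blast
      have "cell \<Gamma> (max p p') (min q q') \<subseteq> a \<inter> b" using 1 2 cell_Int_iff by blast
      moreover have "z \<in> cell \<Gamma> (max p p') (min q q')" using 1(3) 2(3) by (simp only: cell_Int_iff)
      moreover have "max p p' \<in> \<Gamma>" "min q q' \<in> \<Gamma>" using 1 2 by (simp_all only: max_min_in)
      ultimately show ?thesis by blast
    qed
    moreover have "a \<inter> b \<subseteq> split_points \<Gamma>" using conjunct1[OF Int.IH(1)] by (rule le_infI1)
    ultimately show ?case by (intro conjI ballI)
  next
    case (UN K)
    have "\<exists>p\<in>\<Gamma>. \<exists>q\<in>\<Gamma>. z \<in> cell \<Gamma> p q \<and> cell \<Gamma> p q \<subseteq> \<Union> K" if z: "z \<in> \<Union> K" for z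
    proof -
      obtain k where k: "k \<in> K" "z \<in> k" using z by blast
      then obtain p q where "p \<in> \<Gamma>" "q \<in> \<Gamma>" "z \<in> cell \<Gamma> p q" "cell \<Gamma> p q \<subseteq> k" using UN.IH[OF k(1)] by blast
      then have "cell \<Gamma> p q \<subseteq> \<Union> K" using k(1) by (meson Union_upper subset_trans)
      then show ?thesis using \<open>p \<in> \<Gamma>\<close> \<open>q \<in> \<Gamma>\<close> \<open>z \<in> cell \<Gamma> p q\<close> by blast
    qed
    moreover have "\<Union> K \<subseteq> split_points \<Gamma>" using UN.IH by (intro Sup_least) simp
    ultimately show ?case by (intro conjI ballI)
  next
    case (Basis s)
    then consider x where "x \<in> split_points \<Gamma>" "s = {y \<in> split_points \<Gamma>. y < x}"
      | x where "x \<in> split_points \<Gamma>" "s = {y \<in> split_points \<Gamma>. x < y}" by blast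
    then show ?case
    proof cases
      case 1
      have "\<exists>p\<in>\<Gamma>. \<exists>q\<in>\<Gamma>. z \<in> cell \<Gamma> p q \<and> cell \<Gamma> p q \<subseteq> s" if "z \<in> s" for z
        using cell_below[of z x] that 1 cell_split_points by blast
      then show ?thesis using 1 by blast
    next
      case 2
      have "\<exists>p\<in>\<Gamma>. \<exists>q\<in>\<Gamma>. z \<in> cell \<Gamma> p q \<and> cell \<Gamma> p q \<subseteq> s" if "z \<in> s" for z
        using cell_above[of z x] that 2 cell_split_points by blast
      then show ?thesis using 2 by blast
    qed
  qed auto
next
  assume U: "U \<subseteq> split_points \<Gamma> \<and> (\<forall>z\<in>U. \<exists>p\<in>\<Gamma>. \<exists>q\<in>\<Gamma>. z \<in> cell \<Gamma> p q \<and> cell \<Gamma> p q \<subseteq> U)"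
  have cell_open: "openin (split_topology \<Gamma>) (cell \<Gamma> p q)" if "p \<in> \<Gamma>" "q \<in> \<Gamma>" for p q
  proof -
    have "cell \<Gamma> p q = {y \<in> split_points \<Gamma>. y < Plus q} \<inter> {y \<in> split_points \<Gamma>. Minus p < y}"
    proof (rule Set.set_eqI)
      fix z show "z \<in> cell \<Gamma> p q \<longleftrightarrow> z \<in> {y \<in> split_points \<Gamma>. y < Plus q} \<inter> {y \<in> split_points \<Gamma>. Minus p < y}"
        using that by (cases z) (auto simp: cell_iff less_split_real_def)
    qed
    moreover have "openin (split_topology \<Gamma>) {y \<in> split_points \<Gamma>. y < Plus q}"
      "openin (split_topology \<Gamma>) {y \<in> split_points \<Gamma>. Minus p < y}"
      unfolding split_topology_def using that
      by (intro topology_generated_by_Basis UnI1 imageI UnI2; simp)+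
    ultimately show ?thesis by (simp only: openin_Int)
  qed
  show "openin (split_topology \<Gamma>) U"
    by (subst openin_subopen) (use U cell_open in blast)
qed

lemma topspace_split_topology: "topspace (split_topology \<Gamma>) = split_points \<Gamma>"
proof (rule subset_antisym)
  show "topspace (split_topology \<Gamma>) \<subseteq> split_points \<Gamma>"
    using openin_split_topology_iff openin_topspace by blast
  have "openin (split_topology \<Gamma>) (split_points \<Gamma>)"
    unfolding openin_split_topology_iff using cell_exists cell_split_points by blast
  then show "split_points \<Gamma> \<subseteq> topspace (split_topology \<Gamma>)" by (rule openin_subset)
qed

end

section \<open>Arrows of the Stein groupoid\<close>

text \<open>
  The operations of the group of affine maps on pairs of reals, without reference to \<open>\<Gamma>\<close> and \<open>\<Lambda>\<close>.
\<close>

definition aff_mult :: "real \<times> real \<Rightarrow> real \<times> real \<Rightarrow> real \<times> real" where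
  "aff_mult g h = (fst g + snd g * fst h, snd g * snd h)"

definition aff_inv :: "real \<times> real \<Rightarrow> real \<times> real" where
  "aff_inv g = (- (fst g / snd g), 1 / snd g)"

lemma affine_act_eq:
  "affine_act g (Regular x) = Regular (snd g * x + fst g)" "affine_act g (Minus x) = Minus (snd g * x + fst g)"
  "affine_act g (Plus x) = Plus (snd g * x + fst g)"
  by (cases g; simp)+

lemma affine_act_mult: "affine_act (aff_mult g h) z = affine_act g (affine_act h z)"
  by (cases z) (simp_all add: affine_act_eq aff_mult_def algebra_simps)

lemma affine_act_one [simp]: "affine_act (0, 1) z = z"
  by (cases z) simp_all

lemma aff_inv_left: "snd g \<noteq> 0 \<Longrightarrow> aff_mult (aff_inv g) g = (0, 1)"
  and aff_inv_right: "snd g \<noteq> 0 \<Longrightarrow> aff_mult g (aff_inv g) = (0, 1)"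
  and aff_inv_inv: "snd g \<noteq> 0 \<Longrightarrow> aff_inv (aff_inv g) = g"
  by (simp_all add: aff_mult_def aff_inv_def prod_eq_iff)

lemma aff_mult_assoc: "aff_mult (aff_mult g h) k = aff_mult g (aff_mult h k)"
  by (simp add: aff_mult_def algebra_simps)

lemma aff_mult_one [simp]: "aff_mult (0, 1) g = g" "aff_mult g (0, 1) = g"
  by (simp_all add: aff_mult_def)

lemma aff_inv_mult: "snd g \<noteq> 0 \<Longrightarrow> snd h \<noteq> 0 \<Longrightarrow> aff_inv (aff_mult g h) = aff_mult (aff_inv h) (aff_inv g)"
  by (simp add: aff_mult_def aff_inv_def field_simps)

lemma affine_act_inv: "snd g \<noteq> 0 \<Longrightarrow> affine_act (aff_inv g) (affine_act g z) = z"
  "snd g \<noteq> 0 \<Longrightarrow> affine_act g (affine_act (aff_inv g) z) = z"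
  by (simp_all add: aff_inv_left aff_inv_right flip: affine_act_mult)

context stein
begin

abbreviation "Aff \<equiv> \<Gamma> \<times> \<Lambda>"
abbreviation "Y \<equiv> cell \<Gamma> 0 l"

lemma Aff_snd: "g \<in> Aff \<Longrightarrow> snd g \<noteq> 0" "g \<in> Aff \<Longrightarrow> 0 < snd g"
  using mul(2) by fastforce+

lemma Aff_mult: "g \<in> Aff \<Longrightarrow> h \<in> Aff \<Longrightarrow> aff_mult g h \<in> Aff"
  using add(3) stable mul(4) by (auto simp: aff_mult_def)

lemma Aff_inv: "g \<in> Aff \<Longrightarrow> aff_inv g \<in> Aff"
  using add(2) divide_in mul(6) by (auto simp: aff_inv_def)

lemma Aff_one: "(0, 1) \<in> Aff" using add(1) mul(1) by simp

lemma affine_group_simps: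
  "carrier (affine_group \<Gamma> \<Lambda>) = Aff" "one (affine_group \<Gamma> \<Lambda>) = (0, 1)" "mult (affine_group \<Gamma> \<Lambda>) = aff_mult"
  by (auto simp: affine_group_def aff_mult_def fun_eq_iff)

lemma group_affine: "group (affine_group \<Gamma> \<Lambda>)"
proof (rule groupI, unfold affine_group_simps)
  show "\<exists>h\<in>Aff. aff_mult h g = (0, 1)" if "g \<in> Aff" for g
    using that Aff_inv aff_inv_left Aff_snd(1) by blast
qed (simp_all only: Aff_mult Aff_one aff_mult_assoc aff_mult_one)

lemma affine_group_inv: "g \<in> Aff \<Longrightarrow> m_inv (affine_group \<Gamma> \<Lambda>) g = aff_inv g"
  by (rule group.inv_equality[OF group_affine])
     (auto simp: affine_group_simps Aff_inv aff_inv_left Aff_snd simp del: mem_Sigma_iff)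

lemma act_split_points:
  assumes g: "g \<in> Aff"
  shows "affine_act g z \<in> split_points \<Gamma> \<longleftrightarrow> z \<in> split_points \<Gamma>"
proof -
  have "snd g * x + fst g \<in> \<Gamma> \<longleftrightarrow> x \<in> \<Gamma>" for x
  proof -
    have "fst g \<in> \<Gamma>" "snd g \<in> \<Lambda>" using g by auto
    then show ?thesis using scale_iff[of "snd g" x] add(3,4) by (metis add_diff_cancel_right')
  qed
  then show ?thesis by (cases z) (simp_all add: affine_act_eq)
qed

lemma act_cell:
  assumes g: "g \<in> Aff"
  shows "affine_act g z \<in> cell \<Gamma> (snd g * p + fst g) (snd g * q + fst g) \<longleftrightarrow> z \<in> cell \<Gamma> p q"
proof -
  have "snd g * x + fst g \<in> \<Gamma> \<longleftrightarrow> x \<in> \<Gamma>" for x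
    using act_split_points[OF g, of "Plus x"] by (simp add: affine_act_eq)
  then show ?thesis using Aff_snd(2)[OF g] by (cases z) (simp_all add: affine_act_eq cell_iff)
qed

abbreviation "Gr \<equiv> reduction (stein_groupoid \<Gamma> \<Lambda>) (unit_interval \<Gamma> \<Lambda> l)"

definition arrow_set :: "(split_real \<times> real \<times> real) set" where
  "arrow_set = {(z, g). z \<in> Y \<and> g \<in> Aff \<and> affine_act (aff_inv g) z \<in> Y}"

lemma unit_interval_eq: "unit_interval \<Gamma> \<Lambda> l = Y \<times> {(0, 1)}"
  by (auto simp: unit_interval_def cell_def affine_group_def)

lemma Gr_rng: "rng Gr (z, g) = (z, (0, 1))"
  and Gr_comp: "gcomp Gr (z, g) (w, h) = (z, aff_mult g h)"
  by (simp_all add: reduction_def stein_groupoid_def transformation_groupoid_def affine_group_simps)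

lemma Gr_src: "g \<in> Aff \<Longrightarrow> src Gr (z, g) = (affine_act (aff_inv g) z, (0, 1))"
  by (simp add: reduction_def stein_groupoid_def transformation_groupoid_def affine_group_simps affine_group_inv)

lemma Gr_arrows: "arrows Gr = subtopology (prod_topology (split_topology \<Gamma>) (discrete_topology Aff)) arrow_set"
proof -
  have "{g \<in> topspace (arrows (stein_groupoid \<Gamma> \<Lambda>)). rng (stein_groupoid \<Gamma> \<Lambda>) g \<in> unit_interval \<Gamma> \<Lambda> l \<and>
      src (stein_groupoid \<Gamma> \<Lambda>) g \<in> unit_interval \<Gamma> \<Lambda> l} = arrow_set"
  proof (rule Set.set_eqI)
    fix w :: "split_real \<times> real \<times> real"
    obtain z g where w: "w = (z, g)" by (cases w)
    show "w \<in> {g \<in> topspace (arrows (stein_groupoid \<Gamma> \<Lambda>)). rng (stein_groupoid \<Gamma> \<Lambda>) g \<in> unit_interval \<Gamma> \<Lambda> l \<and>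
        src (stein_groupoid \<Gamma> \<Lambda>) g \<in> unit_interval \<Gamma> \<Lambda> l} \<longleftrightarrow> w \<in> arrow_set"
    proof (cases "g \<in> Aff")
      case True
      then have in_top: "w \<in> topspace (arrows (stein_groupoid \<Gamma> \<Lambda>)) \<longleftrightarrow> z \<in> split_points \<Gamma>"
        by (simp add: w stein_groupoid_def transformation_groupoid_def affine_group_simps topspace_split_topology
            del: mem_Sigma_iff) (simp add: mem_Times_iff)
      have "rng (stein_groupoid \<Gamma> \<Lambda>) w = (z, (0, 1))" "src (stein_groupoid \<Gamma> \<Lambda>) w = (affine_act (aff_inv g) z, (0, 1))"
        by (simp_all add: w stein_groupoid_def transformation_groupoid_def affine_group_simps affine_group_inv[OF True])
      then show ?thesis using in_top True cell_split_points[of \<Gamma> 0 l]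
        unfolding w arrow_set_def unit_interval_eq by auto
    next
      case False
      then show ?thesis
        unfolding w arrow_set_def by (auto simp: stein_groupoid_def transformation_groupoid_def affine_group_simps)
    qed
  qed
  then show ?thesis
    by (simp add: reduction_def stein_groupoid_def transformation_groupoid_def affine_group_simps)
qed

lemma topspace_Gr: "topspace (arrows Gr) = arrow_set"
  using cell_split_points[of \<Gamma> 0 l]
  by (auto simp: Gr_arrows topspace_split_topology arrow_set_def)

text \<open>
  The group coordinate is discrete, so neighbourhoods vary only the point.
\<close>

lemma openin_Gr_iff:
  "openin (arrows Gr) W \<longleftrightarrow> W \<subseteq> arrow_set \<and>
     (\<forall>(z, g)\<in>W. \<exists>p\<in>\<Gamma>. \<exists>q\<in>\<Gamma>. z \<in> cell \<Gamma> p q \<and> (\<forall>z'\<in>cell \<Gamma> p q. (z', g) \<in> arrow_set \<longrightarrow> (z', g) \<in> W))"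
proof
  assume "openin (arrows Gr) W"
  then obtain T where T: "openin (prod_topology (split_topology \<Gamma>) (discrete_topology Aff)) T" "W = T \<inter> arrow_set"
    unfolding Gr_arrows openin_subtopology by blast
  have "\<exists>p\<in>\<Gamma>. \<exists>q\<in>\<Gamma>. z \<in> cell \<Gamma> p q \<and> (\<forall>z'\<in>cell \<Gamma> p q. (z', g) \<in> arrow_set \<longrightarrow> (z', g) \<in> W)" if zg: "(z, g) \<in> W" for z g
  proof -
    obtain U U' where U: "openin (split_topology \<Gamma>) U" "z \<in> U" "g \<in> U'" "U \<times> U' \<subseteq> T"
      using T zg unfolding openin_prod_topology_alt by blast
    then obtain p q where "p \<in> \<Gamma>" "q \<in> \<Gamma>" "z \<in> cell \<Gamma> p q" "cell \<Gamma> p q \<subseteq> U"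
      unfolding openin_split_topology_iff by blast
    then show ?thesis using U T(2) by blast
  qed
  then show "W \<subseteq> arrow_set \<and> (\<forall>(z, g)\<in>W. \<exists>p\<in>\<Gamma>. \<exists>q\<in>\<Gamma>. z \<in> cell \<Gamma> p q \<and>
      (\<forall>z'\<in>cell \<Gamma> p q. (z', g) \<in> arrow_set \<longrightarrow> (z', g) \<in> W))" using T(2) by blast
next
  assume W: "W \<subseteq> arrow_set \<and> (\<forall>(z, g)\<in>W. \<exists>p\<in>\<Gamma>. \<exists>q\<in>\<Gamma>. z \<in> cell \<Gamma> p q \<and>
      (\<forall>z'\<in>cell \<Gamma> p q. (z', g) \<in> arrow_set \<longrightarrow> (z', g) \<in> W))"
  define T where "T = \<Union>{cell \<Gamma> p q \<times> {g} |p q g. p \<in> \<Gamma> \<and> q \<in> \<Gamma> \<and> g \<in> Aff \<and>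
      (\<forall>z'\<in>cell \<Gamma> p q. (z', g) \<in> arrow_set \<longrightarrow> (z', g) \<in> W)}"
  have "openin (prod_topology (split_topology \<Gamma>) (discrete_topology Aff)) T"
    unfolding T_def
  proof (rule openin_Union)
    fix S assume "S \<in> {cell \<Gamma> p q \<times> {g} |p q g. p \<in> \<Gamma> \<and> q \<in> \<Gamma> \<and> g \<in> Aff \<and>
      (\<forall>z'\<in>cell \<Gamma> p q. (z', g) \<in> arrow_set \<longrightarrow> (z', g) \<in> W)}"
    then obtain p q g where S: "S = cell \<Gamma> p q \<times> {g}" "p \<in> \<Gamma>" "q \<in> \<Gamma>" "g \<in> Aff" by blast
    then have "openin (split_topology \<Gamma>) (cell \<Gamma> p q)"
      unfolding openin_split_topology_iff using cell_split_points by blast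
    then show "openin (prod_topology (split_topology \<Gamma>) (discrete_topology Aff)) S"
      unfolding S(1) using S(4) by (intro openin_prod_Times_iff[THEN iffD2]) simp
  qed
  moreover have "W = T \<inter> arrow_set"
  proof (intro equalityI subsetI)
    fix w assume w: "w \<in> W"
    obtain z g where zg: "w = (z, g)" by (cases w)
    then have "g \<in> Aff" using w W by (auto simp: arrow_set_def)
    obtain p q where "p \<in> \<Gamma>" "q \<in> \<Gamma>" "z \<in> cell \<Gamma> p q" "\<forall>z'\<in>cell \<Gamma> p q. (z', g) \<in> arrow_set \<longrightarrow> (z', g) \<in> W"
      using w W zg by blast
    then have "(z, g) \<in> T" unfolding T_def using \<open>g \<in> Aff\<close> by blast
    then show "w \<in> T \<inter> arrow_set" using w W zg by blast
  next
    fix w assume "w \<in> T \<inter> arrow_set"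
    then show "w \<in> W" unfolding T_def by blast
  qed
  ultimately show "openin (arrows Gr) W" unfolding Gr_arrows openin_subtopology by blast
qed

lemma arrow_setI: "z \<in> Y \<Longrightarrow> g \<in> Aff \<Longrightarrow> affine_act (aff_inv g) z \<in> Y \<Longrightarrow> (z, g) \<in> arrow_set"
  by (simp add: arrow_set_def)

lemma arrow_setD: "(z, g) \<in> arrow_set \<Longrightarrow> z \<in> Y" "(z, g) \<in> arrow_set \<Longrightarrow> g \<in> Aff"
  "(z, g) \<in> arrow_set \<Longrightarrow> affine_act (aff_inv g) z \<in> Y"
  by (auto simp: arrow_set_def)

lemma unit_arrow: "z \<in> Y \<Longrightarrow> (z, (0, 1)) \<in> arrow_set"
proof -
  assume z: "z \<in> Y"
  have "aff_inv (0, 1) = (0, 1)" by (simp add: aff_inv_def)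
  then show ?thesis using z Aff_one by (intro arrow_setI) simp_all
qed

end

section \<open>Piecewise linear homeomorphisms induce isomorphisms of groupoids\<close>

primrec split_map :: "(real \<Rightarrow> real) \<Rightarrow> split_real \<Rightarrow> split_real" where
  "split_map F (Regular x) = Regular (F x)"
| "split_map F (Minus x) = Minus (F x)"
| "split_map F (Plus x) = Plus (F x)"

context pl_equivalence
begin

lemma F_mem_iff: "F x \<in> \<Gamma>\<^sub>2 \<longleftrightarrow> x \<in> \<Gamma>\<^sub>1"
  by (rule pl_homeo_mem_iff[OF homeo slopes S2.add_group])

lemma split_map_cell: "split_map F z \<in> cell \<Gamma>\<^sub>2 (F p) (F q) \<longleftrightarrow> z \<in> cell \<Gamma>\<^sub>1 p q"
  by (cases z) (simp_all add: cell_iff F_mem_iff strict_mono_less[OF mono] strict_mono_less_eq[OF mono])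

lemma split_map_Y: "split_map F z \<in> S2.Y \<longleftrightarrow> z \<in> S1.Y"
  using split_map_cell[of z 0 l\<^sub>1] ends by simp

definition germ :: "split_real \<Rightarrow> real \<times> real \<Rightarrow> bool" where
  "germ z g \<longleftrightarrow> g \<in> \<Gamma>\<^sub>2 \<times> A \<and> (\<exists>p\<in>\<Gamma>\<^sub>1. \<exists>q\<in>\<Gamma>\<^sub>1. z \<in> cell \<Gamma>\<^sub>1 p q \<and> (\<forall>x\<in>{p..q}. F x = snd g * x + fst g))"

text \<open>
  The breakpoints of \<open>F\<close> lie in \<open>\<Gamma>\<^sub>1\<close>, where the line is split: at \<open>Minus x\<close> and \<open>Plus x\<close> a
  one-sided neighbourhood is enough.
\<close>

lemma germ_exists:
  assumes z: "z \<in> split_points \<Gamma>\<^sub>1"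
  shows "\<exists>g. germ z g"
proof -
  obtain D where D: "finite D" "D \<subseteq> \<Gamma>\<^sub>1" "\<forall>p q. p < q \<longrightarrow> {p<..<q} \<inter> D = {} \<longrightarrow> (\<exists>a\<in>A. \<exists>s\<in>\<Gamma>\<^sub>2. \<forall>x\<in>{p..q}. F x = a * x + s)"
    by (rule pl_homeoE[OF homeo])
  have germI: "\<exists>g. germ z g" if pq: "p \<in> \<Gamma>\<^sub>1" "q \<in> \<Gamma>\<^sub>1" "z \<in> cell \<Gamma>\<^sub>1 p q" "{p<..<q} \<inter> D = {}" for p q
  proof -
    obtain a s where "a \<in> A" "s \<in> \<Gamma>\<^sub>2" "\<forall>x\<in>{p..q}. F x = a * x + s" using D(3) pq(4) cell_less[OF pq(3)] by blast
    then have "germ z (s, a)" unfolding germ_def using pq by auto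
    then show ?thesis by blast
  qed
  have right: "\<exists>q\<in>\<Gamma>\<^sub>1. x < q \<and> {x<..<q} \<inter> D = {}" for x
  proof -
    obtain q' where q': "x < q'" "{x<..<q'} \<inter> D = {}" using finite_gap_right[OF D(1)] by blast
    then obtain q where q: "q \<in> \<Gamma>\<^sub>1" "x < q" "q < q'" using S1.between by blast
    then have "{x<..<q} \<subseteq> {x<..<q'}" by auto
    then show ?thesis using q q'(2) by blast
  qed
  have left: "\<exists>p\<in>\<Gamma>\<^sub>1. p < x \<and> {p<..<x} \<inter> D = {}" for x
  proof -
    obtain p' where p': "p' < x" "{p'<..<x} \<inter> D = {}" using finite_gap_left[OF D(1)] by blast
    then obtain p where p: "p \<in> \<Gamma>\<^sub>1" "p' < p" "p < x" using S1.between by blast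
    then have "{p<..<x} \<subseteq> {p'<..<x}" by auto
    then show ?thesis using p p'(2) by blast
  qed
  show ?thesis
  proof (cases z)
    case (Regular x)
    obtain p where p: "p \<in> \<Gamma>\<^sub>1" "p < x" "{p<..<x} \<inter> D = {}" using left by blast
    obtain q where q: "q \<in> \<Gamma>\<^sub>1" "x < q" "{x<..<q} \<inter> D = {}" using right by blast
    have "x \<notin> D" using z Regular D(2) by auto
    have "{p<..<q} \<inter> D = {}"
    proof (rule ccontr)
      assume "\<not> ?thesis"
      then obtain d where d: "d \<in> D" "p < d" "d < q" by auto
      then show False using p(3) q(3) \<open>x \<notin> D\<close> by (cases d x rule: linorder_cases) auto
    qed
    then show ?thesis using germI[OF p(1) q(1)] p q z Regular by (simp add: cell_iff)
  next
    case (Minus x)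
    obtain p where p: "p \<in> \<Gamma>\<^sub>1" "p < x" "{p<..<x} \<inter> D = {}" using left by blast
    then show ?thesis using germI[OF p(1), of x] z Minus by (simp add: cell_iff)
  next
    case (Plus x)
    obtain q where q: "q \<in> \<Gamma>\<^sub>1" "x < q" "{x<..<q} \<inter> D = {}" using right by blast
    then show ?thesis using germI[OF _ q(1), of x] z Plus by (simp add: cell_iff)
  qed
qed

lemma germ_unique:
  assumes "germ z g" "germ z h"
  shows "g = h"
proof -
  obtain p q where 1: "z \<in> cell \<Gamma>\<^sub>1 p q" "\<forall>x\<in>{p..q}. F x = snd g * x + fst g"
    using assms(1) unfolding germ_def by blast
  obtain p' q' where 2: "z \<in> cell \<Gamma>\<^sub>1 p' q'" "\<forall>x\<in>{p'..q'}. F x = snd h * x + fst h"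
    using assms(2) unfolding germ_def by blast
  define u v where "u = max p p'" and "v = min q q'"
  have "u < v" using cell_less[of z \<Gamma>\<^sub>1 u v] 1(1) 2(1) cell_Int_iff unfolding u_def v_def by blast
  then have uv: "u \<in> {p..q}" "v \<in> {p..q}" "u \<in> {p'..q'}" "v \<in> {p'..q'}" by (auto simp: u_def v_def)
  have e: "snd g * u + fst g = snd h * u + fst h" "snd g * v + fst g = snd h * v + fst h"
    using 1(2) 2(2) uv by metis+
  then have "(snd g - snd h) * (u - v) = 0" by (simp add: algebra_simps)
  then have "snd g = snd h" using \<open>u < v\<close> by simp
  then show ?thesis using e by (simp add: prod_eq_iff)
qed

definition the_germ :: "split_real \<Rightarrow> real \<times> real" where "the_germ z = (THE g. germ z g)"

lemma the_germ_eq: "germ z g \<Longrightarrow> the_germ z = g"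
  unfolding the_germ_def by (rule the_equality) (use germ_unique in auto)

lemma germ_the_germ: "z \<in> split_points \<Gamma>\<^sub>1 \<Longrightarrow> germ z (the_germ z)"
  using germ_exists the_germ_eq by metis

lemma the_germ_in: "z \<in> split_points \<Gamma>\<^sub>1 \<Longrightarrow> the_germ z \<in> \<Gamma>\<^sub>2 \<times> A"
  using germ_the_germ germ_def by blast

lemma the_germ_snd: "z \<in> split_points \<Gamma>\<^sub>1 \<Longrightarrow> 0 < snd (the_germ z)"
  using the_germ_in slope_setD(1)[OF slopes] by fastforce

lemma the_germ_locally_constant:
  assumes "z \<in> split_points \<Gamma>\<^sub>1"
  shows "\<exists>p\<in>\<Gamma>\<^sub>1. \<exists>q\<in>\<Gamma>\<^sub>1. z \<in> cell \<Gamma>\<^sub>1 p q \<and> (\<forall>w\<in>cell \<Gamma>\<^sub>1 p q. the_germ w = the_germ z)"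
proof -
  obtain p q where pq: "p \<in> \<Gamma>\<^sub>1" "q \<in> \<Gamma>\<^sub>1" "z \<in> cell \<Gamma>\<^sub>1 p q" "\<forall>x\<in>{p..q}. F x = snd (the_germ z) * x + fst (the_germ z)"
    using germ_the_germ[OF assms] unfolding germ_def by blast
  have "germ w (the_germ z)" if "w \<in> cell \<Gamma>\<^sub>1 p q" for w
    unfolding germ_def using the_germ_in[OF assms] pq that by blast
  then show ?thesis using pq the_germ_eq by blast
qed

lemma split_map_germ: "z \<in> split_points \<Gamma>\<^sub>1 \<Longrightarrow> split_map F z = affine_act (the_germ z) z"
proof -
  assume z: "z \<in> split_points \<Gamma>\<^sub>1"
  obtain p q where pq: "z \<in> cell \<Gamma>\<^sub>1 p q" "\<forall>x\<in>{p..q}. F x = snd (the_germ z) * x + fst (the_germ z)"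
    using germ_the_germ[OF z] unfolding germ_def by blast
  then have "F (collapse z) = snd (the_germ z) * collapse z + fst (the_germ z)" using cell_collapse[OF pq(1)] by simp
  then show ?thesis by (cases z) (simp_all add: affine_act_eq)
qed

lemma split_map_inverse: "split_map (inv_into UNIV F) (split_map F z) = z"
  by (cases z) (simp_all add: inv_F)

text \<open>Arrows are conjugated by the germs of \<open>F\<close> at their range and source.\<close>

definition arrow_map :: "split_real \<times> real \<times> real \<Rightarrow> split_real \<times> real \<times> real" where
  "arrow_map w = (split_map F (fst w), aff_mult (aff_mult (the_germ (fst w)) (snd w))
     (aff_inv (the_germ (affine_act (aff_inv (snd w)) (fst w)))))"

lemma conj_germ_in:
  assumes "c \<in> \<Gamma>\<^sub>2 \<times> A" "d \<in> \<Gamma>\<^sub>2 \<times> A" "g \<in> S1.Aff"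
  shows "aff_mult (aff_mult c g) (aff_inv d) \<in> S2.Aff"
proof -
  obtain s a where c: "c = (s, a)" "s \<in> \<Gamma>\<^sub>2" "a \<in> A" using assms(1) by blast
  obtain r b where d: "d = (r, b)" "r \<in> \<Gamma>\<^sub>2" "b \<in> A" using assms(2) by blast
  obtain t k where g: "g = (t, k)" "t \<in> \<Gamma>\<^sub>1" "k \<in> \<Lambda>" using assms(3) by blast
  have "a * k / b \<in> \<Lambda>" using ratio c d g by blast
  moreover have "s + a * t + a * k * (- (r / b)) \<in> \<Gamma>\<^sub>2"
  proof -
    have "(a * k / b) * r \<in> \<Gamma>\<^sub>2" using S2.stable calculation d by blast
    moreover have "a * t \<in> \<Gamma>\<^sub>2" using slope_setD(2)[OF slopes c(3)] g by blast
    ultimately have "s + a * t - (a * k / b) * r \<in> \<Gamma>\<^sub>2" using S2.add(3,4) c by blast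
    then show ?thesis by simp
  qed
  ultimately show ?thesis using c d g by (simp add: aff_mult_def aff_inv_def)
qed

lemma arrow_points:
  assumes "(z, g) \<in> S1.arrow_set"
  shows "z \<in> split_points \<Gamma>\<^sub>1" "affine_act (aff_inv g) z \<in> split_points \<Gamma>\<^sub>1" "snd g \<noteq> 0"
  using S1.arrow_setD[OF assms] cell_split_points[of \<Gamma>\<^sub>1 0 l\<^sub>1] S1.Aff_snd(1) by blast+

lemma arrow_map_source:
  assumes "(z, g) \<in> S1.arrow_set"
  shows "affine_act (aff_inv (snd (arrow_map (z, g)))) (fst (arrow_map (z, g))) = split_map F (affine_act (aff_inv g) z)"
proof -
  let ?w = "affine_act (aff_inv g) z"
  note pts = arrow_points[OF assms]
  have nz: "snd (the_germ z) \<noteq> 0" "snd (the_germ ?w) \<noteq> 0" using the_germ_snd pts by fastforce+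
  have nz': "snd (aff_mult (the_germ z) g) \<noteq> 0" "snd (aff_inv (the_germ ?w)) \<noteq> 0"
    using nz pts(3) by (simp_all add: aff_mult_def aff_inv_def)
  have "aff_inv (snd (arrow_map (z, g))) = aff_mult (the_germ ?w) (aff_mult (aff_inv g) (aff_inv (the_germ z)))"
    using nz nz' pts(3) by (simp add: arrow_map_def aff_inv_mult aff_inv_inv)
  then show ?thesis
    using nz by (simp add: arrow_map_def split_map_germ[OF pts(1)] split_map_germ[OF pts(2)] affine_act_mult affine_act_inv)
qed

lemma arrow_map_in:
  assumes "(z, g) \<in> S1.arrow_set"
  shows "arrow_map (z, g) \<in> S2.arrow_set"
proof -
  note pts = arrow_points[OF assms]
  have "(fst (arrow_map (z, g)), snd (arrow_map (z, g))) \<in> S2.arrow_set"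
  proof (rule S2.arrow_setI)
    show "fst (arrow_map (z, g)) \<in> S2.Y"
      using S1.arrow_setD(1)[OF assms] by (simp add: arrow_map_def split_map_Y)
    show "snd (arrow_map (z, g)) \<in> S2.Aff"
      unfolding arrow_map_def fst_conv snd_conv
      by (intro conj_germ_in the_germ_in pts S1.arrow_setD(2)[OF assms])
    show "affine_act (aff_inv (snd (arrow_map (z, g)))) (fst (arrow_map (z, g))) \<in> S2.Y"
      unfolding arrow_map_source[OF assms] split_map_Y by (rule S1.arrow_setD(3)[OF assms])
  qed
  then show ?thesis by simp
qed

text \<open>
  Germs are locally constant, so near an arrow only its point moves.
\<close>

lemma arrow_map_continuous: "continuous_map (arrows S1.Gr) (arrows S2.Gr) arrow_map"
  unfolding continuous_map_def S1.topspace_Gr S2.topspace_Gr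
proof (intro conjI allI impI)
  show "arrow_map \<in> S1.arrow_set \<rightarrow> S2.arrow_set" using arrow_map_in by auto
  fix U assume U: "openin (arrows S2.Gr) U"
  show "openin (arrows S1.Gr) {w \<in> S1.arrow_set. arrow_map w \<in> U}"
    unfolding S1.openin_Gr_iff
  proof (intro conjI)
    show "\<forall>(z, g)\<in>{w \<in> S1.arrow_set. arrow_map w \<in> U}. \<exists>p\<in>\<Gamma>\<^sub>1. \<exists>q\<in>\<Gamma>\<^sub>1. z \<in> cell \<Gamma>\<^sub>1 p q \<and>
        (\<forall>z'\<in>cell \<Gamma>\<^sub>1 p q. (z', g) \<in> S1.arrow_set \<longrightarrow> (z', g) \<in> {w \<in> S1.arrow_set. arrow_map w \<in> U})"
    proof clarify
      fix z :: split_real and s a :: real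
      define g where "g = (s, a)"
      assume "(z, s, a) \<in> S1.arrow_set" "arrow_map (z, s, a) \<in> U"
      then have zg: "(z, g) \<in> S1.arrow_set" and in_U: "arrow_map (z, g) \<in> U" by (simp_all add: g_def)
      note pts = arrow_points[OF zg]
      have gA: "g \<in> S1.Aff" using S1.arrow_setD(2)[OF zg] .
      obtain p1 q1 where 1: "p1 \<in> \<Gamma>\<^sub>1" "q1 \<in> \<Gamma>\<^sub>1" "z \<in> cell \<Gamma>\<^sub>1 p1 q1" "\<forall>w\<in>cell \<Gamma>\<^sub>1 p1 q1. the_germ w = the_germ z"
        using the_germ_locally_constant[OF pts(1)] by blast
      obtain p2 q2 where 2: "p2 \<in> \<Gamma>\<^sub>1" "q2 \<in> \<Gamma>\<^sub>1" "affine_act (aff_inv g) z \<in> cell \<Gamma>\<^sub>1 p2 q2"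
        "\<forall>w\<in>cell \<Gamma>\<^sub>1 p2 q2. the_germ w = the_germ (affine_act (aff_inv g) z)"
        using the_germ_locally_constant[OF pts(2)] by blast
      have "\<exists>p\<in>\<Gamma>\<^sub>2. \<exists>q\<in>\<Gamma>\<^sub>2. fst (arrow_map (z, g)) \<in> cell \<Gamma>\<^sub>2 p q \<and>
          (\<forall>z'\<in>cell \<Gamma>\<^sub>2 p q. (z', snd (arrow_map (z, g))) \<in> S2.arrow_set \<longrightarrow> (z', snd (arrow_map (z, g))) \<in> U)"
      proof -
        obtain z2 g2 where e: "arrow_map (z, g) = (z2, g2)" by (cases "arrow_map (z, g)")
        then have "(z2, g2) \<in> U" using in_U by simp
        then show ?thesis using U[unfolded S2.openin_Gr_iff] unfolding e fst_conv snd_conv by blast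
      qed
      then obtain p3 q3 where 3: "p3 \<in> \<Gamma>\<^sub>2" "q3 \<in> \<Gamma>\<^sub>2" "split_map F z \<in> cell \<Gamma>\<^sub>2 p3 q3"
        "\<And>z'. z' \<in> cell \<Gamma>\<^sub>2 p3 q3 \<Longrightarrow> (z', snd (arrow_map (z, g))) \<in> S2.arrow_set \<Longrightarrow> (z', snd (arrow_map (z, g))) \<in> U"
        by (auto simp: arrow_map_def)
      obtain p3' q3' where F3: "p3 = F p3'" "q3 = F q3'" using surj by blast
      define p q where "p = max (max p1 (snd g * p2 + fst g)) p3'" and "q = min (min q1 (snd g * q2 + fst g)) q3'"
      have in_\<Gamma>: "p3' \<in> \<Gamma>\<^sub>1" "q3' \<in> \<Gamma>\<^sub>1" "snd g * p2 + fst g \<in> \<Gamma>\<^sub>1" "snd g * q2 + fst g \<in> \<Gamma>\<^sub>1"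
        using 3 F3 F_mem_iff S1.add(3) S1.stable gA 2 by auto
      have cell_pq: "w \<in> cell \<Gamma>\<^sub>1 p q \<longleftrightarrow> w \<in> cell \<Gamma>\<^sub>1 p1 q1 \<and> affine_act (aff_inv g) w \<in> cell \<Gamma>\<^sub>1 p2 q2 \<and>
          split_map F w \<in> cell \<Gamma>\<^sub>2 p3 q3" for w
        using S1.act_cell[OF gA, of "affine_act (aff_inv g) w" p2 q2] split_map_cell[of w p3' q3']
        unfolding p_def q_def cell_Int_iff F3 by (simp add: affine_act_inv(2)[OF pts(3)])
      have "(z', g) \<in> {w \<in> S1.arrow_set. arrow_map w \<in> U}" if z': "z' \<in> cell \<Gamma>\<^sub>1 p q" "(z', g) \<in> S1.arrow_set" for z'
      proof -
        have "arrow_map (z', g) = (split_map F z', snd (arrow_map (z, g)))"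
          using 1(4) 2(4) z'(1)[unfolded cell_pq] by (simp add: arrow_map_def)
        then show ?thesis using 3(4)[of "split_map F z'"] arrow_map_in[OF z'(2)] z' cell_pq by auto
      qed
      moreover have "z \<in> cell \<Gamma>\<^sub>1 p q" using 1 2 3 cell_pq by blast
      moreover have "p \<in> \<Gamma>\<^sub>1" "q \<in> \<Gamma>\<^sub>1" unfolding p_def q_def using in_\<Gamma> 1 S1.max_min_in by simp_all
      ultimately show "\<exists>p\<in>\<Gamma>\<^sub>1. \<exists>q\<in>\<Gamma>\<^sub>1. z \<in> cell \<Gamma>\<^sub>1 p q \<and> (\<forall>z'\<in>cell \<Gamma>\<^sub>1 p q. (z', s, a) \<in> S1.arrow_set \<longrightarrow>
          (z', s, a) \<in> {w \<in> S1.arrow_set. arrow_map w \<in> U})" unfolding g_def by blast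
    qed
  qed auto
qed

lemma germ_inverse:
  assumes z: "z \<in> split_points \<Gamma>\<^sub>1"
  shows "pl_equivalence.the_germ \<Gamma>\<^sub>2 \<Gamma>\<^sub>1 (inverse ` A) (inv_into UNIV F) (split_map F z) = aff_inv (the_germ z)"
proof -
  interpret I: pl_equivalence \<Gamma>\<^sub>2 \<Lambda> l\<^sub>2 \<Gamma>\<^sub>1 l\<^sub>1 "inverse ` A" "inv_into UNIV F" by (rule inverse_equivalence)
  let ?g = "the_germ z"
  obtain p q where pq: "p \<in> \<Gamma>\<^sub>1" "q \<in> \<Gamma>\<^sub>1" "z \<in> cell \<Gamma>\<^sub>1 p q" "\<forall>x\<in>{p..q}. F x = snd ?g * x + fst ?g"
    using germ_the_germ[OF z] unfolding germ_def by blast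
  have g: "fst ?g \<in> \<Gamma>\<^sub>2" "snd ?g \<in> A" "0 < snd ?g" using the_germ_in[OF z] the_germ_snd[OF z] by auto
  have "I.germ (split_map F z) (aff_inv ?g)"
    unfolding I.germ_def
  proof (intro conjI)
    have "snd ?g * (fst ?g / snd ?g) \<in> \<Gamma>\<^sub>2" using g by simp
    then have "fst ?g / snd ?g \<in> \<Gamma>\<^sub>1" using slope_setD(2)[OF slopes g(2)] by blast
    then have "- (fst ?g / snd ?g) \<in> \<Gamma>\<^sub>1" by (rule S1.add(2))
    moreover have "1 / snd ?g \<in> inverse ` A" using g(2) by (auto simp: divide_inverse)
    ultimately show "aff_inv ?g \<in> \<Gamma>\<^sub>1 \<times> inverse ` A" by (simp add: aff_inv_def)
    have "split_map F z \<in> cell \<Gamma>\<^sub>2 (F p) (F q)" using pq(3) split_map_cell by blast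
    moreover have "F p \<in> \<Gamma>\<^sub>2" "F q \<in> \<Gamma>\<^sub>2" using pq F_mem_iff by auto
    moreover have "inv_into UNIV F y = snd (aff_inv ?g) * y + fst (aff_inv ?g)" if y: "y \<in> {F p..F q}" for y
    proof -
      obtain x where x: "y = F x" using surj by blast
      then have "x \<in> {p..q}" using y strict_mono_less_eq[OF mono] by auto
      then have "y = snd ?g * x + fst ?g" using pq(4) x by blast
      then show ?thesis using g(3) x inv_F[of x] by (simp add: aff_inv_def field_simps)
    qed
    ultimately show "\<exists>p\<in>\<Gamma>\<^sub>2. \<exists>q\<in>\<Gamma>\<^sub>2. split_map F z \<in> cell \<Gamma>\<^sub>2 p q \<and>
        (\<forall>y\<in>{p..q}. inv_into UNIV F y = snd (aff_inv ?g) * y + fst (aff_inv ?g))" by blast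
  qed
  then show ?thesis by (rule I.the_germ_eq)
qed

lemma arrow_map_inverse:
  assumes w: "(z, g) \<in> S1.arrow_set"
  shows "pl_equivalence.arrow_map \<Gamma>\<^sub>2 \<Gamma>\<^sub>1 (inverse ` A) (inv_into UNIV F) (arrow_map (z, g)) = (z, g)"
proof -
  interpret I: pl_equivalence \<Gamma>\<^sub>2 \<Lambda> l\<^sub>2 \<Gamma>\<^sub>1 l\<^sub>1 "inverse ` A" "inv_into UNIV F" by (rule inverse_equivalence)
  note pts = arrow_points[OF w]
  let ?w = "affine_act (aff_inv g) z"
  have nz: "snd (the_germ z) \<noteq> 0" "snd (the_germ ?w) \<noteq> 0" using the_germ_snd pts by fastforce+
  have 1: "fst (arrow_map (z, g)) = split_map F z" by (simp add: arrow_map_def)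
  have 2: "I.the_germ (split_map F z) = aff_inv (the_germ z)" "I.the_germ (split_map F ?w) = aff_inv (the_germ ?w)"
    using germ_inverse pts by auto
  have "aff_mult (aff_mult (aff_inv (the_germ z)) (snd (arrow_map (z, g)))) (the_germ ?w) =
      aff_mult (aff_mult (aff_inv (the_germ z)) (the_germ z)) (aff_mult g (aff_mult (aff_inv (the_germ ?w)) (the_germ ?w)))"
    by (simp add: arrow_map_def aff_mult_assoc)
  also have "\<dots> = g" using nz by (simp add: aff_inv_left)
  finally show ?thesis
    unfolding I.arrow_map_def using nz
    by (simp only: arrow_map_source[OF w] 1[symmetric]) (simp add: 1 2 split_map_inverse aff_inv_inv)
qed

lemma groupoids_isomorphic: "isomorphic_groupoids S1.Gr S2.Gr"
proof -
  interpret I: pl_equivalence \<Gamma>\<^sub>2 \<Lambda> l\<^sub>2 \<Gamma>\<^sub>1 l\<^sub>1 "inverse ` A" "inv_into UNIV F" by (rule inverse_equivalence)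
  have invinv: "inv_into UNIV (inv_into UNIV F) = F" using inj surj by (intro inv_inv_eq) (simp add: bij_def)
  have invA: "inverse ` inverse ` A = A" by (simp add: image_image)
  have unit: "arrow_map (z, (0, 1)) = (split_map F z, (0, 1))" if z: "z \<in> S1.Y" for z
  proof -
    have "snd (the_germ z) \<noteq> 0" using the_germ_snd[of z] z cell_split_points[of \<Gamma>\<^sub>1 0 l\<^sub>1] by fastforce
    moreover have "aff_inv (0, 1) = (0, 1)" by (simp add: aff_inv_def)
    ultimately show ?thesis by (simp add: arrow_map_def aff_inv_right)
  qed
  have rng: "arrow_map (rng S1.Gr w) = rng S2.Gr (arrow_map w)" if "w \<in> S1.arrow_set" for w
  proof -
    obtain z g where Pair: "w = (z, g)" by (cases w)
    then have "z \<in> S1.Y" using that S1.arrow_setD(1) by blast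
    then show ?thesis using Pair unit
      by (simp add: S1.Gr_rng) (simp add: arrow_map_def S2.Gr_rng)
  qed
  have src: "arrow_map (src S1.Gr w) = src S2.Gr (arrow_map w)" if w: "w \<in> S1.arrow_set" for w
  proof -
    obtain z g where Pair: "w = (z, g)" by (cases w)
    then have zg: "(z, g) \<in> S1.arrow_set" using w by simp
    have "arrow_map (src S1.Gr w) = (split_map F (affine_act (aff_inv g) z), (0, 1))"
      unfolding Pair S1.Gr_src[OF S1.arrow_setD(2)[OF zg]] by (rule unit[OF S1.arrow_setD(3)[OF zg]])
    moreover have "src S2.Gr (arrow_map (z, g)) = (split_map F (affine_act (aff_inv g) z), (0, 1))"
      using S2.Gr_src[of "snd (arrow_map (z, g))" "fst (arrow_map (z, g))"] arrow_map_in[OF zg]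
        S2.arrow_setD(2)[of "fst (arrow_map (z, g))" "snd (arrow_map (z, g))"] arrow_map_source[OF zg] by simp
    ultimately show ?thesis using Pair by simp
  qed
  have comp: "arrow_map (gcomp S1.Gr w w') = gcomp S2.Gr (arrow_map w) (arrow_map w')"
    if w: "w \<in> S1.arrow_set" "w' \<in> S1.arrow_set" and eq: "src S1.Gr w = rng S1.Gr w'" for w w'
  proof -
    obtain z g z' g' where zg: "w = (z, g)" "w' = (z', g')" by (cases w, cases w')
    have "affine_act (aff_inv g) z = z'"
      using eq S1.Gr_src[OF S1.arrow_setD(2)] w(1) unfolding zg S1.Gr_rng by auto
    moreover have "snd g \<noteq> 0" "snd g' \<noteq> 0" using arrow_points(3) w zg by blast+
    then have "affine_act (aff_inv (aff_mult g g')) z = affine_act (aff_inv g') (affine_act (aff_inv g) z)"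
      by (simp add: aff_inv_mult affine_act_mult)
    moreover have "z' \<in> split_points \<Gamma>\<^sub>1" using arrow_points(1) w zg by blast
    then have "snd (the_germ z') \<noteq> 0" using the_germ_snd by fastforce
    then have "aff_mult (aff_inv (the_germ z')) (aff_mult (the_germ z') h) = h" for h
      by (simp add: aff_inv_left flip: aff_mult_assoc)
    ultimately show ?thesis
      unfolding zg S1.Gr_comp by (simp add: arrow_map_def S2.Gr_comp aff_mult_assoc)
  qed
  have "homeomorphic_maps (arrows S1.Gr) (arrows S2.Gr) arrow_map I.arrow_map"
    unfolding homeomorphic_maps_def S1.topspace_Gr S2.topspace_Gr
  proof (intro conjI ballI)
    show "continuous_map (arrows S1.Gr) (arrows S2.Gr) arrow_map" by (rule arrow_map_continuous)
    show "continuous_map (arrows S2.Gr) (arrows S1.Gr) I.arrow_map" by (rule I.arrow_map_continuous)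
    show "I.arrow_map (arrow_map w) = w" if "w \<in> S1.arrow_set" for w
      using arrow_map_inverse that by (cases w) blast
    show "arrow_map (I.arrow_map w) = w" if "w \<in> S2.arrow_set" for w
      using I.arrow_map_inverse that unfolding invinv invA by (cases w) blast
  qed
  then have "homeomorphic_map (arrows S1.Gr) (arrows S2.Gr) arrow_map"
    unfolding homeomorphic_map_maps by blast
  then have "groupoid_iso S1.Gr S2.Gr arrow_map"
    unfolding groupoid_iso_def S1.topspace_Gr using rng src comp by blast
  then show ?thesis unfolding isomorphic_groupoids_def by blast
qed

end

section \<open>The length of compact open sets under isomorphisms of groupoids\<close>

context stein
begin

text \<open>
  Compactness of a cell. The statement to be propagated is that \<open>f\<close> is constant on the cells of a
  finite partition with cuts in \<open>\<Gamma>\<close>; at a junction \<open>c\<close> outside \<open>\<Gamma>\<close> a neighbourhood of \<open>Regular c\<close>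
  with endpoints in \<open>\<Gamma>\<close> bridges the two partitions.
\<close>

lemma locally_constant_piecewise:
  fixes f :: "split_real \<Rightarrow> 'b"
  assumes uv: "u \<in> \<Gamma>" "v \<in> \<Gamma>" "u < v"
    and loc: "\<And>z. z \<in> cell \<Gamma> u v \<Longrightarrow> \<exists>p\<in>\<Gamma>. \<exists>q\<in>\<Gamma>. z \<in> cell \<Gamma> p q \<and> (\<forall>w\<in>cell \<Gamma> p q \<inter> cell \<Gamma> u v. f w = f z)"
  shows "piecewise \<Gamma> u v (\<lambda>p q. \<exists>c. \<forall>w\<in>cell \<Gamma> p q. f w = c)"
proof -
  define Q where "Q p q \<longleftrightarrow> (\<exists>c. \<forall>w\<in>cell \<Gamma> p q \<inter> cell \<Gamma> u v. f w = c)" for p q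
  have Q_mono: "Q p q" if "Q p' q'" "p' \<le> p" "q \<le> q'" for p q p' q'
    using that cell_mono[OF that(2,3)] unfolding Q_def by blast
  have at_point: "\<exists>p q. z \<in> cell \<Gamma> p q \<and> Q p q" if z: "z \<in> split_points \<Gamma>" for z
  proof (cases "z \<in> cell \<Gamma> u v")
    case True
    then show ?thesis using loc[OF True] unfolding Q_def by blast
  next
    case False
    have Q0: "Q p q" if "q \<le> u \<or> v \<le> p" for p q
    proof -
      have "w \<notin> cell \<Gamma> u v" if "w \<in> cell \<Gamma> p q" for w
        using that \<open>q \<le> u \<or> v \<le> p\<close> by (cases w) (auto simp: cell_iff)
      then show ?thesis unfolding Q_def by blast
    qed
    have "z \<in> cell \<Gamma> (collapse z - 1) u \<or> z \<in> cell \<Gamma> v (collapse z + 1)"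
    proof (cases z)
      case (Regular x)
      then have "x \<noteq> u" "x \<noteq> v" using z uv by auto
      then show ?thesis using z False Regular by (auto simp: cell_iff)
    qed (use z False in \<open>auto simp: cell_iff\<close>)
    then show ?thesis using Q0 by blast
  qed
  have local_piecewise: "\<exists>d>0. piecewise \<Gamma> (c - d) (c + d) Q" for c
  proof (cases "c \<in> \<Gamma>")
    case True
    obtain p p' where p: "p < c" "c \<le> p'" "Q p p'" using at_point[of "Minus c"] True by (auto simp: cell_iff)
    obtain q' q where q: "q' \<le> c" "c < q" "Q q' q" using at_point[of "Plus c"] True by (auto simp: cell_iff)
    have "piecewise \<Gamma> (c - min (c - p) (q - c)) (c + min (c - p) (q - c)) Q"
    proof (rule piecewiseI[of "{c}"])
      fix x y assume xy: "c - min (c - p) (q - c) \<le> x" "x < y" "y \<le> c + min (c - p) (q - c)" "{x<..<y} \<inter> {c} = {}"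
      then have "y \<le> c \<or> c \<le> x" by auto
      then show "Q x y" using Q_mono[OF p(3), of x y] Q_mono[OF q(3), of x y] p q xy by (auto simp: min_def split: if_splits)
    qed (use True in auto)
    then show ?thesis using p q by (intro exI[of _ "min (c - p) (q - c)"]) simp
  next
    case False
    then obtain p q where pq: "p < c" "c < q" "Q p q" using at_point[of "Regular c"] by (auto simp: cell_iff)
    have "piecewise \<Gamma> (c - min (c - p) (q - c)) (c + min (c - p) (q - c)) Q"
      by (rule piecewise_trivial) (use pq(1,2) in \<open>auto intro!: Q_mono[OF pq(3)] simp: min_def split: if_splits\<close>)
    then show ?thesis using pq by (intro exI[of _ "min (c - p) (q - c)"]) simp
  qed
  have "piecewise \<Gamma> u v Q"
  proof (rule Bolzano[of u v "\<lambda>a b. piecewise \<Gamma> a b Q"])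
    show "u \<le> v" using uv by simp
  next
    fix a c b assume ab: "piecewise \<Gamma> a c Q" "piecewise \<Gamma> c b Q" "a \<le> c" "c \<le> b"
    obtain d where d: "0 < d" "piecewise \<Gamma> (c - d) (c + d) Q" using local_piecewise by blast
    obtain D where D: "finite D" "D \<subseteq> \<Gamma>"
      "\<forall>p\<in>\<Gamma>. \<forall>q\<in>\<Gamma>. a \<le> p \<longrightarrow> p < q \<longrightarrow> q \<le> c \<longrightarrow> {p<..<q} \<inter> D = {} \<longrightarrow> Q p q"
      using ab(1) unfolding piecewise_def by blast
    obtain E where E: "finite E" "E \<subseteq> \<Gamma>"
      "\<forall>p\<in>\<Gamma>. \<forall>q\<in>\<Gamma>. c \<le> p \<longrightarrow> p < q \<longrightarrow> q \<le> b \<longrightarrow> {p<..<q} \<inter> E = {} \<longrightarrow> Q p q"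
      using ab(2) unfolding piecewise_def by blast
    obtain G where G: "finite G" "G \<subseteq> \<Gamma>"
      "\<forall>p\<in>\<Gamma>. \<forall>q\<in>\<Gamma>. c - d \<le> p \<longrightarrow> p < q \<longrightarrow> q \<le> c + d \<longrightarrow> {p<..<q} \<inter> G = {} \<longrightarrow> Q p q"
      using d(2) unfolding piecewise_def by blast
    obtain x where x: "x \<in> \<Gamma>" "c - d < x" "x < c" using between[of "c - d" c] d by auto
    obtain y where y: "y \<in> \<Gamma>" "c < y" "y < c + d" using between[of c "c + d"] d by auto
    show "piecewise \<Gamma> a b Q"
    proof (rule piecewiseI[of "D \<union> E \<union> G \<union> {x, y}"])
      fix p q assume pq: "p \<in> \<Gamma>" "q \<in> \<Gamma>" "a \<le> p" "p < q" "q \<le> b" "{p<..<q} \<inter> (D \<union> E \<union> G \<union> {x, y}) = {}"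
      then have e: "{p<..<q} \<inter> D = {}" "{p<..<q} \<inter> E = {}" "{p<..<q} \<inter> G = {}" "x \<notin> {p<..<q}" "y \<notin> {p<..<q}" by blast+
      consider "q \<le> c" | "c \<le> p" | "p < c" "c < q" by linarith
      then show "Q p q"
      proof cases
        case 3
        then have "c - d \<le> p" "q \<le> c + d" using e(4,5) x y by auto
        then show ?thesis using G(3) pq e(3) by blast
      qed (use D(3) E(3) pq e in blast)+
    qed (use D E G x y in auto)
  next
    fix c :: real
    obtain d where d: "0 < d" "piecewise \<Gamma> (c - d) (c + d) Q" using local_piecewise by blast
    then show "\<exists>d>0. \<forall>a b. a \<le> c \<and> c \<le> b \<and> b - a < d \<longrightarrow> piecewise \<Gamma> a b Q"
      by (intro exI[of _ d] conjI allI impI) (auto intro: piecewise_subinterval)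
  qed
  then show ?thesis
  proof (rule piecewise_mono)
    fix p q assume "u \<le> p" "q \<le> v" "Q p q"
    then show "\<exists>c. \<forall>w\<in>cell \<Gamma> p q. f w = c" using cell_mono[of u p q v] unfolding Q_def by blast
  qed
qed

text \<open>
  The embedding of the line that is continuous from the right; a half-open interval is the
  preimage of a cell under it.
\<close>

definition right_point :: "real \<Rightarrow> split_real" where
  "right_point x = (if x \<in> \<Gamma> then Plus x else Regular x)"

lemma right_point_cell: "p \<in> \<Gamma> \<Longrightarrow> right_point x \<in> cell \<Gamma> p q \<longleftrightarrow> p \<le> x \<and> x < q"
  by (cases "x = p") (auto simp: right_point_def cell_iff)

lemma right_point_affine: "g \<in> Aff \<Longrightarrow> right_point (snd g * x + fst g) = affine_act g (right_point x)"
  using act_split_points[of g "Plus x"] by (simp add: right_point_def affine_act_eq)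

text \<open>
  The subsets of the compact space \<open>Y\<close> that are both open and closed, hence compact open. Local
  constancy of membership is the form in which they are used.
\<close>

definition clopen :: "split_real set \<Rightarrow> bool" where
  "clopen U \<longleftrightarrow> U \<subseteq> Y \<and> (\<forall>z\<in>Y. \<exists>p\<in>\<Gamma>. \<exists>q\<in>\<Gamma>. z \<in> cell \<Gamma> p q \<and> (\<forall>w\<in>cell \<Gamma> p q \<inter> Y. w \<in> U \<longleftrightarrow> z \<in> U))"

definition projection :: "split_real set \<Rightarrow> real set" where
  "projection U = {x. right_point x \<in> U}"

lemma projection_cell: "p \<in> \<Gamma> \<Longrightarrow> projection (cell \<Gamma> p q) = {p..<q}"
  by (auto simp: projection_def right_point_cell)

lemma clopen_cell:
  assumes pq: "p \<in> \<Gamma>" "q \<in> \<Gamma>" "0 \<le> p" "q \<le> l"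
  shows "clopen (cell \<Gamma> p q)"
  unfolding clopen_def
proof (intro conjI ballI)
  show "cell \<Gamma> p q \<subseteq> Y" by (rule cell_mono) (use pq in auto)
  fix z assume z: "z \<in> Y"
  show "\<exists>p'\<in>\<Gamma>. \<exists>q'\<in>\<Gamma>. z \<in> cell \<Gamma> p' q' \<and> (\<forall>w\<in>cell \<Gamma> p' q' \<inter> Y. w \<in> cell \<Gamma> p q \<longleftrightarrow> z \<in> cell \<Gamma> p q)"
  proof (cases "z \<in> cell \<Gamma> p q")
    case True
    then show ?thesis using pq by blast
  next
    case False
    have disj: "w \<notin> cell \<Gamma> p q" if "w \<in> cell \<Gamma> 0 p \<or> w \<in> cell \<Gamma> q l" for w
      using that by (cases w) (auto simp: cell_iff)
    have "z \<in> cell \<Gamma> 0 p \<or> z \<in> cell \<Gamma> q l"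
    proof (cases z)
      case (Regular x)
      then have "x \<noteq> p" "x \<noteq> q" using pq z by (auto simp: cell_iff)
      then show ?thesis using z False Regular by (auto simp: cell_iff)
    qed (use z False in \<open>auto simp: cell_iff\<close>)
    then show ?thesis using disj False pq add(1) l_in by blast
  qed
qed

lemma clopen_Un:
  assumes U: "clopen U" and W: "clopen W"
  shows "clopen (U \<union> W)"
  unfolding clopen_def
proof (intro conjI ballI)
  show "U \<union> W \<subseteq> Y" using U W unfolding clopen_def by blast
  fix z assume z: "z \<in> Y"
  obtain p q where 1: "p \<in> \<Gamma>" "q \<in> \<Gamma>" "z \<in> cell \<Gamma> p q" "\<forall>w\<in>cell \<Gamma> p q \<inter> Y. w \<in> U \<longleftrightarrow> z \<in> U"
    using U z unfolding clopen_def by blast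
  obtain p' q' where 2: "p' \<in> \<Gamma>" "q' \<in> \<Gamma>" "z \<in> cell \<Gamma> p' q'" "\<forall>w\<in>cell \<Gamma> p' q' \<inter> Y. w \<in> W \<longleftrightarrow> z \<in> W"
    using W z unfolding clopen_def by blast
  have "max p p' \<in> \<Gamma>" "min q q' \<in> \<Gamma>" using 1 2 by (simp_all only: max_min_in)
  moreover have "z \<in> cell \<Gamma> (max p p') (min q q')" using 1(3) 2(3) by (simp only: cell_Int_iff)
  moreover have "\<forall>w\<in>cell \<Gamma> (max p p') (min q q') \<inter> Y. w \<in> U \<union> W \<longleftrightarrow> z \<in> U \<union> W"
    using 1(4) 2(4) by (simp add: cell_Int_iff)
  ultimately show "\<exists>p\<in>\<Gamma>. \<exists>q\<in>\<Gamma>. z \<in> cell \<Gamma> p q \<and> (\<forall>w\<in>cell \<Gamma> p q \<inter> Y. w \<in> U \<union> W \<longleftrightarrow> z \<in> U \<union> W)" by blast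
qed

lemma projection_subset_iff:
  assumes U: "clopen U" and W: "clopen W"
  shows "projection U \<subseteq> projection W \<longleftrightarrow> U \<subseteq> W"
proof
  assume sub: "projection U \<subseteq> projection W"
  show "U \<subseteq> W"
  proof
    fix z assume zU: "z \<in> U"
    then have z: "z \<in> Y" using U unfolding clopen_def by blast
    obtain p q where 1: "p \<in> \<Gamma>" "q \<in> \<Gamma>" "z \<in> cell \<Gamma> p q" "\<forall>w\<in>cell \<Gamma> p q \<inter> Y. w \<in> U \<longleftrightarrow> z \<in> U"
      using U z unfolding clopen_def by blast
    obtain p' q' where 2: "p' \<in> \<Gamma>" "q' \<in> \<Gamma>" "z \<in> cell \<Gamma> p' q'" "\<forall>w\<in>cell \<Gamma> p' q' \<inter> Y. w \<in> W \<longleftrightarrow> z \<in> W"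
      using W z unfolding clopen_def by blast
    define a b where "a = max (max p p') 0" and "b = min (min q q') l"
    have ab: "w \<in> cell \<Gamma> a b \<longleftrightarrow> (w \<in> cell \<Gamma> p q \<and> w \<in> cell \<Gamma> p' q') \<and> w \<in> Y" for w
      unfolding a_def b_def cell_Int_iff by simp
    have "a < b" using cell_less[of z \<Gamma> a b] ab 1(3) 2(3) z by blast
    moreover have "a \<in> \<Gamma>" unfolding a_def using 1 2 add(1) max_min_in(1) by simp
    ultimately have "right_point a \<in> cell \<Gamma> a b" by (simp add: right_point_cell)
    then have a: "right_point a \<in> cell \<Gamma> p q" "right_point a \<in> cell \<Gamma> p' q'" "right_point a \<in> Y" unfolding ab by blast+
    then have "right_point a \<in> U" using 1(4) zU by blast
    then have "right_point a \<in> W" using sub unfolding projection_def by blast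
    then show "z \<in> W" using 2(4) a by blast
  qed
qed (auto simp: projection_def)

text \<open>
  A clopen set is locally constant, so finitely many cells make it up.
\<close>

lemma projection_bij: "bij_betw projection (Collect clopen) \<B>"
  unfolding bij_betw_def
proof (intro conjI subset_antisym subsetI)
  show "inj_on projection (Collect clopen)"
  proof (rule inj_onI)
    fix U W assume "U \<in> Collect clopen" "W \<in> Collect clopen" "projection U = projection W"
    then show "U = W" using projection_subset_iff[of U W] projection_subset_iff[of W U] by simp
  qed
next
  fix B assume "B \<in> projection ` Collect clopen"
  then obtain U where U: "clopen U" "B = projection U" by blast
  have "\<exists>p\<in>\<Gamma>. \<exists>q\<in>\<Gamma>. z \<in> cell \<Gamma> p q \<and> (\<forall>w\<in>cell \<Gamma> p q \<inter> Y. (w \<in> U) = (z \<in> U))" if "z \<in> Y" for z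
    using U(1) that unfolding clopen_def by blast
  then have "piecewise \<Gamma> 0 l (\<lambda>p q. \<exists>c. \<forall>w\<in>cell \<Gamma> p q. (w \<in> U) = c)"
    by (intro locally_constant_piecewise) (use add(1) l_in l_pos in auto)
  then have "piecewise \<Gamma> 0 l (\<lambda>p q. {p..<q} \<subseteq> B \<or> {p..<q} \<inter> B = {})"
  proof (rule piecewise_mono)
    fix p q assume p: "p \<in> \<Gamma>" and "\<exists>c. \<forall>w\<in>cell \<Gamma> p q. (w \<in> U) = c"
    then obtain c where c: "\<forall>w\<in>cell \<Gamma> p q. (w \<in> U) = c" by blast
    then have "x \<in> B \<longleftrightarrow> c" if "x \<in> {p..<q}" for x
      using right_point_cell[OF p, of x q] that unfolding U(2) projection_def by auto
    then show "{p..<q} \<subseteq> B \<or> {p..<q} \<inter> B = {}" by blast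
  qed
  moreover have "B \<subseteq> {0..<l}"
  proof
    fix x assume "x \<in> B"
    then have "right_point x \<in> Y" using U unfolding clopen_def projection_def by blast
    then show "x \<in> {0..<l}" using right_point_cell[OF add(1)] by simp
  qed
  ultimately show "B \<in> \<B>" by (intro algebraI)
next
  fix B assume "B \<in> \<B>"
  then show "B \<in> projection ` Collect clopen"
  proof (rule algebra_induct)
    have "clopen {}" using cell_exists cell_split_points[of \<Gamma> 0 l] unfolding clopen_def by blast
    moreover have "projection {} = {}" by (simp add: projection_def)
    ultimately show "{} \<in> projection ` Collect clopen" by (metis image_eqI mem_Collect_eq)
  next
    fix p q assume "p \<in> \<Gamma>" "q \<in> \<Gamma>" "0 \<le> p" "q \<le> l"
    then show "{p..<q} \<in> projection ` Collect clopen"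
      using clopen_cell projection_cell by (metis image_eqI mem_Collect_eq)
  next
    fix U V assume "U \<in> projection ` Collect clopen" "V \<in> projection ` Collect clopen"
    then obtain U' V' where "clopen U'" "U = projection U'" "clopen V'" "V = projection V'" by blast
    then have "clopen (U' \<union> V')" "U \<union> V = projection (U' \<union> V')" using clopen_Un by (auto simp: projection_def)
    then show "U \<union> V \<in> projection ` Collect clopen" by blast
  qed
qed

lemma unit_arrow_iff: "(z, (0, 1)) \<in> arrow_set \<longleftrightarrow> z \<in> Y"
  using unit_arrow arrow_setD(1) by blast

lemma openin_units: "openin (arrows Gr) (U \<times> {(0, 1)}) \<longleftrightarrow>
    U \<subseteq> Y \<and> (\<forall>z\<in>U. \<exists>p\<in>\<Gamma>. \<exists>q\<in>\<Gamma>. z \<in> cell \<Gamma> p q \<and> cell \<Gamma> p q \<inter> Y \<subseteq> U)"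
proof -
  have "U \<times> {(0, 1)} \<subseteq> arrow_set \<longleftrightarrow> U \<subseteq> Y" using unit_arrow_iff by blast
  moreover have "(\<forall>(z, g)\<in>U \<times> {(0, 1)}. \<exists>p\<in>\<Gamma>. \<exists>q\<in>\<Gamma>. z \<in> cell \<Gamma> p q \<and>
      (\<forall>z'\<in>cell \<Gamma> p q. (z', g) \<in> arrow_set \<longrightarrow> (z', g) \<in> U \<times> {(0, 1)})) \<longleftrightarrow>
    (\<forall>z\<in>U. \<exists>p\<in>\<Gamma>. \<exists>q\<in>\<Gamma>. z \<in> cell \<Gamma> p q \<and> (\<forall>z'\<in>cell \<Gamma> p q. z' \<in> Y \<longrightarrow> z' \<in> U))"
    by (simp add: unit_arrow_iff)
  moreover have "(\<forall>z'\<in>cell \<Gamma> p q. z' \<in> Y \<longrightarrow> z' \<in> U) \<longleftrightarrow> cell \<Gamma> p q \<inter> Y \<subseteq> U" for p q by auto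
  ultimately show ?thesis unfolding openin_Gr_iff by simp
qed

text \<open>
  Expressed in this way, clopen sets are respected by isomorphisms of groupoids.
\<close>

lemma clopen_iff_openin:
  "clopen U \<longleftrightarrow> U \<subseteq> Y \<and> openin (arrows Gr) (U \<times> {(0, 1)}) \<and> openin (arrows Gr) ((Y - U) \<times> {(0, 1)})"
proof -
  define P where "P z W \<longleftrightarrow> (\<exists>p\<in>\<Gamma>. \<exists>q\<in>\<Gamma>. z \<in> cell \<Gamma> p q \<and> cell \<Gamma> p q \<inter> Y \<subseteq> W)" for z W
  have "(\<exists>p\<in>\<Gamma>. \<exists>q\<in>\<Gamma>. z \<in> cell \<Gamma> p q \<and> (\<forall>w\<in>cell \<Gamma> p q \<inter> Y. w \<in> U \<longleftrightarrow> z \<in> U)) \<longleftrightarrow>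
      (if z \<in> U then P z U else P z (Y - U))" for z
  proof -
    have "(\<forall>w\<in>cell \<Gamma> p q \<inter> Y. w \<in> U \<longleftrightarrow> z \<in> U) \<longleftrightarrow> cell \<Gamma> p q \<inter> Y \<subseteq> (if z \<in> U then U else Y - U)" for p q
      by auto
    then show ?thesis unfolding P_def by simp
  qed
  then have "clopen U \<longleftrightarrow> U \<subseteq> Y \<and> (\<forall>z\<in>Y. if z \<in> U then P z U else P z (Y - U))"
    unfolding clopen_def by simp
  also have "\<dots> \<longleftrightarrow> U \<subseteq> Y \<and> (\<forall>z\<in>U. P z U) \<and> (\<forall>z\<in>Y - U. P z (Y - U))" by auto
  finally show ?thesis unfolding openin_units P_def by simp
qed

lemma arrow_rng: "w \<in> arrow_set \<Longrightarrow> rng Gr w \<in> arrow_set"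
  using unit_arrow by (cases w) (auto simp: Gr_rng arrow_set_def)

lemma arrow_src: "w \<in> arrow_set \<Longrightarrow> src Gr w \<in> arrow_set"
proof -
  assume w: "w \<in> arrow_set"
  obtain z g where zg: "w = (z, g)" by (cases w)
  then show ?thesis using w Gr_src[OF arrow_setD(2)] unit_arrow[OF arrow_setD(3)] by simp
qed

lemma arrow_comp:
  assumes "w \<in> arrow_set" "w' \<in> arrow_set" "src Gr w = rng Gr w'"
  shows "gcomp Gr w w' \<in> arrow_set"
proof -
  obtain z g z' g' where zg: "w = (z, g)" "w' = (z', g')" by (cases w, cases w')
  have g: "g \<in> Aff" "g' \<in> Aff" using assms arrow_setD(2) zg by blast+
  have "affine_act (aff_inv g) z = z'" using assms(3) g unfolding zg Gr_rng Gr_src[OF g(1)] by simp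
  then have "affine_act (aff_inv (aff_mult g g')) z = affine_act (aff_inv g') z'"
    using Aff_snd(1) g by (simp add: aff_inv_mult affine_act_mult del: mem_Sigma_iff)
  then show ?thesis unfolding zg Gr_comp
    by (intro arrow_setI Aff_mult g) (use assms zg arrow_setD in auto)
qed

end

text \<open>
  The closure assumptions are part of the axioms of a groupoid, which the record type leaves to
  its instances.
\<close>

lemma isomorphic_groupoids_sym:
  assumes iso: "isomorphic_groupoids \<G> \<H>"
    and closed: "\<And>g. g \<in> topspace (arrows \<G>) \<Longrightarrow> rng \<G> g \<in> topspace (arrows \<G>)"
      "\<And>g. g \<in> topspace (arrows \<G>) \<Longrightarrow> src \<G> g \<in> topspace (arrows \<G>)"
      "\<And>g h. g \<in> topspace (arrows \<G>) \<Longrightarrow> h \<in> topspace (arrows \<G>) \<Longrightarrow> src \<G> g = rng \<G> h \<Longrightarrow>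
        gcomp \<G> g h \<in> topspace (arrows \<G>)"
  shows "isomorphic_groupoids \<H> \<G>"
proof -
  obtain \<phi> where \<phi>: "groupoid_iso \<G> \<H> \<phi>" using iso unfolding isomorphic_groupoids_def by blast
  then obtain \<psi> where \<psi>: "homeomorphic_maps (arrows \<G>) (arrows \<H>) \<phi> \<psi>"
    unfolding groupoid_iso_def homeomorphic_map_maps by blast
  have inv: "\<psi> (\<phi> g) = g" if "g \<in> topspace (arrows \<G>)" for g using \<psi> that unfolding homeomorphic_maps_def by blast
  have inv': "\<phi> (\<psi> h) = h" "\<psi> h \<in> topspace (arrows \<G>)" if "h \<in> topspace (arrows \<H>)" for h
    using \<psi> that unfolding homeomorphic_maps_def continuous_map_def by blast+
  have \<phi>_iso: "\<phi> (rng \<G> g) = rng \<H> (\<phi> g)" "\<phi> (src \<G> g) = src \<H> (\<phi> g)" if "g \<in> topspace (arrows \<G>)" for g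
    using \<phi> that unfolding groupoid_iso_def by blast+
  have \<phi>_comp: "\<phi> (gcomp \<G> g h) = gcomp \<H> (\<phi> g) (\<phi> h)"
    if "g \<in> topspace (arrows \<G>)" "h \<in> topspace (arrows \<G>)" "src \<G> g = rng \<G> h" for g h
    using \<phi> that unfolding groupoid_iso_def by blast
  have r: "\<psi> (rng \<H> h) = rng \<G> (\<psi> h)" "\<psi> (src \<H> h) = src \<G> (\<psi> h)" if h: "h \<in> topspace (arrows \<H>)" for h
    using \<phi>_iso[OF inv'(2)[OF h]] inv[OF closed(1)[OF inv'(2)[OF h]]] inv[OF closed(2)[OF inv'(2)[OF h]]]
    unfolding inv'(1)[OF h] by metis+
  have "\<psi> (gcomp \<H> g h) = gcomp \<G> (\<psi> g) (\<psi> h)"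
    if gh: "g \<in> topspace (arrows \<H>)" "h \<in> topspace (arrows \<H>)" "src \<H> g = rng \<H> h" for g h
  proof -
    have e: "src \<G> (\<psi> g) = rng \<G> (\<psi> h)" using r gh by metis
    have "gcomp \<H> g h = \<phi> (gcomp \<G> (\<psi> g) (\<psi> h))" using \<phi>_comp[OF inv'(2) inv'(2) e] gh inv'(1) by metis
    then show ?thesis using inv[OF closed(3)[OF inv'(2) inv'(2) e]] gh by simp
  qed
  moreover have "homeomorphic_map (arrows \<H>) (arrows \<G>) \<psi>"
    using \<psi> homeomorphic_maps_sym homeomorphic_map_maps by metis
  ultimately have "groupoid_iso \<H> \<G> \<psi>" unfolding groupoid_iso_def using r by blast
  then show ?thesis unfolding isomorphic_groupoids_def by blast
qed

text \<open>
  Let \<open>\<psi>\<close> be the isomorphism and \<open>\<psi>0\<close> its restriction to units. An affine map \<open>g\<close> between two cells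
  consists of the arrows \<open>(g z, g)\<close>. Their images have group coordinates \<open>\<gamma> z\<close> that are locally
  constant in \<open>z\<close>, and \<open>\<psi>0 (g z)\<close> is \<open>\<gamma> z\<close> applied to \<open>\<psi>0 z\<close>. So on the pieces where \<open>\<gamma>\<close> is constant
  \<open>g\<close> corresponds to an affine map with slope in \<open>\<Lambda>\<^sub>1\<close>.
\<close>

lemma scaling_model_of_groupoid_iso:
  assumes S1: "stein \<Gamma>\<^sub>1 \<Lambda>\<^sub>1 l\<^sub>1" and S2: "stein \<Gamma>\<^sub>2 \<Lambda>\<^sub>2 l\<^sub>2"
    and rank: "\<exists>t\<in>\<Gamma>\<^sub>2. \<forall>n k :: int. of_int n * t = of_int k * l\<^sub>2 \<longrightarrow> n = 0"
    and iso: "isomorphic_groupoids (reduction (stein_groupoid \<Gamma>\<^sub>2 \<Lambda>\<^sub>2) (unit_interval \<Gamma>\<^sub>2 \<Lambda>\<^sub>2 l\<^sub>2))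
      (reduction (stein_groupoid \<Gamma>\<^sub>1 \<Lambda>\<^sub>1) (unit_interval \<Gamma>\<^sub>1 \<Lambda>\<^sub>1 l\<^sub>1))"
  shows "\<exists>m. scaling_model \<Gamma>\<^sub>1 \<Lambda>\<^sub>1 l\<^sub>1 \<Gamma>\<^sub>2 \<Lambda>\<^sub>2 l\<^sub>2 m"
proof -
  interpret A: stein \<Gamma>\<^sub>1 \<Lambda>\<^sub>1 l\<^sub>1 by (rule S1)
  interpret B: stein \<Gamma>\<^sub>2 \<Lambda>\<^sub>2 l\<^sub>2 by (rule S2)
  obtain \<psi> where \<psi>: "homeomorphic_map (arrows B.Gr) (arrows A.Gr) \<psi>"
    "\<forall>w\<in>B.arrow_set. \<psi> (rng B.Gr w) = rng A.Gr (\<psi> w) \<and> \<psi> (src B.Gr w) = src A.Gr (\<psi> w)"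
    using iso unfolding isomorphic_groupoids_def groupoid_iso_def B.topspace_Gr by blast
  have inj: "inj_on \<psi> B.arrow_set" and image: "\<psi> ` B.arrow_set = A.arrow_set"
    using homeomorphic_imp_injective_map[OF \<psi>(1)] homeomorphic_imp_surjective_map[OF \<psi>(1)]
    unfolding A.topspace_Gr B.topspace_Gr .
  have \<psi>_in: "\<psi> w \<in> A.arrow_set" if "w \<in> B.arrow_set" for w using image that by blast
  define \<psi>0 where "\<psi>0 z = fst (\<psi> (z, (0, 1)))" for z
  have \<psi>_fst: "fst (\<psi> (z, g)) = \<psi>0 z" and \<psi>_unit: "\<psi> (z, (0, 1)) = (\<psi>0 z, (0, 1))"
    if zg: "(z, g) \<in> B.arrow_set" for z g
  proof -
    have "\<psi> (z, (0, 1)) = rng A.Gr (\<psi> (z, g))" using \<psi>(2) zg B.Gr_rng by metis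
    also have "\<dots> = (fst (\<psi> (z, g)), (0, 1))" using A.Gr_rng by (metis prod.collapse)
    finally show "fst (\<psi> (z, g)) = \<psi>0 z" "\<psi> (z, (0, 1)) = (\<psi>0 z, (0, 1))" by (simp_all add: \<psi>0_def)
  qed
  have unit: "\<psi> (z, (0, 1)) = (\<psi>0 z, (0, 1))" if "z \<in> B.Y" for z by (rule \<psi>_unit[OF B.unit_arrow[OF that]])
  have \<psi>_src: "\<psi>0 z = affine_act (snd (\<psi> (z, g))) (\<psi>0 (affine_act (aff_inv g) z))" "snd (\<psi> (z, g)) \<in> A.Aff"
    if zg: "(z, g) \<in> B.arrow_set" for z g
  proof -
    have \<psi>zg: "\<psi> (z, g) = (\<psi>0 z, snd (\<psi> (z, g)))" using \<psi>_fst[OF zg] by (metis prod.collapse)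
    show a: "snd (\<psi> (z, g)) \<in> A.Aff" using \<psi>_in[OF zg] \<psi>zg A.arrow_setD(2) by metis
    have "\<psi> (src B.Gr (z, g)) = src A.Gr (\<psi>0 z, snd (\<psi> (z, g)))" using \<psi>(2) zg \<psi>zg by metis
    then have "\<psi>0 (affine_act (aff_inv g) z) = affine_act (aff_inv (snd (\<psi> (z, g)))) (\<psi>0 z)"
      unfolding B.Gr_src[OF B.arrow_setD(2)[OF zg]] A.Gr_src[OF a] unit[OF B.arrow_setD(3)[OF zg]] by simp
    then show "\<psi>0 z = affine_act (snd (\<psi> (z, g))) (\<psi>0 (affine_act (aff_inv g) z))"
      using affine_act_inv(2) A.Aff_snd(1)[OF a] by metis
  qed
  have inj0: "inj_on \<psi>0 B.Y"
  proof (rule inj_onI)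
    fix z w assume zw: "z \<in> B.Y" "w \<in> B.Y" "\<psi>0 z = \<psi>0 w"
    then have "\<psi> (z, (0, 1)) = \<psi> (w, (0, 1))" using unit by simp
    then show "z = w" using inj_onD[OF inj] B.unit_arrow zw by blast
  qed
  have image0: "\<psi>0 ` B.Y = A.Y"
  proof (intro subset_antisym subsetI)
    fix y assume "y \<in> \<psi>0 ` B.Y"
    then obtain z where z: "z \<in> B.Y" "y = \<psi>0 z" by blast
    then show "y \<in> A.Y" using \<psi>_in[OF B.unit_arrow[OF z(1)]] unit[OF z(1)] A.unit_arrow_iff by metis
  next
    fix y assume "y \<in> A.Y"
    then have "(y, (0, 1)) \<in> \<psi> ` B.arrow_set" using A.unit_arrow image by simp
    then obtain w where w: "w \<in> B.arrow_set" "(y, (0, 1)) = \<psi> w" by blast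
    obtain z g where zg: "w = (z, g)" by (cases w)
    have "fst (y, (0, 1) :: real \<times> real) = \<psi>0 z" unfolding w(2) zg by (rule \<psi>_fst) (use w zg in blast)
    then show "y \<in> \<psi>0 ` B.Y" using B.arrow_setD(1)[of z g] w(1) zg by simp
  qed
  have \<psi>_units: "\<psi> ` (U \<times> {(0, 1)}) = (\<psi>0 ` U) \<times> {(0, 1)}" if "U \<subseteq> B.Y" for U
  proof -
    have "\<psi> ` (U \<times> {(0, 1)}) = (\<lambda>z. \<psi> (z, (0, 1))) ` U" by auto
    also have "\<dots> = (\<lambda>z. (\<psi>0 z, (0, 1))) ` U" by (rule image_cong) (use unit that in auto)
    finally show ?thesis by auto
  qed
  have clopen_iff: "A.clopen (\<psi>0 ` U) \<longleftrightarrow> B.clopen U" if U: "U \<subseteq> B.Y" for U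
  proof -
    have "openin (arrows A.Gr) (\<psi>0 ` V \<times> {(0, 1)}) \<longleftrightarrow> openin (arrows B.Gr) (V \<times> {(0, 1)})" if V: "V \<subseteq> B.Y" for V
    proof -
      have "V \<times> {(0, 1)} \<subseteq> topspace (arrows B.Gr)" unfolding B.topspace_Gr using V B.unit_arrow by blast
      then show ?thesis unfolding \<psi>_units[OF V, symmetric] by (rule homeomorphic_map_openness[OF \<psi>(1)])
    qed
    moreover have "A.Y - \<psi>0 ` U = \<psi>0 ` (B.Y - U)"
      unfolding image0[symmetric] using inj0 U by (metis inj_on_image_set_diff Diff_subset subset_refl)
    moreover have "\<psi>0 ` U \<subseteq> A.Y" using U image0 by blast
    ultimately show ?thesis unfolding A.clopen_iff_openin B.clopen_iff_openin using U by auto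
  qed
  define hat where "hat = inv_into (Collect B.clopen) B.projection"
  have hat_bij: "bij_betw hat B.\<B> (Collect B.clopen)"
    unfolding hat_def by (rule bij_betw_inv_into[OF B.projection_bij])
  have hat_clopen: "B.clopen (hat U)" and hat_sub: "hat U \<subseteq> B.Y" and projection_hat: "B.projection (hat U) = U" if "U \<in> B.\<B>" for U
  proof -
    show "B.clopen (hat U)" using hat_bij that unfolding bij_betw_def by blast
    then show "hat U \<subseteq> B.Y" unfolding B.clopen_def by blast
    show "B.projection (hat U) = U" unfolding hat_def by (rule bij_betw_inv_into_right[OF B.projection_bij that])
  qed
  have hat_cell: "hat {p..<q} = cell \<Gamma>\<^sub>2 p q" if "p \<in> \<Gamma>\<^sub>2" "q \<in> \<Gamma>\<^sub>2" "0 \<le> p" "q \<le> l\<^sub>2" for p q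
    unfolding hat_def B.projection_cell[OF that(1), symmetric]
    by (rule bij_betw_inv_into_left[OF B.projection_bij]) (use B.clopen_cell that in blast)
  have image_bij: "bij_betw (image \<psi>0) (Collect B.clopen) (Collect A.clopen)"
    unfolding bij_betw_def
  proof (intro conjI subset_antisym subsetI)
    show "inj_on (image \<psi>0) (Collect B.clopen)"
      by (rule inj_on_subset[OF inj_on_image_Pow[OF inj0]]) (auto simp: B.clopen_def)
    show "V \<in> Collect A.clopen" if "V \<in> image \<psi>0 ` Collect B.clopen" for V
      using that clopen_iff B.clopen_def by auto
    show "V \<in> image \<psi>0 ` Collect B.clopen" if V: "V \<in> Collect A.clopen" for V
    proof -
      have "V \<subseteq> \<psi>0 ` B.Y" using V image0 A.clopen_def by simp
      then obtain U where "U \<subseteq> B.Y" "V = \<psi>0 ` U" by (meson subset_imageE)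
      then show ?thesis using V clopen_iff by blast
    qed
  qed
  define \<kappa> where "\<kappa> U = A.projection (\<psi>0 ` hat U)" for U
  have \<kappa>_bij: "bij_betw \<kappa> B.\<B> A.\<B>"
    using bij_betw_trans[OF hat_bij bij_betw_trans[OF image_bij A.projection_bij]]
    unfolding \<kappa>_def comp_def .
  have \<kappa>_order: "\<kappa> U \<subseteq> \<kappa> V \<longleftrightarrow> U \<subseteq> V" if UV: "U \<in> B.\<B>" "V \<in> B.\<B>" for U V
  proof -
    have "\<kappa> U \<subseteq> \<kappa> V \<longleftrightarrow> \<psi>0 ` hat U \<subseteq> \<psi>0 ` hat V"
      unfolding \<kappa>_def by (rule A.projection_subset_iff) (use UV hat_clopen hat_sub clopen_iff in auto)
    also have "\<dots> \<longleftrightarrow> hat U \<subseteq> hat V" by (rule inj_on_image_subset_iff[OF inj0]) (use UV hat_sub in auto)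
    also have "\<dots> \<longleftrightarrow> B.projection (hat U) \<subseteq> B.projection (hat V)"
      by (rule B.projection_subset_iff[symmetric]) (use UV hat_clopen in auto)
    finally show ?thesis using projection_hat UV by simp
  qed
  have projection_affine: "A.projection (affine_act c ` V) = (\<lambda>x. snd c * x + fst c) ` A.projection V" if c: "c \<in> A.Aff" for c V
  proof (rule Set.set_eqI)
    fix y
    obtain x where x: "y = snd c * x + fst c"
      using A.Aff_snd(1)[OF c] by (intro that[of "(y - fst c) / snd c"]) simp
    have "A.right_point y \<in> affine_act c ` V \<longleftrightarrow> A.right_point x \<in> V"
      unfolding x A.right_point_affine[OF c] using affine_act_inv(1)[OF A.Aff_snd(1)[OF c]] by (metis imageE imageI)
    moreover have "y \<in> (\<lambda>x. snd c * x + fst c) ` A.projection V \<longleftrightarrow> x \<in> A.projection V"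
      unfolding x using A.Aff_snd(1)[OF c] by auto
    ultimately show "y \<in> A.projection (affine_act c ` V) \<longleftrightarrow> y \<in> (\<lambda>x. snd c * x + fst c) ` A.projection V"
      unfolding A.projection_def by simp
  qed
  have pieces: "piecewise \<Gamma>\<^sub>2 p q (\<lambda>r s. \<exists>c\<in>\<Lambda>\<^sub>1. \<forall>x\<in>\<Gamma>\<^sub>2. \<forall>y\<in>\<Gamma>\<^sub>2. r \<le> x \<longrightarrow> x < y \<longrightarrow> y \<le> s \<longrightarrow>
      measure lebesgue (\<kappa> {a * x + (p' - a * p)..<a * y + (p' - a * p)}) = c * measure lebesgue (\<kappa> {x..<y}))"
    if a: "a \<in> \<Lambda>\<^sub>2" and pq: "p \<in> \<Gamma>\<^sub>2" "q \<in> \<Gamma>\<^sub>2" "p' \<in> \<Gamma>\<^sub>2" "0 \<le> p" "p < q" "q \<le> l\<^sub>2" "0 \<le> p'" "p' + a * (q - p) \<le> l\<^sub>2"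
    for a p q p'
  proof -
    define g where "g = (p' - a * p, a)"
    have g: "g \<in> B.Aff" unfolding g_def using a pq B.add(4) B.stable by simp
    have a0: "0 < a" using B.mul(2) a .
    have gnz: "snd g \<noteq> 0" using B.Aff_snd(1)[OF g] .
    have g_cell: "affine_act g z \<in> cell \<Gamma>\<^sub>2 (a * x + (p' - a * p)) (a * y + (p' - a * p)) \<longleftrightarrow> z \<in> cell \<Gamma>\<^sub>2 x y" for z x y
      using B.act_cell[OF g, of z x y] by (simp add: g_def)
    have arrow: "(affine_act g z, g) \<in> B.arrow_set" if z: "z \<in> cell \<Gamma>\<^sub>2 p q" for z
    proof (rule B.arrow_setI[OF _ g])
      have "affine_act g z \<in> cell \<Gamma>\<^sub>2 p' (p' + a * (q - p))"
        using g_cell[of z p q] z by (simp add: algebra_simps)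
      then show "affine_act g z \<in> B.Y" using cell_mono[OF pq(7,8)] by blast
      have "z \<in> B.Y" using z cell_mono[OF pq(4,6)] by blast
      then show "affine_act (aff_inv g) (affine_act g z) \<in> B.Y" using affine_act_inv(1)[OF gnz] by simp
    qed
    define \<gamma> where "\<gamma> z = snd (\<psi> (affine_act g z, g))" for z
    have \<gamma>: "\<psi>0 (affine_act g z) = affine_act (\<gamma> z) (\<psi>0 z)" "\<gamma> z \<in> A.Aff" if "z \<in> cell \<Gamma>\<^sub>2 p q" for z
      using \<psi>_src[OF arrow[OF that]] affine_act_inv(1)[OF gnz] unfolding \<gamma>_def by simp_all
    have "\<exists>u\<in>\<Gamma>\<^sub>2. \<exists>v\<in>\<Gamma>\<^sub>2. z \<in> cell \<Gamma>\<^sub>2 u v \<and> (\<forall>w\<in>cell \<Gamma>\<^sub>2 u v \<inter> cell \<Gamma>\<^sub>2 p q. \<gamma> w = \<gamma> z)" if z: "z \<in> cell \<Gamma>\<^sub>2 p q" for z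
    proof -
      have "openin (arrows A.Gr) {w \<in> A.arrow_set. snd w = \<gamma> z}"
        unfolding A.openin_Gr_iff
      proof (intro conjI ballI)
        fix w assume w: "w \<in> {w \<in> A.arrow_set. snd w = \<gamma> z}"
        obtain y h where yh: "w = (y, h)" by (cases w)
        have "y \<in> split_points \<Gamma>\<^sub>1" using w A.arrow_setD(1) cell_split_points yh by blast
        then obtain u v where "u \<in> \<Gamma>\<^sub>1" "v \<in> \<Gamma>\<^sub>1" "y \<in> cell \<Gamma>\<^sub>1 u v" using A.cell_exists by blast
        then show "case w of (y, h) \<Rightarrow> \<exists>u\<in>\<Gamma>\<^sub>1. \<exists>v\<in>\<Gamma>\<^sub>1. y \<in> cell \<Gamma>\<^sub>1 u v \<and>
            (\<forall>y'\<in>cell \<Gamma>\<^sub>1 u v. (y', h) \<in> A.arrow_set \<longrightarrow> (y', h) \<in> {w \<in> A.arrow_set. snd w = \<gamma> z})"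
          using w yh by auto
      qed simp
      then have "openin (arrows B.Gr) {w \<in> topspace (arrows B.Gr). \<psi> w \<in> {w \<in> A.arrow_set. snd w = \<gamma> z}}"
        by (rule openin_continuous_map_preimage[OF homeomorphic_imp_continuous_map[OF \<psi>(1)]])
      moreover have "(affine_act g z, g) \<in> {w \<in> topspace (arrows B.Gr). \<psi> w \<in> {w \<in> A.arrow_set. snd w = \<gamma> z}}"
        using arrow[OF z] \<psi>_in unfolding B.topspace_Gr \<gamma>_def by simp
      ultimately obtain u v where uv: "u \<in> \<Gamma>\<^sub>2" "v \<in> \<Gamma>\<^sub>2" "affine_act g z \<in> cell \<Gamma>\<^sub>2 u v"
        "\<forall>w\<in>cell \<Gamma>\<^sub>2 u v. (w, g) \<in> B.arrow_set \<longrightarrow> snd (\<psi> (w, g)) = \<gamma> z"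
        unfolding B.openin_Gr_iff by blast
      define u' v' where "u' = (u - (p' - a * p)) / a" and "v' = (v - (p' - a * p)) / a"
      have "u' \<in> \<Gamma>\<^sub>2" "v' \<in> \<Gamma>\<^sub>2" unfolding u'_def v'_def using uv(1,2) pq a by (auto intro!: B.divide_in B.add(4) B.stable)
      moreover have "w \<in> cell \<Gamma>\<^sub>2 u' v' \<longleftrightarrow> affine_act g w \<in> cell \<Gamma>\<^sub>2 u v" for w
        using g_cell[of w u' v'] a0 by (simp add: u'_def v'_def)
      ultimately show ?thesis using uv(3,4) arrow unfolding \<gamma>_def by blast
    qed
    then have "piecewise \<Gamma>\<^sub>2 p q (\<lambda>r s. \<exists>c. \<forall>w\<in>cell \<Gamma>\<^sub>2 r s. \<gamma> w = c)"
      by (intro B.locally_constant_piecewise pq)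
    then show ?thesis
    proof (rule piecewise_mono)
      fix r s assume rs: "r \<in> \<Gamma>\<^sub>2" "s \<in> \<Gamma>\<^sub>2" "p \<le> r" "r < s" "s \<le> q" "\<exists>c. \<forall>w\<in>cell \<Gamma>\<^sub>2 r s. \<gamma> w = c"
      then obtain c where c: "\<forall>w\<in>cell \<Gamma>\<^sub>2 r s. \<gamma> w = c" by blast
      have sub: "cell \<Gamma>\<^sub>2 r s \<subseteq> cell \<Gamma>\<^sub>2 p q" using rs by (intro cell_mono)
      have "Plus r \<in> cell \<Gamma>\<^sub>2 r s" using rs by (simp add: cell_iff)
      then have "\<gamma> (Plus r) = c" "Plus r \<in> cell \<Gamma>\<^sub>2 p q" using c sub by blast+
      then have cA: "c \<in> A.Aff" using \<gamma>(2)[of "Plus r"] by (simp only:)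
      show "\<exists>c\<in>\<Lambda>\<^sub>1. \<forall>x\<in>\<Gamma>\<^sub>2. \<forall>y\<in>\<Gamma>\<^sub>2. r \<le> x \<longrightarrow> x < y \<longrightarrow> y \<le> s \<longrightarrow>
          measure lebesgue (\<kappa> {a * x + (p' - a * p)..<a * y + (p' - a * p)}) = c * measure lebesgue (\<kappa> {x..<y})"
      proof (intro bexI[of _ "snd c"] ballI impI)
        fix x y assume xy: "x \<in> \<Gamma>\<^sub>2" "y \<in> \<Gamma>\<^sub>2" "r \<le> x" "x < y" "y \<le> s"
        let ?gx = "a * x + (p' - a * p)" and ?gy = "a * y + (p' - a * p)"
        have cell_sub: "cell \<Gamma>\<^sub>2 x y \<subseteq> cell \<Gamma>\<^sub>2 r s" using xy by (intro cell_mono)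
        have g_image: "cell \<Gamma>\<^sub>2 ?gx ?gy = affine_act g ` cell \<Gamma>\<^sub>2 x y"
        proof (intro subset_antisym subsetI)
          fix z assume "z \<in> cell \<Gamma>\<^sub>2 ?gx ?gy"
          then have "affine_act (aff_inv g) z \<in> cell \<Gamma>\<^sub>2 x y"
            using g_cell[of "affine_act (aff_inv g) z" x y] affine_act_inv(2)[OF gnz] by simp
          then show "z \<in> affine_act g ` cell \<Gamma>\<^sub>2 x y" using affine_act_inv(2)[OF gnz] by (metis imageI)
        qed (use g_cell in blast)
        have "a * (x - p) \<ge> 0" "a * (q - y) \<ge> 0" using a0 xy rs by simp_all
        then have bounds: "0 \<le> ?gx" "?gy \<le> l\<^sub>2" using pq(7,8) by (simp_all add: algebra_simps)
        have "hat {?gx..<?gy} = cell \<Gamma>\<^sub>2 ?gx ?gy"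
          by (rule hat_cell) (use xy a pq bounds in \<open>auto intro!: B.add(3,4) B.stable\<close>)
        moreover have "\<psi>0 ` (affine_act g ` cell \<Gamma>\<^sub>2 x y) = affine_act c ` (\<psi>0 ` cell \<Gamma>\<^sub>2 x y)"
          unfolding image_image
        proof (rule image_cong[OF refl])
          fix z assume "z \<in> cell \<Gamma>\<^sub>2 x y"
          then have z: "z \<in> cell \<Gamma>\<^sub>2 r s" "z \<in> cell \<Gamma>\<^sub>2 p q" using cell_sub sub by blast+
          then have "\<gamma> z = c" using c by blast
          then show "\<psi>0 (affine_act g z) = affine_act c (\<psi>0 z)" using \<gamma>(1)[OF z(2)] by (simp only:)
        qed
        moreover have "hat {x..<y} = cell \<Gamma>\<^sub>2 x y" by (rule hat_cell) (use xy rs pq in auto)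
        ultimately have "\<kappa> {?gx..<?gy} = (\<lambda>x. snd c * x + fst c) ` \<kappa> {x..<y}"
          unfolding \<kappa>_def g_image by (simp add: projection_affine[OF cA])
        then show "measure lebesgue (\<kappa> {?gx..<?gy}) = snd c * measure lebesgue (\<kappa> {x..<y})"
          using measure_lebesgue_affine[of "snd c" "fst c" "\<kappa> {x..<y}"] A.Aff_snd(2)[OF cA] by simp
      qed (use cA in auto)
    qed
  qed
  have "scaling_model \<Gamma>\<^sub>1 \<Lambda>\<^sub>1 l\<^sub>1 \<Gamma>\<^sub>2 \<Lambda>\<^sub>2 l\<^sub>2 (\<lambda>x. measure lebesgue (\<kappa> {0..<x}))"
    by (rule scaling_model_of_algebra_iso[OF S1 S2 rank \<kappa>_bij \<kappa>_order])
       (use pieces in \<open>auto intro!: exI[of _ 1]\<close>)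
  then show ?thesis by blast
qed

section \<open>The equivalence of the four conditions\<close>

lemma iso_commutator_subgroup:
  assumes G: "group G" and H: "group H" and iso: "G \<cong> H"
  shows "commutator_subgroup G \<cong> commutator_subgroup H"
proof -
  obtain h where h: "h \<in> Group.iso G H" using iso unfolding is_iso_def by blast
  then have hom: "h \<in> hom G H" and bij: "bij_betw h (carrier G) (carrier H)" by (auto simp: iso_def)
  interpret group_hom G H h using G H hom by (simp add: group_hom_def group_hom_axioms_def)
  have img: "derived H (carrier H) = h ` derived G (carrier G)"
    using derived_img[of "carrier G"] bij by (simp add: bij_betw_def)
  have sub: "derived G (carrier G) \<subseteq> carrier G"
    by (rule group.derived_in_carrier[OF G]) simp
  have "h \<in> Group.iso (commutator_subgroup G) (commutator_subgroup H)"
  proof (rule isoI)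
    show "h \<in> hom (commutator_subgroup G) (commutator_subgroup H)"
      by (rule homI) (simp_all add: commutator_subgroup_def img subsetD[OF sub])
    show "bij_betw h (carrier (commutator_subgroup G)) (carrier (commutator_subgroup H))"
      using bij sub img by (auto simp: commutator_subgroup_def bij_betw_def intro: inj_on_subset)
  qed
  then show ?thesis unfolding is_iso_def by blast
qed

text \<open>
  Otherwise \<open>\<Gamma>\<close> would lie in the rational line through \<open>l\<close>.
\<close>

lemma incommensurable_element:
  assumes \<Gamma>: "subgroup \<Gamma> real_additive" and rank: "group_rank \<Gamma> \<ge> 2" and l: "l \<in> \<Gamma>"
  shows "\<exists>t\<in>\<Gamma>. \<forall>n k :: int. of_int n * t = of_int k * l \<longrightarrow> n = 0"
proof (rule ccontr)
  assume "\<not> ?thesis"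
  then have rel: "\<exists>n k :: int. of_int n * t = of_int k * l \<and> n \<noteq> 0" if "t \<in> \<Gamma>" for t using that by blast
  have "\<Gamma> \<subseteq> rat_real.span {l}"
  proof
    fix t assume "t \<in> \<Gamma>"
    then obtain n k :: int where nk: "of_int n * t = of_int k * l" "n \<noteq> 0" using rel by blast
    then have "t = rat_scale (of_int k / of_int n) l"
      by (simp add: rat_scale_def of_rat_divide field_simps)
    then show "t \<in> rat_real.span {l}" by (simp add: rat_real.span_scale rat_real.span_base)
  qed
  then have "rat_real.span \<Gamma> \<subseteq> rat_real.span {l}" by (simp add: rat_real.span_minimal)
  moreover have "rat_real.span {l} \<subseteq> rat_real.span \<Gamma>" using l by (intro rat_real.span_mono) simp
  ultimately have span: "rat_real.span {l} = rat_real.span \<Gamma>" by (rule subset_antisym[rotated])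
  then have "group_rank \<Gamma> = enat (rat_real.dim (rat_real.span \<Gamma>))" unfolding group_rank_def by auto
  moreover have "rat_real.dim (rat_real.span {l}) \<le> card {l}"
    by (rule rat_real.dim_le_card) simp_all
  ultimately have "group_rank \<Gamma> \<le> enat 1" unfolding span by simp
  then have "(2::enat) \<le> enat 1" using rank by (rule order_trans[rotated])
  then show False by (simp add: numeral_eq_enat)
qed

lemma stein_intro:
  assumes "fg_subgroup \<Lambda> positive_reals" "ZLambda_module \<Lambda> \<Gamma>" "closure \<Gamma> = UNIV" "l \<in> \<Gamma> \<inter> {0<..}"
  shows "stein \<Gamma> \<Lambda> l"
proof
  show "add_group \<Gamma>" using assms(2) unfolding ZLambda_module_def by (intro add_group_subgroup) blast
  show "mult_group \<Lambda>" using assms(1) unfolding fg_subgroup_def by (intro mult_group_subgroup) blast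
  show "a * x \<in> \<Gamma>" if "a \<in> \<Lambda>" "x \<in> \<Gamma>" for a x using assms(2) that unfolding ZLambda_module_def by blast
qed (use assms in auto)

theorem theorem5p10:
  fixes \<Lambda>\<^sub>1 \<Lambda>\<^sub>2 \<Gamma>\<^sub>1 \<Gamma>\<^sub>2 :: "real set" and l\<^sub>1 l\<^sub>2 :: real
  assumes "fg_subgroup \<Lambda>\<^sub>1 positive_reals" and "fg_subgroup \<Lambda>\<^sub>2 positive_reals"
    and "ZLambda_module \<Lambda>\<^sub>1 \<Gamma>\<^sub>1" and "ZLambda_module \<Lambda>\<^sub>2 \<Gamma>\<^sub>2"
    and "countable \<Gamma>\<^sub>1" and "countable \<Gamma>\<^sub>2"
    and "closure \<Gamma>\<^sub>1 = UNIV" and "closure \<Gamma>\<^sub>2 = UNIV"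
    and "group_rank \<Gamma>\<^sub>1 \<ge> 2" and "group_rank \<Gamma>\<^sub>2 \<ge> 2"
    and "l\<^sub>1 \<in> \<Gamma>\<^sub>1 \<inter> {0<..}" and "l\<^sub>2 \<in> \<Gamma>\<^sub>2 \<inter> {0<..}"
  shows
    "let cond1 = stein_group \<Gamma>\<^sub>1 \<Lambda>\<^sub>1 l\<^sub>1 \<cong> stein_group \<Gamma>\<^sub>2 \<Lambda>\<^sub>2 l\<^sub>2;
         cond2 = commutator_subgroup (stein_group \<Gamma>\<^sub>1 \<Lambda>\<^sub>1 l\<^sub>1) \<cong>
                 commutator_subgroup (stein_group \<Gamma>\<^sub>2 \<Lambda>\<^sub>2 l\<^sub>2);
         cond3 = isomorphic_groupoids
                   (reduction (stein_groupoid \<Gamma>\<^sub>1 \<Lambda>\<^sub>1) (unit_interval \<Gamma>\<^sub>1 \<Lambda>\<^sub>1 l\<^sub>1))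
                   (reduction (stein_groupoid \<Gamma>\<^sub>2 \<Lambda>\<^sub>2) (unit_interval \<Gamma>\<^sub>2 \<Lambda>\<^sub>2 l\<^sub>2));
         cond4 = (\<Lambda>\<^sub>1 = \<Lambda>\<^sub>2 \<and>
                   (\<exists>s>0. \<Gamma>\<^sub>1 = (\<lambda>t. s * t) ` \<Gamma>\<^sub>2 \<and>
                          H0_class \<Lambda>\<^sub>1 \<Gamma>\<^sub>1 (l\<^sub>1 - s * l\<^sub>2) = \<one>\<^bsub>H0 \<Lambda>\<^sub>1 \<Gamma>\<^sub>1\<^esub>))
     in (cond1 \<longleftrightarrow> cond2) \<and> (cond2 \<longleftrightarrow> cond3) \<and> (cond3 \<longleftrightarrow> cond4)"
proof -
  interpret A: stein \<Gamma>\<^sub>1 \<Lambda>\<^sub>1 l\<^sub>1 by (rule stein_intro) (use assms in auto)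
  interpret B: stein \<Gamma>\<^sub>2 \<Lambda>\<^sub>2 l\<^sub>2 by (rule stein_intro) (use assms in auto)
  note stein = A.stein_axioms B.stein_axioms
  have rank1: "\<exists>t\<in>\<Gamma>\<^sub>1. \<forall>n k :: int. of_int n * t = of_int k * l\<^sub>1 \<longrightarrow> n = 0"
    using assms unfolding ZLambda_module_def by (intro incommensurable_element) auto
  have rank2: "\<exists>t\<in>\<Gamma>\<^sub>2. \<forall>n k :: int. of_int n * t = of_int k * l\<^sub>2 \<longrightarrow> n = 0"
    using assms unfolding ZLambda_module_def by (intro incommensurable_element) auto
  let ?c4 = "\<Lambda>\<^sub>1 = \<Lambda>\<^sub>2 \<and> (\<exists>s>0. \<Gamma>\<^sub>1 = (\<lambda>t. s * t) ` \<Gamma>\<^sub>2 \<and> l\<^sub>1 - s * l\<^sub>2 \<in> coinvariant_relations \<Lambda>\<^sub>1 \<Gamma>\<^sub>1)"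
  have H0: "H0_class \<Lambda>\<^sub>1 \<Gamma>\<^sub>1 (l\<^sub>1 - s * l\<^sub>2) = \<one>\<^bsub>H0 \<Lambda>\<^sub>1 \<Gamma>\<^sub>1\<^esub> \<longleftrightarrow> l\<^sub>1 - s * l\<^sub>2 \<in> coinvariant_relations \<Lambda>\<^sub>1 \<Gamma>\<^sub>1"
    if "\<Gamma>\<^sub>1 = (\<lambda>t. s * t) ` \<Gamma>\<^sub>2" for s
    by (rule A.H0_class_eq_one_iff) (use that A.add(4) A.l_in B.l_in in blast)
  have c4: "(\<Lambda>\<^sub>1 = \<Lambda>\<^sub>2 \<and> (\<exists>s>0. \<Gamma>\<^sub>1 = (\<lambda>t. s * t) ` \<Gamma>\<^sub>2 \<and>
      H0_class \<Lambda>\<^sub>1 \<Gamma>\<^sub>1 (l\<^sub>1 - s * l\<^sub>2) = \<one>\<^bsub>H0 \<Lambda>\<^sub>1 \<Gamma>\<^sub>1\<^esub>)) \<longleftrightarrow> ?c4"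
    using H0 by blast
  have "commutator_subgroup A.SG \<cong> commutator_subgroup B.SG" if "A.SG \<cong> B.SG"
    using that A.group_SG B.group_SG by (rule iso_commutator_subgroup[rotated 2])
  moreover have ?c4 if iso: "commutator_subgroup A.SG \<cong> commutator_subgroup B.SG"
  proof -
    have "group (commutator_subgroup A.SG)"
      unfolding commutator_subgroup_def
      by (intro subgroup.subgroup_is_group group.derived_is_subgroup A.group_SG) simp
    then have "commutator_subgroup B.SG \<cong> commutator_subgroup A.SG" using iso by (rule group.iso_sym)
    then show ?thesis
      using scaling_model_of_commutator_iso[OF stein rank2] scaling_model_of_commutator_iso[OF stein(2,1) rank1]
        invariants_of_two_models iso by blast
  qed
  moreover have ?c4 if iso: "isomorphic_groupoids A.Gr B.Gr"
  proof -
    have "isomorphic_groupoids B.Gr A.Gr"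
      by (rule isomorphic_groupoids_sym[OF iso]; unfold A.topspace_Gr)
         (use A.arrow_rng A.arrow_src A.arrow_comp in blast)+
    then show ?thesis
      using scaling_model_of_groupoid_iso[OF stein rank2] scaling_model_of_groupoid_iso[OF stein(2,1) rank1]
        invariants_of_two_models iso by blast
  qed
  moreover have "A.SG \<cong> B.SG \<and> isomorphic_groupoids A.Gr B.Gr" if c: ?c4
  proof -
    obtain s where \<Lambda>: "\<Lambda>\<^sub>2 = \<Lambda>\<^sub>1" and s: "0 < s" "\<Gamma>\<^sub>1 = (\<lambda>t. s * t) ` \<Gamma>\<^sub>2" "l\<^sub>1 - s * l\<^sub>2 \<in> coinvariant_relations \<Lambda>\<^sub>1 \<Gamma>\<^sub>1"
      using c by blast
    obtain A F where "pl_equivalence \<Gamma>\<^sub>1 \<Lambda>\<^sub>1 l\<^sub>1 \<Gamma>\<^sub>2 l\<^sub>2 A F"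
      using pl_equivalence_exists[OF stein(1) stein(2)[unfolded \<Lambda>] s] by blast
    then interpret pl_equivalence \<Gamma>\<^sub>1 \<Lambda>\<^sub>1 l\<^sub>1 \<Gamma>\<^sub>2 l\<^sub>2 A F .
    show ?thesis using stein_groups_isomorphic groupoids_isomorphic unfolding \<Lambda> by blast
  qed
  ultimately show ?thesis unfolding Let_def c4 by blast
qed

end
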